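(* Let $n\geq 2$, let $\mathsf{\Lambda} \subseteq \mathbb{Z}^n$ be a lattice of dimension $m\geq 2$ with successive minima (with respect to Euclidean length) $s_1\leq\cdots\leq s_m$, and let $F \in \mathbb{Z}[x_1,\ldots,x_n]$ be a form of degree $d$ (not necessarily irreducible) which does not vanish identically on $\mathsf{\Lambda}$; let $X\subseteq\mathbb{P}^{n-1}$ be the variety $F=0$. Let $p_0$ be the smallest prime with $p_0>n$, and let $B\geq s_m$. Then there exist lattices $\mathsf{M}_1, \ldots, \mathsf{M}_J \subseteq \mathsf{\Lambda}$ such that the projective linear space $M_j$ spanned by each $\mathsf{M}_j$ lies in $X$, such that $$ J \ll \left(\frac{B^m}{\det \mathsf{\Lambda}}\right)^{(m-2)/m} (\log\|F\|B)^{(m-2)(2m^2+m+3)/3}, $$ such that the successive minima of each $\mathsf{M}_j$ are all $O(B(\log\|F\|B)^{m(m+1)})$, and such that \[S(F;B,\mathsf{\Lambda})\subseteq\bigcup_{j=1}^J\mathsf{M}_j.\] Moreover, for each $j$ for which $\mathsf{M}_j$ is a proper sublattice of $\mathsf{\Lambda}$, of dimension $m-h$ say, there exist positive integers $q_1,\ldots,q_h$ and a vector $\mathbf{w}\in\mathbb{Z}^n$ (depending on $\mathsf{M}_j$) such that each $q_i$ is a power of a prime $p_i\equiv m+1-i\pmod{p_0}$, \[ \mathsf{M}_j\subseteq\{\mathbf{x}\in \mathsf{\Lambda}: ~\mathbf{x}\equiv \rho\mathbf{w} \bmod{q_1\cdots q_h}~\mbox{for some $\rho\in\mathbb{Z}$}\},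 \] and \[ \det\mathsf{M}_j\ll(\det\mathsf{\Lambda})\prod_{i=1}^h\frac{q_i^{m-(i-1)}}{B}. \] All implied constants depend at most on $d$ and $n$.
   Context: For a lattice $\mathsf{\Lambda}\subseteq\mathbb{Z}^n$ of rank $r$ with basis $\mathbf{b}_1,\ldots,\mathbf{b}_r$, $\det\mathsf{\Lambda}$ is the $r$-dimensional volume of the parallelepiped spanned by the basis. The successive minima $s_1\le\cdots\le s_r$ are defined by taking $\mathbf{m}_1$ a shortest non-zero vector of $\mathsf{\Lambda}$, and inductively $\mathbf{m}_i$ a shortest vector of $\mathsf{\Lambda}$ not in the $\mathbb{Z}$-span of $\mathbf{m}_1,\ldots,\mathbf{m}_{i-1}$, and setting $s_i=|\mathbf{m}_i|$ (Euclidean length). $\|F\|$ is the maximum modulus of the coefficients of $F$. $S(F;B,\mathsf{\Lambda})=\{\mathbf{x} \in \mathsf{\Lambda}: \mathrm{h.c.f.}(x_1,\ldots,x_n)=1,\ F(\mathbf{x})=0, ~\max_{i} |x_i| \leq B\}$. The linear space $M_j$ spanned by $\mathsf{M}_j$ is the projectivisation of the linear span of $\mathsf{M}_j$.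
   Formalization: Successive minima are taken with m_i outside the real span (not the Z-span) of m_1,…,m_{i-1}, and log‖F‖B is read as log max(2,‖F‖B); with the Z-span, or with ‖F‖B close to 1, the claim as written is false. *)

theory Defs
  imports
    "HOL-Analysis.Analysis"
    "HOL-Library.Poly_Mapping"
    "HOL-Number_Theory.Cong"
begin

section \<open>Lattices in \<open>\<int>\<^sup>n\<close>\<close>

definition of_int_vec :: "int ^ 'n \<Rightarrow> ('a::ring_1) ^ 'n" where
  "of_int_vec x = (\<chi> i. of_int (x $ i))"

definition euclidean_length :: "int ^ ('n::finite) \<Rightarrow> real" where
  "euclidean_length x = norm (of_int_vec x :: real ^ 'n)"

text \<open>Linear independence is over the reals, so \<^term>\<open>b\<close> is automatically finite;
  \<^term>\<open>b = {}\<close> gives the zero lattice.\<close>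

definition lattice_basis :: "(int ^ ('n::finite)) set \<Rightarrow> (int ^ 'n) set \<Rightarrow> bool" where
  "lattice_basis b L \<longleftrightarrow>
     independent (of_int_vec ` b :: (real ^ 'n) set) \<and>
     L = range (\<lambda>c :: int ^ 'n \<Rightarrow> int. \<Sum>v\<in>b. c v *s v)"

definition integer_lattice :: "(int ^ ('n::finite)) set \<Rightarrow> bool" where
  "integer_lattice L \<longleftrightarrow> (\<exists>b. lattice_basis b L)"

definition lattice_rank :: "(int ^ ('n::finite)) set \<Rightarrow> nat" where
  "lattice_rank L = dim (of_int_vec ` L :: (real ^ 'n) set)"

definition parallelepiped :: "(real ^ ('n::finite)) set \<Rightarrow> (real ^ 'n) set" where
  "parallelepiped b = (\<lambda>t. \<Sum>v\<in>b. t v *\<^sub>R v) ` (b \<rightarrow> {0..1})"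

text \<open>The \<open>r\<close>-dimensional volume of a set \<^term>\<open>P\<close> whose linear span has dimension \<open>r\<close>:
  the \<open>n\<close>-dimensional Lebesgue measure of the product of \<^term>\<open>P\<close> with a unit cube of the
  orthogonal complement. The value does not depend on the orthonormal basis \<^term>\<open>U\<close>.\<close>

definition relative_volume :: "(real ^ ('n::finite)) set \<Rightarrow> real" where
  "relative_volume P =
     (let U = (SOME U. pairwise orthogonal U \<and> (\<forall>u\<in>U. norm u = 1) \<and> span U = orthogonal_comp P)
      in measure lebesgue {x + u | x u. x \<in> P \<and> u \<in> parallelepiped U})"

definition lattice_det :: "(int ^ ('n::finite)) set \<Rightarrow> real" where
  "lattice_det L = relative_volume (parallelepiped (of_int_vec ` (SOME b. lattice_basis b L)))"

text \<open>Each \<open>ms ! i\<close> is a shortest lattice vector outside the \<^emph>\<open>real\<close> linear span of its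
  predecessors, as usual for successive minima. Excluding only their integral span would be
  different: the lattice generated by \<open>2 \<int>\<^sup>5\<close> and \<open>(1,1,1,1,1)\<close> has shortest
  vectors \<open>\<plusminus>2 e\<^sub>i\<close>, which do not generate it, so in a lattice of rank 6 containing it
  a sixth vector could depend linearly on the first five.
  The lengths of the \<open>ms ! i\<close> do not depend on the choices made.\<close>

definition minimal_vectors :: "(int ^ ('n::finite)) set \<Rightarrow> (int ^ 'n) list \<Rightarrow> bool" where
  "minimal_vectors L ms \<longleftrightarrow>
     length ms = lattice_rank L \<and>
     (\<forall>i < length ms.
        is_arg_min euclidean_length
          (\<lambda>x. x \<in> L \<and> (of_int_vec x :: real ^ 'n) \<notin> span (of_int_vec ` set (take i ms)))
          (ms ! i))"

text \<open>The \<^term>\<open>i\<close>-th successive minimum, for \<open>1 \<le> i \<le> lattice_rank L\<close>.\<close>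

definition successive_minimum :: "(int ^ ('n::finite)) set \<Rightarrow> nat \<Rightarrow> real" where
  "successive_minimum L i = euclidean_length ((SOME ms. minimal_vectors L ms) ! (i - 1))"


section \<open>Integral forms\<close>

text \<open>A polynomial maps each monomial, given by its exponent vector, to its coefficient.\<close>

type_synonym 'n int_mpoly = "('n \<Rightarrow>\<^sub>0 nat) \<Rightarrow>\<^sub>0 int"

definition is_form :: "('n::finite) int_mpoly \<Rightarrow> nat \<Rightarrow> bool" where
  "is_form F d \<longleftrightarrow> (\<forall>\<alpha> \<in> Poly_Mapping.keys F. (\<Sum>i\<in>UNIV. Poly_Mapping.lookup \<alpha> i) = d)"

definition eval_poly :: "('n::finite) int_mpoly \<Rightarrow> ('a::comm_ring_1) ^ 'n \<Rightarrow> 'a" where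
  "eval_poly F x =
     (\<Sum>\<alpha>\<in>Poly_Mapping.keys F. of_int (Poly_Mapping.lookup F \<alpha>) *
        (\<Prod>i\<in>UNIV. x $ i ^ Poly_Mapping.lookup \<alpha> i))"

definition poly_height :: "('n::finite) int_mpoly \<Rightarrow> int" where
  "poly_height F = Max (range (\<lambda>\<alpha>. \<bar>Poly_Mapping.lookup F \<alpha>\<bar>))"

text \<open>The projective linear space spanned by \<^term>\<open>M\<close> lies in the hypersurface \<open>F = 0\<close> of
  \<open>\<P>\<^sup>n\<^sup>-\<^sup>1(\<complex>)\<close>, expressed through the affine cones over both.\<close>

definition spans_linear_space_in :: "(int ^ ('n::finite)) set \<Rightarrow> 'n int_mpoly \<Rightarrow> bool" where
  "spans_linear_space_in M F \<longleftrightarrow>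
     vec.span (of_int_vec ` M) \<subseteq> {v :: complex ^ 'n. eval_poly F v = 0}"

definition primitive_zeros ::
    "('n::finite) int_mpoly \<Rightarrow> real \<Rightarrow> (int ^ 'n) set \<Rightarrow> (int ^ 'n) set" where
  "primitive_zeros F B L =
     {x \<in> L. (GCD i. x $ i) = 1 \<and> eval_poly F x = 0 \<and> (\<forall>i. of_int \<bar>x $ i\<bar> \<le> B)}"

text \<open>The quantity \<open>log (\<parallel>F\<parallel> B)\<close> of an upper bound. For \<open>\<parallel>F\<parallel> = 1\<close> and
  \<open>1 \<le> B < 2\<close> the logarithm is zero or arbitrarily small and must be kept away from 0;
  for \<open>\<parallel>F\<parallel> B \<ge> 2\<close> this is exactly the logarithm.\<close>

definition log_height :: "('n::finite) int_mpoly \<Rightarrow> real \<Rightarrow> real" where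
  "log_height F B = ln (max 2 (of_int (poly_height F) * B))"

end

theory Submission
  imports
    Defs
    "HOL-Computational_Algebra.Polynomial"
    "HOL-Computational_Algebra.Squarefree"
    "HOL-Number_Theory.Number_Theory"
    "HOL-Real_Asymp.Real_Asymp"
begin

text \<open>Let \<open>x\<close> be a zero of \<open>F\<close> in a lattice of rank \<open>r\<close> on which \<open>F\<close> does not vanish. Some iterated
  directional derivative \<open>G\<close> of \<open>F\<close> vanishes at \<open>x\<close> and is smooth there, even modulo a suitable
  prime \<open>p\<close> of logarithmic size. For \<open>q = p ^ k\<close>, every zero of \<open>G\<close> that is congruent modulo \<open>q\<close> to
  a multiple of \<open>x\<close> lies in the lattice of all \<open>y\<close> congruent to multiples of \<open>x\<close> modulo \<open>q\<close> and
  tangent to \<open>G = 0\<close> at \<open>x\<close> modulo \<open>q\<^sup>2\<close>, which has index \<open>q ^ r\<close>. Take the least \<open>k\<close> such that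
  the vectors of length at most \<open>R = sqrt n * B\<close> in it no longer span it: then they lie in a
  sublattice of rank \<open>r - 1\<close>, whose determinant is controlled by Minkowski's second theorem. Hensel
  lifting leaves \<open>O(q ^ (r - 2))\<close> such sublattices for each \<open>q\<close>, and one iterates until \<open>F\<close> vanishes.
  Reserving the class of \<open>r\<close> modulo \<open>p\<^sub>0\<close> for the primes used in rank \<open>r\<close> keeps the moduli coprime;
  that such primes are plentiful is proved with the method of Mertens and Shapiro.\<close>

hide_const (open) up_ring.coeff up_ring.monom module.smult

section \<open>Integral forms and their roots modulo prime powers\<close>

text \<open>As \<open>F\<close> may be singular or reducible, smoothness is obtained along a
  direction: a short \<open>y\<close> with \<open>F y\<close> nonzero. The derivative along
  \<open>y\<close> at \<open>x\<close> is a nonzero integer whose logarithm is of the order of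
  \<open>log (||F|| B)\<close>. The primes of one class below a large multiple \<open>P\<close> of
  that logarithm cannot all divide it, their product being too large. \<open>P\<close> also occurs
  in the bound for this integer, but only \<open>ln P\<close> matters, so the multiple depends on
  \<open>d\<close> and \<open>n\<close> alone. The exponent \<open>k\<close> of the modulus
  \<open>q\<close> is not under control, so the loss of \<open>q ^ (r - 2)\<close> in the number of
  sublattices must cancel. It does: the determinant of each sublattice \<open>N\<close> is at least
  \<open>q ^ r * det M\<close> divided by the bound for the minima. Hence
  \<open>(B ^ (r - 1) / det N) ^ ((r - 3) / (r - 1))\<close>, which bounds the further branching, is
  smaller than \<open>(B ^ r / det M) ^ ((r - 2) / r)\<close> by the factor
  \<open>q ^ (r - 2)\<close>, up to logarithms and constants. Minimality of \<open>k\<close> is used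
  for the minima: at exponent \<open>k - 1\<close> the bound for them still holds, and one more
  power of \<open>p\<close> multiplies it by at most \<open>p ^ 2\<close>. This is the origin of the
  powers of the logarithm.\<close>

text \<open>\<open>H\<close> bounds the sum of the absolute values of the coefficients of a form that represents \<open>f\<close>.\<close>

inductive hform :: "nat \<Rightarrow> int \<Rightarrow> (int ^ ('n::finite) \<Rightarrow> int) \<Rightarrow> bool" where
  zero: "hform e 0 (\<lambda>x. 0)"
| const: "hform 0 \<bar>c\<bar> (\<lambda>x. c)"
| coord: "hform 1 1 (\<lambda>x. x $ i)"
| add: "hform e H f \<Longrightarrow> hform e K g \<Longrightarrow> hform e (H + K) (\<lambda>x. f x + g x)"
| mult: "hform e H f \<Longrightarrow> hform e' K g \<Longrightarrow> hform (e + e') (H * K) (\<lambda>x. f x * g x)"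

lemma hform_nonneg: "hform e H f \<Longrightarrow> 0 \<le> H"
  by (induction rule: hform.induct) auto

lemma hform_sum:
  assumes "finite A" "\<And>a. a \<in> A \<Longrightarrow> hform e (H a) (f a)"
  shows "hform e (\<Sum>a\<in>A. H a) (\<lambda>x. \<Sum>a\<in>A. f a x)"
  using assms by (induction A rule: finite_induct) (auto intro: hform.zero hform.add)

lemma hform_power: "hform e H f \<Longrightarrow> hform (k * e) (H ^ k) (\<lambda>x. f x ^ k)"
proof (induction k)
  case 0
  then show ?case using hform.const[of 1] by simp
next
  case (Suc k)
  then show ?case using hform.mult[of e H f "k * e" "H ^ k" "\<lambda>x. f x ^ k"] by simp
qed

lemma hform_prod:
  assumes "finite A" "\<And>a. a \<in> A \<Longrightarrow> hform (e a) (H a) (f a)"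
  shows "hform (\<Sum>a\<in>A. e a) (\<Prod>a\<in>A. H a) (\<lambda>x. \<Prod>a\<in>A. f a x)"
  using assms
proof (induction A rule: finite_induct)
  case empty
  then show ?case using hform.const[of 1] by simp
next
  case (insert a A)
  then show ?case by (auto intro: hform.mult)
qed

lemma hform_eval_poly:
  fixes F :: "('n::finite) int_mpoly"
  assumes "is_form F d"
  shows "hform d (\<Sum>\<alpha>\<in>Poly_Mapping.keys F. \<bar>Poly_Mapping.lookup F \<alpha>\<bar>) (eval_poly F)"
proof -
  have "hform d \<bar>Poly_Mapping.lookup F \<alpha>\<bar>
      (\<lambda>x. of_int (Poly_Mapping.lookup F \<alpha>) * (\<Prod>i\<in>UNIV. x $ i ^ Poly_Mapping.lookup \<alpha> i))"
    if "\<alpha> \<in> Poly_Mapping.keys F" for \<alpha>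
  proof -
    have p: "hform (Poly_Mapping.lookup \<alpha> i) 1 (\<lambda>x :: int ^ 'n. x $ i ^ Poly_Mapping.lookup \<alpha> i)" for i
      using hform_power[OF hform.coord, of "Poly_Mapping.lookup \<alpha> i" i] by simp
    have "hform (\<Sum>i\<in>UNIV. Poly_Mapping.lookup \<alpha> i) (\<Prod>i\<in>(UNIV :: 'n set). 1)
        (\<lambda>x :: int ^ 'n. \<Prod>i\<in>UNIV. x $ i ^ Poly_Mapping.lookup \<alpha> i)"
      by (rule hform_prod) (auto intro: p)
    moreover have "(\<Sum>i\<in>UNIV. Poly_Mapping.lookup \<alpha> i) = d"
      using assms that by (simp add: is_form_def)
    ultimately show ?thesis
      using hform.mult[OF hform.const[of "Poly_Mapping.lookup F \<alpha>"]] by fastforce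
  qed
  then show ?thesis
    unfolding eval_poly_def[abs_def] by (intro hform_sum) auto
qed

lemma hform_homogeneous: "hform e H f \<Longrightarrow> f (\<rho> *s x) = \<rho> ^ e * f x"
  by (induction rule: hform.induct) (auto simp: algebra_simps power_add)

text \<open>Taylor expansion along \<open>y\<close>: the coefficients are iterated derivatives
  divided by factorials, which keeps them integral. The last clause bounds all coefficients
  together; it is the source of the size bound for the integer that a prime has to avoid.\<close>

definition form_expansion ::
    "nat \<Rightarrow> int \<Rightarrow> (int ^ 'n \<Rightarrow> int) \<Rightarrow> int ^ ('n::finite) \<Rightarrow> (int ^ 'n \<Rightarrow> int poly) \<Rightarrow> bool" where
  "form_expansion e H f y Q \<longleftrightarrow> (\<forall>x s. poly (Q x) s = f (x + s *s y)) \<and> (\<forall>x. degree (Q x) \<le> e) \<and>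
    (\<forall>k\<le>e. \<exists>K. hform (e - k) K (\<lambda>x. coeff (Q x) k)) \<and>
    (\<forall>x X Y. (\<forall>i. \<bar>x $ i\<bar> \<le> X) \<longrightarrow> (\<forall>i. \<bar>y $ i\<bar> \<le> Y) \<longrightarrow>
      (\<Sum>k\<le>e. \<bar>coeff (Q x) k\<bar>) \<le> H * (X + Y) ^ e)"

lemma hform_expand:
  fixes y :: "int ^ 'n::finite"
  assumes "hform e H f"
  shows "\<exists>Q. form_expansion e H f y Q"
  using assms
proof (induction rule: hform.induct)
  case (zero e)
  then show ?case by (intro exI[of _ "\<lambda>x. 0"]) (auto simp: form_expansion_def intro: hform.zero)
next
  case (const c)
  then show ?case by (intro exI[of _ "\<lambda>x. [:c:]"]) (auto simp: form_expansion_def intro: hform.const)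
next
  case (coord i)
  have "hform (1 - k) (if k = 0 then 1 else \<bar>y $ i\<bar>) (\<lambda>x. coeff [:x $ i, y $ i:] k)" if "k \<le> 1" for k
    using that hform.coord[of i] hform.const[of "y $ i"] by (cases k) auto
  then have co: "\<forall>k\<le>1. \<exists>K. hform (1 - k) K (\<lambda>x. coeff [:x $ i, y $ i:] k)" by blast
  have le: "(\<Sum>k\<le>1. \<bar>coeff [:x $ i, y $ i:] k\<bar>) \<le> 1 * (X + Y) ^ 1"
    if "\<forall>i. \<bar>x $ i\<bar> \<le> X" "\<forall>i. \<bar>y $ i\<bar> \<le> Y" for x and X Y :: int
    using that[THEN spec, of i] by simp
  show ?case
    unfolding form_expansion_def
    by (rule exI[of _ "\<lambda>x. [:x $ i, y $ i:]"], intro conjI co) (use le in auto)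
next
  case (add e H f K g)
  then obtain Q1 Q2 where QQ: "form_expansion e H f y Q1" "form_expansion e K g y Q2"
    by blast
  note Q1 = QQ(1)[unfolded form_expansion_def, THEN conjunct1]
    QQ(1)[unfolded form_expansion_def, THEN conjunct2, THEN conjunct1]
    QQ(1)[unfolded form_expansion_def, THEN conjunct2, THEN conjunct2, THEN conjunct1]
    QQ(1)[unfolded form_expansion_def, THEN conjunct2, THEN conjunct2, THEN conjunct2]
  note Q2 = QQ(2)[unfolded form_expansion_def, THEN conjunct1]
    QQ(2)[unfolded form_expansion_def, THEN conjunct2, THEN conjunct1]
    QQ(2)[unfolded form_expansion_def, THEN conjunct2, THEN conjunct2, THEN conjunct1]
    QQ(2)[unfolded form_expansion_def, THEN conjunct2, THEN conjunct2, THEN conjunct2]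
  show ?case
    unfolding form_expansion_def
  proof (intro exI[of _ "\<lambda>x. Q1 x + Q2 x"] conjI allI impI)
    fix k assume "k \<le> e"
    then obtain K1 K2 where "hform (e - k) K1 (\<lambda>x. coeff (Q1 x) k)" "hform (e - k) K2 (\<lambda>x. coeff (Q2 x) k)"
      using Q1(3) Q2(3) by blast
    from hform.add[OF this] show "\<exists>K. hform (e - k) K (\<lambda>x. coeff (Q1 x + Q2 x) k)"
      by auto
  next
    fix x :: "int ^ 'n" and X Y :: int
    assume a: "\<forall>i. \<bar>x $ i\<bar> \<le> X" "\<forall>i. \<bar>y $ i\<bar> \<le> Y"
    have "(\<Sum>k\<le>e. \<bar>coeff (Q1 x + Q2 x) k\<bar>) \<le> (\<Sum>k\<le>e. \<bar>coeff (Q1 x) k\<bar>) + (\<Sum>k\<le>e. \<bar>coeff (Q2 x) k\<bar>)"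
      by (auto simp: sum.distrib[symmetric] intro!: sum_mono)
    also have "\<dots> \<le> H * (X + Y) ^ e + K * (X + Y) ^ e"
      using Q1(4) Q2(4) a by (intro add_mono) auto
    finally show "(\<Sum>k\<le>e. \<bar>coeff (Q1 x + Q2 x) k\<bar>) \<le> (H + K) * (X + Y) ^ e"
      by (simp add: algebra_simps)
  qed (use Q1(1,2) Q2(1,2) in \<open>auto intro!: degree_add_le\<close>)
next
  case (mult e H f e' K g)
  then obtain Q1 Q2 where QQ: "form_expansion e H f y Q1" "form_expansion e' K g y Q2"
    by blast
  note Q1 = QQ(1)[unfolded form_expansion_def, THEN conjunct1]
    QQ(1)[unfolded form_expansion_def, THEN conjunct2, THEN conjunct1]
    QQ(1)[unfolded form_expansion_def, THEN conjunct2, THEN conjunct2, THEN conjunct1]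
    QQ(1)[unfolded form_expansion_def, THEN conjunct2, THEN conjunct2, THEN conjunct2]
  note Q2 = QQ(2)[unfolded form_expansion_def, THEN conjunct1]
    QQ(2)[unfolded form_expansion_def, THEN conjunct2, THEN conjunct1]
    QQ(2)[unfolded form_expansion_def, THEN conjunct2, THEN conjunct2, THEN conjunct1]
    QQ(2)[unfolded form_expansion_def, THEN conjunct2, THEN conjunct2, THEN conjunct2]
  show ?case
    unfolding form_expansion_def
  proof (intro exI[of _ "\<lambda>x. Q1 x * Q2 x"] conjI allI impI)
    fix x show "degree (Q1 x * Q2 x) \<le> e + e'"
      using Q1(2) Q2(2) by (meson add_mono degree_mult_le order_trans)
  next
    fix k assume k: "k \<le> e + e'"
    have "\<exists>K. hform (e + e' - k) K (\<lambda>x. coeff (Q1 x) i * coeff (Q2 x) (k - i))" if i: "i \<le> k" for i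
    proof (cases "i \<le> e \<and> k - i \<le> e'")
      case True
      then obtain K1 K2 where "hform (e - i) K1 (\<lambda>x. coeff (Q1 x) i)"
          "hform (e' - (k - i)) K2 (\<lambda>x. coeff (Q2 x) (k - i))"
        using Q1(3) Q2(3) by blast
      from hform.mult[OF this] have "hform (e - i + (e' - (k - i))) (K1 * K2)
        (\<lambda>x. coeff (Q1 x) i * coeff (Q2 x) (k - i))" .
      moreover have "e - i + (e' - (k - i)) = e + e' - k" using True i by linarith
      ultimately show ?thesis by auto
    next
      case False
      then have "coeff (Q1 x) i * coeff (Q2 x) (k - i) = 0" for x
        using Q1(2) Q2(2) by (metis coeff_eq_0 linorder_not_le mult_eq_0_iff order_le_less_trans)
      then have eq: "(\<lambda>x. coeff (Q1 x) i * coeff (Q2 x) (k - i)) = (\<lambda>x. 0)" by (intro ext)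
      show ?thesis unfolding eq using hform.zero by blast
    qed
    then obtain KK where "\<And>i. i \<le> k \<Longrightarrow> hform (e + e' - k) (KK i) (\<lambda>x. coeff (Q1 x) i * coeff (Q2 x) (k - i))"
      by metis
    then have "hform (e + e' - k) (\<Sum>i\<in>{..k}. KK i) (\<lambda>x. \<Sum>i\<in>{..k}. coeff (Q1 x) i * coeff (Q2 x) (k - i))"
      by (intro hform_sum) auto
    then show "\<exists>K. hform (e + e' - k) K (\<lambda>x. coeff (Q1 x * Q2 x) k)"
      by (auto simp: coeff_mult)
  next
    fix x :: "int ^ 'n" and X Y :: int
    assume a: "\<forall>i. \<bar>x $ i\<bar> \<le> X" "\<forall>i. \<bar>y $ i\<bar> \<le> Y"
    \<comment> \<open>The sum of the absolute coefficients is submultiplicative. The factors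
      \<open>1 ^ k\<close> bring the double sum into the shape of a product of two polynomials
      evaluated at \<open>1\<close>.\<close>
    have "(\<Sum>k\<le>e + e'. \<bar>coeff (Q1 x * Q2 x) k\<bar>)
        \<le> (\<Sum>k\<le>e + e'. (\<Sum>i\<le>k. \<bar>coeff (Q1 x) i\<bar> * \<bar>coeff (Q2 x) (k - i)\<bar>) * 1 ^ k)"
      by (auto simp: coeff_mult abs_mult[symmetric] intro!: sum_mono sum_abs)
    also have "\<dots> = (\<Sum>k\<le>e. \<bar>coeff (Q1 x) k\<bar> * 1 ^ k) * (\<Sum>k\<le>e'. \<bar>coeff (Q2 x) k\<bar> * 1 ^ k)"
      using Q1(2) Q2(2)
      by (intro polynomial_product[symmetric]) (metis abs_zero coeff_eq_0 order_le_less_trans)+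
    also have "\<dots> \<le> (H * (X + Y) ^ e) * (K * (X + Y) ^ e')"
    proof -
      have "0 \<le> X" "0 \<le> Y" using a by (meson abs_ge_zero order_trans)+
      then show ?thesis
        using Q1(4) Q2(4) a hform_nonneg[OF mult(1)]
        by (intro mult_mono) (auto intro!: sum_nonneg mult_nonneg_nonneg)
    qed
    finally show "(\<Sum>k\<le>e + e'. \<bar>coeff (Q1 x * Q2 x) k\<bar>) \<le> H * K * (X + Y) ^ (e + e')"
      by (simp add: algebra_simps power_add)
  qed (use Q1(1) Q2(1) in auto)
qed

text \<open>The derivative of a form, characterised by the properties that the descent uses: a
  Taylor congruence, Euler's identity, and the behaviour under scaling and congruence. The factor
  \<open>\<rho>\<close> on the left expresses homogeneity of degree \<open>e - 1\<close> in a form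
  that makes sense for \<open>e = 0\<close> too.\<close>

definition form_gradient :: "nat \<Rightarrow> (int ^ 'n \<Rightarrow> int) \<Rightarrow> (int ^ ('n::finite) \<Rightarrow> int ^ 'n \<Rightarrow> int) \<Rightarrow> bool" where
  "form_gradient e f D \<longleftrightarrow> (\<forall>x y z. D x (y + z) = D x y + D x z) \<and> (\<forall>x c y. D x (c *s y) = c * D x y) \<and>
    (\<forall>x y u. u ^ 2 dvd f (x + u *s y) - f x - u * D x y) \<and> (\<forall>x. D x x = int e * f x) \<and>
    (\<forall>x \<rho> y. \<rho> * D (\<rho> *s x) y = \<rho> ^ e * D x y) \<and> (\<forall>q x w y. q dvd D (x + q *s w) y - D x y)"

lemma hform_gradient:
  fixes f :: "int ^ 'n::finite \<Rightarrow> int"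
  assumes "hform e H f"
  shows "\<exists>D. form_gradient e f D"
  using assms
proof (induction rule: hform.induct)
  case (zero e)
  then show ?case by (intro exI[of _ "\<lambda>x y. 0"]) (auto simp: form_gradient_def)
next
  case (const c)
  then show ?case by (intro exI[of _ "\<lambda>x y. 0"]) (auto simp: form_gradient_def)
next
  case (coord i)
  then show ?case by (intro exI[of _ "\<lambda>x y. y $ i"]) (auto simp: form_gradient_def)
next
  case (add e H f K g)
  then obtain D1 D2 where DD: "form_gradient e f D1" "form_gradient e g D2"
    by blast
  have D1: "(\<forall>x y z. D1 x (y + z) = D1 x y + D1 x z)" "(\<forall>x c y. D1 x (c *s y) = c * D1 x y)"
    "(\<forall>x y u. u ^ 2 dvd f (x + u *s y) - f x - u * D1 x y)" "(\<forall>x. D1 x x = int e * f x)"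
    "(\<forall>x \<rho> y. \<rho> * D1 (\<rho> *s x) y = \<rho> ^ e * D1 x y)" "(\<forall>q x w y. q dvd D1 (x + q *s w) y - D1 x y)"
    using DD(1) unfolding form_gradient_def by blast+
  have D2: "(\<forall>x y z. D2 x (y + z) = D2 x y + D2 x z)" "(\<forall>x c y. D2 x (c *s y) = c * D2 x y)"
    "(\<forall>x y u. u ^ 2 dvd g (x + u *s y) - g x - u * D2 x y)" "(\<forall>x. D2 x x = int e * g x)"
    "(\<forall>x \<rho> y. \<rho> * D2 (\<rho> *s x) y = \<rho> ^ e * D2 x y)" "(\<forall>q x w y. q dvd D2 (x + q *s w) y - D2 x y)"
    using DD(2) unfolding form_gradient_def by blast+
  show ?case
    unfolding form_gradient_def
  proof (intro exI[of _ "\<lambda>x y. D1 x y + D2 x y"] conjI allI)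
    fix x y and u :: int
    have "u ^ 2 dvd (f (x + u *s y) - f x - u * D1 x y) + (g (x + u *s y) - g x - u * D2 x y)"
      using D1(3) D2(3) by (intro dvd_add) (auto simp: form_gradient_def)
    then show "u ^ 2 dvd f (x + u *s y) + g (x + u *s y) - (f x + g x) - u * (D1 x y + D2 x y)"
      by (simp add: algebra_simps)
  next
    fix x y w and q :: int
    have "q dvd (D1 (x + q *s w) y - D1 x y) + (D2 (x + q *s w) y - D2 x y)"
      using D1(6) D2(6) by (intro dvd_add) (auto simp: form_gradient_def)
    then show "q dvd D1 (x + q *s w) y + D2 (x + q *s w) y - (D1 x y + D2 x y)"
      by (simp add: algebra_simps)
  qed (use D1(1,2,4,5) D2(1,2,4,5) in \<open>auto simp: algebra_simps\<close>)
next
  case (mult e H f e' K g)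
  then obtain D1 D2 where DD: "form_gradient e f D1" "form_gradient e' g D2"
    by blast
  have D1: "(\<forall>x y z. D1 x (y + z) = D1 x y + D1 x z)" "(\<forall>x c y. D1 x (c *s y) = c * D1 x y)"
    "(\<forall>x y u. u ^ 2 dvd f (x + u *s y) - f x - u * D1 x y)" "(\<forall>x. D1 x x = int e * f x)"
    "(\<forall>x \<rho> y. \<rho> * D1 (\<rho> *s x) y = \<rho> ^ e * D1 x y)" "(\<forall>q x w y. q dvd D1 (x + q *s w) y - D1 x y)"
    using DD(1) unfolding form_gradient_def by blast+
  have D2: "(\<forall>x y z. D2 x (y + z) = D2 x y + D2 x z)" "(\<forall>x c y. D2 x (c *s y) = c * D2 x y)"
    "(\<forall>x y u. u ^ 2 dvd g (x + u *s y) - g x - u * D2 x y)" "(\<forall>x. D2 x x = int e' * g x)"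
    "(\<forall>x \<rho> y. \<rho> * D2 (\<rho> *s x) y = \<rho> ^ e' * D2 x y)" "(\<forall>q x w y. q dvd D2 (x + q *s w) y - D2 x y)"
    using DD(2) unfolding form_gradient_def by blast+
  have fq: "q dvd f (x + q *s w) - f x" for q x w
  proof -
    have "q dvd (f (x + q *s w) - f x - q * D1 x w) + q * D1 x w"
      by (intro dvd_add dvd_triv_left dvd_trans[OF _ D1(3)[rule_format]]) (simp add: power2_eq_square)
    then show ?thesis by simp
  qed
  have gq: "q dvd g (x + q *s w) - g x" for q x w
  proof -
    have "q dvd (g (x + q *s w) - g x - q * D2 x w) + q * D2 x w"
      by (intro dvd_add dvd_triv_left dvd_trans[OF _ D2(3)[rule_format]]) (simp add: power2_eq_square)
    then show ?thesis by simp
  qed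
  show ?case
    unfolding form_gradient_def
  proof (intro exI[of _ "\<lambda>x y. f x * D2 x y + g x * D1 x y"] conjI allI)
    fix x y and u :: int
    obtain a where a: "f (x + u *s y) - f x - u * D1 x y = u ^ 2 * a" using D1(3) by (meson dvdE)
    obtain b where b: "g (x + u *s y) - g x - u * D2 x y = u ^ 2 * b" using D2(3) by (meson dvdE)
    have fa: "f (x + u *s y) = f x + u * D1 x y + u ^ 2 * a" using a by simp
    have gb: "g (x + u *s y) = g x + u * D2 x y + u ^ 2 * b" using b by simp
    have "f (x + u *s y) * g (x + u *s y) - f x * g x - u * (f x * D2 x y + g x * D1 x y)
      = u ^ 2 * (f x * b + g x * a + D1 x y * D2 x y + u * D1 x y * b + u * D2 x y * a + u ^ 2 * a * b)"
      unfolding fa gb by (simp add: algebra_simps power2_eq_square)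
    then show "u ^ 2 dvd f (x + u *s y) * g (x + u *s y) - f x * g x - u * (f x * D2 x y + g x * D1 x y)"
      by simp
  next
    fix x y w and q :: int
    have "q dvd f (x + q *s w) * (D2 (x + q *s w) y - D2 x y) + (f (x + q *s w) - f x) * D2 x y
      + (g (x + q *s w) * (D1 (x + q *s w) y - D1 x y) + (g (x + q *s w) - g x) * D1 x y)"
      using D1(6) D2(6) fq gq by (intro dvd_add) (auto intro: dvd_mult dvd_mult2)
    then show "q dvd f (x + q *s w) * D2 (x + q *s w) y + g (x + q *s w) * D1 (x + q *s w) y
      - (f x * D2 x y + g x * D1 x y)"
      by (simp add: algebra_simps)
  next
    fix x y and \<rho> :: int
    have "\<rho> * (f (\<rho> *s x) * D2 (\<rho> *s x) y + g (\<rho> *s x) * D1 (\<rho> *s x) y)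
      = f (\<rho> *s x) * (\<rho> * D2 (\<rho> *s x) y) + g (\<rho> *s x) * (\<rho> * D1 (\<rho> *s x) y)"
      by (simp add: algebra_simps)
    also have "\<dots> = \<rho> ^ e * f x * (\<rho> ^ e' * D2 x y) + \<rho> ^ e' * g x * (\<rho> ^ e * D1 x y)"
      using D1(5) D2(5) hform_homogeneous[OF mult(1)] hform_homogeneous[OF mult(2)] by simp
    finally show "\<rho> * (f (\<rho> *s x) * D2 (\<rho> *s x) y + g (\<rho> *s x) * D1 (\<rho> *s x) y)
      = \<rho> ^ (e + e') * (f x * D2 x y + g x * D1 x y)"
      by (simp add: algebra_simps power_add)
  qed (use D1(1,2,4) D2(1,2,4) in \<open>auto simp: algebra_simps\<close>)
qed

section \<open>Nonsingular roots of polynomials in one variable\<close>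

text \<open>Lagrange's bound modulo \<open>p\<close>: a root splits off by synthetic division over
  the integers, and at the other points the linear factor is prime to \<open>p\<close>, so the
  quotient inherits these roots.\<close>

lemma prime_dvd_coeff_of_many_roots:
  fixes f :: "int poly"
  assumes "prime p" "degree f \<le> e" "finite A" "card A > e"
    and "\<And>s. s \<in> A \<Longrightarrow> p dvd poly f s"
    and "\<And>s t. s \<in> A \<Longrightarrow> t \<in> A \<Longrightarrow> s \<noteq> t \<Longrightarrow> \<not> p dvd s - t"
  shows "p dvd coeff f k"
  using assms(2-)
proof (induction e arbitrary: f A k)
  case 0
  then obtain c where f: "f = [:c:]" by (metis degree_eq_zeroE le_zero_eq)
  obtain s where "s \<in> A" using 0 by (metis card.empty equals0I less_irrefl)
  then have "p dvd c" using 0(4)[of s] f by simp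
  then show ?case by (simp add: f coeff_pCons split: nat.split)
next
  case (Suc e)
  obtain s where s: "s \<in> A" using Suc.prems by (metis card.empty equals0I less_zeroE)
  define g where "g = synthetic_div f s"
  have fg: "f = [:poly f s:] + [:-s, 1:] * g"
    using synthetic_div_correct'[of s f] by (simp add: g_def add.commute)
  have dg: "degree g \<le> e" using Suc.prems(1) by (simp add: g_def degree_synthetic_div)
  have ps: "p dvd poly f s" using Suc.prems s by blast
  have "p dvd coeff g k" for k
  proof (rule Suc.IH[OF dg, of "A - {s}"])
    show "finite (A - {s})" using Suc.prems by simp
    show "e < card (A - {s})" using Suc.prems s by simp
  next
    fix t assume t: "t \<in> A - {s}"
    have "poly f t = poly f s + (t - s) * poly g t"
      by (subst fg) (simp add: algebra_simps)
    then have "p dvd (t - s) * poly g t"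
      using Suc.prems(4)[of t] t ps by (metis DiffD1 dvd_add_right_iff)
    moreover have "\<not> p dvd t - s" using Suc.prems(5)[of t s] s t by auto
    ultimately show "p dvd poly g t" using assms(1) by (metis prime_dvd_mult_iff)
  next
    fix a b assume "a \<in> A - {s}" "b \<in> A - {s}" "a \<noteq> b"
    then show "\<not> p dvd a - b" using Suc.prems(5) by blast
  qed
  then have "p dvd coeff ([:poly f s:] + [:-s, 1:] * g) k"
    using ps by (simp add: coeff_pCons dvd_add dvd_diff split: nat.split)
  then show ?case by (subst fg)
qed

text \<open>The uniqueness half of Hensel's lemma: two roots modulo \<open>p ^ k\<close> that agree
  modulo \<open>p\<close> coincide if the derivative is a unit, so the roots counted are distinct
  modulo \<open>p\<close> and Lagrange's bound applies. The derivative \<open>\<delta>\<close> is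
  given only by its Taylor congruence, because in the application it is a gradient evaluated along a
  direction.\<close>

lemma card_nonsingular_roots_le:
  fixes f :: "int poly" and p :: int
  assumes p: "prime p" and deg: "degree f \<le> e" and q: "q = p ^ k" "k \<ge> 1"
    and \<delta>: "\<And>s u. u ^ 2 dvd poly f (s + u) - poly f s - u * \<delta> s"
  shows "card {s \<in> {0..<q}. q dvd poly f s \<and> \<not> p dvd \<delta> s} \<le> e"
proof (rule ccontr)
  define A where "A = {s \<in> {0..<q}. q dvd poly f s \<and> \<not> p dvd \<delta> s}"
  assume "\<not> ?thesis"
  then have c: "card A > e" by (simp add: A_def)
  have fin: "finite A" unfolding A_def by (rule finite_subset[of _ "{0..<q}"]) auto
  have pq: "p dvd q" using q by (simp add: dvd_power)
  have inc: "\<not> p dvd s - t" if st: "s \<in> A" "t \<in> A" "s \<noteq> t" for s t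
  proof
    assume "p dvd s - t"
    define u where "u = s - t"
    have s: "s = t + u" by (simp add: u_def)
    have pu: "p dvd u" using \<open>p dvd s - t\<close> by (simp add: u_def)
    obtain w where "poly f s - poly f t - u * \<delta> t = u ^ 2 * w" using \<delta>[of u t] s by (metis dvdE)
    then have "poly f s - poly f t = u * (\<delta> t + u * w)" by (simp add: algebra_simps power2_eq_square)
    moreover have "q dvd poly f s - poly f t" using st by (simp add: A_def dvd_diff)
    ultimately have "q dvd u * (\<delta> t + u * w)" by simp
    moreover have "\<not> p dvd \<delta> t + u * w"
      using st pu by (simp add: A_def dvd_add_left_iff)
    then have "coprime q (\<delta> t + u * w)"
      using p q by (simp add: prime_imp_coprime)
    ultimately have "q dvd u" using coprime_dvd_mult_left_iff by blast
    moreover have "\<bar>u\<bar> < q" using st by (auto simp: A_def u_def)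
    ultimately have "u = 0" by (metis dvd_imp_le_int linorder_not_le abs_ge_self order_le_less_trans)
    then show False using st s by simp
  qed
  have co: "p dvd coeff f i" for i
    by (rule prime_dvd_coeff_of_many_roots[OF p deg fin c _ inc]) (auto simp: A_def intro: dvd_trans[OF pq])
  \<comment> \<open>What remains is that \<open>f\<close> vanishes identically modulo
    \<open>p\<close>. Then \<open>f (s + p) - f s\<close> is divisible by \<open>p ^ 2\<close>, and
    the Taylor congruence with \<open>u = p\<close> makes the derivative divisible by
    \<open>p\<close>.\<close>
  then have "[:p:] dvd f" by (simp add: const_poly_dvd_iff)
  then obtain g where g: "f = smult p g" by (auto elim!: dvdE)
  obtain s where s: "s \<in> A" using c by (metis card.empty equals0I less_zeroE)
  have "poly g (s + p) = poly ([:poly g s:] + [:-s, 1:] * synthetic_div g s) (s + p)"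
    using synthetic_div_correct'[of s g] by (simp add: add.commute)
  then have "p dvd poly g (s + p) - poly g s" by (simp add: left_diff_distrib[symmetric])
  then have "p ^ 2 dvd poly f (s + p) - poly f s"
    by (simp add: g power2_eq_square right_diff_distrib[symmetric])
  then have "p ^ 2 dvd p * \<delta> s"
    using dvd_diff[OF _ \<delta>[of p s], of "poly f (s + p) - poly f s"] by simp
  then have "p dvd \<delta> s" using p by (simp add: power2_eq_square)
  then show False using s by (simp add: A_def)
qed

text \<open>The derivative of a Taylor coefficient along the same direction is a multiple of the
  next coefficient. The form of a congruence modulo \<open>u ^ 2\<close> matches the way in which
  gradients are known.\<close>

lemma coeff_pcompose_shift:
  fixes f :: "int poly"
  shows "u ^ 2 dvd coeff (pcompose f [:u, 1:]) k - coeff f k - u * (int (Suc k) * coeff f (Suc k))"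
proof (induction f arbitrary: k)
  case 0
  then show ?case by simp
next
  case (pCons a f)
  show ?case
  proof (cases k)
    case 0
    obtain b where "coeff (pcompose f [:u, 1:]) 0 - coeff f 0 - u * (int (Suc 0) * coeff f (Suc 0)) = u ^ 2 * b"
      using pCons.IH[of 0] by (meson dvdE)
    then have b: "poly f u = coeff f 0 + u * coeff f (Suc 0) + u ^ 2 * b" by simp
    have "coeff (pcompose (pCons a f) [:u, 1:]) 0 - a - u * coeff f 0 = u ^ 2 * (coeff f (Suc 0) + u * b)"
      by (simp add: pcompose_pCons b algebra_simps power2_eq_square)
    then show ?thesis using 0 by simp
  next
    case (Suc j)
    obtain b where "coeff (pcompose f [:u, 1:]) k - coeff f k - u * (int (Suc k) * coeff f (Suc k)) = u ^ 2 * b"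
      using pCons.IH[of k] by (meson dvdE)
    then have b: "coeff (pcompose f [:u, 1:]) k = coeff f k + u * (int (Suc k) * coeff f (Suc k)) + u ^ 2 * b" by simp
    obtain c where "coeff (pcompose f [:u, 1:]) j - coeff f j - u * (int (Suc j) * coeff f (Suc j)) = u ^ 2 * c"
      using pCons.IH[of j] by (meson dvdE)
    then have c: "coeff (pcompose f [:u, 1:]) j = coeff f j + u * (int (Suc j) * coeff f (Suc j)) + u ^ 2 * c" by simp
    have "coeff (pcompose (pCons a f) [:u, 1:]) k - coeff (pCons a f) k - u * (int (Suc k) * coeff (pCons a f) (Suc k))
      = u ^ 2 * (int (Suc k) * coeff f (Suc k) + u * b + c)"
      using b c Suc by (simp add: pcompose_pCons algebra_simps power2_eq_square)
    then show ?thesis by simp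
  qed
qed

section \<open>Determinants and volumes of lattices\<close>

text \<open>The change of variables theorem of the library needs a linearly ordered index type.\<close>

typedef ('n::finite) ordered_copy = "{..<CARD('n)}"
  by (rule exI[of _ 0]) simp

instance ordered_copy :: (finite) finite
proof
  have "(UNIV :: 'a ordered_copy set) = Abs_ordered_copy ` {..<CARD('a)}"
    by (rule type_definition.univ[OF type_definition_ordered_copy])
  then show "finite (UNIV :: 'a ordered_copy set)" by (metis finite_imageI finite_lessThan)
qed

instantiation ordered_copy :: (finite) linorder
begin
definition less_eq_ordered_copy :: "'a ordered_copy \<Rightarrow> 'a ordered_copy \<Rightarrow> bool" where
  "x \<le> y \<longleftrightarrow> Rep_ordered_copy x \<le> Rep_ordered_copy y"
definition less_ordered_copy :: "'a ordered_copy \<Rightarrow> 'a ordered_copy \<Rightarrow> bool" where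
  "x < y \<longleftrightarrow> Rep_ordered_copy x < Rep_ordered_copy y"
instance
  by standard (auto simp: less_eq_ordered_copy_def less_ordered_copy_def Rep_ordered_copy_inject)
end

instance ordered_copy :: (finite) wellorder
proof -
  have "wf {(x :: 'a ordered_copy, y). x < y}"
    by (rule wf_subset[OF wf_measure[of Rep_ordered_copy]]) (auto simp: less_ordered_copy_def)
  then show "OFCLASS('a ordered_copy, wellorder_class)"
    by (rule wf_wellorderI) intro_classes
qed

lemma card_ordered_copy: "CARD('n::finite ordered_copy) = CARD('n)"
  by (simp add: type_definition.card[OF type_definition_ordered_copy])

lemma swapidseq_conj:
  assumes "bij e" "swapidseq n p"
  shows "swapidseq n (e \<circ> p \<circ> inv_into UNIV e)"
  using assms(2)
proof (induction rule: swapidseq.induct)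
  case id
  have "e \<circ> id \<circ> inv_into UNIV e = id" using assms(1) by (auto simp: fun_eq_iff bij_is_surj surj_f_inv_f)
  then show ?case using swapidseq.id by metis
next
  case (comp_Suc n p a b)
  have ne: "e a \<noteq> e b" using comp_Suc.hyps(2) bij_is_inj[OF assms(1)] by (auto dest: injD)
  have eq: "e \<circ> (Transposition.transpose a b \<circ> p) \<circ> inv_into UNIV e = Transposition.transpose (e a) (e b) \<circ> (e \<circ> p \<circ> inv_into UNIV e)"
    using assms(1) by (auto simp: fun_eq_iff Transposition.transpose_def dest: bij_is_inj injD)
  show ?case unfolding eq by (rule swapidseq.comp_Suc[OF comp_Suc.IH ne])
qed

lemma sign_conj:
  fixes e :: "'m::finite \<Rightarrow> 'n::finite"
  assumes "bij e" "p permutes UNIV"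
  shows "sign (e \<circ> p \<circ> inv_into UNIV e) = sign p"
proof -
  have "permutation p" using assms(2) by (metis finite permutation_permutes)
  then obtain n where n: "swapidseq n p" by (auto simp: permutation_def)
  have "evenperm p \<longleftrightarrow> even n" "evenperm (e \<circ> p \<circ> inv_into UNIV e) \<longleftrightarrow> even n"
    using n swapidseq_conj[OF assms(1) n] by (metis evenperm_unique)+
  then show ?thesis by (simp add: sign_def)
qed

lemma det_reindex:
  fixes e :: "'m::finite \<Rightarrow> 'n::finite" and A :: "'n \<Rightarrow> 'n \<Rightarrow> real"
  assumes e: "bij e"
  shows "det (\<chi> k l. A (e k) (e l)) = det (\<chi> i j. A i j)"
proof -
  have ei: "inv_into UNIV e (e x) = x" "e (inv_into UNIV e y) = y" for x y
    using e by (auto simp: bij_is_inj bij_is_surj surj_f_inv_f)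
  have "(\<Sum>p | p permutes UNIV. of_int (sign p) * (\<Prod>k\<in>UNIV. A (e k) (e (p k))))
    = (\<Sum>p | p permutes UNIV. of_int (sign p) * (\<Prod>i\<in>UNIV. A i (p i)))"
  proof (rule sum.reindex_bij_witness[of _ "\<lambda>p. inv_into UNIV e \<circ> p \<circ> e" "\<lambda>p. e \<circ> p \<circ> inv_into UNIV e"])
    fix p :: "'m \<Rightarrow> 'm" assume "p \<in> {p. p permutes UNIV}"
    then have p: "p permutes UNIV" by simp
    show "inv_into UNIV e \<circ> (e \<circ> p \<circ> inv_into UNIV e) \<circ> e = p" by (simp add: fun_eq_iff ei)
    have "bij (e \<circ> p \<circ> inv_into UNIV e)" using e p by (intro bij_comp bij_imp_bij_inv permutes_bij)
    then show "e \<circ> p \<circ> inv_into UNIV e \<in> {p. p permutes UNIV}" by (intro CollectI bij_imp_permutes) auto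
    have "(\<Prod>i\<in>UNIV. A i ((e \<circ> p \<circ> inv_into UNIV e) i)) = (\<Prod>k\<in>UNIV. A (e k) ((e \<circ> p \<circ> inv_into UNIV e) (e k)))"
      using e by (intro prod.reindex_bij_betw[symmetric])
    then show "of_int (sign (e \<circ> p \<circ> inv_into UNIV e)) * (\<Prod>i\<in>UNIV. A i ((e \<circ> p \<circ> inv_into UNIV e) i))
        = of_int (sign p) * (\<Prod>k\<in>UNIV. A (e k) (e (p k)))"
      using sign_conj[OF e p] by (simp add: ei)
  next
    fix p :: "'n \<Rightarrow> 'n" assume "p \<in> {p. p permutes UNIV}"
    then have p: "p permutes UNIV" by simp
    show "e \<circ> (inv_into UNIV e \<circ> p \<circ> e) \<circ> inv_into UNIV e = p" by (simp add: fun_eq_iff ei)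
    have "bij (inv_into UNIV e \<circ> p \<circ> e)" using e p by (intro bij_comp bij_imp_bij_inv permutes_bij)
    then show "inv_into UNIV e \<circ> p \<circ> e \<in> {p. p permutes UNIV}" by (intro CollectI bij_imp_permutes) auto
  qed
  then show ?thesis by (simp add: det_def)
qed

lemma prod_Basis_cart:
  fixes v :: "real ^ 'n::finite"
  shows "(\<Prod>b\<in>Basis. v \<bullet> b) = (\<Prod>i\<in>UNIV. v $ i)"
proof -
  have B: "(Basis :: (real ^ 'n) set) = range (\<lambda>i. axis i 1)" by (auto simp: Basis_vec_def)
  have inj: "inj (\<lambda>i. axis i 1 :: real ^ 'n)" by (auto simp: inj_on_def axis_eq_axis)
  show ?thesis unfolding B prod.reindex[OF inj] by (simp add: inner_axis)
qed

text \<open>The formula for ordered index types is transported along a bijection of the indices.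
  Renaming coordinates maps boxes to boxes with the same edges, which pins down Lebesgue measure,
  and it conjugates the matrix without changing its determinant.\<close>

lemma measure_linear_image_unit_cube:
  fixes T :: "real ^ 'n::finite \<Rightarrow> real ^ 'n"
  assumes T: "linear T"
  shows "measure lebesgue (T ` cbox 0 1) = \<bar>det (matrix T)\<bar>"
proof -
  obtain e :: "'n ordered_copy \<Rightarrow> 'n" where e: "bij e"
    by (metis card_ordered_copy finite finite_same_card_bij)
  have ei: "inv_into UNIV e (e x) = x" "e (inv_into UNIV e y) = y" for x y
    using e by (auto simp: bij_is_inj bij_is_surj surj_f_inv_f)
  define \<phi> :: "real ^ 'n \<Rightarrow> real ^ ('n ordered_copy)" where "\<phi> x = (\<chi> k. x $ e k)" for x
  define \<psi> :: "real ^ ('n ordered_copy) \<Rightarrow> real ^ 'n" where "\<psi> y = (\<chi> i. y $ inv_into UNIV e i)" for y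
  have pp: "\<phi> (\<psi> y) = y" "\<psi> (\<phi> x) = x" for x y by (simp_all add: \<phi>_def \<psi>_def vec_eq_iff ei)
  have lin: "linear \<phi>" "linear \<psi>" by (auto intro!: linearI simp: \<phi>_def \<psi>_def vec_eq_iff)
  have meas: "\<phi> \<in> borel_measurable lborel"
    using lin(1) by (auto intro!: borel_measurable_continuous_onI linear_continuous_on linear_conv_bounded_linear[THEN iffD1])
  have lb: "lborel = distr lborel borel \<phi>"
  proof (rule lborel_eqI)
    fix l u :: "real ^ ('n ordered_copy)" assume lu: "\<And>b. b \<in> Basis \<Longrightarrow> l \<bullet> b \<le> u \<bullet> b"
    have vim: "\<phi> -` box l u = box (\<psi> l) (\<psi> u)"
    proof (intro equalityI subsetI)
      fix x assume "x \<in> \<phi> -` box l u"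
      then have "l $ k < x $ e k \<and> x $ e k < u $ k" for k by (auto simp: \<phi>_def mem_box_cart)
      from this[of "inv_into UNIV e _"] show "x \<in> box (\<psi> l) (\<psi> u)" by (simp add: mem_box_cart \<psi>_def ei)
    next
      fix x assume "x \<in> box (\<psi> l) (\<psi> u)"
      then have "l $ inv_into UNIV e i < x $ i \<and> x $ i < u $ inv_into UNIV e i" for i by (auto simp: \<psi>_def mem_box_cart)
      from this[of "e _"] show "x \<in> \<phi> -` box l u" by (simp add: mem_box_cart \<phi>_def ei)
    qed
    have le: "l $ k \<le> u $ k" for k
    proof -
      have "axis k (1 :: real) \<in> Basis" by (auto simp: Basis_vec_def)
      from lu[OF this] show ?thesis by (simp add: inner_axis)
    qed
    have "emeasure (distr lborel borel \<phi>) (box l u) = emeasure lborel (box (\<psi> l) (\<psi> u))"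
      using meas by (subst emeasure_distr) (auto simp: vim)
    also have "\<dots> = (\<Prod>b\<in>Basis. (\<psi> u - \<psi> l) \<bullet> b)"
    proof (rule emeasure_lborel_box)
      fix b :: "real ^ 'n" assume "b \<in> Basis"
      then obtain i where "b = axis i 1" by (auto simp: Basis_vec_def)
      then show "\<psi> l \<bullet> b \<le> \<psi> u \<bullet> b" using le by (simp add: inner_axis \<psi>_def)
    qed
    also have "(\<Prod>b\<in>Basis. (\<psi> u - \<psi> l) \<bullet> b) = (\<Prod>i\<in>UNIV. (u - l) $ inv_into UNIV e i)"
      unfolding prod_Basis_cart by (simp add: \<psi>_def)
    also have "\<dots> = (\<Prod>k\<in>UNIV. (u - l) $ k)"
      by (rule prod.reindex_bij_betw) (rule bij_imp_bij_inv[OF e])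
    finally show "emeasure (distr lborel borel \<phi>) (box l u) = (\<Prod>b\<in>Basis. (u - l) \<bullet> b)"
      unfolding prod_Basis_cart .
  qed simp
  define A where "A = T ` cbox 0 1"
  have comp: "compact A" unfolding A_def using T by (intro compact_continuous_image linear_continuous_on compact_cbox) (simp add: linear_conv_bounded_linear)
  have compp: "compact (\<phi> ` A)" using comp lin by (intro compact_continuous_image linear_continuous_on) (auto simp: linear_conv_bounded_linear)
  have "emeasure lborel (\<phi> ` A) = emeasure lborel (\<phi> -` (\<phi> ` A))"
    using compp meas by (subst lb) (subst emeasure_distr, auto intro: borel_compact)
  also have "\<phi> -` (\<phi> ` A) = A"
  proof
    show "\<phi> -` (\<phi> ` A) \<subseteq> A" by (auto, metis pp(2))
  qed auto
  finally have "measure lborel (\<phi> ` A) = measure lborel A" by (simp add: measure_def)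
  moreover have "measure lebesgue A = measure lborel A"
    using comp by (intro measure_completion) (auto intro: borel_compact)
  moreover have "measure lebesgue (\<phi> ` A) = measure lborel (\<phi> ` A)"
    using compp by (intro measure_completion) (auto intro: borel_compact)
  ultimately have 1: "measure lebesgue A = measure lebesgue (\<phi> ` A)" by simp
  define T' where "T' = \<phi> \<circ> T \<circ> \<psi>"
  have linT': "linear T'" unfolding T'_def by (intro linear_compose lin T)
  have \<psi>cube: "\<psi> ` cbox 0 1 = cbox 0 1"
  proof
    show "\<psi> ` cbox 0 1 \<subseteq> cbox 0 1" by (auto simp: \<psi>_def mem_box_cart)
    show "cbox 0 1 \<subseteq> \<psi> ` cbox 0 1"
    proof
      fix x :: "real ^ 'n" assume "x \<in> cbox 0 1"
      then have "\<phi> x \<in> cbox 0 1" by (auto simp: \<phi>_def mem_box_cart)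
      then show "x \<in> \<psi> ` cbox 0 1" using pp(2) by (metis imageI)
    qed
  qed
  have "\<phi> ` A = T' ` cbox 0 1"
  proof -
    have "T' ` cbox 0 1 = \<phi> ` T ` \<psi> ` cbox 0 1" by (simp only: T'_def image_comp comp_assoc)
    then show ?thesis by (simp only: \<psi>cube A_def)
  qed
  moreover have "measure lebesgue (T' ` cbox 0 1) = \<bar>det (matrix T')\<bar> * measure lebesgue (cbox 0 (1 :: real ^ ('n ordered_copy)))"
    by (rule measure_linear_image[OF linT']) auto
  moreover have "measure lebesgue (cbox 0 (1 :: real ^ ('n ordered_copy))) = 1"
  proof -
    have "(0 :: real ^ ('n ordered_copy)) \<in> cbox 0 1" by (simp add: mem_box_cart)
    then have "cbox 0 (1 :: real ^ ('n ordered_copy)) \<noteq> {}" by blast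
    then show ?thesis by (subst measure_completion) (auto simp: content_cbox_cart)
  qed
  moreover have "matrix T' = (\<chi> k l. matrix T $ e k $ e l)"
  proof -
    have ax: "\<psi> (axis l 1) = axis (e l) 1" for l
      by (simp add: \<psi>_def vec_eq_iff axis_def) (metis ei)
    show ?thesis unfolding matrix_def T'_def \<phi>_def o_def ax by (simp add: vec_eq_iff)
  qed
  moreover have "det (\<chi> k l. matrix T $ e k $ e l) = det (matrix T)"
    using det_reindex[OF e, of "\<lambda>i j. matrix T $ i $ j"] by simp
  ultimately show ?thesis using 1 by (simp add: A_def)
qed

lemma of_int_vec_nth [simp]: "of_int_vec x $ i = of_int (x $ i)"
  by (simp add: of_int_vec_def)

lemma of_int_vec_add: "of_int_vec (x + y) = of_int_vec x + of_int_vec y"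
  by (simp add: vec_eq_iff)

lemma of_int_vec_diff: "of_int_vec (x - y) = of_int_vec x - of_int_vec y"
  by (simp add: vec_eq_iff)

lemma of_int_vec_0 [simp]: "of_int_vec 0 = 0"
  by (simp add: vec_eq_iff)

lemma of_int_vec_scaleR: "of_int_vec (c *s x) = of_int c *\<^sub>R (of_int_vec x :: real ^ 'n)"
  by (simp add: vec_eq_iff)

lemma of_int_vec_sum: "of_int_vec (\<Sum>a\<in>A. f a) = (\<Sum>a\<in>A. of_int_vec (f a))"
  by (induction A rule: infinite_finite_induct) (auto simp: of_int_vec_add)

lemma of_int_vec_inject [simp]: "of_int_vec x = (of_int_vec y :: real ^ 'n) \<longleftrightarrow> x = y"
  by (simp add: vec_eq_iff)

lemma inj_of_int_vec: "inj_on (of_int_vec :: int ^ 'n \<Rightarrow> real ^ 'n) A"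
  by (simp add: inj_on_def)

abbreviation rv :: "int ^ 'n \<Rightarrow> real ^ 'n" where "rv \<equiv> of_int_vec"

section \<open>Determinants of systems of \<open>n\<close> vectors\<close>

definition rows_det :: "('n \<Rightarrow> real ^ 'n) \<Rightarrow> real" where
  "rows_det f = det (\<chi> i. f i)"

lemma rows_det_gram: "rows_det f ^ 2 = det (\<chi> i j. f i \<bullet> f j)"
proof -
  have "(\<chi> i j. f i \<bullet> f j) = (\<chi> i. f i) ** transpose (\<chi> i. f i)"
    by (simp add: vec_eq_iff matrix_matrix_mult_def transpose_def inner_vec_def)
  then show ?thesis by (simp add: det_mul rows_det_def power2_eq_square)
qed

lemma det_of_int: "det (\<chi> i j. (of_int (A i j) :: real)) = of_int (det (\<chi> i j. A i j))"
  by (simp add: det_def)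

lemma rows_det_nonzero:
  fixes f :: "'n::finite \<Rightarrow> real ^ 'n"
  assumes "inj f" "independent (range f)"
  shows "rows_det f \<noteq> 0"
proof -
  have "\<forall>c. (\<Sum>i\<in>UNIV. c i *s row i (\<chi> i. f i)) = 0 \<longrightarrow> (\<forall>i. c i = 0)"
  proof (intro allI impI)
    fix c :: "'n \<Rightarrow> real" and i
    assume 0: "(\<Sum>i\<in>UNIV. c i *s row i (\<chi> i. f i)) = 0"
    have row: "row i (\<chi> i. f i) = f i" for i by (simp add: row_def vec_eq_iff)
    have "(\<Sum>i\<in>UNIV. c i *\<^sub>R f i) = 0" using 0 by (simp add: row scalar_mult_eq_scaleR)
    then have "(\<Sum>v\<in>range f. c (inv_into UNIV f v) *\<^sub>R v) = 0"
      using assms(1) by (subst sum.reindex) auto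
    then have "c (inv_into UNIV f (f i)) = 0"
      using assms(2) by (subst (asm) independent_explicit) auto
    then show "c i = 0" using assms(1) by simp
  qed
  then have "\<exists>B. (\<chi> i. f i) ** B = mat 1" by (simp only: matrix_right_invertible_independent_rows)
  then have "invertible (\<chi> i. f i)" by (metis invertible_def matrix_left_right_inverse)
  then show ?thesis unfolding rows_det_def by (simp add: invertible_det_nz)
qed

lemma rows_det_independent:
  fixes f :: "'n::finite \<Rightarrow> real ^ 'n"
  assumes "rows_det f \<noteq> 0"
  shows "inj f" "independent (range f)"
proof -
  show "inj f"
  proof (rule injI, rule ccontr)
    fix i j assume "f i = f j" "i \<noteq> j"
    then have "det (\<chi> i. f i) = 0"
      by (intro det_identical_rows[of i j]) (auto simp: row_def vec_eq_iff)
    then show False using assms by (simp add: rows_det_def)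
  qed
  have "rows (\<chi> i. f i) = range f" by (auto simp: rows_def row_def vec_eq_iff image_def vec_lambda_eta)
  moreover have "vec.independent (rows (\<chi> i. f i))"
    using assms det_dependent_rows unfolding rows_det_def by blast
  ultimately show "independent (range f)"
    by (simp add: dependent_vec_eq)
qed

text \<open>Both transition matrices are integral. A nonzero integral determinant has absolute value
  at least \<open>1\<close>, which gives one inequality; exchanging the roles gives the other. The
  first alternative in \<open>main\<close> covers the case that everything vanishes.\<close>

lemma rows_det_integer_change:
  fixes f g :: "'n::finite \<Rightarrow> real ^ 'n"
  assumes fg: "\<And>i. \<exists>c :: 'n \<Rightarrow> int. f i = (\<Sum>j\<in>UNIV. of_int (c j) *\<^sub>R g j)"
    and gf: "\<And>i. \<exists>c :: 'n \<Rightarrow> int. g i = (\<Sum>j\<in>UNIV. of_int (c j) *\<^sub>R f j)"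
  shows "\<bar>rows_det f\<bar> = \<bar>rows_det g\<bar>"
proof -
  have main: "\<bar>rows_det f\<bar> = 0 \<and> \<bar>rows_det g\<bar> = 0 \<or> \<bar>rows_det g\<bar> \<le> \<bar>rows_det f\<bar>"
    if fg: "\<And>i. \<exists>c :: 'n \<Rightarrow> int. f i = (\<Sum>j\<in>UNIV. of_int (c j) *\<^sub>R g j)"
    and gf: "\<And>i. \<exists>c :: 'n \<Rightarrow> int. g i = (\<Sum>j\<in>UNIV. of_int (c j) *\<^sub>R f j)" for f g :: "'n \<Rightarrow> real ^ 'n"
  proof -
    obtain C :: "'n \<Rightarrow> 'n \<Rightarrow> int" where C: "\<And>i. f i = (\<Sum>j\<in>UNIV. of_int (C i j) *\<^sub>R g j)" using fg by metis
    obtain D :: "'n \<Rightarrow> 'n \<Rightarrow> int" where D: "\<And>i. g i = (\<Sum>j\<in>UNIV. of_int (D i j) *\<^sub>R f j)" using gf by metis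
    have 1: "(\<chi> i. f i) = (\<chi> i j. of_int (C i j)) ** (\<chi> i. g i)"
      by (subst vec_eq_iff) (auto simp: C matrix_matrix_mult_def vec_eq_iff)
    have 2: "(\<chi> i. g i) = (\<chi> i j. of_int (D i j)) ** (\<chi> i. f i)"
      by (subst vec_eq_iff) (auto simp: D matrix_matrix_mult_def vec_eq_iff)
    have e1: "rows_det f = of_int (det (\<chi> i j. C i j)) * rows_det g"
      unfolding rows_det_def by (subst 1) (simp add: det_mul det_of_int)
    have e2: "rows_det g = of_int (det (\<chi> i j. D i j)) * rows_det f"
      unfolding rows_det_def by (subst 2) (simp add: det_mul det_of_int)
    show ?thesis
    proof (cases "det (\<chi> i j. C i j) = 0")
      case True
      then show ?thesis using e1 e2 by simp
    next
      case False
      then have "1 \<le> \<bar>det (\<chi> i j. C i j)\<bar>" by linarith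
      then have "1 \<le> \<bar>of_int (det (\<chi> i j. C i j)) :: real\<bar>" by linarith
      then have "1 * \<bar>rows_det g\<bar> \<le> \<bar>of_int (det (\<chi> i j. C i j))\<bar> * \<bar>rows_det g\<bar>" by (intro mult_right_mono) auto
      then show ?thesis using e1 by (simp add: abs_mult)
    qed
  qed
  from main[OF fg gf] main[OF gf fg] show ?thesis by linarith
qed

lemma rows_det_add_span:
  fixes f :: "'n::finite \<Rightarrow> real ^ 'n"
  assumes "x \<in> span (f ` (- {i}))"
  shows "rows_det (f(i := f i + x)) = rows_det f"
proof -
  have row: "row j (\<chi> i. f i) = f j" for j by (simp add: row_def vec_eq_iff)
  have "{row j (\<chi> i. f i) |j. j \<noteq> i} = f ` (- {i})" by (auto simp: row)
  then have "det (\<chi> k. if k = i then row i (\<chi> i. f i) + x else row k (\<chi> i. f i)) = det (\<chi> i. f i)"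
    using assms by (intro det_row_span) (simp add: span_vec_eq)
  moreover have "(\<chi> k. if k = i then row i (\<chi> i. f i) + x else row k (\<chi> i. f i)) = (\<chi> k. (f(i := f i + x)) k)"
    by (subst vec_eq_iff) (simp add: row)
  ultimately show ?thesis by (simp add: rows_det_def)
qed

lemma rows_det_scale:
  fixes f :: "'n::finite \<Rightarrow> real ^ 'n"
  shows "rows_det (f(i := c *\<^sub>R f i)) = c * rows_det f"
proof -
  have eq: "f(i := c *\<^sub>R f i) = (\<lambda>k. if k = i then c *s f k else f k)"
    by (auto simp: scalar_mult_eq_scaleR)
  show ?thesis unfolding rows_det_def eq using det_row_mul[of i c f f] by (simp only: if_cancel)
qed

lemma rows_det_shear:
  fixes f :: "'n::finite \<Rightarrow> real ^ 'n"
  shows "rows_det (\<lambda>i. if i = i0 then f i else f i + c i *\<^sub>R f i0) = rows_det f"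
proof -
  have "rows_det (\<lambda>i. if i \<in> S then f i + c i *\<^sub>R f i0 else f i) = rows_det f" if "finite S" "i0 \<notin> S" for S
    using that
  proof (induction S rule: finite_induct)
    case (insert a S)
    define g where "g = (\<lambda>i. if i \<in> S then f i + c i *\<^sub>R f i0 else f i)"
    have "(\<lambda>i. if i \<in> insert a S then f i + c i *\<^sub>R f i0 else f i) = g(a := g a + c a *\<^sub>R f i0)"
      using insert by (auto simp: g_def)
    moreover have "rows_det (g(a := g a + c a *\<^sub>R f i0)) = rows_det g"
    proof (rule rows_det_add_span)
      have "f i0 = g i0" "i0 \<noteq> a" using insert by (auto simp: g_def)
      then have "f i0 \<in> g ` (- {a})" by auto
      then show "c a *\<^sub>R f i0 \<in> span (g ` (- {a}))" by (intro span_scale span_base)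
    qed
    ultimately show ?case using insert by (simp add: g_def)
  qed simp
  from this[of "- {i0}"] have "rows_det (\<lambda>i. if i \<in> - {i0} then f i + c i *\<^sub>R f i0 else f i) = rows_det f" by simp
  moreover have "(\<lambda>i. if i \<in> - {i0} then f i + c i *\<^sub>R f i0 else f i) = (\<lambda>i. if i = i0 then f i else f i + c i *\<^sub>R f i0)"
    by auto
  ultimately show ?thesis by simp
qed

text \<open>Completed in this way, a lattice basis has the relative volume as an \<open>n\<close>-dimensional determinant.\<close>

definition lattice_frame :: "(int ^ 'n) set \<Rightarrow> 'n set \<Rightarrow> ('n \<Rightarrow> real ^ ('n::finite)) \<Rightarrow> bool" where
  "lattice_frame b I f \<longleftrightarrow> inj_on f I \<and> f ` I = rv ` b \<and>
     (\<forall>i. i \<notin> I \<longrightarrow> norm (f i) = 1) \<and> (\<forall>i j. i \<notin> I \<longrightarrow> j \<noteq> i \<longrightarrow> f i \<bullet> f j = 0)"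

section \<open>Frames and the determinant of a lattice\<close>

lemma frame_enumeration:
  fixes B U :: "(real ^ 'n::finite) set"
  assumes "finite B" "finite U" "card B + card U = CARD('n)" "card (I :: 'n set) = card B"
  shows "\<exists>f. bij_betw f I B \<and> bij_betw f (- I) U"
proof -
  have "card (- I) = card U" using assms by (simp add: Compl_eq_Diff_UNIV card_Diff_subset)
  then obtain f g where "bij_betw f I B" "bij_betw g (- I) U"
    using assms by (metis finite_same_card_bij finite)
  then have "bij_betw (\<lambda>i. if i \<in> I then f i else g i) I B" "bij_betw (\<lambda>i. if i \<in> I then f i else g i) (- I) U"
    by (auto simp: bij_betw_def inj_on_def image_def)
  then show ?thesis by blast
qed

lemma orthonormal_complement_card:
  fixes S U :: "(real ^ 'n::finite) set"
  assumes "subspace S" "pairwise orthogonal U" "\<forall>u\<in>U. norm u = 1" "span U = {x. \<forall>y\<in>S. orthogonal y x}"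
  shows "finite U" "card U + dim S = CARD('n)"
proof -
  have "0 \<notin> U" using assms(3) by auto
  then have ind: "independent U" using assms(2) by (rule pairwise_orthogonal_independent[rotated])
  then show "finite U" by (rule independent_imp_finite)
  have "card U = dim (span U)" using ind by (simp add: dim_eq_card_independent)
  moreover have "dim {y \<in> (UNIV :: (real ^ 'n) set). \<forall>x\<in>S. orthogonal x y} + dim S = dim (UNIV :: (real ^ 'n) set)"
    using assms(1) by (intro dim_subspace_orthogonal_to_vectors) auto
  ultimately show "card U + dim S = CARD('n)" using assms(4) by (simp add: dim_UNIV)
qed

lemma orthonormal_complement_exists:
  fixes S :: "(real ^ 'n::finite) set"
  shows "\<exists>U. pairwise orthogonal U \<and> (\<forall>u\<in>U. norm u = 1) \<and> span U = {x. \<forall>y\<in>S. orthogonal y x}"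
proof -
  have "subspace {x. \<forall>y\<in>S. orthogonal y x}"
    using subspace_orthogonal_comp[of S] by (simp add: orthogonal_comp_def)
  then show ?thesis by (rule orthonormal_basis_subspace) blast
qed

lemma lattice_basis_finite: "lattice_basis b L \<Longrightarrow> finite b"
  by (auto simp: lattice_basis_def finite_image_iff[OF inj_of_int_vec] dest: independent_imp_finite)

lemma lattice_basis_card_le:
  fixes b :: "(int ^ 'n::finite) set"
  assumes "lattice_basis b L"
  shows "card b \<le> CARD('n)"
  using independent_bound[of "rv ` b"] assms by (simp add: lattice_basis_def card_image[OF inj_of_int_vec])

lemma lattice_basis_subset:
  assumes "lattice_basis b L"
  shows "b \<subseteq> L"
proof
  fix v assume v: "v \<in> b"
  have "v = (\<Sum>u\<in>b. (if u = v then 1 else 0) *s u)"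
    using v lattice_basis_finite[OF assms] by (simp add: if_distrib[of "\<lambda>c. c *s _"] sum.delta cong: if_cong)
  moreover have "L = range (\<lambda>c :: int ^ 'a \<Rightarrow> int. \<Sum>v\<in>b. c v *s v)" using assms by (simp add: lattice_basis_def)
  ultimately show "v \<in> L" by (simp only:) (rule range_eqI)
qed

lemma lattice_basis_span:
  assumes "lattice_basis b L"
  shows "span (rv ` L) = span (rv ` b)"
proof
  show "span (rv ` b) \<subseteq> span (rv ` L)" using lattice_basis_subset[OF assms] by (intro span_mono image_mono)
  have "rv x \<in> span (rv ` b)" if "x \<in> L" for x
  proof -
    from that obtain c :: "int ^ 'a \<Rightarrow> int" where "x = (\<Sum>v\<in>b. c v *s v)"
      using assms by (auto simp: lattice_basis_def)
    then have "rv x = (\<Sum>v\<in>b. of_int (c v) *\<^sub>R rv v)" by (simp add: of_int_vec_sum of_int_vec_scaleR)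
    also have "\<dots> \<in> span (rv ` b)" by (intro span_sum span_scale span_base) auto
    finally show ?thesis .
  qed
  then show "span (rv ` L) \<subseteq> span (rv ` b)" by (intro span_minimal) auto
qed

lemma lattice_basis_card:
  assumes "lattice_basis b L"
  shows "card b = lattice_rank L"
proof -
  have "dim (rv ` L) = dim (rv ` b)" using lattice_basis_span[OF assms] by (metis dim_span)
  also have "\<dots> = card (rv ` b)" using assms by (intro dim_eq_card_independent) (simp add: lattice_basis_def)
  finally show ?thesis by (simp add: lattice_rank_def card_image[OF inj_of_int_vec])
qed

lemma lattice_frame_extend:
  assumes b: "lattice_basis b L" and U: "pairwise orthogonal U" "\<forall>u\<in>U. norm u = 1"
    "span U = {x. \<forall>y\<in>span (rv ` b). orthogonal y x}" and I: "card I = card b"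
  shows "\<exists>f. lattice_frame b I f \<and> bij_betw f (- I) U"
proof -
  have ind: "independent (rv ` b)" using b by (simp add: lattice_basis_def)
  have "dim (span (rv ` b)) = card b"
    using dim_eq_card_independent[OF ind] card_image[OF inj_of_int_vec] by (simp add: dim_span)
  then have cU: "finite U" "card b + card U = CARD('a)"
    using orthonormal_complement_card[OF subspace_span U] by auto
  obtain f where f: "bij_betw f I (rv ` b)" "bij_betw f (- I) U"
    using frame_enumeration[of "rv ` b" U I] cU I lattice_basis_finite[OF b]
    by (auto simp: card_image[OF inj_of_int_vec])
  have "lattice_frame b I f"
    unfolding lattice_frame_def
  proof (intro conjI allI impI)
    show "inj_on f I" "f ` I = rv ` b" using f by (auto simp: bij_betw_def)
    fix i assume i: "i \<notin> I"
    then have fi: "f i \<in> U" using f(2) by (auto simp: bij_betw_def)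
    then show "norm (f i) = 1" using U by blast
    fix j assume "j \<noteq> i"
    show "f i \<bullet> f j = 0"
    proof (cases "j \<in> I")
      case True
      then have "f j \<in> rv ` b" using f(1) by (auto simp: bij_betw_def)
      then have "f j \<in> span (rv ` b)" by (rule span_base)
      moreover have "f i \<in> span U" using fi by (rule span_base)
      ultimately show ?thesis using U(3) by (auto simp: orthogonal_def inner_commute)
    next
      case False
      then have "f j \<in> U" "f i \<noteq> f j" using f(2) i \<open>j \<noteq> i\<close> by (auto simp: bij_betw_def inj_on_def)
      then show ?thesis using U(1) fi by (auto simp: pairwise_def orthogonal_def)
    qed
  qed
  then show ?thesis using f(2) by blast
qed

lemma lattice_frame_exists:
  assumes "lattice_basis b L"
  shows "\<exists>I f. lattice_frame b I f"
proof -
  obtain U where U: "pairwise orthogonal U" "\<forall>u\<in>U. norm u = 1"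
    "span U = {x. \<forall>y\<in>span (rv ` b). orthogonal y x}"
    using orthonormal_complement_exists by blast
  have "card b \<le> CARD('a)" by (rule lattice_basis_card_le[OF assms])
  then obtain I :: "'a set" where "card I = card b" by (metis obtain_subset_with_card_n)
  then show ?thesis using lattice_frame_extend[OF assms U] by blast
qed

text \<open>Any two orthonormal completions of the same basis have the same Gram matrix, hence the
  same determinant up to sign.\<close>

lemma frame_gram_eq:
  assumes f: "lattice_frame b I f" and g: "lattice_frame b I g" and eq: "\<And>i. i \<in> I \<Longrightarrow> f i = g i"
  shows "\<bar>rows_det f\<bar> = \<bar>rows_det g\<bar>"
proof -
  have "f i \<bullet> f j = g i \<bullet> g j" for i j
  proof (cases "i \<in> I \<and> j \<in> I")
    case True
    then show ?thesis using eq by simp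
  next
    case False
    show ?thesis
    proof (cases "i = j")
      case True
      then show ?thesis using False f g unfolding lattice_frame_def by (simp add: dot_square_norm)
    next
      case ne: False
      then have "f i \<bullet> f j = 0" "g i \<bullet> g j = 0"
        using False f g unfolding lattice_frame_def by (metis inner_commute)+
      then show ?thesis by simp
    qed
  qed
  then have "rows_det f ^ 2 = rows_det g ^ 2" by (simp add: rows_det_gram)
  then show ?thesis by (auto simp: power2_eq_iff)
qed

lemma lattice_frame_orthonormal_complement:
  assumes b: "lattice_basis b L" and f: "lattice_frame b I f"
  shows "card I = card b"
  using f card_image[of f I] card_image[OF inj_of_int_vec, of b] by (simp add: lattice_frame_def)

lemma frame_integer_combination:
  assumes b: "lattice_basis b L" and f: "lattice_frame b I f" and x: "x \<in> L"
  shows "\<exists>c :: 'n \<Rightarrow> int. rv x = (\<Sum>j\<in>UNIV. of_int (c j) *\<^sub>R f (j :: 'n::finite))"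
proof -
  from x obtain c :: "int ^ 'n \<Rightarrow> int" where "x = (\<Sum>v\<in>b. c v *s v)"
    using b by (auto simp: lattice_basis_def)
  then have "rv x = (\<Sum>v\<in>b. of_int (c v) *\<^sub>R rv v)" by (simp add: of_int_vec_sum of_int_vec_scaleR)
  also have "\<dots> = (\<Sum>w\<in>rv ` b. of_int (c (inv_into b rv w)) *\<^sub>R w)"
    by (subst sum.reindex[OF inj_of_int_vec]) (simp add: inv_into_f_f[OF inj_of_int_vec])
  also have "\<dots> = (\<Sum>w\<in>f ` I. of_int (c (inv_into b rv w)) *\<^sub>R w)" using f by (simp add: lattice_frame_def)
  also have "\<dots> = (\<Sum>j\<in>I. of_int (c (inv_into b rv (f j))) *\<^sub>R f j)"
    using f by (subst sum.reindex) (auto simp: lattice_frame_def)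
  also have "\<dots> = (\<Sum>j\<in>UNIV. of_int (if j \<in> I then c (inv_into b rv (f j)) else 0) *\<^sub>R f j)"
    by (rule sum.mono_neutral_cong_left) auto
  finally show ?thesis
    by (intro exI[of _ "\<lambda>j. if j \<in> I then c (inv_into b rv (f j)) else 0"])
qed

text \<open>Basis vectors and orthonormal vectors together are the images of the coordinate vectors
  under one linear map, and the solid is the image of the unit cube.\<close>

lemma relative_volume_frame:
  fixes B U :: "(real ^ 'n::finite) set" and f :: "'n \<Rightarrow> real ^ 'n"
  assumes f: "bij_betw f I B" "bij_betw f (- I) U"
  shows "measure lebesgue {x + u | x u. x \<in> parallelepiped B \<and> u \<in> parallelepiped U} = \<bar>rows_det f\<bar>"
proof -
  define T where "T y = (\<Sum>i\<in>UNIV. y $ i *\<^sub>R f i)" for y :: "real ^ 'n"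
  have par: "parallelepiped (f ` J) = (\<lambda>s. \<Sum>i\<in>J. s i *\<^sub>R f i) ` (J \<rightarrow> {0..1})" if inj: "inj_on f J" for J
  proof (intro equalityI subsetI)
    fix x assume "x \<in> parallelepiped (f ` J)"
    then obtain t where t: "t \<in> f ` J \<rightarrow> {0..1}" "x = (\<Sum>v\<in>f ` J. t v *\<^sub>R v)" by (auto simp: parallelepiped_def)
    then have "x = (\<Sum>i\<in>J. (t \<circ> f) i *\<^sub>R f i)" using inj by (simp add: sum.reindex)
    moreover have "t \<circ> f \<in> J \<rightarrow> {0..1}" using t by auto
    ultimately show "x \<in> (\<lambda>s. \<Sum>i\<in>J. s i *\<^sub>R f i) ` (J \<rightarrow> {0..1})" by blast
  next
    fix x assume "x \<in> (\<lambda>s. \<Sum>i\<in>J. s i *\<^sub>R f i) ` (J \<rightarrow> {0..1})"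
    then obtain s where s: "s \<in> J \<rightarrow> {0..1}" "x = (\<Sum>i\<in>J. s i *\<^sub>R f i)" by auto
    then have "x = (\<Sum>v\<in>f ` J. (s \<circ> inv_into J f) v *\<^sub>R v)" using inj by (simp add: sum.reindex)
    moreover have "s \<circ> inv_into J f \<in> f ` J \<rightarrow> {0..1}" using s inj by auto
    ultimately show "x \<in> parallelepiped (f ` J)" unfolding parallelepiped_def by blast
  qed
  have injs: "inj_on f I" "inj_on f (- I)" and im: "f ` I = B" "f ` (- I) = U" using f by (auto simp: bij_betw_def)
  have split: "(\<Sum>i\<in>UNIV. g i) = (\<Sum>i\<in>I. g i) + (\<Sum>i\<in>- I. g i)" for g :: "'n \<Rightarrow> real ^ 'n"
    by (metis Compl_disjoint Compl_partition finite sum.union_disjoint)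
  have "{x + u | x u. x \<in> parallelepiped B \<and> u \<in> parallelepiped U} = T ` cbox 0 1"
  proof (intro equalityI subsetI)
    fix z assume "z \<in> {x + u | x u. x \<in> parallelepiped B \<and> u \<in> parallelepiped U}"
    then obtain s t where st: "s \<in> I \<rightarrow> {0..1}" "t \<in> - I \<rightarrow> {0..1}"
      "z = (\<Sum>i\<in>I. s i *\<^sub>R f i) + (\<Sum>i\<in>- I. t i *\<^sub>R f i)"
      using par[OF injs(1)] par[OF injs(2)] im by auto
    define y :: "real ^ 'n" where "y = (\<chi> i. if i \<in> I then s i else t i)"
    have "z = T y" unfolding T_def split st(3) by (simp add: y_def)
    moreover have "y \<in> cbox 0 1" using st by (auto simp: y_def mem_box_cart Pi_iff)
    ultimately show "z \<in> T ` cbox 0 1" by blast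
  next
    fix z assume "z \<in> T ` cbox 0 1"
    then obtain y where y: "y \<in> cbox 0 1" "z = T y" by auto
    have "(\<Sum>i\<in>I. y $ i *\<^sub>R f i) \<in> parallelepiped B" "(\<Sum>i\<in>- I. y $ i *\<^sub>R f i) \<in> parallelepiped U"
      using par[OF injs(1)] par[OF injs(2)] im y by (auto simp: mem_box_cart intro!: imageI)
    then show "z \<in> {x + u | x u. x \<in> parallelepiped B \<and> u \<in> parallelepiped U}"
      using y(2) unfolding T_def split by blast
  qed
  moreover have "linear T"
    unfolding T_def by (rule linearI) (simp_all add: scaleR_add_left sum.distrib scaleR_sum_right)
  moreover have "matrix T = transpose (\<chi> i. f i)"
    unfolding matrix_def T_def transpose_def
    by (simp add: vec_eq_iff axis_def if_distrib[of "\<lambda>c. c * _"] cong: if_cong)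
  ultimately show ?thesis
    using measure_linear_image_unit_cube[of T] by (simp add: rows_det_def)
qed

text \<open>This frees the determinant from the two choices in its definition, of a basis and of the
  orthonormal set, and turns a volume into an algebraic quantity. The two choices are compared one
  after the other.\<close>

theorem lattice_det_frame:
  assumes b: "lattice_basis b L" and f: "lattice_frame b I f"
  shows "lattice_det L = \<bar>rows_det f\<bar>"
proof -
  define b0 where "b0 = (SOME b. lattice_basis b L)"
  have b0: "lattice_basis b0 L" unfolding b0_def using b by (rule someI)
  define P where "P = parallelepiped (rv ` b0)"
  define Q where "Q U \<longleftrightarrow> pairwise orthogonal U \<and> (\<forall>u\<in>U. norm u = 1) \<and> span U = orthogonal_comp P" for U
  define U where "U = (SOME U. Q U)"
  have comp: "orthogonal_comp P = {x. \<forall>y\<in>span (rv ` b0). orthogonal y x}"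
  proof (intro equalityI subsetI)
    fix x assume x: "x \<in> orthogonal_comp P"
    have "y \<in> P" if "y \<in> rv ` b0" for y
    proof -
      have "y = (\<Sum>v\<in>rv ` b0. (if v = y then 1 else 0) *\<^sub>R v)"
        using that lattice_basis_finite[OF b0] by (simp add: if_distrib[of "\<lambda>c. c *\<^sub>R _"] sum.delta cong: if_cong)
      then show ?thesis unfolding P_def parallelepiped_def
        by (rule image_eqI[where x = "\<lambda>v. if v = y then 1 else 0"]) auto
    qed
    then have 1: "orthogonal x y" if "y \<in> rv ` b0" for y using x that by (auto simp: orthogonal_comp_def orthogonal_commute)
    have "orthogonal x y" if "y \<in> span (rv ` b0)" for y
      using orthogonal_to_span[OF that, of x] 1 by blast
    then show "x \<in> {x. \<forall>y\<in>span (rv ` b0). orthogonal y x}" by (simp add: orthogonal_commute)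
  next
    fix x assume x: "x \<in> {x. \<forall>y\<in>span (rv ` b0). orthogonal y x}"
    have "P \<subseteq> span (rv ` b0)"
      unfolding P_def parallelepiped_def by clarify (rule span_sum, rule span_scale, rule span_base)
    then show "x \<in> orthogonal_comp P" using x by (auto simp: orthogonal_comp_def)
  qed
  have "Q U" unfolding U_def using orthonormal_complement_exists[of "span (rv ` b0)"]
    by (intro someI_ex[of Q]) (simp add: Q_def comp)
  then have U: "pairwise orthogonal U" "\<forall>u\<in>U. norm u = 1" "span U = {x. \<forall>y\<in>span (rv ` b0). orthogonal y x}"
    by (auto simp: Q_def comp)
  have spans: "span (rv ` b) = span (rv ` b0)" using lattice_basis_span[OF b] lattice_basis_span[OF b0] by simp
  have cI: "card I = card b0"
    using lattice_frame_orthonormal_complement[OF b f] lattice_basis_card[OF b] lattice_basis_card[OF b0] by simp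
  obtain f0 where f0: "lattice_frame b0 I f0" "bij_betw f0 (- I) U"
    using lattice_frame_extend[OF b0 U cI] by blast
  have "bij_betw f0 I (rv ` b0)" using f0(1) by (simp add: lattice_frame_def bij_betw_def)
  then have "measure lebesgue {x + u | x u. x \<in> P \<and> u \<in> parallelepiped U} = \<bar>rows_det f0\<bar>"
    unfolding P_def using relative_volume_frame f0(2) by blast
  then have det0: "lattice_det L = \<bar>rows_det f0\<bar>"
    unfolding lattice_det_def relative_volume_def Let_def U_def Q_def P_def b0_def[symmetric] by simp
  \<comment> \<open>A hybrid of both frames: the basis vectors of \<open>f\<close> with the
    orthonormal vectors of \<open>f0\<close>. It is related to \<open>f0\<close> by integral changes
    in both directions, and it differs from \<open>f\<close> only in the orthonormal part.\<close>
  define f1 where "f1 i = (if i \<in> I then f i else f0 i)" for i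
  have fr1: "lattice_frame b I f1"
    unfolding lattice_frame_def
  proof (intro conjI allI impI)
    show "inj_on f1 I" "f1 ` I = rv ` b" using f by (auto simp: lattice_frame_def f1_def inj_on_def image_def)
    fix i assume i: "i \<notin> I"
    then show "norm (f1 i) = 1" using f0 by (simp add: f1_def lattice_frame_def)
    fix j assume j: "j \<noteq> i"
    show "f1 i \<bullet> f1 j = 0"
    proof (cases "j \<in> I")
      case True
      then have "f j \<in> rv ` b" using f by (auto simp: lattice_frame_def)
      then have "f j \<in> span (rv ` b)" by (rule span_base)
      then have "f j \<in> span (rv ` b0)" by (simp only: spans)
      moreover have "f0 i \<in> span U" using f0(2) i by (auto simp: bij_betw_def intro: span_base)
      ultimately show ?thesis using U(3) i True by (auto simp: f1_def orthogonal_def inner_commute)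
    next
      case False
      then show ?thesis using f0(1) i j by (simp add: f1_def lattice_frame_def)
    qed
  qed
  have "\<bar>rows_det f1\<bar> = \<bar>rows_det f0\<bar>"
  proof (rule rows_det_integer_change)
    fix i show "\<exists>c :: 'a \<Rightarrow> int. f1 i = (\<Sum>j\<in>UNIV. of_int (c j) *\<^sub>R f0 j)"
    proof (cases "i \<in> I")
      case True
      then have "f1 i \<in> rv ` b" using fr1 by (auto simp: lattice_frame_def)
      then show ?thesis using frame_integer_combination[OF b0 f0(1)] lattice_basis_subset[OF b] by auto
    next
      case False
      then show ?thesis
        by (intro exI[of _ "\<lambda>j. if j = i then 1 else 0"])
          (simp add: f1_def if_distrib[of "\<lambda>c. of_int c *\<^sub>R _"] sum.delta cong: if_cong)
    qed
    show "\<exists>c :: 'a \<Rightarrow> int. f0 i = (\<Sum>j\<in>UNIV. of_int (c j) *\<^sub>R f1 j)"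
    proof (cases "i \<in> I")
      case True
      then have "f0 i \<in> rv ` b0" using f0 by (auto simp: lattice_frame_def)
      then show ?thesis using frame_integer_combination[OF b fr1] lattice_basis_subset[OF b0] by auto
    next
      case False
      then show ?thesis
        by (intro exI[of _ "\<lambda>j. if j = i then 1 else 0"])
          (simp add: f1_def if_distrib[of "\<lambda>c. of_int c *\<^sub>R _"] sum.delta cong: if_cong)
    qed
  qed
  moreover have "\<bar>rows_det f1\<bar> = \<bar>rows_det f\<bar>"
    by (rule frame_gram_eq[OF fr1 f]) (simp add: f1_def)
  ultimately show ?thesis using det0 by simp
qed

lemma lattice_frame_det_nonzero:
  assumes b: "lattice_basis b L" and f: "lattice_frame b I f"
  shows "rows_det f \<noteq> 0"
proof (rule rows_det_nonzero)
  have nz: "f i \<noteq> 0" if "i \<notin> I" for i using f that by (auto simp: lattice_frame_def)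
  have ne: "f i \<noteq> f j" if "i \<notin> I" "i \<noteq> j" for i j
    using f that nz[OF that(1)] unfolding lattice_frame_def by (metis inner_eq_zero_iff)
  show "inj f"
    using f ne unfolding lattice_frame_def inj_on_def by (metis UNIV_I)
  have "f ` (- I) \<union> f ` I = range f" by (metis Compl_partition2 image_Un)
  moreover have "independent (f ` J \<union> f ` I)" if "finite J" "J \<inter> I = {}" for J
    using that
  proof (induction J rule: finite_induct)
    case empty
    then show ?case using b f by (simp add: lattice_basis_def lattice_frame_def)
  next
    case (insert a J)
    have "f a \<notin> span (f ` J \<union> f ` I)"
    proof
      assume *: "f a \<in> span (f ` J \<union> f ` I)"
      have "orthogonal (f a) (f a)"
      proof (rule orthogonal_to_span[OF *])
        fix y assume "y \<in> f ` J \<union> f ` I"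
        then obtain k where "y = f k" "k \<in> J \<union> I" by auto
        then show "orthogonal (f a) y"
          using insert f by (auto simp: lattice_frame_def orthogonal_def)
      qed
      then show False using nz[of a] insert by (simp add: orthogonal_self)
    qed
    then show ?case using insert by (simp add: independent_insertI)
  qed
  ultimately show "independent (range f)" by (metis Compl_disjoint2 finite)
qed

text \<open>The square of the determinant is a Gram determinant with integer entries, as the
  completing vectors contribute only \<open>0\<close> and \<open>1\<close>; being positive, it is at
  least \<open>1\<close>.\<close>

lemma lattice_det_ge_1:
  assumes "integer_lattice L"
  shows "1 \<le> lattice_det L"
proof -
  obtain b where b: "lattice_basis b L" using assms by (auto simp: integer_lattice_def)
  obtain I f where f: "lattice_frame b I f" using lattice_frame_exists[OF b] by blast
  have "f i \<bullet> f j \<in> \<int>" for i j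
  proof (cases "i \<in> I \<and> j \<in> I")
    case True
    then obtain x y where "f i = rv x" "f j = rv y" using f unfolding lattice_frame_def by (metis (no_types, lifting) image_iff)
    then show ?thesis by (auto simp: inner_vec_def intro!: Ints_sum Ints_mult Ints_of_int)
  next
    case False
    show ?thesis
    proof (cases "i = j")
      case True
      then have "norm (f i) = 1" using False f by (auto simp: lattice_frame_def)
      then show ?thesis using True by (simp add: dot_square_norm)
    next
      case ne: False
      then have "f i \<bullet> f j = 0"
        using False f unfolding lattice_frame_def by (metis inner_commute)
      then show ?thesis by simp
    qed
  qed
  then have "\<exists>k. f i \<bullet> f j = of_int k" for i j using Ints_cases by blast
  then obtain G where G: "\<And>i j. f i \<bullet> f j = of_int (G i j)" by metis
  have "rows_det f ^ 2 = of_int (det (\<chi> i j. G i j))"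
    unfolding rows_det_gram G by (rule det_of_int)
  moreover have "rows_det f ^ 2 > 0" using lattice_frame_det_nonzero[OF b f] by simp
  ultimately have "(1::real) \<le> \<bar>rows_det f\<bar> ^ 2" by simp
  then have "1 \<le> \<bar>rows_det f\<bar>" by (metis abs_ge_zero one_power2 power2_le_imp_le)
  then show ?thesis using lattice_det_frame[OF b f] by simp
qed

lemma lattice_det_rank_0:
  fixes L :: "(int ^ 'n::finite) set"
  assumes b: "lattice_basis {} L"
  shows "lattice_det L = 1"
proof -
  obtain I and f :: "'n \<Rightarrow> real ^ 'n" where f: "lattice_frame {} I f" using lattice_frame_exists[OF b] by blast
  then have "I = {}" by (simp add: lattice_frame_def)
  then have "(\<chi> i j. f i \<bullet> f j) = (mat 1 :: real ^ 'n ^ 'n)"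
    using f by (auto simp: vec_eq_iff mat_def lattice_frame_def dot_square_norm)
  then have "rows_det f ^ 2 = 1" unfolding rows_det_gram by simp
  then have "\<bar>rows_det f\<bar> = 1" by (simp add: power2_eq_1_iff) (auto simp: power2_eq_1_iff)
  then show ?thesis using lattice_det_frame[OF b f] by simp
qed

text \<open>Height times base: \<open>w\<close> is the component of \<open>v\<close> orthogonal to
  the other basis vectors. Normalised and put in the place of \<open>v\<close>, it turns a frame of
  \<open>L\<close> into a frame of \<open>L'\<close>.\<close>

lemma lattice_det_insert:
  fixes v :: "int ^ 'n::finite"
  assumes b: "lattice_basis (insert v b) L" and v: "v \<notin> b" and b': "lattice_basis b L'"
    and hw: "rv v = h + w" "h \<in> span (rv ` b)" "\<And>y. y \<in> span (rv ` b) \<Longrightarrow> w \<bullet> y = 0"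
  shows "lattice_det L = norm w * lattice_det L'"
proof -
  have vs: "rv v \<notin> span (rv ` b)"
  proof -
    have "independent (insert (rv v) (rv ` b))" using b by (simp add: lattice_basis_def)
    moreover have "rv v \<notin> rv ` b" using v by auto
    ultimately show ?thesis by (simp add: independent_insert)
  qed
  then have w0: "w \<noteq> 0" using hw(1,2) by auto
  define u0 where "u0 = (1 / norm w) *\<^sub>R w"
  have u0: "norm u0 = 1" "w = norm w *\<^sub>R u0" using w0 by (auto simp: u0_def)
  obtain U where U: "pairwise orthogonal U" "\<forall>u\<in>U. norm u = 1"
    "span U = {x. \<forall>y\<in>span (rv ` insert v b). orthogonal y x}"
    using orthonormal_complement_exists by blast
  have "card (insert v b) \<le> CARD('n)"
    by (rule lattice_basis_card_le[OF b])
  then obtain I1 :: "'n set" where I1: "card I1 = card (insert v b)" by (metis obtain_subset_with_card_n)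
  obtain f1 where f1: "lattice_frame (insert v b) I1 f1" "bij_betw f1 (- I1) U"
    using lattice_frame_extend[OF b U I1] by blast
  obtain i0 where i0: "i0 \<in> I1" "f1 i0 = rv v"
    using f1(1) unfolding lattice_frame_def by (metis imageE image_eqI insertI1)
  define f where "f = f1(i0 := u0)"
  define I where "I = I1 - {i0}"
  have f1I: "f1 ` I = rv ` b"
  proof -
    have "inj_on f1 I1" using f1(1) by (simp add: lattice_frame_def)
    then have "f1 ` I = f1 ` I1 - {f1 i0}" using i0 unfolding I_def
      by (subst inj_on_image_set_diff[of f1 I1]) auto
    also have "\<dots> = rv ` insert v b - {rv v}" using f1(1) i0 by (simp add: lattice_frame_def)
    also have "\<dots> = rv ` b" using v by auto
    finally show ?thesis .
  qed
  have fI: "f ` I = rv ` b" using f1I by (auto simp: f_def I_def)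
  have hsp: "rv ` b \<subseteq> span (rv ` b)" by (rule span_superset)
  have U_orth: "u \<bullet> y = 0" if "u \<in> U" "y \<in> span (rv ` insert v b)" for u y
    using U(3) that span_base[OF that(1)] by (auto simp: orthogonal_def inner_commute)
  have wspan: "w \<in> span (rv ` insert v b)"
  proof -
    have "w = rv v - h" using hw(1) by simp
    moreover have "h \<in> span (rv ` insert v b)" using hw(2) span_mono[of "rv ` b" "rv ` insert v b"] by auto
    ultimately show ?thesis by (metis image_eqI insertI1 span_base span_diff)
  qed
  have fr: "lattice_frame b I f"
    unfolding lattice_frame_def
  proof (intro conjI allI impI)
    show "inj_on f I" using f1(1) by (auto simp: f_def I_def lattice_frame_def inj_on_def)
    show "f ` I = rv ` b" by (rule fI)
    fix i assume i: "i \<notin> I"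
    show "norm (f i) = 1"
      using i u0 f1(1) by (auto simp: f_def I_def lattice_frame_def)
    fix j assume j: "j \<noteq> i"
    have u0y: "u0 \<bullet> f1 k = 0" if "k \<noteq> i0" for k
    proof (cases "k \<in> I1")
      case True
      then have "f1 k \<in> span (rv ` b)" using f1I that hsp by (auto simp: I_def)
      then show ?thesis using hw(3) by (simp add: u0_def)
    next
      case False
      then have "f1 k \<in> U" using f1(2) by (auto simp: bij_betw_def)
      then have "f1 k \<bullet> w = 0" using wspan by (rule U_orth)
      then have "w \<bullet> f1 k = 0" by (simp add: inner_commute)
      then show ?thesis by (simp add: u0_def)
    qed
    show "f i \<bullet> f j = 0"
    proof (cases "i = i0 \<or> j = i0")
      case True
      then show ?thesis using u0y[of i] u0y[of j] j by (auto simp: f_def inner_commute)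
    next
      case False
      then have "i \<notin> I1" using i by (auto simp: I_def)
      then show ?thesis using f1(1) False j by (simp add: f_def lattice_frame_def)
    qed
  qed
  have "f1 = (f(i0 := norm w *\<^sub>R f i0))(i0 := (f(i0 := norm w *\<^sub>R f i0)) i0 + h)"
    using i0 hw(1) u0 by (auto simp: f_def fun_eq_iff)
  moreover have "rows_det ((f(i0 := norm w *\<^sub>R f i0))(i0 := (f(i0 := norm w *\<^sub>R f i0)) i0 + h)) = rows_det (f(i0 := norm w *\<^sub>R f i0))"
  proof (rule rows_det_add_span)
    have "rv ` b \<subseteq> (f(i0 := norm w *\<^sub>R f i0)) ` (- {i0})"
      using fI by (auto simp: I_def)
    then show "h \<in> span ((f(i0 := norm w *\<^sub>R f i0)) ` (- {i0}))" using hw(2) span_mono by blast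
  qed
  ultimately have "rows_det f1 = norm w * rows_det f" by (metis rows_det_scale)
  then show ?thesis using lattice_det_frame[OF b f1(1)] lattice_det_frame[OF b' fr] by (simp add: abs_mult)
qed

section \<open>Sublattices\<close>

text \<open>Additive subgroups. Congruences and subspaces cut them out without any basis at hand,
  and \<open>submodule_lattice\<close> shows that each of them is a lattice.\<close>

definition int_submodule :: "(int ^ 'n) set \<Rightarrow> bool" where
  "int_submodule L \<longleftrightarrow> 0 \<in> L \<and> (\<forall>x\<in>L. \<forall>y\<in>L. x - y \<in> L)"

lemma int_submoduleD:
  assumes "int_submodule L"
  shows "0 \<in> L" "x \<in> L \<Longrightarrow> y \<in> L \<Longrightarrow> x - y \<in> L" "x \<in> L \<Longrightarrow> - x \<in> L"
    "x \<in> L \<Longrightarrow> y \<in> L \<Longrightarrow> x + y \<in> L"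
proof -
  show z: "0 \<in> L" and d: "x \<in> L \<Longrightarrow> y \<in> L \<Longrightarrow> x - y \<in> L" for x y
    using assms by (auto simp: int_submodule_def)
  show m: "x \<in> L \<Longrightarrow> - x \<in> L" for x using d[OF z] by simp
  show "x \<in> L \<Longrightarrow> y \<in> L \<Longrightarrow> x + y \<in> L" using d[OF _ m] by fastforce
qed

lemma int_submodule_scale:
  assumes L: "int_submodule L" and x: "x \<in> L"
  shows "c *s x \<in> L"
proof -
  have nat: "int k *s x \<in> L" for k
  proof (induction k)
    case 0
    then show ?case using int_submoduleD(1)[OF L] by simp
  next
    case (Suc k)
    have "int (Suc k) *s x = int k *s x + x" by (simp add: vec_eq_iff algebra_simps)
    then show ?case using int_submoduleD(4)[OF L Suc x] by (simp only:)
  qed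
  show ?thesis
  proof (cases "c \<ge> 0")
    case True
    then show ?thesis using nat[of "nat c"] by simp
  next
    case False
    have "- (int (nat (- c)) *s x) \<in> L" using nat int_submoduleD(3)[OF L] by blast
    moreover have "- (int (nat (- c)) *s x) = c *s x" using False by (simp add: vec_eq_iff)
    ultimately show ?thesis by simp
  qed
qed

lemma int_submodule_sum:
  assumes L: "int_submodule L" and "\<And>v. v \<in> b \<Longrightarrow> f v \<in> L"
  shows "(\<Sum>v\<in>b. f v) \<in> L"
  using assms(2)
  by (induction b rule: infinite_finite_induct) (auto intro: int_submoduleD[OF L])

lemma lattice_submodule:
  assumes "integer_lattice L"
  shows "int_submodule L"
proof -
  obtain b where L: "L = range (\<lambda>c :: int ^ 'a \<Rightarrow> int. \<Sum>v\<in>b. c v *s v)"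
    using assms by (auto simp: integer_lattice_def lattice_basis_def)
  have "0 \<in> L" unfolding L by (rule range_eqI[of _ _ "\<lambda>v. 0"]) simp
  moreover have "x - y \<in> L" if "x \<in> L" "y \<in> L" for x y
  proof -
    obtain c d :: "int ^ 'a \<Rightarrow> int" where "x = (\<Sum>v\<in>b. c v *s v)" "y = (\<Sum>v\<in>b. d v *s v)"
      using \<open>x \<in> L\<close> \<open>y \<in> L\<close> unfolding L by auto
    then have "x - y = (\<Sum>v\<in>b. (c v - d v) *s v)"
      by (simp add: sum_subtractf[symmetric] vec.scale_left_diff_distrib vector_ssub_ldistrib sum_component vec_eq_iff algebra_simps)
    then show ?thesis unfolding L by (intro range_eqI)
  qed
  ultimately show ?thesis by (simp add: int_submodule_def)
qed

lemma submodule_restrict: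
  assumes "int_submodule L" "subspace H"
  shows "int_submodule (L \<inter> {x. rv x \<in> H})"
  using assms by (auto simp: int_submodule_def of_int_vec_diff subspace_0 subspace_diff)

lemma rows_det_row_linear:
  fixes f :: "'n::finite \<Rightarrow> real ^ 'n"
  shows "rows_det (f(i := x - c *\<^sub>R y)) = rows_det (f(i := x)) - c * rows_det (f(i := y))"
proof -
  have 1: "f(i := x - c *\<^sub>R y) = (\<lambda>k. if k = i then x + (- c) *s y else f k)"
    by (auto simp: scalar_mult_eq_scaleR)
  have 2: "f(i := x) = (\<lambda>k. if k = i then x else f k)" "f(i := y) = (\<lambda>k. if k = i then y else f k)" by auto
  show ?thesis
    unfolding rows_det_def 1 2 det_row_add[of i "\<lambda>k. x" "\<lambda>k. (- c) *s y"] det_row_mul[of i "- c" "\<lambda>k. y"] by simp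
qed

lemma rows_det_of_int:
  fixes F :: "'n::finite \<Rightarrow> int ^ 'n"
  shows "rows_det (\<lambda>i. rv (F i)) = of_int (det (\<chi> i j. F i $ j))"
proof -
  have "(\<chi> i. rv (F i)) = (\<chi> i j. of_int (F i $ j))" by (simp add: vec_eq_iff)
  then show ?thesis unfolding rows_det_def by (simp only: det_of_int)
qed

text \<open>A determinant with integer rows is an integral linear form on \<open>L\<close> whose kernel is
  \<open>L \<inter> H\<close>; a vector at which it has its least positive value completes the basis.\<close>

lemma adjoin_basis:
  fixes L :: "(int ^ 'n::finite) set"
  assumes L: "int_submodule L" and H: "subspace H" and b: "lattice_basis b (L \<inter> {x. rv x \<in> H})"
    and w: "w \<in> L" "rv w \<notin> H" and sp: "rv ` L \<subseteq> span (insert (rv w) (rv ` b))"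
  shows "\<exists>v. v \<in> L \<and> v \<notin> b \<and> rv v \<notin> H \<and> lattice_basis (insert v b) L \<and>
    (\<forall>x\<in>L. \<exists>k. x - k *s v \<in> L \<and> rv (x - k *s v) \<in> H)"
proof -
  have bH: "span (rv ` b) \<subseteq> H" using lattice_basis_subset[OF b] H by (intro span_minimal) auto
  have indb: "independent (rv ` b)" using b by (simp add: lattice_basis_def)
  have ind: "independent (insert (rv w) (rv ` b))"
    using indb bH w by (intro independent_insertI) auto
  \<comment> \<open>Completion by standard basis vectors keeps all rows integral, so that the
    determinant below takes integer values on integral vectors.\<close>
  obtain B where B: "insert (rv w) (rv ` b) \<subseteq> B" "B \<subseteq> insert (rv w) (rv ` b) \<union> Basis" "independent B"
    "insert (rv w) (rv ` b) \<union> Basis \<subseteq> span B"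
    using maximal_independent_subset_extend[OF _ ind, of "insert (rv w) (rv ` b) \<union> Basis"] by auto
  have "span Basis \<subseteq> span B" using B(4) by (intro span_minimal) auto
  then have spB: "span B = (UNIV :: (real ^ 'n) set)" by auto
  have cB: "card B = CARD('n)"
    using dim_eq_card_independent[OF B(3)] dim_span[of B] spB by (simp add: dim_UNIV)
  obtain f :: "'n \<Rightarrow> real ^ 'n" where f: "bij_betw f UNIV B"
    using cB independent_imp_finite[OF B(3)] by (metis finite finite_same_card_bij)
  have "\<exists>x. f i = rv x" for i
  proof -
    have "f i \<in> insert (rv w) (rv ` b) \<union> Basis" using f B(2) by (auto simp: bij_betw_def)
    moreover have "\<exists>x. u = rv x" if u: "u \<in> Basis" for u :: "real ^ 'n"
    proof -
      obtain j where "u = axis j 1" using u by (auto simp: Basis_vec_def)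
      then have "u = rv (axis j 1)" by (simp add: vec_eq_iff axis_def)
      then show ?thesis by blast
    qed
    ultimately show ?thesis by blast
  qed
  then obtain F where F: "\<And>i. f i = rv (F i)" by metis
  obtain i0 where i0: "f i0 = rv w" using f B(1) by (metis bij_betw_def imageE insert_subset)
  define \<Phi> where "\<Phi> x = det (\<chi> i j. (F(i0 := x)) i $ j)" for x
  have \<Phi>: "rows_det (f(i0 := rv x)) = of_int (\<Phi> x)" for x
  proof -
    have "f(i0 := rv x) = (\<lambda>i. rv ((F(i0 := x)) i))" by (auto simp: F)
    then show ?thesis unfolding \<Phi>_def by (simp only: rows_det_of_int)
  qed
  have \<Phi>lin: "\<Phi> (x - c *s y) = \<Phi> x - c * \<Phi> y" for x y c
  proof -
    have "real_of_int (\<Phi> (x - c *s y)) = of_int (\<Phi> x) - of_int c * of_int (\<Phi> y)"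
      unfolding \<Phi>[symmetric] of_int_vec_diff of_int_vec_scaleR by (rule rows_det_row_linear)
    then show ?thesis by (metis of_int_diff of_int_eq_iff of_int_mult)
  qed
  have rb: "rv ` b \<subseteq> f ` (- {i0})"
  proof
    fix y assume y: "y \<in> rv ` b"
    then have "y \<noteq> rv w" using bH w span_base[of y "rv ` b"] by auto
    moreover obtain i where "y = f i" using y f B(1) by (auto simp: bij_betw_def)
    ultimately show "y \<in> f ` (- {i0})" using i0 by auto
  qed
  have zero: "rows_det (f(i0 := h)) = 0" if "h \<in> span (rv ` b)" for h
  proof -
    have "h \<in> span ((f(i0 := 0)) ` (- {i0}))"
    proof -
      have "(f(i0 := 0)) ` (- {i0}) = f ` (- {i0})" by auto
      then show ?thesis using that span_mono[OF rb] by auto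
    qed
    then have "rows_det ((f(i0 := 0))(i0 := (f(i0 := 0)) i0 + h)) = rows_det (f(i0 := 0))"
      by (rule rows_det_add_span)
    moreover have "rows_det (f(i0 := 0)) = 0" using rows_det_scale[of f i0 0] by simp
    ultimately show ?thesis by simp
  qed
  have "f(i0 := rv w) = f" using i0 by auto
  moreover have "rows_det f \<noteq> 0" using f B(3) by (intro rows_det_nonzero) (auto simp: bij_betw_def)
  ultimately have \<Phi>w: "\<Phi> w \<noteq> 0" using \<Phi>[of w] by simp
  have ker: "rv x \<in> H" if x: "x \<in> L" "\<Phi> x = 0" for x
  proof -
    obtain c where c: "rv x - c *\<^sub>R rv w \<in> span (rv ` b)"
      using sp x(1) span_breakdown_eq[of "rv x" "rv w" "rv ` b"] by auto
    then have "rows_det (f(i0 := rv x - c *\<^sub>R rv w)) = 0" by (rule zero)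
    then have "real_of_int (\<Phi> x) - c * of_int (\<Phi> w) = 0" by (simp only: rows_det_row_linear \<Phi>)
    then have "c = 0" using x(2) \<Phi>w by simp
    then show ?thesis using c bH by auto
  qed
  define g where "g = (LEAST k. k > 0 \<and> (\<exists>x\<in>L. nat \<bar>\<Phi> x\<bar> = k))"
  have "\<exists>k. k > 0 \<and> (\<exists>x\<in>L. nat \<bar>\<Phi> x\<bar> = k)" using \<Phi>w w(1) by (intro exI[of _ "nat \<bar>\<Phi> w\<bar>"]) auto
  then have g: "g > 0 \<and> (\<exists>x\<in>L. nat \<bar>\<Phi> x\<bar> = g)" unfolding g_def by (rule LeastI_ex)
  then obtain v where v: "v \<in> L" "nat \<bar>\<Phi> v\<bar> = g" by blast
  have least: "g \<le> nat \<bar>\<Phi> x\<bar>" if "x \<in> L" "\<Phi> x \<noteq> 0" for x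
    unfolding g_def using that by (intro Least_le) auto
  have \<Phi>v: "\<Phi> v \<noteq> 0" using v g by auto
  have decomp: "x - (\<Phi> x div \<Phi> v) *s v \<in> L \<and> rv (x - (\<Phi> x div \<Phi> v) *s v) \<in> H" if x: "x \<in> L" for x
  proof -
    define y where "y = x - (\<Phi> x div \<Phi> v) *s v"
    have yL: "y \<in> L" unfolding y_def using L x v by (intro int_submoduleD int_submodule_scale)
    have "\<Phi> y = \<Phi> x mod \<Phi> v" unfolding y_def \<Phi>lin by (simp add: minus_div_mult_eq_mod)
    then have "\<bar>\<Phi> y\<bar> < \<bar>\<Phi> v\<bar>" using \<Phi>v by (simp add: abs_mod_less)
    then have "\<Phi> y = 0" using least[OF yL] v(2) by linarith
    then show ?thesis using ker[OF yL] yL by (simp add: y_def)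
  qed
  have vH: "rv v \<notin> H"
  proof
    assume "rv v \<in> H"
    then have "v \<in> L \<inter> {x. rv x \<in> H}" using v by simp
    then have "rv v \<in> span (rv ` b)" using lattice_basis_span[OF b] by (metis image_eqI span_base)
    then show False using zero \<Phi>[of v] \<Phi>v by simp
  qed
  have vb: "v \<notin> b" using vH lattice_basis_subset[OF b] by auto
  have bL: "b \<subseteq> L" using lattice_basis_subset[OF b] by auto
  have "lattice_basis (insert v b) L"
    unfolding lattice_basis_def
  proof (intro conjI equalityI subsetI)
    show "independent (rv ` insert v b)"
      using indb vH bH by (simp add: independent_insert) blast
  next
    fix x assume x: "x \<in> L"
    define k where "k = \<Phi> x div \<Phi> v"
    have "x - k *s v \<in> L \<inter> {x. rv x \<in> H}" using decomp[OF x] by (simp add: k_def)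
    then obtain c :: "int ^ 'n \<Rightarrow> int" where c: "x - k *s v = (\<Sum>u\<in>b. c u *s u)"
      using b unfolding lattice_basis_def by blast
    have "(\<Sum>u\<in>insert v b. (c(v := k)) u *s u) = k *s v + (\<Sum>u\<in>b. (c(v := k)) u *s u)"
      using vb lattice_basis_finite[OF b] by simp
    also have "(\<Sum>u\<in>b. (c(v := k)) u *s u) = (\<Sum>u\<in>b. c u *s u)"
      using vb by (intro sum.cong refl) auto
    finally have "x = (\<Sum>u\<in>insert v b. (c(v := k)) u *s u)" using c by (simp add: algebra_simps)
    then show "x \<in> range (\<lambda>c :: int ^ 'n \<Rightarrow> int. \<Sum>v\<in>insert v b. c v *s v)" by (intro range_eqI)
  next
    fix x assume "x \<in> range (\<lambda>c :: int ^ 'n \<Rightarrow> int. \<Sum>v\<in>insert v b. c v *s v)"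
    then obtain c :: "int ^ 'n \<Rightarrow> int" where x: "x = (\<Sum>u\<in>insert v b. c u *s u)" by blast
    have "(\<Sum>u\<in>insert v b. c u *s u) \<in> L"
      using v(1) bL by (intro int_submodule_sum[OF L] int_submodule_scale[OF L]) auto
    then show "x \<in> L" using x by simp
  qed
  then show ?thesis using v(1) vb vH decomp by blast
qed

text \<open>Induction on the rank: all but one member of a real basis consisting of vectors of
  \<open>L\<close> span a subspace \<open>H\<close>; the intersection of \<open>L\<close> with
  \<open>H\<close> has smaller rank, and \<open>adjoin_basis\<close> supplies the missing basis
  vector.\<close>

lemma submodule_lattice:
  fixes L :: "(int ^ 'n::finite) set"
  assumes "int_submodule L"
  shows "integer_lattice L"
  using assms
proof (induction "dim (rv ` L)" arbitrary: L)
  case 0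
  have "rv ` L \<subseteq> span {}"
    using 0(1) by (metis dim_eq_0 span_empty)
  then have L: "L = {0}" using int_submoduleD(1)[OF 0(2)] by (auto simp: vec_eq_iff)
  have "lattice_basis {} L"
    unfolding lattice_basis_def L by (auto simp: independent_empty)
  then show ?case by (auto simp: integer_lattice_def)
next
  case (Suc r)
  obtain B where B: "B \<subseteq> rv ` L" "independent B" "rv ` L \<subseteq> span B" "card B = dim (rv ` L)"
    using basis_exists by blast
  then have cB: "card B = Suc r" "finite B" using Suc(2) independent_imp_finite by auto
  then obtain u where u: "u \<in> B" by (metis card.empty equals0I nat.distinct(1))
  define B' where "B' = B - {u}"
  define H where "H = span B'"
  define L' where "L' = L \<inter> {x. rv x \<in> H}"
  have Bu: "B = insert u B'" "u \<notin> B'" using u by (auto simp: B'_def)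
  obtain w where w: "w \<in> L" "u = rv w" using u B(1) by blast
  have indB': "independent B'" using B(2) unfolding B'_def by (rule independent_mono) auto
  have uH: "u \<notin> H" unfolding H_def using B(2) Bu by (simp add: independent_insert)
  have L': "int_submodule L'" unfolding L'_def H_def using Suc.prems by (intro submodule_restrict subspace_span)
  have B'L: "B' \<subseteq> rv ` L'" using B(1) by (auto simp: L'_def H_def B'_def intro: span_base)
  have spL': "span (rv ` L') = H"
  proof
    show "span (rv ` L') \<subseteq> H" unfolding H_def by (intro span_minimal subspace_span) (auto simp: L'_def H_def)
    show "H \<subseteq> span (rv ` L')" unfolding H_def by (intro span_mono B'L)
  qed
  have "dim (rv ` L') = card B'"
    using spL' dim_span[of "rv ` L'"] dim_span[of B'] dim_eq_card_independent[OF indB'] by (simp add: H_def)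
  also have "\<dots> = r" using cB u by (simp add: B'_def)
  finally obtain b where b: "lattice_basis b L'" using Suc.hyps(1)[OF _ L'] by (auto simp: integer_lattice_def)
  have "span (rv ` b) = H" using lattice_basis_span[OF b] spL' by simp
  then have spb: "B' \<subseteq> span (rv ` b)" unfolding H_def by (metis span_superset)
  have "rv ` L \<subseteq> span (insert (rv w) (rv ` b))"
  proof -
    have "B \<subseteq> span (insert (rv w) (rv ` b))"
      using spb span_mono[of "rv ` b" "insert (rv w) (rv ` b)"] unfolding Bu w(2) by (auto intro: span_base)
    then have "span B \<subseteq> span (insert (rv w) (rv ` b))" by (intro span_minimal) auto
    then show ?thesis using B(3) by auto
  qed
  then obtain v where "lattice_basis (insert v b) L"
    using adjoin_basis[OF Suc.prems, of H b w] b uH w unfolding H_def L'_def by (metis subspace_span)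
  then show ?case by (auto simp: integer_lattice_def)
qed

lemma lattice_rank_eq_card: "lattice_basis b L \<Longrightarrow> lattice_rank L = card b"
  using lattice_basis_card by metis

text \<open>Some basis vector \<open>b1\<close> has \<open>\<mu> b1\<close> prime to
  \<open>p\<close>. Subtracting multiples of it makes \<open>\<mu>\<close> divisible by
  \<open>q\<close> at the other basis vectors, and \<open>q *s b1\<close> replaces \<open>b1\<close>
  itself. On frames this is a shear followed by scaling one row by \<open>q\<close>, whence the
  index.\<close>

lemma congruence_sublattice:
  fixes L :: "(int ^ 'n::finite) set" and \<mu> :: "int ^ 'n \<Rightarrow> int"
  assumes L: "integer_lattice L"
    and add: "\<And>x y. x \<in> L \<Longrightarrow> y \<in> L \<Longrightarrow> \<mu> (x + y) = \<mu> x + \<mu> y"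
    and scale: "\<And>c x. x \<in> L \<Longrightarrow> \<mu> (c *s x) = c * \<mu> x"
    and p: "prime p" and q: "q = p ^ k" and v: "v \<in> L" "\<not> p dvd \<mu> v"
  defines "L' \<equiv> {y \<in> L. q dvd \<mu> y}"
  shows "integer_lattice L'" "lattice_rank L' = lattice_rank L" "lattice_det L' = of_int q * lattice_det L"
proof -
  have Ls: "int_submodule L" using L by (rule lattice_submodule)
  obtain b where b: "lattice_basis b L" using L by (auto simp: integer_lattice_def)
  have bL: "b \<subseteq> L" using b by (rule lattice_basis_subset)
  have finb: "finite b" using b by (rule lattice_basis_finite)
  have qpos: "q > 0" using p q by (simp add: prime_gt_0_int)
  have mu_sum: "\<mu> (\<Sum>u\<in>A. c u *s h u) = (\<Sum>u\<in>A. c u * \<mu> (h u))" if "finite A" "h ` A \<subseteq> L" for A c and h :: "int ^ 'n \<Rightarrow> int ^ 'n"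
    using that
  proof (induction A rule: finite_induct)
    case empty
    have "\<mu> (0 *s 0) = 0" using scale[OF int_submoduleD(1)[OF Ls], of 0] by simp
    then show ?case by simp
  next
    case (insert a A)
    have "(\<Sum>u\<in>A. c u *s h u) \<in> L" using insert.prems by (intro int_submodule_sum[OF Ls] int_submodule_scale[OF Ls]) auto
    moreover have "h a \<in> L" using insert.prems by auto
    ultimately show ?case using insert by (simp add: add scale int_submodule_scale[OF Ls])
  qed
  obtain cv :: "int ^ 'n \<Rightarrow> int" where cv: "v = (\<Sum>u\<in>b. cv u *s u)" using v(1) b by (auto simp: lattice_basis_def)
  have "\<exists>b1\<in>b. \<not> p dvd \<mu> b1"
  proof (rule ccontr)
    assume "\<not> ?thesis"
    then have "p dvd (\<Sum>u\<in>b. cv u * \<mu> u)" by (intro dvd_sum) auto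
    moreover have "\<mu> v = (\<Sum>u\<in>b. cv u * \<mu> u)" using mu_sum[OF finb, of "\<lambda>u. u" cv] bL cv by simp
    ultimately show False using v(2) by simp
  qed
  then obtain b1 where b1: "b1 \<in> b" "\<not> p dvd \<mu> b1" by blast
  have cop: "coprime (\<mu> b1) q" using p b1(2) unfolding q by (simp add: coprime_commute prime_imp_coprime)
  then obtain t where t: "[\<mu> b1 * t = 1] (mod q)" using cong_solve_coprime_int by blast
  define a where "a x = \<mu> x * t" for x
  define \<beta> where "\<beta> x = (if x = b1 then q *s b1 else x - a x *s b1)" for x
  have \<beta>L: "\<beta> x \<in> L" if "x \<in> b" for x
    using that b1 bL by (auto simp: \<beta>_def intro!: int_submoduleD(2)[OF Ls] int_submodule_scale[OF Ls])
  have mu_diff: "\<mu> (x - y) = \<mu> x - \<mu> y" if "x \<in> L" "y \<in> L" for x y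
    using add[of "x - y" y] that int_submoduleD(2)[OF Ls] by simp
  have q\<beta>: "q dvd \<mu> (\<beta> x)" if "x \<in> b" for x
  proof (cases "x = b1")
    case True
    then show ?thesis using b1 bL by (auto simp: \<beta>_def scale)
  next
    case False
    have "\<mu> (\<beta> x) = \<mu> x - a x * \<mu> b1" using False that b1 bL
      by (auto simp: \<beta>_def mu_diff scale int_submodule_scale[OF Ls] subset_iff)
    also have "\<dots> = \<mu> x * (1 - \<mu> b1 * t)" by (simp add: a_def algebra_simps)
    finally show ?thesis using t by (simp add: cong_iff_dvd_diff dvd_diff_commute)
  qed
  have L's: "int_submodule L'"
    using Ls mu_diff scale[OF int_submoduleD(1)[OF Ls], of 0] by (auto simp: L'_def int_submodule_def dvd_diff)
  then show "integer_lattice L'" by (rule submodule_lattice)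
  obtain I and f :: "'n \<Rightarrow> real ^ 'n" where f: "lattice_frame b I f" using lattice_frame_exists[OF b] by blast
  define xx where "xx i = inv_into b rv (f i)" for i
  have xx: "xx i \<in> b" "rv (xx i) = f i" if "i \<in> I" for i
  proof -
    have "f i \<in> rv ` b" using f that by (auto simp: lattice_frame_def)
    then show "xx i \<in> b" "rv (xx i) = f i" unfolding xx_def by (auto intro: inv_into_into f_inv_into_f)
  qed
  obtain i1 where i1: "i1 \<in> I" "f i1 = rv b1" using f b1 unfolding lattice_frame_def by (metis imageE image_eqI)
  have xxi1: "xx i1 = b1" using xx(2)[OF i1(1)] i1(2) by simp
  have xxne: "xx i \<noteq> b1" if "i \<in> I" "i \<noteq> i1" for i
    using that xx i1 f by (metis inj_on_def lattice_frame_def)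
  define g where "g i = (if i \<in> I then rv (\<beta> (xx i)) else f i)" for i
  define d where "d i = (if i \<in> I then - of_int (a (xx i)) else 0 :: real)" for i
  define g0 where "g0 i = (if i = i1 then f i else f i + d i *\<^sub>R f i1)" for i
  have g_eq: "g = g0(i1 := of_int q *\<^sub>R g0 i1)"
  proof
    fix i
    show "g i = (g0(i1 := of_int q *\<^sub>R g0 i1)) i"
    proof (cases "i \<in> I")
      case True
      then show ?thesis using xxne[of i] xxi1 i1 xx
        by (auto simp: g_def g0_def d_def \<beta>_def of_int_vec_diff of_int_vec_scaleR)
    next
      case False
      then have "i \<noteq> i1" using i1 by auto
      then show ?thesis using False by (simp add: g_def g0_def d_def)
    qed
  qed
  have detg: "rows_det g = of_int q * rows_det f"
    unfolding g_eq rows_det_scale unfolding g0_def rows_det_shear by simp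
  then have "rows_det g \<noteq> 0" using lattice_frame_det_nonzero[OF b f] qpos by simp
  then have g_ind: "inj g" "independent (range g)" using rows_det_independent by auto
  have xxI: "xx ` I = b"
  proof
    show "xx ` I \<subseteq> b" using xx by auto
    show "b \<subseteq> xx ` I"
    proof
      fix x assume "x \<in> b"
      then obtain i where "i \<in> I" "f i = rv x" using f unfolding lattice_frame_def by (metis imageE image_eqI)
      then show "x \<in> xx ` I" using xx(2)[of i] by auto
    qed
  qed
  have gI: "g ` I = rv ` \<beta> ` b"
    unfolding xxI[symmetric] by (auto simp: g_def image_image)
  have inj\<beta>: "inj_on \<beta> b"
    unfolding xxI[symmetric]
  proof (rule inj_onI)
    fix x y assume "x \<in> xx ` I" "y \<in> xx ` I" and eq: "\<beta> x = \<beta> y"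
    then obtain i j where ij: "i \<in> I" "j \<in> I" "x = xx i" "y = xx j" by auto
    then have "g i = g j" using eq by (simp add: g_def)
    then show "x = y" using g_ind(1) ij by (metis injD)
  qed
  define b' where "b' = \<beta> ` b"
  have b': "lattice_basis b' L'"
    unfolding lattice_basis_def
  proof (intro conjI equalityI subsetI)
    show "independent (rv ` b')" unfolding b'_def gI[symmetric] using g_ind(2) by (rule independent_mono) auto
  next
    fix y assume y: "y \<in> L'"
    then obtain c :: "int ^ 'n \<Rightarrow> int" where c: "y = (\<Sum>x\<in>b. c x *s x)" using b by (auto simp: L'_def lattice_basis_def)
    define e where "e = c b1 + (\<Sum>x\<in>b - {b1}. c x * a x)"
    have y_eq: "y = e *s b1 + (\<Sum>x\<in>b - {b1}. c x *s \<beta> x)"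
    proof -
      have "y = c b1 *s b1 + (\<Sum>x\<in>b - {b1}. c x *s x)" using c b1 finb by (simp add: sum.remove)
      also have "(\<Sum>x\<in>b - {b1}. c x *s x) = (\<Sum>x\<in>b - {b1}. (c x * a x) *s b1 + c x *s \<beta> x)"
        by (intro sum.cong refl) (auto simp: \<beta>_def vec_eq_iff algebra_simps)
      also have "\<dots> = (\<Sum>x\<in>b - {b1}. c x * a x) *s b1 + (\<Sum>x\<in>b - {b1}. c x *s \<beta> x)"
        by (simp add: sum.distrib vec_eq_iff sum_distrib_right)
      finally show ?thesis by (simp add: e_def vec_eq_iff algebra_simps)
    qed
    have "q dvd e"
    proof -
      have *: "(\<Sum>x\<in>b - {b1}. c x *s \<beta> x) \<in> L"
        using \<beta>L by (intro int_submodule_sum[OF Ls] int_submodule_scale[OF Ls]) auto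
      have "\<mu> (\<Sum>x\<in>b - {b1}. c x *s \<beta> x) = (\<Sum>x\<in>b - {b1}. c x * \<mu> (\<beta> x))"
        using \<beta>L finb by (intro mu_sum) auto
      moreover have "b1 \<in> L" using b1 bL by auto
      ultimately have "\<mu> y = e * \<mu> b1 + (\<Sum>x\<in>b - {b1}. c x * \<mu> (\<beta> x))"
        unfolding y_eq using * by (simp add: add scale int_submodule_scale[OF Ls])
      moreover have "q dvd (\<Sum>x\<in>b - {b1}. c x * \<mu> (\<beta> x))" using q\<beta> by (intro dvd_sum) auto
      moreover have "q dvd \<mu> y" using y by (simp add: L'_def)
      ultimately have "q dvd e * \<mu> b1" by (metis dvd_add_left_iff)
      then show ?thesis using cop by (simp add: coprime_commute coprime_dvd_mult_left_iff)
    qed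
    then obtain e' where e': "e = e' * q" by (metis dvdE mult.commute)
    have "y = (\<Sum>x\<in>b. (c(b1 := e')) x *s \<beta> x)"
    proof -
      have "(\<Sum>x\<in>b. (c(b1 := e')) x *s \<beta> x) = e' *s \<beta> b1 + (\<Sum>x\<in>b - {b1}. (c(b1 := e')) x *s \<beta> x)"
        using b1 finb by (simp add: sum.remove)
      also have "(\<Sum>x\<in>b - {b1}. (c(b1 := e')) x *s \<beta> x) = (\<Sum>x\<in>b - {b1}. c x *s \<beta> x)"
        by (intro sum.cong refl) auto
      also have "e' *s \<beta> b1 = e *s b1" by (simp add: \<beta>_def e' vec_eq_iff)
      finally show ?thesis using y_eq by simp
    qed
    also have "\<dots> = (\<Sum>z\<in>b'. (\<lambda>z. (c(b1 := e')) (inv_into b \<beta> z)) z *s z)"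
      unfolding b'_def by (subst sum.reindex[OF inj\<beta>]) (auto simp: inv_into_f_f[OF inj\<beta>] intro!: sum.cong)
    finally show "y \<in> range (\<lambda>c :: int ^ 'n \<Rightarrow> int. \<Sum>v\<in>b'. c v *s v)" by (intro range_eqI)
  next
    fix y assume "y \<in> range (\<lambda>c :: int ^ 'n \<Rightarrow> int. \<Sum>v\<in>b'. c v *s v)"
    then obtain c :: "int ^ 'n \<Rightarrow> int" where y: "y = (\<Sum>u\<in>b'. c u *s u)" by blast
    have "b' \<subseteq> L'" using \<beta>L q\<beta> by (auto simp: b'_def L'_def)
    then have "(\<Sum>u\<in>b'. c u *s u) \<in> L'"
      by (intro int_submodule_sum[OF L's] int_submodule_scale[OF L's]) auto
    then show "y \<in> L'" using y by simp
  qed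
  have "card b' = card b" unfolding b'_def by (rule card_image[OF inj\<beta>])
  then show "lattice_rank L' = lattice_rank L" using lattice_rank_eq_card[OF b] lattice_rank_eq_card[OF b'] by simp
  have "lattice_frame b' I g"
    unfolding lattice_frame_def
  proof (intro conjI allI impI)
    show "inj_on g I" using g_ind(1) by (metis inj_on_subset subset_UNIV)
    show "g ` I = rv ` b'" by (simp add: gI b'_def)
    fix i assume i: "i \<notin> I"
    then have gi: "g i = f i" by (simp add: g_def)
    then show "norm (g i) = 1" using f i by (simp add: lattice_frame_def)
    fix j assume j: "j \<noteq> i"
    have "i1 \<noteq> i" using i i1 by auto
    then have orth: "f i \<bullet> f j = 0" "f i \<bullet> f i1 = 0" using f i j by (auto simp: lattice_frame_def)
    have "f i \<bullet> g j = 0" unfolding g_eq using orth by (auto simp: g0_def inner_add_right)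
    then show "g i \<bullet> g j = 0" unfolding gi .
  qed
  then show "lattice_det L' = of_int q * lattice_det L"
    using lattice_det_frame[OF b'] lattice_det_frame[OF b f] detg qpos by (simp add: abs_mult)
qed

section \<open>Lattices spanned by short vectors\<close>

text \<open>The largest successive minimum is at most \<open>t\<close>, without a choice of minimal
  vectors. The descent works with this predicate throughout; the translations from and to
  \<open>successive_minimum\<close> are made at its beginning and at its end.\<close>

definition short_spanned :: "(int ^ ('n::finite)) set \<Rightarrow> real \<Rightarrow> bool" where
  "short_spanned L t \<longleftrightarrow> rv ` L \<subseteq> span (rv ` {x \<in> L. euclidean_length x \<le> t})"

lemma euclidean_length_nonneg: "0 \<le> euclidean_length x"
  by (simp add: euclidean_length_def)

lemma euclidean_length_scale: "euclidean_length (c *s x) = \<bar>of_int c\<bar> * euclidean_length x"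
  by (simp add: euclidean_length_def of_int_vec_scaleR)

text \<open>Since squared lengths are natural numbers, least lengths are attained and strict bounds
  can be replaced by weak ones.\<close>

lemma euclidean_length_sq: "\<exists>k::nat. euclidean_length x ^ 2 = real k"
proof -
  have "euclidean_length x ^ 2 = (\<Sum>i\<in>UNIV. of_int (x $ i * x $ i))"
    unfolding euclidean_length_def power2_norm_eq_inner inner_vec_def by simp
  also have "\<dots> = of_int (\<Sum>i\<in>UNIV. x $ i * x $ i)" by (simp only: of_int_sum)
  also have "(\<Sum>i\<in>UNIV. x $ i * x $ i) = int (nat (\<Sum>i\<in>UNIV. x $ i * x $ i))"
    by (simp add: sum_nonneg)
  finally show ?thesis by (metis of_int_of_nat_eq)
qed

lemma component_le_euclidean_length: "\<bar>of_int (x $ i)\<bar> \<le> euclidean_length x"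
  unfolding euclidean_length_def using component_le_norm_cart[of "rv x" i] by simp

lemma short_spanned_mono:
  assumes "short_spanned L s" "s \<le> t"
  shows "short_spanned L t"
proof -
  have "{x \<in> L. euclidean_length x \<le> s} \<subseteq> {x \<in> L. euclidean_length x \<le> t}" using assms(2) by auto
  then have "span (rv ` {x \<in> L. euclidean_length x \<le> s}) \<subseteq> span (rv ` {x \<in> L. euclidean_length x \<le> t})"
    by (intro span_mono image_mono)
  then show ?thesis using assms(1) unfolding short_spanned_def by blast
qed

lemma short_spanned_multiple:
  assumes "short_spanned L t" "L' \<subseteq> L" "\<And>x. x \<in> L \<Longrightarrow> c *s x \<in> L'" "c > 0"
  shows "short_spanned L' (of_int c * t)"
proof -
  have "rv x \<in> span (rv ` {x \<in> L'. euclidean_length x \<le> of_int c * t})"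
    if x: "x \<in> L" "euclidean_length x \<le> t" for x
  proof -
    have "c *s x \<in> {x \<in> L'. euclidean_length x \<le> of_int c * t}"
      using assms x by (simp add: euclidean_length_scale)
    then have "rv (c *s x) \<in> span (rv ` {x \<in> L'. euclidean_length x \<le> of_int c * t})"
      by (intro span_base imageI)
    then have "(1 / of_int c) *\<^sub>R rv (c *s x) \<in> span (rv ` {x \<in> L'. euclidean_length x \<le> of_int c * t})"
      by (rule span_scale)
    then show ?thesis using assms(4) by (simp add: of_int_vec_scaleR)
  qed
  then have "span (rv ` {x \<in> L. euclidean_length x \<le> t}) \<subseteq> span (rv ` {x \<in> L'. euclidean_length x \<le> of_int c * t})"
    by (intro span_minimal subspace_span) auto
  then show ?thesis using assms(1,2) unfolding short_spanned_def by blast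
qed

text \<open>Dirichlet's box principle: \<open>A ^ card S + 1\<close> multiples fall into
  \<open>A ^ card S\<close> boxes of side \<open>1 / A\<close>.\<close>

lemma pigeonhole_multiples:
  fixes a :: "'b \<Rightarrow> real"
  assumes fin: "finite S" and A: "A \<ge> (1::nat)"
  shows "\<exists>i j. i < j \<and> j \<le> A ^ card S \<and> (\<forall>u\<in>S. \<bar>frac (real j * a u) - frac (real i * a u)\<bar> \<le> 1 / real A)"
proof -
  define N where "N = A ^ card S"
  define \<beta> where "\<beta> j = restrict (\<lambda>u. nat \<lfloor>real A * frac (real j * a u)\<rfloor>) S" for j :: nat
  have rng: "\<beta> ` {..N} \<subseteq> S \<rightarrow>\<^sub>E {..<A}"
  proof
    fix x assume "x \<in> \<beta> ` {..N}"
    then obtain j where x: "x = \<beta> j" by blast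
    have "nat \<lfloor>real A * frac (real j * a u)\<rfloor> < A" for u
    proof -
      have "real A * frac (real j * a u) < real A * 1" using A frac_lt_1 by (intro mult_strict_left_mono) auto
      then have "\<lfloor>real A * frac (real j * a u)\<rfloor> < int A" by (simp add: floor_less_iff)
      then show ?thesis using A by linarith
    qed
    then show "x \<in> S \<rightarrow>\<^sub>E {..<A}" by (auto simp: x \<beta>_def)
  qed
  have "card (\<beta> ` {..N}) \<le> card (S \<rightarrow>\<^sub>E {..<A})"
    using rng fin by (intro card_mono finite_PiE) auto
  also have "\<dots> = N" using fin by (simp add: card_PiE N_def)
  finally have "\<not> inj_on \<beta> {..N}" using card_image[of \<beta> "{..N}"] by auto
  then obtain i j where ij: "i \<le> N" "j \<le> N" "i \<noteq> j" "\<beta> i = \<beta> j" by (auto simp: inj_on_def)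
  have main: "\<exists>i j. i < j \<and> j \<le> N \<and> (\<forall>u\<in>S. \<bar>frac (real j * a u) - frac (real i * a u)\<bar> \<le> 1 / real A)"
    if "i < j" "j \<le> N" "\<beta> i = \<beta> j" for i j
  proof (intro exI conjI ballI)
    fix u assume u: "u \<in> S"
    have "nat \<lfloor>real A * frac (real i * a u)\<rfloor> = nat \<lfloor>real A * frac (real j * a u)\<rfloor>"
      using fun_cong[OF that(3), of u] u by (simp add: \<beta>_def)
    moreover have "0 \<le> \<lfloor>real A * frac (real i * a u)\<rfloor>" "0 \<le> \<lfloor>real A * frac (real j * a u)\<rfloor>" by simp_all
    ultimately have "\<lfloor>real A * frac (real i * a u)\<rfloor> = \<lfloor>real A * frac (real j * a u)\<rfloor>" by (metis nat_eq_iff2)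
    then have "\<bar>real A * frac (real j * a u) - real A * frac (real i * a u)\<bar> \<le> 1" by linarith
    then have "real A * \<bar>frac (real j * a u) - frac (real i * a u)\<bar> \<le> 1"
      by (simp add: right_diff_distrib[symmetric] abs_mult)
    then show "\<bar>frac (real j * a u) - frac (real i * a u)\<bar> \<le> 1 / real A"
      using A by (simp add: field_simps)
  qed (use that in auto)
  show ?thesis
  proof (cases "i < j")
    case True
    then show ?thesis using main[of i j] ij by (simp add: N_def)
  next
    case False
    then show ?thesis using main[of j i] ij by (simp add: N_def)
  qed
qed

text \<open>With \<open>2 * n\<close> boxes for each of at most \<open>n\<close> coordinates, the
  remainder in the box argument has length at most half of the last minimum, and the multiples
  involved are at most \<open>(2 * n) ^ n\<close>. The factor \<open>2\<close> in front pays for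
  that half.\<close>

definition minkowski_const :: "nat \<Rightarrow> real" where
  "minkowski_const n = 1 / (2 * real ((2 * n) ^ n))"

lemma minkowski_const_pos: "n \<ge> 1 \<Longrightarrow> minkowski_const n > 0"
  by (simp add: minkowski_const_def)

text \<open>\<open>\<tau>\<close> is the last successive minimum of \<open>L\<close> and \<open>L'\<close> the sublattice in the span of the other
  minimal vectors. The lower bound for the determinant compares the distance of \<open>L\<close> from that span
  with \<open>\<tau>\<close>: among boundedly many multiples of a vector outside of the span, two are close modulo \<open>L'\<close>.\<close>

lemma last_minimum_sublattice:
  fixes L :: "(int ^ 'n::finite) set"
  assumes L: "integer_lattice L" and sp: "short_spanned L t" and nsp: "\<not> short_spanned L R" and R: "R \<ge> 0"
  obtains \<tau> L' where "R < \<tau>" "\<tau> \<le> t" "1 \<le> \<tau>" "integer_lattice L'" "L' \<subseteq> L" "lattice_rank L' + 1 = lattice_rank L"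
    "short_spanned L' \<tau>" "{x \<in> L. euclidean_length x \<le> R} \<subseteq> L'"
    "minkowski_const CARD('n) * \<tau> * lattice_det L' \<le> lattice_det L" "lattice_det L \<le> \<tau> * lattice_det L'"
proof -
  have Ls: "int_submodule L" using L by (rule lattice_submodule)
  have tR: "R < t" using sp nsp short_spanned_mono by (metis linorder_not_less)
  \<comment> \<open>Thresholds of the form \<open>sqrt k\<close> with natural \<open>k\<close> lose
    nothing, as squared lengths are natural numbers; so there is a least one.\<close>
  define Q where "Q k \<longleftrightarrow> short_spanned L (sqrt (real k))" for k :: nat
  have sq_le: "euclidean_length x \<le> sqrt (real k) \<longleftrightarrow> euclidean_length x ^ 2 \<le> real k" for x :: "int ^ 'n" and k
    using euclidean_length_nonneg[of x] by (metis real_sqrt_le_iff real_sqrt_abs abs_of_nonneg)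
  define k1 where "k1 = nat \<lfloor>t ^ 2\<rfloor>"
  have Qk1: "Q k1"
  proof -
    have "{x \<in> L. euclidean_length x \<le> t} \<subseteq> {x \<in> L. euclidean_length x \<le> sqrt (real k1)}"
    proof
      fix x assume x: "x \<in> {x \<in> L. euclidean_length x \<le> t}"
      obtain k where k: "euclidean_length x ^ 2 = real k" using euclidean_length_sq by blast
      have "euclidean_length x ^ 2 \<le> t ^ 2" using x euclidean_length_nonneg by (intro power_mono) auto
      then have "k \<le> k1" unfolding k k1_def by (simp add: le_nat_floor)
      then show "x \<in> {x \<in> L. euclidean_length x \<le> sqrt (real k1)}" using x k by (simp add: sq_le)
    qed
    then have "span (rv ` {x \<in> L. euclidean_length x \<le> t}) \<subseteq> span (rv ` {x \<in> L. euclidean_length x \<le> sqrt (real k1)})"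
      by (intro span_mono image_mono)
    then show ?thesis using sp unfolding Q_def short_spanned_def by blast
  qed
  define k0 where "k0 = (LEAST k. Q k)"
  have Qk0: "Q k0" unfolding k0_def using Qk1 by (rule LeastI)
  have k0least: "\<not> Q k" if "k < k0" for k using not_less_Least that unfolding k0_def by blast
  define \<tau> where "\<tau> = sqrt (real k0)"
  have \<tau>t: "\<tau> \<le> t"
  proof -
    have "k0 \<le> k1" unfolding k0_def using Qk1 by (rule Least_le)
    then have "real k0 \<le> real k1" by simp
    also have "\<dots> \<le> t ^ 2" unfolding k1_def by simp
    finally show ?thesis using tR R by (simp add: \<tau>_def real_le_lsqrt)
  qed
  have R\<tau>: "R < \<tau>" using Qk0 nsp short_spanned_mono unfolding Q_def \<tau>_def by (metis linorder_not_less)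
  have k0pos: "k0 > 0" using R\<tau> R unfolding \<tau>_def by (metis gr0I of_nat_0 order_less_le_trans real_sqrt_zero less_irrefl order_le_less_trans)
  have \<tau>1: "1 \<le> \<tau>" using k0pos by (simp add: \<tau>_def)
  \<comment> \<open>The vectors strictly shorter than \<open>\<tau>\<close>. By minimality of
    \<open>k0\<close> they do not span, whereas those in \<open>S1\<close> do.\<close>
  define S0 where "S0 = {x \<in> L. euclidean_length x ^ 2 < real k0}"
  define S1 where "S1 = {x \<in> L. euclidean_length x \<le> \<tau>}"
  have S01: "S0 \<subseteq> S1" by (auto simp: S0_def S1_def \<tau>_def sq_le)
  have S1sp: "rv ` L \<subseteq> span (rv ` S1)" using Qk0 by (simp add: Q_def short_spanned_def S1_def \<tau>_def)
  have S0nsp: "\<not> rv ` L \<subseteq> span (rv ` S0)"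
  proof -
    have "S0 = {x \<in> L. euclidean_length x \<le> sqrt (real (k0 - 1))}"
    proof -
      have "euclidean_length x ^ 2 < real k0 \<longleftrightarrow> euclidean_length x ^ 2 \<le> real (k0 - 1)" for x :: "int ^ 'n"
        using euclidean_length_sq[of x] k0pos by auto
      then show ?thesis by (simp add: S0_def sq_le)
    qed
    then show ?thesis using k0least[of "k0 - 1"] k0pos by (simp add: Q_def short_spanned_def)
  qed
  obtain B0 where B0: "B0 \<subseteq> rv ` S0" "independent B0" "rv ` S0 \<subseteq> span B0" "card B0 = dim (rv ` S0)"
    by (rule basis_exists[of "rv ` S0"])
  have B0S1: "B0 \<subseteq> rv ` S1" using B0(1) image_mono[OF S01] by (rule order_trans)
  obtain B where B: "B0 \<subseteq> B" "B \<subseteq> rv ` S1" "independent B" "rv ` S1 \<subseteq> span B"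
    by (rule maximal_independent_subset_extend[OF B0S1 B0(2)])
  have LB: "rv ` L \<subseteq> span B"
    using S1sp span_minimal[OF B(4) subspace_span] by (rule order_trans)
  have "B0 \<noteq> B"
  proof
    assume "B0 = B"
    then have "span B \<subseteq> span (rv ` S0)" using B0(1) by (intro span_mono) auto
    then show False using LB S0nsp by auto
  qed
  then obtain u where u: "u \<in> B" "u \<notin> B0" using B(1) by auto
  \<comment> \<open>As \<open>u\<close> lies outside of \<open>B0\<close>, the span \<open>H\<close>
    of the rest still contains all of \<open>S0\<close>. Every lattice vector outside of
    \<open>H\<close> therefore has length at least \<open>\<tau>\<close>, which drives the lower
    bound for the determinant.\<close>
  define B' where "B' = B - {u}"
  have Bu: "B = insert u B'" "u \<notin> B'" using u by (auto simp: B'_def)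
  define H where "H = span B'"
  have subH: "subspace H" by (simp add: H_def)
  define L' where "L' = L \<inter> {x. rv x \<in> H}"
  obtain w where w: "w \<in> S1" "u = rv w" using u B(2) by auto
  have wL: "w \<in> L" using w by (simp add: S1_def)
  have finB': "finite B'" using B(3) independent_imp_finite by (auto simp: B'_def)
  have indB': "independent B'" unfolding B'_def using B(3) by (rule independent_mono) auto
  have uH: "u \<notin> H" unfolding H_def using B(3) Bu by (simp add: independent_insert)
  have L's: "int_submodule L'" unfolding L'_def using Ls subH by (rule submodule_restrict)
  have L'l: "integer_lattice L'" using L's by (rule submodule_lattice)
  have B'S: "B' \<subseteq> rv ` {x \<in> L'. euclidean_length x \<le> \<tau>}"
    using B(2) by (auto simp: L'_def H_def S1_def B'_def intro!: span_base imageI) 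
  then have B'L: "B' \<subseteq> rv ` L'" by auto
  have spL': "span (rv ` L') = H"
  proof
    show "span (rv ` L') \<subseteq> H" using subH by (intro span_minimal) (auto simp: L'_def)
    show "H \<subseteq> span (rv ` L')" unfolding H_def by (intro span_mono B'L)
  qed
  obtain b where b: "lattice_basis b L'" using L'l by (auto simp: integer_lattice_def)
  have spb: "span (rv ` b) = H" using lattice_basis_span[OF b] spL' by simp
  have "rv ` L \<subseteq> span (insert (rv w) (rv ` b))"
  proof -
    have "B' \<subseteq> span (rv ` b)" unfolding spb H_def by (rule span_superset)
    then have "B \<subseteq> span (insert (rv w) (rv ` b))"
      using span_mono[of "rv ` b" "insert (rv w) (rv ` b)"] unfolding Bu w(2) by (auto intro: span_base)
    then have "span B \<subseteq> span (insert (rv w) (rv ` b))" by (intro span_minimal) auto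
    then show ?thesis using LB by auto
  qed
  from adjoin_basis[OF Ls subH b[unfolded L'_def] wL uH[unfolded w(2)] this]
  obtain v where v: "v \<in> L" "v \<notin> b" "rv v \<notin> H" "lattice_basis (insert v b) L"
    "\<forall>x\<in>L. \<exists>k. x - k *s v \<in> L \<and> rv (x - k *s v) \<in> H"
    by (elim exE conjE) (rule that)
  have rank: "lattice_rank L' + 1 = lattice_rank L"
    using lattice_rank_eq_card[OF b] lattice_rank_eq_card[OF v(4)] v(2) lattice_basis_finite[OF b] by simp
  have short: "short_spanned L' \<tau>"
  proof -
    have "H \<subseteq> span (rv ` {x \<in> L'. euclidean_length x \<le> \<tau>})" unfolding H_def by (intro span_mono B'S)
    then show ?thesis unfolding short_spanned_def using spL' span_superset[of "rv ` L'"] by auto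
  qed
  have longer: "\<tau> \<le> euclidean_length x" if "x \<in> L" "rv x \<notin> H" for x
  proof (rule ccontr)
    assume "\<not> \<tau> \<le> euclidean_length x"
    then have "euclidean_length x < sqrt (real k0)" by (simp add: \<tau>_def)
    then have "euclidean_length x ^ 2 < sqrt (real k0) ^ 2" using euclidean_length_nonneg by (intro power_strict_mono) auto
    then have "x \<in> S0" using that by (simp add: S0_def)
    then have "rv x \<in> span B0" using B0(3) by auto
    moreover have "span B0 \<subseteq> H" unfolding H_def using B(1) u by (intro span_mono) (auto simp: B'_def)
    ultimately show False using that by auto
  qed
  have shortL': "{x \<in> L. euclidean_length x \<le> R} \<subseteq> L'"
    using longer R\<tau> by (force simp: L'_def)
  obtain h z where hz0: "h \<in> H" "\<And>y. y \<in> H \<Longrightarrow> orthogonal z y" "rv v = h + z"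
    by (rule orthogonal_subspace_decomp_exists[of B' "rv v", folded H_def]) (rule that, assumption, blast, assumption)
  note hz = hz0(1,3)
  have zorth: "z \<bullet> y = 0" if "y \<in> H" for y using hz0(2)[OF that] by (simp add: orthogonal_def)
  have det: "lattice_det L = norm z * lattice_det L'"
    by (rule lattice_det_insert[OF v(4,2) b hz(2)]) (use hz(1) zorth spb in auto)
  have d1: "1 \<le> lattice_det L'" using L'l by (rule lattice_det_ge_1)
  have pyth: "norm (k *\<^sub>R z) \<le> norm (k *\<^sub>R z + y)" if "y \<in> H" for k y
  proof -
    have "norm (k *\<^sub>R z + y) ^ 2 = norm (k *\<^sub>R z) ^ 2 + norm y ^ 2"
      using zorth[OF that] by (intro norm_add_Pythagorean) (simp add: orthogonal_def)
    then have "norm (k *\<^sub>R z) ^ 2 \<le> norm (k *\<^sub>R z + y) ^ 2" by simp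
    then show ?thesis by (rule power2_le_imp_le) simp
  qed
  \<comment> \<open>\<open>w\<close> has length at most \<open>\<tau>\<close> and lies outside of
    \<open>H\<close>, so its component orthogonal to \<open>H\<close> is a nonzero integral multiple
    of \<open>z\<close>.\<close>
  have upper: "norm z \<le> \<tau>"
  proof -
    obtain k where k: "rv (w - k *s v) \<in> H" using v(5) wL by blast
    have "k \<noteq> 0" using k uH w(2) by auto
    then have "1 \<le> \<bar>k\<bar>" by linarith
    then have k1: "1 \<le> \<bar>of_int k :: real\<bar>" by linarith
    have wk: "rv w = of_int k *\<^sub>R z + (of_int k *\<^sub>R h + rv (w - k *s v))"
      by (simp add: of_int_vec_diff of_int_vec_scaleR hz(2) algebra_simps)
    have "1 * norm z \<le> \<bar>of_int k\<bar> * norm z" using k1 by (intro mult_right_mono) auto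
    also have "\<dots> = norm (of_int k *\<^sub>R z)" by simp
    also have "\<dots> \<le> norm (rv w)" unfolding wk by (rule pyth) (use k hz(1) subH in \<open>auto intro: subspace_add subspace_scale\<close>)
    also have "\<dots> \<le> \<tau>" using w(1) by (simp add: S1_def euclidean_length_def)
    finally show ?thesis by simp
  qed
  define n where "n = CARD('n)"
  have n1: "n \<ge> 1" unfolding n_def by (simp add: Suc_le_eq)
  have lower: "minkowski_const n * \<tau> \<le> norm z"
  proof -
    obtain a where a: "h = (\<Sum>u\<in>B'. a u *\<^sub>R u)"
      using hz(1) finB' unfolding H_def by (auto simp: span_finite)
    have cB': "card B' \<le> n" using independent_bound[OF indB'] by (simp add: n_def)
    have n2: "1 \<le> 2 * n" using n1 by simp
    obtain i j where ij: "i < j" "j \<le> (2 * n) ^ card B'" and close: "\<forall>u\<in>B'. \<bar>frac (real j * a u) - frac (real i * a u)\<bar> \<le> 1 / real (2 * n)"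
      using pigeonhole_multiples[OF finB' n2, of a] by (elim exE conjE) (rule that)
    have ex: "\<forall>u\<in>B'. \<exists>x. x \<in> L' \<and> euclidean_length x \<le> \<tau> \<and> rv x = u" using B'S by auto
    from bchoice[OF ex] obtain X where "\<forall>u\<in>B'. X u \<in> L' \<and> euclidean_length (X u) \<le> \<tau> \<and> rv (X u) = u"
      by (elim exE) (rule that)
    then have X: "X u \<in> L'" "euclidean_length (X u) \<le> \<tau>" "rv (X u) = u" if "u \<in> B'" for u
      using that by auto
    \<comment> \<open>Rounding the coefficients of the two multiples leaves a lattice vector
      \<open>x\<close> whose part in \<open>H\<close> besides the multiple of \<open>z\<close> has
      length at most \<open>\<tau> / 2\<close>. As \<open>x\<close> is outside of \<open>H\<close>,
      the multiple of \<open>z\<close> must account for the other half of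
      \<open>\<tau>\<close>.\<close>
    define c where "c u = \<lfloor>real j * a u\<rfloor> - \<lfloor>real i * a u\<rfloor>" for u
    define x where "x = (int j - int i) *s v - (\<Sum>u\<in>B'. c u *s X u)"
    have sumL': "(\<Sum>u\<in>B'. c u *s X u) \<in> L'"
      using X by (intro int_submodule_sum[OF L's] int_submodule_scale[OF L's]) auto
    have xL: "x \<in> L" unfolding x_def using sumL' v(1) Ls
      by (intro int_submoduleD(2)[OF Ls] int_submodule_scale[OF Ls]) (auto simp: L'_def)
    define \<delta> where "\<delta> u = frac (real j * a u) - frac (real i * a u)" for u
    have sumX: "rv (\<Sum>u\<in>B'. c u *s X u) = (\<Sum>u\<in>B'. of_int (c u) *\<^sub>R u)"
      using X by (simp add: of_int_vec_sum of_int_vec_scaleR)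
    have "rv x = (real j - real i) *\<^sub>R z + ((real j - real i) *\<^sub>R h - (\<Sum>u\<in>B'. of_int (c u) *\<^sub>R u))"
      unfolding x_def of_int_vec_diff of_int_vec_scaleR sumX hz(2) by (simp add: algebra_simps)
    also have "(real j - real i) *\<^sub>R h - (\<Sum>u\<in>B'. of_int (c u) *\<^sub>R u) = (\<Sum>u\<in>B'. \<delta> u *\<^sub>R u)"
    proof -
      have "(real j - real i) * a u - of_int (c u) = \<delta> u" for u
        by (simp add: c_def \<delta>_def frac_def algebra_simps)
      then show ?thesis unfolding a by (simp add: scaleR_sum_right sum_subtractf[symmetric] scaleR_diff_left[symmetric])
    qed
    finally have rvx: "rv x = (real j - real i) *\<^sub>R z + (\<Sum>u\<in>B'. \<delta> u *\<^sub>R u)" .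
    have sumH: "(\<Sum>u\<in>B'. \<delta> u *\<^sub>R u) \<in> H" unfolding H_def by (intro span_sum span_scale span_base)
    have z0: "z \<noteq> 0" using v(3) hz(1,2) by auto
    have xH: "rv x \<notin> H"
    proof
      assume "rv x \<in> H"
      then have "rv x - (\<Sum>u\<in>B'. \<delta> u *\<^sub>R u) \<in> H" using sumH by (rule subspace_diff[OF subH])
      then have "(real j - real i) *\<^sub>R z \<in> H" unfolding rvx by simp
      then have "(1 / (real j - real i)) *\<^sub>R ((real j - real i) *\<^sub>R z) \<in> H" by (rule subspace_scale[OF subH])
      then have "z \<in> H" using ij by simp
      then show False using zorth[of z] z0 by simp
    qed
    have "\<tau> \<le> euclidean_length x" by (rule longer[OF xL xH])
    also have "\<dots> \<le> norm ((real j - real i) *\<^sub>R z) + norm (\<Sum>u\<in>B'. \<delta> u *\<^sub>R u)"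
      unfolding euclidean_length_def rvx by (rule norm_triangle_ineq)
    also have "norm (\<Sum>u\<in>B'. \<delta> u *\<^sub>R u) \<le> (\<Sum>u\<in>B'. 1 / real (2 * n) * \<tau>)"
    proof (intro sum_norm_le)
      fix u assume u: "u \<in> B'"
      have "norm u \<le> \<tau>" using X(2)[OF u] by (simp add: euclidean_length_def X(3)[OF u])
      moreover have "\<bar>\<delta> u\<bar> \<le> 1 / real (2 * n)" using close u unfolding \<delta>_def by (rule bspec)
      ultimately show "norm (\<delta> u *\<^sub>R u) \<le> 1 / real (2 * n) * \<tau>"
        unfolding norm_scaleR by (intro mult_mono) auto
    qed
    also have "(\<Sum>u\<in>B'. 1 / real (2 * n) * \<tau>) = (real (card B') / real n) * (\<tau> / 2)"
      by simp
    also have "\<dots> \<le> 1 * (\<tau> / 2)" using cB' n1 \<tau>1 by (intro mult_right_mono) (auto simp: field_simps)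
    also have "norm ((real j - real i) *\<^sub>R z) \<le> real ((2 * n) ^ n) * norm z"
    proof -
      have "(2 * n) ^ card B' \<le> (2 * n) ^ n" using cB' n1 by (intro power_increasing) auto
      then have "j \<le> (2 * n) ^ n" using ij by simp
      then have "real j \<le> real ((2 * n) ^ n)" by (simp only: of_nat_le_iff)
      then have "\<bar>real j - real i\<bar> \<le> real ((2 * n) ^ n)" using ij by simp
      then show ?thesis unfolding norm_scaleR by (intro mult_right_mono) auto
    qed
    finally have "\<tau> \<le> 2 * real ((2 * n) ^ n) * norm z" by simp
    moreover have "real ((2 * n) ^ n) > 0" using n1 by simp
    moreover have "1 / (2 * D) * s \<le> y" if "s \<le> 2 * D * y" "D > 0" for D s y :: real
      using that by (simp add: field_simps)
    ultimately show ?thesis unfolding minkowski_const_def by blast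
  qed
  have "minkowski_const n * \<tau> * lattice_det L' \<le> lattice_det L" "lattice_det L \<le> \<tau> * lattice_det L'"
    unfolding det using lower upper d1 by (auto intro!: mult_right_mono)
  moreover have "L' \<subseteq> L" by (auto simp: L'_def)
  ultimately show ?thesis using that[OF R\<tau> \<tau>t \<tau>1 L'l _ rank short shortL'] unfolding n_def by simp
qed

lemma rank_0_lattice:
  assumes "integer_lattice L" "lattice_rank L = 0"
  shows "L = {0}" "lattice_det L = 1"
proof -
  obtain b where b: "lattice_basis b L" using assms by (auto simp: integer_lattice_def)
  then have "b = {}" using lattice_rank_eq_card[OF b] lattice_basis_finite[OF b] assms by simp
  then show "L = {0}" "lattice_det L = 1" using b lattice_det_rank_0 by (auto simp: lattice_basis_def)
qed

lemma not_short_spanned_0: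
  assumes "integer_lattice L" "lattice_rank L \<ge> 1"
  shows "\<not> short_spanned L 0"
proof
  assume "short_spanned L 0"
  moreover have "rv ` {x \<in> L. euclidean_length x \<le> 0} \<subseteq> {0}"
    by (auto simp: euclidean_length_def)
  then have "span (rv ` {x \<in> L. euclidean_length x \<le> 0}) \<subseteq> {0}"
    by (rule span_minimal) (rule subspace_single_0)
  ultimately have "rv ` L \<subseteq> {0}" by (auto simp: short_spanned_def)
  then have "lattice_rank L = 0" by (simp only: lattice_rank_def dim_eq_0)
  then show False using assms(2) by simp
qed

text \<open>Hadamard's inequality in terms of the largest minimum, by splitting off the last minimum
  repeatedly.\<close>

lemma lattice_det_le_power:
  fixes L :: "(int ^ 'n::finite) set"
  assumes "integer_lattice L" "short_spanned L t" "t \<ge> 0"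
  shows "lattice_det L \<le> t ^ lattice_rank L"
  using assms
proof (induction "lattice_rank L" arbitrary: L t)
  case 0
  then show ?case using rank_0_lattice[of L] by simp
next
  case (Suc r)
  have "\<not> short_spanned L 0" using Suc.hyps(2) Suc.prems by (intro not_short_spanned_0) auto
  then obtain \<tau> L' where "0 < \<tau>" "\<tau> \<le> t" "1 \<le> \<tau>" "integer_lattice L'" "L' \<subseteq> L" "lattice_rank L' + 1 = lattice_rank L"
    "short_spanned L' \<tau>" "{x \<in> L. euclidean_length x \<le> 0} \<subseteq> L'"
    "minkowski_const CARD('n) * \<tau> * lattice_det L' \<le> lattice_det L" "lattice_det L \<le> \<tau> * lattice_det L'"
    by (rule last_minimum_sublattice[OF Suc.prems(1,2) _ order_refl])
  note * = this(1,2,4,6,7,10)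
  have r: "r = lattice_rank L'" using * Suc.hyps(2) by simp
  have "lattice_det L' \<le> \<tau> ^ lattice_rank L'" using Suc.hyps(1)[OF r *(3,5)] *(1) by simp
  also have "\<dots> \<le> t ^ lattice_rank L'" using * by (intro power_mono) auto
  finally have "\<tau> * lattice_det L' \<le> t * t ^ lattice_rank L'"
    using * lattice_det_ge_1[OF *(3)] by (intro mult_mono) auto
  then show ?case using *(4,6) by (metis Suc_eq_plus1 order_trans power_Suc)
qed

lemma finite_bounded_vectors: "finite {x :: int ^ 'n::finite. \<forall>i. \<bar>x $ i\<bar> \<le> K}"
proof -
  have "finite {f :: 'n \<Rightarrow> int. \<forall>i. f i \<in> {-K..K}}"
    using finite_PiE[of "UNIV :: 'n set" "\<lambda>_. {-K..K}"] by (simp add: PiE_def Pi_def)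
  then have "finite (vec_lambda ` {f :: 'n \<Rightarrow> int. \<forall>i. f i \<in> {-K..K}})" by (rule finite_imageI)
  moreover have "{x :: int ^ 'n. \<forall>i. \<bar>x $ i\<bar> \<le> K} \<subseteq> vec_lambda ` {f :: 'n \<Rightarrow> int. \<forall>i. f i \<in> {-K..K}}"
  proof
    fix x :: "int ^ 'n" assume "x \<in> {x. \<forall>i. \<bar>x $ i\<bar> \<le> K}"
    then have "x = vec_lambda (($) x)" "\<forall>i. x $ i \<in> {-K..K}" by (auto simp: abs_le_iff minus_le_iff)
    then show "x \<in> vec_lambda ` {f. \<forall>i. f i \<in> {-K..K}}" by blast
  qed
  ultimately show ?thesis by (rule rev_finite_subset)
qed

section \<open>Successive minima and spanning by short vectors\<close>

lemma minimal_vectors_exist: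
  fixes L :: "(int ^ 'n::finite) set"
  assumes "integer_lattice L"
  shows "\<exists>ms. minimal_vectors L ms"
proof -
  have ex: "\<exists>ms. length ms = k \<and> (\<forall>i < k. is_arg_min euclidean_length
      (\<lambda>x. x \<in> L \<and> rv x \<notin> span (rv ` set (take i ms))) (ms ! i))" if "k \<le> lattice_rank L" for k
    using that
  proof (induction k)
    case (Suc k)
    then obtain ms where ms: "length ms = k" "\<forall>i < k. is_arg_min euclidean_length
      (\<lambda>x. x \<in> L \<and> rv x \<notin> span (rv ` set (take i ms))) (ms ! i)" by auto
    define P where "P x \<longleftrightarrow> x \<in> L \<and> rv x \<notin> span (rv ` set ms)" for x
    have "\<exists>x. P x"
    proof (rule ccontr)
      assume "\<nexists>x. P x"
      then have "rv ` L \<subseteq> span (rv ` set ms)" by (auto simp: P_def)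
      then have "dim (rv ` L) \<le> card (rv ` set ms)" by (intro dim_le_card) auto
      also have "\<dots> \<le> card (set ms)" by (intro card_image_le) auto
      also have "\<dots> \<le> k" using ms(1) card_length by metis
      finally show False using Suc.prems by (simp add: lattice_rank_def)
    qed
    then obtain x0 where x0: "P x0" by blast
    define N where "N x = (THE j::nat. euclidean_length x ^ 2 = real j)" for x :: "int ^ 'n"
    have N: "euclidean_length x ^ 2 = real (N x)" for x
      using euclidean_length_sq[of x] unfolding N_def by (metis (mono_tags, lifting) of_nat_eq_iff theI)
    define x where "x = arg_min N P"
    have Px: "P x" and minx: "\<And>y. P y \<Longrightarrow> N x \<le> N y"
      unfolding x_def using arg_min_nat_lemma[of P x0 N] x0 by auto
    have "is_arg_min euclidean_length P x"
      unfolding is_arg_min_def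
    proof (intro conjI Px notI)
      assume "\<exists>y. P y \<and> euclidean_length y < euclidean_length x"
      then obtain y where y: "P y" "euclidean_length y < euclidean_length x" by blast
      then have "euclidean_length y ^ 2 < euclidean_length x ^ 2"
        using euclidean_length_nonneg by (intro power_strict_mono) auto
      then show False using minx[OF y(1)] by (simp add: N)
    qed
    then have last: "is_arg_min euclidean_length (\<lambda>x. x \<in> L \<and> rv x \<notin> span (rv ` set ms)) x"
      by (simp add: P_def[abs_def])
    show ?case
    proof (intro exI[of _ "ms @ [x]"] conjI allI impI)
      show "length (ms @ [x]) = Suc k" using ms(1) by simp
      fix i assume "i < Suc k"
      then show "is_arg_min euclidean_length (\<lambda>y. y \<in> L \<and> rv y \<notin> span (rv ` set (take i (ms @ [x])))) ((ms @ [x]) ! i)"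
        using ms last by (cases "i < k") (auto simp: nth_append less_Suc_eq)
    qed
  qed auto
  from ex[OF order_refl] show ?thesis by (auto simp: minimal_vectors_def)
qed

text \<open>The \<open>i - 1\<close> earlier minimal vectors cannot span the lattice, so some vector
  of length at most \<open>t\<close> competes for the \<open>i\<close>-th place.\<close>

lemma successive_minimum_le:
  fixes L :: "(int ^ 'n::finite) set"
  assumes L: "integer_lattice L" and sp: "short_spanned L t" and i: "i \<in> {1..lattice_rank L}"
  shows "successive_minimum L i \<le> t"
proof -
  define ms where "ms = (SOME ms. minimal_vectors L ms)"
  have ms: "minimal_vectors L ms" unfolding ms_def using minimal_vectors_exist[OF L] by (rule someI_ex)
  define W where "W = span (rv ` set (take (i - 1) ms))"
  have min: "is_arg_min euclidean_length (\<lambda>x. x \<in> L \<and> rv x \<notin> W) (ms ! (i - 1))"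
    using ms i unfolding minimal_vectors_def W_def by auto
  have "\<exists>x\<in>L. euclidean_length x \<le> t \<and> rv x \<notin> W"
  proof (rule ccontr)
    assume "\<not> ?thesis"
    then have "rv ` {x \<in> L. euclidean_length x \<le> t} \<subseteq> W" by auto
    then have "span (rv ` {x \<in> L. euclidean_length x \<le> t}) \<subseteq> W" unfolding W_def by (intro span_minimal) auto
    then have "rv ` L \<subseteq> W" using sp by (auto simp: short_spanned_def)
    then have "dim (rv ` L) \<le> card (rv ` set (take (i - 1) ms))" unfolding W_def by (intro dim_le_card) auto
    also have "\<dots> \<le> card (set (take (i - 1) ms))" by (intro card_image_le) auto
    also have "\<dots> \<le> i - 1" using card_length[of "take (i - 1) ms"] by simp
    finally show False using i by (auto simp: lattice_rank_def)
  qed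
  then obtain x where "x \<in> L" "euclidean_length x \<le> t" "rv x \<notin> W" by blast
  then have "euclidean_length (ms ! (i - 1)) \<le> t"
    using min unfolding is_arg_min_def by (meson linorder_not_less order_trans)
  then show ?thesis by (simp add: successive_minimum_def ms_def)
qed

text \<open>The minimal vectors are independent and as many as the rank, hence span. None is longer
  than the last one, because the last one was available as a competitor at every earlier
  place.\<close>

lemma short_spanned_successive_minimum:
  fixes L :: "(int ^ 'n::finite) set"
  assumes L: "integer_lattice L" and r: "lattice_rank L = r" "r \<ge> 1"
  shows "short_spanned L (successive_minimum L r)" "1 \<le> successive_minimum L r"
proof -
  define ms where "ms = (SOME ms. minimal_vectors L ms)"
  have ms: "minimal_vectors L ms" unfolding ms_def using minimal_vectors_exist[OF L] by (rule someI_ex)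
  have len: "length ms = r" using ms r by (simp add: minimal_vectors_def)
  have min: "is_arg_min euclidean_length (\<lambda>x. x \<in> L \<and> rv x \<notin> span (rv ` set (take i ms))) (ms ! i)" if "i < r" for i
    using ms that len unfolding minimal_vectors_def by auto
  have sm: "successive_minimum L r = euclidean_length (ms ! (r - 1))" by (simp add: successive_minimum_def ms_def)
  have le: "euclidean_length (ms ! i) \<le> successive_minimum L r" if "i < r" for i
  proof -
    have "ms ! (r - 1) \<in> L" "rv (ms ! (r - 1)) \<notin> span (rv ` set (take (r - 1) ms))"
      using min[of "r - 1"] r by (auto simp: is_arg_min_def)
    moreover have "span (rv ` set (take i ms)) \<subseteq> span (rv ` set (take (r - 1) ms))"
      using that by (intro span_mono image_mono set_take_subset_set_take) simp
    ultimately show ?thesis using min[OF that] unfolding sm is_arg_min_def by (meson linorder_not_less subsetD)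
  qed
  have sub: "rv ` set ms \<subseteq> rv ` {x \<in> L. euclidean_length x \<le> successive_minimum L r}"
    using le min len by (auto simp: in_set_conv_nth is_arg_min_def)
  have indk: "card (rv ` set (take k ms)) = k \<and> independent (rv ` set (take k ms))" if "k \<le> r" for k
    using that
  proof (induction k)
    case (Suc k)
    then have IH: "card (rv ` set (take k ms)) = k" "independent (rv ` set (take k ms))" by auto
    have nin: "rv (ms ! k) \<notin> span (rv ` set (take k ms))" using min[of k] Suc.prems by (simp add: is_arg_min_def)
    moreover have "set (take (Suc k) ms) = insert (ms ! k) (set (take k ms))"
      using Suc.prems len by (simp add: take_Suc_conv_app_nth)
    moreover have "rv (ms ! k) \<notin> rv ` set (take k ms)"
    proof
      assume "rv (ms ! k) \<in> rv ` set (take k ms)"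
      then have "rv (ms ! k) \<in> span (rv ` set (take k ms))" by (rule span_base)
      then show False using nin by simp
    qed
    ultimately show ?case using IH by (simp add: independent_insertI)
  qed (simp add: independent_empty)
  then have ind: "card (rv ` set ms) = r" "independent (rv ` set ms)" using indk[of r] len by auto
  have "rv ` L \<subseteq> span (rv ` set ms)"
  proof (rule card_ge_dim_independent)
    show "rv ` set ms \<subseteq> rv ` L" using sub by auto
    show "dim (rv ` L) \<le> card (rv ` set ms)" using r ind by (simp add: lattice_rank_def)
  qed (rule ind)
  then show "short_spanned L (successive_minimum L r)"
    unfolding short_spanned_def using span_mono[OF sub] by (rule order_trans)
  have "rv (ms ! (r - 1)) \<notin> span (rv ` set (take (r - 1) ms))" using min[of "r - 1"] r by (simp add: is_arg_min_def)
  then have "ms ! (r - 1) \<noteq> 0" using span_zero by (metis of_int_vec_0)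
  then have "rv (ms ! (r - 1)) \<noteq> 0" using of_int_vec_inject[of "ms ! (r - 1)" 0] by simp
  then have ne: "euclidean_length (ms ! (r - 1)) ^ 2 \<noteq> 0" by (simp add: euclidean_length_def)
  obtain k where k: "euclidean_length (ms ! (r - 1)) ^ 2 = real k" using euclidean_length_sq by blast
  have "k \<noteq> 0" using ne unfolding k by simp
  then have "1 \<le> euclidean_length (ms ! (r - 1)) ^ 2" unfolding k by simp
  then show "1 \<le> successive_minimum L r"
    unfolding sm using euclidean_length_nonneg by (metis one_power2 power2_le_imp_le)
qed

section \<open>Tangent lattices\<close>

lemma vector_scale_sum:
  fixes f :: "'a \<Rightarrow> 'b::comm_ring_1 ^ 'n"
  shows "c *s (\<Sum>a\<in>A. f a) = (\<Sum>a\<in>A. c *s f a)"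
  by (simp add: vec_eq_iff sum_distrib_left)

lemma hform_0_const: "hform 0 H f \<Longrightarrow> f x = f 0"
  using hform_homogeneous[of 0 H f 0 x] by simp

text \<open>Gradients are known through Taylor congruences, and these determine their values: a
  modulus \<open>u\<close> larger than \<open>|a - b|\<close> already decides.\<close>

lemma dvd_all_squares_imp_eq:
  fixes a b :: int
  assumes "\<And>u. u ^ 2 dvd z u - u * a" "\<And>u. u ^ 2 dvd z u - u * b"
  shows "a = b"
proof -
  define u where "u = \<bar>a - b\<bar> + 1"
  have "u ^ 2 dvd (z u - u * b) - (z u - u * a)" by (rule dvd_diff[OF assms(2) assms(1)])
  then have "u * u dvd u * (a - b)" by (simp add: power2_eq_square algebra_simps)
  moreover have "u \<noteq> 0" by (simp add: u_def)
  ultimately have "u dvd a - b" by simp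
  then have "a - b = 0" using zdvd_not_zless[of "\<bar>a - b\<bar>" u] by (auto simp: u_def)
  then show ?thesis by simp
qed

text \<open>The forms \<open>G e\<close> are the coefficients of \<open>s ^ (e - 1)\<close> in \<open>f (x + s y)\<close>. Since \<open>f y\<close> is the
  leading coefficient, every zero \<open>x\<close> of \<open>f\<close> is a zero of some \<open>G e\<close> at which the derivative of
  \<open>G e\<close> in the direction \<open>y\<close> is nonzero, even if \<open>x\<close> is a singular point of \<open>f = 0\<close>.\<close>

lemma directional_coefficient_forms:
  fixes f :: "int ^ 'n::finite \<Rightarrow> int"
  assumes f: "hform d H f" and y: "f y \<noteq> 0"
  obtains G D where "\<And>e. e \<in> {1..d} \<Longrightarrow> \<exists>K. hform (d - (e - 1)) K (G e)"
    "\<And>e. e \<in> {1..d} \<Longrightarrow> form_gradient (d - (e - 1)) (G e) (D e)"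
    "\<And>x X Y. f x = 0 \<Longrightarrow> \<forall>i. \<bar>x $ i\<bar> \<le> X \<Longrightarrow> \<forall>i. \<bar>y $ i\<bar> \<le> Y \<Longrightarrow>
      \<exists>e\<in>{1..d}. G e x = 0 \<and> D e x y \<noteq> 0 \<and> \<bar>D e x y\<bar> \<le> int d * (H * (X + Y) ^ d)"
proof -
  obtain Q where Q: "form_expansion d H f y Q" using hform_expand[OF f] by blast
  note Q1 = Q[unfolded form_expansion_def, THEN conjunct1, rule_format]
  note Q2 = Q[unfolded form_expansion_def, THEN conjunct2, THEN conjunct1, rule_format]
  note Q3 = Q[unfolded form_expansion_def, THEN conjunct2, THEN conjunct2, THEN conjunct1, rule_format]
  note Q4 = Q[unfolded form_expansion_def, THEN conjunct2, THEN conjunct2, THEN conjunct2, rule_format]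
  define G where "G e x = Polynomial.coeff (Q x) (e - 1)" for e x
  have G: "\<exists>K. hform (d - (e - 1)) K (G e)" if "e \<in> {1..d}" for e
    using Q3[of "e - 1"] that unfolding G_def[abs_def] by auto
  have "\<exists>D. form_gradient (d - (e - 1)) (G e) D" if "e \<in> {1..d}" for e
    using G[OF that] hform_gradient by blast
  then obtain D where D: "\<And>e. e \<in> {1..d} \<Longrightarrow> form_gradient (d - (e - 1)) (G e) (D e)" by metis
  have shift: "Q (x + u *s y) = pcompose (Q x) [:u, 1:]" for x u
  proof -
    have "poly (Q (x + u *s y)) s = poly (pcompose (Q x) [:u, 1:]) s" for s
      by (simp add: Q1 poly_pcompose vector_sadd_rdistrib add.assoc)
    then show ?thesis by (simp add: poly_eq_poly_eq_iff[symmetric] fun_eq_iff)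
  qed
  have DQ: "D e x y = int e * Polynomial.coeff (Q x) e" if e: "e \<in> {1..d}" for e x
  proof (rule dvd_all_squares_imp_eq)
    fix u :: int
    show "u ^ 2 dvd (G e (x + u *s y) - G e x) - u * D e x y"
      using D[OF e] by (simp add: form_gradient_def)
    show "u ^ 2 dvd (G e (x + u *s y) - G e x) - u * (int e * Polynomial.coeff (Q x) e)"
      using coeff_pcompose_shift[of u "Q x" "e - 1"] e by (simp add: G_def shift)
  qed
  have "Q 0 = Polynomial.monom (f y) d"
  proof -
    have "poly (Q 0) s = poly (Polynomial.monom (f y) d) s" for s
      using Q1[of 0 s] hform_homogeneous[OF f, of s y] by (simp add: poly_monom)
    then show ?thesis by (simp add: poly_eq_poly_eq_iff[symmetric] fun_eq_iff)
  qed
  \<comment> \<open>The coefficient of \<open>s ^ d\<close> is a form of degree \<open>0\<close> in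
    \<open>x\<close>, hence constant, and at \<open>x = 0\<close> it is \<open>f y\<close>.\<close>
  then have lead: "Polynomial.coeff (Q x) d = f y" for x
  proof -
    obtain K where "hform 0 K (\<lambda>x. Polynomial.coeff (Q x) d)" using Q3[of d] by auto
    from hform_0_const[OF this, of x] show ?thesis using \<open>Q 0 = Polynomial.monom (f y) d\<close> by simp
  qed
  show ?thesis
  proof (rule that[of G D, OF G D])
    fix x X Y assume x: "f x = 0" and X: "\<forall>i. \<bar>x $ i\<bar> \<le> X" and Y: "\<forall>i. \<bar>y $ i\<bar> \<le> Y"
    \<comment> \<open>The order of vanishing of \<open>f (x + s *s y)\<close> at
      \<open>s = 0\<close>. Coefficient \<open>e - 1\<close> vanishes by minimality, and its
      derivative along \<open>y\<close> is \<open>e\<close> times the nonzero coefficient of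
      \<open>s ^ e\<close>.\<close>
    define e where "e = (LEAST e. Polynomial.coeff (Q x) e \<noteq> 0)"
    have ne: "Polynomial.coeff (Q x) d \<noteq> 0" using lead y by simp
    have e_ne: "Polynomial.coeff (Q x) e \<noteq> 0" unfolding e_def using ne by (rule LeastI)
    have ed: "e \<le> d" unfolding e_def using ne by (rule Least_le)
    have "Polynomial.coeff (Q x) 0 = 0" using Q1[of x 0] x by (simp add: poly_0_coeff_0)
    then have e1: "e \<ge> 1" using e_ne by (metis One_nat_def Suc_leI not_gr_zero)
    have "Polynomial.coeff (Q x) (e - 1) = 0" using not_less_Least[of "e - 1" "\<lambda>e. Polynomial.coeff (Q x) e \<noteq> 0"] e1 by (auto simp: e_def)
    then have 1: "G e x = 0" by (simp add: G_def)
    have e: "e \<in> {1..d}" using e1 ed by simp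
    have 2: "D e x y \<noteq> 0" using DQ[OF e] e_ne e1 by simp
    have "\<bar>Polynomial.coeff (Q x) e\<bar> \<le> (\<Sum>k\<le>d. \<bar>Polynomial.coeff (Q x) k\<bar>)" using ed by (intro member_le_sum) auto
    also have "\<dots> \<le> H * (X + Y) ^ d" using X Y by (intro Q4) auto
    finally have "int e * \<bar>Polynomial.coeff (Q x) e\<bar> \<le> int d * (H * (X + Y) ^ d)"
      using ed by (intro mult_mono) auto
    then have 3: "\<bar>D e x y\<bar> \<le> int d * (H * (X + Y) ^ d)" by (simp add: DQ[OF e] abs_mult)
    show "\<exists>e\<in>{1..d}. G e x = 0 \<and> D e x y \<noteq> 0 \<and> \<bar>D e x y\<bar> \<le> int d * (H * (X + Y) ^ d)"
      using e 1 2 3 by blast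
  qed
qed

section \<open>Coordinates in a lattice and the index of a tangent lattice\<close>

definition coordinates :: "(int ^ ('n::finite)) set \<Rightarrow> (int ^ 'n) set \<Rightarrow> (int ^ 'n \<Rightarrow> int ^ 'n \<Rightarrow> int) \<Rightarrow> bool" where
  "coordinates b L co \<longleftrightarrow> (\<forall>y\<in>L. (\<Sum>u\<in>b. co y u *s u) = y) \<and>
    (\<forall>x\<in>L. \<forall>y\<in>L. \<forall>u\<in>b. co (x + y) u = co x u + co y u) \<and>
    (\<forall>c. \<forall>x\<in>L. \<forall>u\<in>b. co (c *s x) u = c * co x u) \<and>
    (\<forall>c. \<forall>u\<in>b. co (\<Sum>v\<in>b. c v *s v) u = c u)"

lemma coordinatesD:
  assumes "coordinates b L co"
  shows "y \<in> L \<Longrightarrow> (\<Sum>u\<in>b. co y u *s u) = y"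
    "x \<in> L \<Longrightarrow> y \<in> L \<Longrightarrow> u \<in> b \<Longrightarrow> co (x + y) u = co x u + co y u"
    "x \<in> L \<Longrightarrow> u \<in> b \<Longrightarrow> co (c *s x) u = c * co x u"
    "u \<in> b \<Longrightarrow> co (\<Sum>v\<in>b. a v *s v) u = a u"
  using assms by (simp_all add: coordinates_def)

lemma coordinates_basis:
  assumes co: "coordinates b L co" and b: "finite b" "u \<in> b" "v \<in> b"
  shows "co u v = (if u = v then 1 else 0)"
proof -
  have "u = (\<Sum>w\<in>b. (if w = u then 1 else 0) *s w)"
    using b by (simp add: if_distrib[of "\<lambda>c. c *s _"] sum.delta cong: if_cong)
  then have "co u v = co (\<Sum>w\<in>b. (if w = u then 1 else 0) *s w) v" by simp
  then show ?thesis using coordinatesD(4)[OF co b(3), of "\<lambda>w. if w = u then 1 else 0"] by auto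
qed

lemma lattice_coordinates:
  fixes L :: "(int ^ 'n::finite) set"
  assumes b: "lattice_basis b L"
  shows "\<exists>co. coordinates b L co"
proof -
  have ind: "independent (rv ` b)" and L: "L = range (\<lambda>c :: int ^ 'n \<Rightarrow> int. \<Sum>v\<in>b. c v *s v)"
    using b by (auto simp: lattice_basis_def)
  have fin: "finite b" by (rule lattice_basis_finite[OF b])
  define co where "co y u = (SOME k. representation (rv ` b) (rv y) (rv u) = of_int k)" for y u
  have co_sum: "co (\<Sum>v\<in>b. c v *s v) u = c u" if u: "u \<in> b" for c :: "int ^ 'n \<Rightarrow> int" and u
  proof -
    have "rv (\<Sum>v\<in>b. c v *s v) = (\<Sum>v\<in>b. of_int (c v) *\<^sub>R rv v)" by (simp add: of_int_vec_sum of_int_vec_scaleR)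
    also have "\<dots> = (\<Sum>w\<in>rv ` b. of_int (c (inv_into b rv w)) *\<^sub>R w)"
      by (subst sum.reindex[OF inj_of_int_vec]) (simp add: inv_into_f_f[OF inj_of_int_vec])
    finally have "representation (rv ` b) (rv (\<Sum>v\<in>b. c v *s v)) (rv u)
      = representation (rv ` b) (\<Sum>w\<in>rv ` b. of_int (c (inv_into b rv w)) *\<^sub>R w) (rv u)" by simp
    also have "\<dots> = (\<Sum>w\<in>rv ` b. of_int (c (inv_into b rv w)) * representation (rv ` b) w (rv u))"
      using ind by (subst representation_sum) (auto intro: span_scale span_base simp: representation_scale span_base)
    also have "\<dots> = (\<Sum>w\<in>rv ` b. if w = rv u then of_int (c (inv_into b rv w)) else 0)"
      using ind by (intro sum.cong refl) (auto simp: representation_basis)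
    also have "\<dots> = of_int (c u)"
      using fin u by (simp add: sum.delta inv_into_f_f[OF inj_of_int_vec])
    finally have "representation (rv ` b) (rv (\<Sum>v\<in>b. c v *s v)) (rv u) = of_int (c u)" .
    then show ?thesis unfolding co_def by (simp add: some_equality)
  qed
  have rep: "(\<Sum>u\<in>b. co y u *s u) = y" if "y \<in> L" for y
  proof -
    obtain c :: "int ^ 'n \<Rightarrow> int" where c: "y = (\<Sum>v\<in>b. c v *s v)" using \<open>y \<in> L\<close> unfolding L by blast
    have "(\<Sum>u\<in>b. co y u *s u) = (\<Sum>u\<in>b. c u *s u)" by (intro sum.cong refl) (simp add: c co_sum)
    then show ?thesis by (simp add: c)
  qed
  have "co (x + y) u = co x u + co y u" if xy: "x \<in> L" "y \<in> L" "u \<in> b" for x y u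
  proof -
    have "x + y = (\<Sum>v\<in>b. co x v *s v) + (\<Sum>v\<in>b. co y v *s v)"
      using rep[OF xy(1)] rep[OF xy(2)] by simp
    also have "\<dots> = (\<Sum>v\<in>b. (co x v + co y v) *s v)" by (simp add: vector_sadd_rdistrib sum.distrib)
    finally show "co (x + y) u = co x u + co y u" using co_sum[OF xy(3), of "\<lambda>v. co x v + co y v"] by simp
  qed
  moreover have "co (c *s x) u = c * co x u" if x: "x \<in> L" "u \<in> b" for c x u
  proof -
    have "c *s x = c *s (\<Sum>v\<in>b. co x v *s v)" using rep[OF x(1)] by simp
    also have "\<dots> = (\<Sum>v\<in>b. (c * co x v) *s v)"
      by (simp add: vector_scale_sum vector_smult_assoc)
    finally show "co (c *s x) u = c * co x u" using co_sum[OF x(2), of "\<lambda>v. c * co x v"] by simp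
  qed
  ultimately have "coordinates b L co" unfolding coordinates_def using rep co_sum by simp
  then show ?thesis by (intro exI)
qed

text \<open>Congruences are taken modulo \<open>q *s M\<close> and not modulo \<open>q\<close> in
  the ambient module, so that the index depends on the rank of \<open>M\<close> only, whatever the
  position of \<open>M\<close>.\<close>

definition tangent_lattice ::
    "(int ^ 'n) set \<Rightarrow> (int ^ ('n::finite) \<Rightarrow> int ^ 'n \<Rightarrow> int) \<Rightarrow> int ^ 'n \<Rightarrow> int \<Rightarrow> (int ^ 'n) set" where
  "tangent_lattice M D x q = {y \<in> M. (\<exists>\<rho>. \<exists>t\<in>M. y = \<rho> *s x + q *s t) \<and> q ^ 2 dvd D x y}"

lemma tangent_lattice_1: "int_submodule M \<Longrightarrow> tangent_lattice M D x 1 = M"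
  unfolding tangent_lattice_def by (auto intro!: exI[of _ 0])

lemma tangent_lattice_subset: "tangent_lattice M D x q \<subseteq> M"
  by (auto simp: tangent_lattice_def)

text \<open>One more factor \<open>p\<close> in the modulus costs \<open>p\<close> for the
  congruence and \<open>p ^ 2\<close> for the tangency condition, so the multiple by
  \<open>p ^ 2\<close> survives. This is the loss of \<open>p ^ 2\<close> in the minima at each step
  of the descent.\<close>

lemma tangent_lattice_descent:
  assumes M: "int_submodule M" and D: "form_gradient E G D" and y: "y \<in> tangent_lattice M D x q"
  shows "p ^ 2 *s y \<in> tangent_lattice M D x (p * q)"
proof -
  obtain \<rho> t where t: "t \<in> M" "y = \<rho> *s x + q *s t" and yM: "y \<in> M" and dv: "q ^ 2 dvd D x y"
    using y by (auto simp: tangent_lattice_def)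
  have "p ^ 2 *s y = (p ^ 2 * \<rho>) *s x + (p * q) *s (p *s t)"
    by (simp add: t(2) vec_eq_iff algebra_simps power2_eq_square)
  moreover have "p *s t \<in> M" using M t(1) by (rule int_submodule_scale)
  moreover have "p ^ 2 *s y \<in> M" using M yM by (rule int_submodule_scale)
  moreover have "D x (p ^ 2 *s y) = p ^ 2 * D x y" using D by (simp add: form_gradient_def)
  then have "(p * q) ^ 2 dvd D x (p ^ 2 *s y)" using dv by (simp add: power_mult_distrib)
  ultimately show ?thesis unfolding tangent_lattice_def by blast
qed

text \<open>Taylor's congruence at \<open>\<rho> *s x\<close>, where \<open>G\<close> vanishes as
  well, shows that \<open>q\<close> divides the derivative along \<open>t\<close>, once the unit
  \<open>\<rho>\<close> is removed. In \<open>D x x'\<close> the multiple of \<open>x\<close> drops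
  out by Euler's identity, which is why modulus \<open>q ^ 2\<close> is reached although
  \<open>x'\<close> is tied to \<open>x\<close> only modulo \<open>q\<close>.\<close>

lemma mem_tangent_lattice:
  assumes M: "int_submodule M" and D: "form_gradient E G D"
    and x: "x \<in> M" "G x = 0" and x': "G x' = 0" "x' = \<rho> *s x + q *s t" "t \<in> M"
    and p: "prime p" "q = p ^ k" "\<not> p dvd \<rho>" and E: "E \<ge> 1" and hG: "hform E H G"
  shows "x' \<in> tangent_lattice M D x q"
proof -
  have D1: "\<And>x y z. D x (y + z) = D x y + D x z" and D2: "\<And>x c y. D x (c *s y) = c * D x y"
    and D3: "\<And>x y u. u ^ 2 dvd G (x + u *s y) - G x - u * D x y" and D4: "\<And>x. D x x = int E * G x"
    and D5: "\<And>x \<rho> y. \<rho> * D (\<rho> *s x) y = \<rho> ^ E * D x y"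
    using D by (auto simp: form_gradient_def)
  have "q ^ 2 dvd G (\<rho> *s x + q *s t) - G (\<rho> *s x) - q * D (\<rho> *s x) t" by (rule D3)
  moreover have "G (\<rho> *s x) = 0" using hform_homogeneous[OF hG] x(2) by simp
  ultimately have "q ^ 2 dvd - (q * D (\<rho> *s x) t)" using x'(1,2) by simp
  then have "q ^ 2 dvd q * D (\<rho> *s x) t" by simp
  then have "q ^ 2 dvd \<rho> * (q * D (\<rho> *s x) t)" by (rule dvd_mult)
  then have "q ^ 2 dvd q * (\<rho> ^ E * D x t)" by (simp add: D5[symmetric] mult.left_commute)
  moreover have "q \<noteq> 0" using p by auto
  ultimately have "q dvd \<rho> ^ E * D x t" by (simp add: power2_eq_square)
  moreover have "coprime q (\<rho> ^ E)" using p by (simp add: prime_imp_coprime)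
  ultimately have qD: "q dvd D x t" using coprime_dvd_mult_right_iff by blast
  have "D x x' = \<rho> * D x x + q * D x t" using x'(2) by (simp add: D1 D2)
  then have "D x x' = q * D x t" using D4 x(2) by simp
  then have "q ^ 2 dvd D x x'" using qD by (simp add: power2_eq_square)
  moreover have "x' \<in> M" using M x(1) x'(2,3) by (auto intro: int_submoduleD(4) int_submodule_scale)
  ultimately show ?thesis using x' unfolding tangent_lattice_def by blast
qed

text \<open>If coordinate \<open>i\<close> of \<open>x\<close> is prime to \<open>p\<close>, being
  congruent to a multiple of \<open>x\<close> amounts to \<open>r - 1\<close> linear congruences
  modulo \<open>q\<close>, given by the minors \<open>\<mu> l\<close>. On the lattice so obtained
  \<open>D x\<close> is divisible by \<open>q\<close>, and tangency modulo \<open>q ^ 2\<close> is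
  one further congruence modulo \<open>q\<close>, for the quotient \<open>\<nu>\<close>.\<close>

lemma tangent_lattice_det:
  fixes M :: "(int ^ 'n::finite) set"
  assumes M: "integer_lattice M" and D: "form_gradient E G D"
    and x: "x \<in> M" "G x = 0" and xp: "\<nexists>t. t \<in> M \<and> x = p *s t"
    and p: "prime p" "q = p ^ k" and z: "z \<in> M" "\<not> p dvd D x z"
  shows "integer_lattice (tangent_lattice M D x q)" "lattice_rank (tangent_lattice M D x q) = lattice_rank M"
    "lattice_det (tangent_lattice M D x q) = of_int q ^ lattice_rank M * lattice_det M"
proof -
  have D1: "\<And>x y z. D x (y + z) = D x y + D x z" and D2: "\<And>x c y. D x (c *s y) = c * D x y"
    and D4: "\<And>x. D x x = int E * G x"
    using D by (auto simp: form_gradient_def)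
  have Ms: "int_submodule M" using M by (rule lattice_submodule)
  obtain b where b: "lattice_basis b M" using M by (auto simp: integer_lattice_def)
  have bM: "b \<subseteq> M" and fin: "finite b" using lattice_basis_subset[OF b] lattice_basis_finite[OF b] by auto
  obtain co where co': "coordinates b M co" using lattice_coordinates[OF b] by blast
  note co = coordinatesD[OF co'] and co_basis = coordinates_basis[OF co' fin]
  have "\<exists>i\<in>b. \<not> p dvd co x i"
  proof (rule ccontr)
    assume "\<not> ?thesis"
    then have all: "\<And>u. u \<in> b \<Longrightarrow> co x u = p * (co x u div p)" by simp
    define t where "t = (\<Sum>u\<in>b. (co x u div p) *s u)"
    have "t \<in> M" unfolding t_def using bM by (intro int_submodule_sum[OF Ms] int_submodule_scale[OF Ms]) auto
    moreover have "p *s t = (\<Sum>u\<in>b. co x u *s u)"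
      unfolding t_def vector_scale_sum using all by (intro sum.cong refl) (metis vector_smult_assoc)
    then have "x = p *s t" using co(1)[OF x(1)] by simp
    ultimately show False using xp by blast
  qed
  then obtain i where i: "i \<in> b" "\<not> p dvd co x i" by blast
  have qpos: "q > 0" using p by (simp add: prime_gt_0_int)
  define \<mu> where "\<mu> l y = co y l * co x i - co y i * co x l" for l y
  define MA where "MA A = {y \<in> M. \<forall>l\<in>A. q dvd \<mu> l y}" for A
  have MA: "integer_lattice (MA A) \<and> lattice_rank (MA A) = lattice_rank M \<and> lattice_det (MA A) = of_int q ^ card A * lattice_det M"
    if "finite A" "A \<subseteq> b - {i}" for A
    using that
  proof (induction A rule: finite_induct)
    case empty
    then show ?case using M by (simp add: MA_def)
  next
    case (insert l A)
    then have IH: "integer_lattice (MA A)" "lattice_rank (MA A) = lattice_rank M"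
      "lattice_det (MA A) = of_int q ^ card A * lattice_det M" by auto
    have l: "l \<in> b" "l \<noteq> i" using insert.prems by auto
    have eq: "MA (insert l A) = {y \<in> MA A. q dvd \<mu> l y}" by (auto simp: MA_def)
    have add: "\<mu> l (y + y') = \<mu> l y + \<mu> l y'" if "y \<in> MA A" "y' \<in> MA A" for y y'
      using that l i by (simp add: \<mu>_def MA_def co(2) algebra_simps)
    have scale: "\<mu> l (c *s y) = c * \<mu> l y" if "y \<in> MA A" for c y
      using that l i by (simp add: \<mu>_def MA_def co(3) algebra_simps)
    \<comment> \<open>The basis vector \<open>l\<close> is the vector at which the new congruence
      has a unit value; it lies in the lattice cut out so far because the other minors vanish at
      it.\<close>
    have lMA: "l \<in> MA A"
      unfolding MA_def
    proof (intro CollectI conjI ballI)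
      show "l \<in> M" using l bM by auto
      fix l' assume l': "l' \<in> A"
      then have "l' \<in> b" "l' \<noteq> l" using insert by auto
      then show "q dvd \<mu> l' l" using l i by (simp add: \<mu>_def co_basis)
    qed
    have lnd: "\<not> p dvd \<mu> l l" using l i by (simp add: \<mu>_def co_basis)
    note c = congruence_sublattice[OF IH(1) add scale p lMA lnd]
    show ?case unfolding eq using c IH(2,3) insert.hyps by simp
  qed
  define A where "A = b - {i}"
  define L where "L = MA A"
  have cA: "card A + 1 = lattice_rank M" using i fin lattice_rank_eq_card[OF b] card_Suc_Diff1[OF fin i(1)] by (simp add: A_def)
  have L: "integer_lattice L" "lattice_rank L = lattice_rank M" "lattice_det L = of_int q ^ card A * lattice_det M"
    using MA[of A] fin by (auto simp: L_def A_def)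
  have Leq: "L = {y \<in> M. \<exists>\<rho>. \<exists>t\<in>M. y = \<rho> *s x + q *s t}"
  proof (intro equalityI subsetI)
    fix y assume "y \<in> L"
    then have y: "y \<in> M" "\<And>l. l \<in> A \<Longrightarrow> q dvd \<mu> l y" by (auto simp: L_def MA_def)
    have "coprime (co x i) q" using p i(2) by (simp add: coprime_commute prime_imp_coprime)
    then obtain w where w: "[co x i * w = 1] (mod q)" using cong_solve_coprime_int by blast
    define \<rho> where "\<rho> = co y i * w"
    have dv: "q dvd co y l - \<rho> * co x l" if l: "l \<in> b" for l
    proof -
      have "q dvd \<mu> l y" using y(2)[of l] l by (cases "l = i") (auto simp: A_def \<mu>_def)
      then have "q dvd w * \<mu> l y + co y l * (1 - co x i * w)"
        using w by (intro dvd_add dvd_mult) (auto simp: cong_iff_dvd_diff dvd_diff_commute)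
      moreover have "w * \<mu> l y + co y l * (1 - co x i * w) = co y l - \<rho> * co x l"
        by (simp add: \<mu>_def \<rho>_def algebra_simps)
      ultimately show ?thesis by simp
    qed
    define t where "t = (\<Sum>l\<in>b. ((co y l - \<rho> * co x l) div q) *s l)"
    have tM: "t \<in> M" unfolding t_def using bM by (intro int_submodule_sum[OF Ms] int_submodule_scale[OF Ms]) auto
    have "\<rho> *s x + q *s t = \<rho> *s (\<Sum>l\<in>b. co x l *s l) + q *s t" using co(1)[OF x(1)] by simp
    also have "\<dots> = (\<Sum>l\<in>b. (\<rho> * co x l + q * ((co y l - \<rho> * co x l) div q)) *s l)"
      unfolding t_def vector_scale_sum by (simp add: sum.distrib[symmetric] vector_sadd_rdistrib vector_smult_assoc)
    also have "\<dots> = (\<Sum>l\<in>b. co y l *s l)"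
    proof (intro sum.cong refl)
      fix l assume "l \<in> b"
      from dv[OF this] have "q * ((co y l - \<rho> * co x l) div q) = co y l - \<rho> * co x l" by simp
      then show "(\<rho> * co x l + q * ((co y l - \<rho> * co x l) div q)) *s l = co y l *s l" by simp
    qed
    also have "\<dots> = y" using co(1)[OF y(1)] .
    finally show "y \<in> {y \<in> M. \<exists>\<rho>. \<exists>t\<in>M. y = \<rho> *s x + q *s t}" using y(1) tM by auto
  next
    fix y assume "y \<in> {y \<in> M. \<exists>\<rho>. \<exists>t\<in>M. y = \<rho> *s x + q *s t}"
    then obtain \<rho> t where y: "y \<in> M" "t \<in> M" "y = \<rho> *s x + q *s t" by auto
    have coy: "co y l = \<rho> * co x l + q * co t l" if "l \<in> b" for l
      using that y x(1) by (simp add: co(2,3) int_submodule_scale[OF Ms])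
    have "q dvd \<mu> l y" if "l \<in> A" for l
    proof -
      have "\<mu> l y = q * (co t l * co x i - co t i * co x l)"
        using that i coy[of l] coy[of i] by (simp add: \<mu>_def A_def algebra_simps)
      then show ?thesis by simp
    qed
    then show "y \<in> L" using y by (auto simp: L_def MA_def)
  qed
  define \<nu> where "\<nu> y = D x y div q" for y
  have qD: "q dvd D x y" if yL: "y \<in> L" for y
  proof -
    obtain \<rho> t where "y = \<rho> *s x + q *s t" using yL unfolding Leq by auto
    then have "D x y = \<rho> * D x x + q * D x t" by (simp add: D1 D2)
    then show ?thesis using D4 x(2) by simp
  qed
  have Teq: "tangent_lattice M D x q = {y \<in> L. q dvd \<nu> y}"
  proof -
    have "q ^ 2 dvd D x y \<longleftrightarrow> q dvd \<nu> y" if "y \<in> L" for y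
      using qD[OF that] qpos by (auto simp: \<nu>_def power2_eq_square elim!: dvdE)
    then show ?thesis unfolding tangent_lattice_def Leq by auto
  qed
  have add: "\<nu> (y + y') = \<nu> y + \<nu> y'" if "y \<in> L" "y' \<in> L" for y y'
    using qD[OF that(1)] qD[OF that(2)] by (simp add: \<nu>_def D1)
  have scale: "\<nu> (c *s y) = c * \<nu> y" if "y \<in> L" for c y
    using qD[OF that] by (simp add: \<nu>_def D2 div_mult_swap)
  \<comment> \<open>\<open>z\<close> may lie outside of \<open>L\<close>, but \<open>q *s z\<close>
    lies inside, and there \<open>\<nu>\<close> has the value \<open>D x z\<close>, which is prime
    to \<open>p\<close>.\<close>
  have "q *s z = 0 *s x + q *s z" by simp
  then have zL: "q *s z \<in> L" unfolding Leq using z(1) int_submodule_scale[OF Ms z(1)] by blast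
  have znd: "\<not> p dvd \<nu> (q *s z)" using z(2) qpos by (simp add: \<nu>_def D2)
  note c = congruence_sublattice[OF L(1) add scale p zL znd]
  show "integer_lattice (tangent_lattice M D x q)" "lattice_rank (tangent_lattice M D x q) = lattice_rank M"
    unfolding Teq using c L(2) by auto
  show "lattice_det (tangent_lattice M D x q) = of_int q ^ lattice_rank M * lattice_det M"
    unfolding Teq cA[symmetric] using c L(3) by simp
qed

section \<open>Residue classes of nonsingular zeros\<close>

text \<open>Points of projective space modulo \<open>q\<close> in the chart where coordinate
  \<open>i\<close> equals \<open>1\<close>, restricted to zeros of \<open>G\<close> that are
  nonsingular in direction \<open>j\<close>.\<close>

definition direction_classes ::
    "(int ^ ('n::finite)) set \<Rightarrow> (int ^ 'n \<Rightarrow> int) \<Rightarrow> (int ^ 'n \<Rightarrow> int ^ 'n \<Rightarrow> int) \<Rightarrow> int \<Rightarrow> int \<Rightarrow>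
      int ^ 'n \<Rightarrow> int ^ 'n \<Rightarrow> (int ^ 'n \<Rightarrow> int) set" where
  "direction_classes b G D p q i j = {z \<in> b \<rightarrow>\<^sub>E {0..<q}. z i = 1 \<and>
     q dvd G (\<Sum>l\<in>b. z l *s l) \<and> \<not> p dvd D (\<Sum>l\<in>b. z l *s l) j}"

text \<open>Once all coordinates except the \<open>i\<close>-th and the \<open>j\<close>-th are
  fixed, the \<open>j\<close>-th is a nonsingular root modulo \<open>q\<close> of a polynomial of
  degree at most \<open>E\<close>. The remaining free coordinates give the exponent of
  \<open>q\<close>.\<close>

lemma card_direction_classes_le:
  fixes b :: "(int ^ 'n::finite) set"
  assumes b: "finite b" "i \<in> b" "j \<in> b" "i \<noteq> j"
    and G: "hform E H G" and D: "form_gradient E G D" and p: "prime p" "q = p ^ k" "k \<ge> 1"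
  shows "finite (direction_classes b G D p q i j)"
    "card (direction_classes b G D p q i j) \<le> nat q ^ (card b - 2) * E"
proof -
  define Z where "Z = direction_classes b G D p q i j"
  have Z: "Z \<subseteq> b \<rightarrow>\<^sub>E {0..<q}" by (auto simp: Z_def direction_classes_def)
  have fb: "finite (b \<rightarrow>\<^sub>E {0..<q})" using b by (intro finite_PiE) auto
  have fin: "finite Z" using Z fb by (rule finite_subset)
  then show "finite (direction_classes b G D p q i j)" by (simp add: Z_def)
  define A where "A = b - {i, j}"
  have bA: "b = insert i (insert j A)" "i \<notin> insert j A" "j \<notin> A" "finite A" using b by (auto simp: A_def)
  have sum_b: "(\<Sum>l\<in>b. z l *s l) = (z i *s i + (\<Sum>l\<in>A. z l *s l)) + z j *s j" for z :: "int ^ 'n \<Rightarrow> int"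
    unfolding bA(1) using bA(2-) by (simp add: add.commute add.left_commute)
  obtain Q where Q: "form_expansion E H G j Q" using hform_expand[OF G] by blast
  note Q1 = Q[unfolded form_expansion_def, THEN conjunct1, rule_format]
  note Q2 = Q[unfolded form_expansion_def, THEN conjunct2, THEN conjunct1, rule_format]
  have fibre: "card {z \<in> Z. restrict z A = w} \<le> E" for w
  proof -
    define x where "x = i + (\<Sum>l\<in>A. w l *s l)"
    define R where "R = {s \<in> {0..<q}. q dvd poly (Q x) s \<and> \<not> p dvd D (x + s *s j) j}"
    have "card R \<le> E"
      unfolding R_def
    proof (rule card_nonsingular_roots_le[OF p(1) Q2 p(2,3)])
      fix s u :: int
      have "u ^ 2 dvd G ((x + s *s j) + u *s j) - G (x + s *s j) - u * D (x + s *s j) j"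
        using D by (simp add: form_gradient_def)
      moreover have "(x + s *s j) + u *s j = x + (s + u) *s j" by (simp add: vector_sadd_rdistrib add.assoc)
      ultimately show "u ^ 2 dvd poly (Q x) (s + u) - poly (Q x) s - u * D (x + s *s j) j" by (simp add: Q1)
    qed
    moreover have "card {z \<in> Z. restrict z A = w} \<le> card R"
    proof (rule card_inj_on_le)
      have rep: "(\<Sum>l\<in>b. z l *s l) = x + z j *s j" if z: "z \<in> Z" "restrict z A = w" for z
      proof -
        have "z i = 1" using z by (simp add: Z_def direction_classes_def)
        moreover have "(\<Sum>l\<in>A. z l *s l) = (\<Sum>l\<in>A. w l *s l)" using z(2) by (intro sum.cong refl) auto
        ultimately show ?thesis unfolding sum_b x_def by simp
      qed
      show "inj_on (\<lambda>z. z j) {z \<in> Z. restrict z A = w}"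
      proof (rule inj_onI)
        fix z z' assume z: "z \<in> {z \<in> Z. restrict z A = w}" "z' \<in> {z \<in> Z. restrict z A = w}" "z j = z' j"
        have "z l = z' l" if l: "l \<in> b" for l
        proof -
          consider "l = i" | "l = j" | "l \<in> A" using l unfolding A_def by blast
          then show ?thesis
          proof cases
            case 1 then show ?thesis using z by (simp add: Z_def direction_classes_def)
          next
            case 3
            have "restrict z A l = restrict z' A l" using z by simp
            then show ?thesis using 3 by simp
          qed (use z in simp)
        qed
        moreover have "z \<in> b \<rightarrow>\<^sub>E {0..<q}" "z' \<in> b \<rightarrow>\<^sub>E {0..<q}" using z Z by auto
        ultimately show "z = z'" by (intro PiE_ext)
      qed
      show "(\<lambda>z. z j) ` {z \<in> Z. restrict z A = w} \<subseteq> R"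
      proof
        fix s assume "s \<in> (\<lambda>z. z j) ` {z \<in> Z. restrict z A = w}"
        then obtain z where z: "z \<in> Z" "restrict z A = w" "s = z j" by blast
        have "s \<in> {0..<q}" using z Z b(3) by (auto simp: PiE_def Pi_def)
        then show "s \<in> R" using z(1) rep[OF z(1,2)] by (simp add: R_def Q1 Z_def direction_classes_def z(3))
      qed
      show "finite R" by (rule finite_subset[of R "{0..<q}"]) (auto simp: R_def)
    qed
    ultimately show ?thesis by simp
  qed
  have "Z \<subseteq> (\<Union>w\<in>A \<rightarrow>\<^sub>E {0..<q}. {z \<in> Z. restrict z A = w})"
  proof
    fix z assume z: "z \<in> Z"
    then have "restrict z A \<in> A \<rightarrow>\<^sub>E {0..<q}" using Z by (auto simp: A_def PiE_def Pi_def)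
    then show "z \<in> (\<Union>w\<in>A \<rightarrow>\<^sub>E {0..<q}. {z \<in> Z. restrict z A = w})" using z by blast
  qed
  then have "card Z \<le> card (\<Union>w\<in>A \<rightarrow>\<^sub>E {0..<q}. {z \<in> Z. restrict z A = w})"
    using fin bA(4) by (intro card_mono finite_UN_I finite_PiE) auto
  also have "\<dots> \<le> (\<Sum>w\<in>A \<rightarrow>\<^sub>E {0..<q}. card {z \<in> Z. restrict z A = w})"
    using bA(4) by (intro card_UN_le finite_PiE) auto
  also have "\<dots> \<le> (\<Sum>w\<in>A \<rightarrow>\<^sub>E {0..<q}. E)" by (intro sum_mono fibre)
  also have "\<dots> = nat q ^ card A * E" using bA(4) by (simp add: card_PiE)
  also have "card A = card b - 2" using b by (simp add: A_def card_Diff_subset)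
  finally show "card (direction_classes b G D p q i j) \<le> nat q ^ (card b - 2) * E" by (simp add: Z_def)
qed

lemma form_cong:
  assumes D: "form_gradient E G D" and "q dvd G x"
  shows "q dvd G (x + q *s t)"
proof -
  have "q ^ 2 dvd G (x + q *s t) - G x - q * D x t" using D by (simp add: form_gradient_def)
  then have "q dvd G (x + q *s t) - G x - q * D x t" by (rule dvd_trans[rotated]) (simp add: power2_eq_square)
  then have "q dvd (G (x + q *s t) - G x - q * D x t) + (G x + q * D x t)" using assms(2) by (intro dvd_add) auto
  then show ?thesis by simp
qed

text \<open>The count requires two different indices. If \<open>j\<close> were the only coordinate
  of \<open>x\<close> prime to \<open>p\<close>, then \<open>x\<close> would be a multiple of the
  basis vector \<open>j\<close> modulo \<open>p\<close>, and Euler's identity would make the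
  derivative along \<open>j\<close> vanish modulo \<open>p\<close>.\<close>

lemma nonsingular_direction_exists:
  fixes M :: "(int ^ 'n::finite) set"
  assumes M: "int_submodule M" and co: "coordinates b M co" and b: "finite b" "b \<subseteq> M"
    and D: "form_gradient E G D"
    and x: "x \<in> M" "G x = 0" and xp: "\<nexists>t. t \<in> M \<and> x = p *s t"
    and p: "prime p" and z: "z \<in> M" "\<not> p dvd D x z"
  shows "\<exists>i\<in>b. \<exists>j\<in>b. i \<noteq> j \<and> \<not> p dvd co x i \<and> \<not> p dvd D x j"
proof -
  have D1: "\<And>x y z. D x (y + z) = D x y + D x z" and D2: "\<And>x c y. D x (c *s y) = c * D x y"
    and D4: "\<And>x. D x x = int E * G x" and D6: "\<And>q x w y. q dvd D (x + q *s w) y - D x y"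
    using D by (auto simp: form_gradient_def)
  have D0: "D x 0 = 0" using D2[of x 0 0] by simp
  have Dsum: "D x (\<Sum>l\<in>A. c l *s l) = (\<Sum>l\<in>A. c l * D x l)" for A and c :: "int ^ 'n \<Rightarrow> int"
    by (induction A rule: infinite_finite_induct) (simp_all add: D0 D1 D2)
  have "\<exists>j\<in>b. \<not> p dvd D x j"
  proof (rule ccontr)
    assume "\<not> ?thesis"
    then have "p dvd (\<Sum>l\<in>b. co z l * D x l)" by (intro dvd_sum) auto
    then show False using z(2) Dsum[of "co z" b] coordinatesD(1)[OF co z(1)] by simp
  qed
  then obtain j where j: "j \<in> b" "\<not> p dvd D x j" by blast
  have "\<exists>i\<in>b. i \<noteq> j \<and> \<not> p dvd co x i"
  proof (rule ccontr)
    assume "\<not> ?thesis"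
    then have all: "\<And>l. l \<in> b \<Longrightarrow> l \<noteq> j \<Longrightarrow> p dvd co x l" by blast
    define t where "t = (\<Sum>l\<in>b - {j}. (co x l div p) *s l)"
    have tM: "t \<in> M" unfolding t_def using b by (intro int_submodule_sum[OF M] int_submodule_scale[OF M]) auto
    have "p *s t = (\<Sum>l\<in>b - {j}. co x l *s l)"
      unfolding t_def vector_scale_sum using all by (intro sum.cong refl) (simp add: vector_smult_assoc)
    then have xt: "x = co x j *s j + p *s t"
      using coordinatesD(1)[OF co x(1)] sum.remove[OF b(1) j(1), of "\<lambda>l. co x l *s l"] by simp
    have nc: "\<not> p dvd co x j"
    proof
      assume "p dvd co x j"
      then have "x = p *s ((co x j div p) *s j + t)" using xt by (simp add: vector_add_ldistrib vector_smult_assoc)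
      moreover have "(co x j div p) *s j + t \<in> M"
        using tM j b by (intro int_submoduleD(4)[OF M] int_submodule_scale[OF M]) auto
      ultimately show False using xp by blast
    qed
    have xt': "co x j *s j = x + p *s (- t)" using xt by (simp add: vec_eq_iff algebra_simps)
    have "p dvd G (co x j *s j)" unfolding xt' by (rule form_cong[OF D]) (simp add: x(2))
    then have "p dvd co x j * D (co x j *s j) j" by (simp add: D2[symmetric] D4)
    then have "p dvd D (co x j *s j) j" using nc p by (simp add: prime_dvd_mult_iff)
    moreover have "p dvd D x j - D (co x j *s j) j" using D6[where ?q = p and ?x = "co x j *s j" and ?w = t and ?y = j] xt by simp
    ultimately have "p dvd D x j" by (simp add: dvd_diff_left_iff)
    then show False using j by blast
  qed
  then show ?thesis using j by blast
qed

lemma normalised_coordinates_mem: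
  fixes M :: "(int ^ 'n::finite) set"
  assumes M: "int_submodule M" and co: "coordinates b M co" and b: "finite b" "b \<subseteq> M" "i \<in> b"
    and hG: "hform E H G" and D: "form_gradient E G D" and E: "E \<ge> 1"
    and x: "x \<in> M" "G x = 0" and p: "prime p" "q = p ^ k" "k \<ge> 1"
    and w: "[co x i * w = 1] (mod q)" and j: "\<not> p dvd D x j"
  shows "(\<lambda>l\<in>b. (co x l * w) mod q) \<in> direction_classes b G D p q i j"
proof -
  define z where "z = (\<lambda>l\<in>b. (co x l * w) mod q)"
  have p2: "p \<ge> 2" using p(1) by (rule prime_ge_2_int)
  then have q2: "q \<ge> 2" using p self_le_power[of p k] by simp
  have pq: "p dvd q" using p by simp
  have nw: "\<not> p dvd w"
  proof
    assume "p dvd w"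
    have "q dvd 1 - co x i * w" using w by (simp add: cong_iff_dvd_diff dvd_diff_commute)
    then have "p dvd (1 - co x i * w) + co x i * w" using \<open>p dvd w\<close> pq by (intro dvd_add) (auto intro: dvd_trans)
    then show False using p2 zdvd_not_zless[of 1 p] by simp
  qed
  have zi: "z i = 1" using w q2 b by (simp add: z_def cong_def)
  define t where "t = (\<Sum>l\<in>b. (- ((co x l * w) div q)) *s l)"
  have "(\<Sum>l\<in>b. z l *s l) = (\<Sum>l\<in>b. (w * co x l + q * (- ((co x l * w) div q))) *s l)"
  proof (intro sum.cong refl)
    fix l assume "l \<in> b"
    then have "z l = w * co x l + q * (- ((co x l * w) div q))"
      using mult_div_mod_eq[of q "co x l * w"] by (simp add: z_def algebra_simps)
    then show "z l *s l = (w * co x l + q * (- ((co x l * w) div q))) *s l" by simp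
  qed
  also have "\<dots> = w *s (\<Sum>l\<in>b. co x l *s l) + q *s t"
    unfolding t_def vector_scale_sum vector_sadd_rdistrib sum.distrib vector_smult_assoc by simp
  also have "\<dots> = w *s x + q *s t" using coordinatesD(1)[OF co x(1)] by simp
  finally have sz: "(\<Sum>l\<in>b. z l *s l) = w *s x + q *s t" .
  have Gw: "G (w *s x) = 0" using hform_homogeneous[OF hG] x(2) by simp
  have 1: "q dvd G (\<Sum>l\<in>b. z l *s l)" unfolding sz by (rule form_cong[OF D]) (simp add: Gw)
  have "w * D (w *s x) j = w ^ E * D x j" using D by (simp add: form_gradient_def)
  moreover have "\<not> p dvd w ^ E * D x j" using nw j p(1) by (auto simp: prime_dvd_mult_iff dest: prime_dvd_power)
  ultimately have "\<not> p dvd D (w *s x) j" using dvd_mult by metis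
  moreover have "q dvd D (w *s x + q *s t) j - D (w *s x) j" using D by (simp add: form_gradient_def)
  then have "p dvd D (w *s x + q *s t) j - D (w *s x) j" using pq dvd_trans by blast
  ultimately have 2: "\<not> p dvd D (\<Sum>l\<in>b. z l *s l) j"
    unfolding sz using dvd_diff[of p "D (w *s x + q *s t) j" "D (w *s x + q *s t) j - D (w *s x) j"] by auto
  have "z \<in> b \<rightarrow>\<^sub>E {0..<q}" using q2 by (auto simp: z_def)
  then have "z \<in> direction_classes b G D p q i j" using zi 1 2 by (simp add: direction_classes_def)
  then show ?thesis by (simp add: z_def)
qed

lemma same_direction_proportional:
  fixes M :: "(int ^ 'n::finite) set"
  assumes M: "int_submodule M" and co: "coordinates b M co" and b: "finite b" "b \<subseteq> M" "i \<in> b"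
    and x: "x \<in> M" and x': "x' \<in> M" and p: "prime p" "q = p ^ k" "k \<ge> 1"
    and w: "[co x i * w = 1] (mod q)" "[co x' i * w' = 1] (mod q)"
    and eq: "\<And>l. l \<in> b \<Longrightarrow> (co x l * w) mod q = (co x' l * w') mod q"
  shows "\<exists>\<rho>. \<exists>t\<in>M. \<not> p dvd \<rho> \<and> x' = \<rho> *s x + q *s t"
proof -
  have pq: "p dvd q" using p by simp
  define \<rho> where "\<rho> = co x' i * w"
  have unit: "\<not> p dvd u" if "[u * v = 1] (mod q)" for u v
  proof
    assume "p dvd u"
    have "q dvd 1 - u * v" using that by (simp add: cong_iff_dvd_diff dvd_diff_commute)
    then have "p dvd (1 - u * v) + u * v" using \<open>p dvd u\<close> pq by (intro dvd_add) (auto intro: dvd_trans)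
    then show False using prime_ge_2_int[OF p(1)] zdvd_not_zless[of 1 p] by simp
  qed
  have "\<not> p dvd co x' i" by (rule unit[OF w(2)])
  moreover have "\<not> p dvd w" by (rule unit[of w "co x i"]) (use w(1) in \<open>simp add: mult.commute\<close>)
  ultimately have "\<not> p dvd \<rho>" using p(1) by (simp add: \<rho>_def prime_dvd_mult_iff)
  have dv: "q dvd co x' l - \<rho> * co x l" if l: "l \<in> b" for l
  proof -
    have "[co x' l * 1 = co x' l * (co x' i * w')] (mod q)" using w(2) by (intro cong_scalar_left) (rule cong_sym)
    also have "co x' l * (co x' i * w') = co x' i * (co x' l * w')" by simp
    also have "[co x' i * (co x' l * w') = co x' i * (co x l * w)] (mod q)"
      using eq[OF l] by (intro cong_scalar_left) (simp add: cong_def)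
    also have "co x' i * (co x l * w) = \<rho> * co x l" by (simp add: \<rho>_def)
    finally show ?thesis by (simp add: cong_iff_dvd_diff)
  qed
  define t where "t = (\<Sum>l\<in>b. ((co x' l - \<rho> * co x l) div q) *s l)"
  have tM: "t \<in> M" unfolding t_def using b by (intro int_submodule_sum[OF M] int_submodule_scale[OF M]) auto
  have "\<rho> *s x + q *s t = \<rho> *s (\<Sum>l\<in>b. co x l *s l) + q *s t" using coordinatesD(1)[OF co x] by simp
  also have "\<dots> = (\<Sum>l\<in>b. (\<rho> * co x l + q * ((co x' l - \<rho> * co x l) div q)) *s l)"
    unfolding t_def vector_scale_sum by (simp add: sum.distrib[symmetric] vector_sadd_rdistrib vector_smult_assoc)
  also have "\<dots> = (\<Sum>l\<in>b. co x' l *s l)"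
  proof (intro sum.cong refl)
    fix l assume "l \<in> b"
    from dv[OF this] have "q * ((co x' l - \<rho> * co x l) div q) = co x' l - \<rho> * co x l" by simp
    then show "(\<rho> * co x l + q * ((co x' l - \<rho> * co x l) div q)) *s l = co x' l *s l" by simp
  qed
  also have "\<dots> = x'" using coordinatesD(1)[OF co x'] .
  finally show ?thesis using tM \<open>\<not> p dvd \<rho>\<close> by metis
qed

text \<open>A point may have several keys, so \<open>Q\<close> is a relation; one representative is
  chosen for each key that occurs.\<close>

lemma representatives_by_key:
  assumes "finite K" "\<And>x. x \<in> X \<Longrightarrow> \<exists>k\<in>K. Q x k" "\<And>x x' k. x \<in> X \<Longrightarrow> x' \<in> X \<Longrightarrow> Q x k \<Longrightarrow> Q x' k \<Longrightarrow> R x x'"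
  shows "\<exists>Y\<subseteq>X. finite Y \<and> card Y \<le> card K \<and> (\<forall>x\<in>X. \<exists>y\<in>Y. R y x)"
proof -
  define K' where "K' = {k \<in> K. \<exists>x\<in>X. Q x k}"
  have "\<forall>k\<in>K'. \<exists>x. x \<in> X \<and> Q x k" by (auto simp: K'_def)
  then obtain g where g: "\<forall>k\<in>K'. g k \<in> X \<and> Q (g k) k" by (rule bchoice[THEN exE])
  have K': "finite K'" "card K' \<le> card K" using assms(1) by (auto simp: K'_def intro: card_mono)
  have "\<exists>y\<in>g ` K'. R y x" if x: "x \<in> X" for x
  proof -
    obtain k where k: "k \<in> K" "Q x k" using assms(2)[OF x] by blast
    then have k': "k \<in> K'" using x by (auto simp: K'_def)
    then have "R (g k) x" using g x k by (intro assms(3)[of _ _ k]) auto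
    then show ?thesis using k' by blast
  qed
  moreover have "card (g ` K') \<le> card K" using card_image_le[OF K'(1), of g] K'(2) by simp
  moreover have "g ` K' \<subseteq> X" using g by auto
  ultimately show ?thesis using K'(1) by (intro exI[of _ "g ` K'"]) auto
qed

text \<open>Points are sorted by a pair of basis vectors and a normalised residue class. Points with
  the same class are proportional modulo \<open>q\<close> up to a unit, hence lie in each other's
  tangent lattices. The square of the rank counts the pairs.\<close>

lemma tangent_lattice_cover:
  fixes M :: "(int ^ 'n::finite) set"
  assumes M: "integer_lattice M" and hG: "hform E H G" and D: "form_gradient E G D" and E: "E \<ge> 1"
    and p: "prime p" "q = p ^ k" "k \<ge> 1" and z: "z \<in> M"
    and X: "\<And>x. x \<in> X \<Longrightarrow> x \<in> M \<and> G x = 0 \<and> \<not> p dvd D x z \<and> (\<nexists>t. t \<in> M \<and> x = p *s t)"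
  shows "\<exists>Y\<subseteq>X. finite Y \<and> card Y \<le> lattice_rank M ^ 2 * (nat q ^ (lattice_rank M - 2) * E) \<and>
    (\<forall>x\<in>X. \<exists>y\<in>Y. x \<in> tangent_lattice M D y q)"
proof -
  have Ms: "int_submodule M" using M by (rule lattice_submodule)
  obtain b where b: "lattice_basis b M" using M by (auto simp: integer_lattice_def)
  have bM: "b \<subseteq> M" and fin: "finite b" using lattice_basis_subset[OF b] lattice_basis_finite[OF b] by auto
  obtain co where co: "coordinates b M co" using lattice_coordinates[OF b] by blast
  define I where "I = {(i, j). i \<in> b \<and> j \<in> b \<and> i \<noteq> j}"
  have "I \<subseteq> b \<times> b" by (auto simp: I_def)
  then have finI: "finite I" and cI: "card I \<le> card b ^ 2"
    using fin finite_subset[of I "b \<times> b"] card_mono[of "b \<times> b" I] by (auto simp: card_cartesian_product power2_eq_square)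
  define K where "K = (SIGMA a:I. direction_classes b G D p q (fst a) (snd a))"
  have dc: "finite (direction_classes b G D p q (fst a) (snd a))"
    "card (direction_classes b G D p q (fst a) (snd a)) \<le> nat q ^ (card b - 2) * E" if "a \<in> I" for a
    using card_direction_classes_le[OF fin _ _ _ hG D p, of "fst a" "snd a"] that by (auto simp: I_def)
  have finK: "finite K" unfolding K_def using finI dc(1) by (rule finite_SigmaI)
  have "card K = (\<Sum>a\<in>I. card (direction_classes b G D p q (fst a) (snd a)))"
    unfolding K_def using finI dc(1) by (intro card_SigmaI) auto
  also have "\<dots> \<le> (\<Sum>a\<in>I. nat q ^ (card b - 2) * E)" by (intro sum_mono dc(2))
  also have "\<dots> \<le> card b ^ 2 * (nat q ^ (card b - 2) * E)" using cI by simp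
  finally have cK: "card K \<le> lattice_rank M ^ 2 * (nat q ^ (lattice_rank M - 2) * E)"
    using lattice_rank_eq_card[OF b] by simp
  define Q where "Q x a \<longleftrightarrow> fst (fst a) \<in> b \<and> (\<exists>w. [co x (fst (fst a)) * w = 1] (mod q) \<and> snd a = (\<lambda>l\<in>b. (co x l * w) mod q))"
    for x and a :: "((int ^ 'n) \<times> (int ^ 'n)) \<times> (int ^ 'n \<Rightarrow> int)"
  have "\<exists>Y\<subseteq>X. finite Y \<and> card Y \<le> card K \<and> (\<forall>x\<in>X. \<exists>y\<in>Y. x \<in> tangent_lattice M D y q)"
  proof (rule representatives_by_key[OF finK, where Q = Q])
    fix x assume "x \<in> X"
    note x = X[OF this]
    have "\<exists>i\<in>b. \<exists>j\<in>b. i \<noteq> j \<and> \<not> p dvd co x i \<and> \<not> p dvd D x j"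
      by (rule nonsingular_direction_exists[OF Ms co fin bM D _ _ _ p(1) z]) (use x in auto)
    then obtain i j where ij: "i \<in> b" "j \<in> b" "i \<noteq> j" "\<not> p dvd co x i" "\<not> p dvd D x j" by blast
    have "coprime (co x i) q" using p ij(4) by (simp add: coprime_commute prime_imp_coprime)
    then obtain w where w: "[co x i * w = 1] (mod q)" using cong_solve_coprime_int by blast
    have "(\<lambda>l\<in>b. (co x l * w) mod q) \<in> direction_classes b G D p q i j"
      using x by (intro normalised_coordinates_mem[OF Ms co fin bM ij(1) hG D E _ _ p w ij(5)]) auto
    then have "((i, j), (\<lambda>l\<in>b. (co x l * w) mod q)) \<in> K" using ij by (simp add: K_def I_def)
    moreover have "Q x ((i, j), (\<lambda>l\<in>b. (co x l * w) mod q))" using w ij(1) by (auto simp: Q_def)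
    ultimately show "\<exists>a\<in>K. Q x a" by blast
  next
    fix x x' a assume xX: "x \<in> X" "x' \<in> X" and Q: "Q x a" "Q x' a"
    note x = X[OF xX(1)] and x' = X[OF xX(2)]
    define i where "i = fst (fst a)"
    obtain w where w: "i \<in> b" "[co x i * w = 1] (mod q)" "snd a = (\<lambda>l\<in>b. (co x l * w) mod q)"
      using Q(1) unfolding Q_def i_def by blast
    obtain w' where w': "[co x' i * w' = 1] (mod q)" "snd a = (\<lambda>l\<in>b. (co x' l * w') mod q)"
      using Q(2) unfolding Q_def i_def by blast
    have eq: "(co x l * w) mod q = (co x' l * w') mod q" if "l \<in> b" for l
    proof -
      have "(\<lambda>l\<in>b. (co x l * w) mod q) l = (\<lambda>l\<in>b. (co x' l * w') mod q) l" using w(3) w'(2) by simp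
      then show ?thesis using that by simp
    qed
    have "\<exists>\<rho>. \<exists>t\<in>M. \<not> p dvd \<rho> \<and> x' = \<rho> *s x + q *s t"
      using x x' by (intro same_direction_proportional[OF Ms co fin bM w(1) _ _ p w(2) w'(1) eq]) auto
    then obtain \<rho> t where "t \<in> M" "\<not> p dvd \<rho>" "x' = \<rho> *s x + q *s t" by blast
    then show "x' \<in> tangent_lattice M D x q"
      using x x' by (intro mem_tangent_lattice[OF Ms D _ _ _ _ _ p(1,2) _ E hG]) auto
  qed
  then show ?thesis using cK by (meson order_trans)
qed

section \<open>Short vectors off the hypersurface, and zeros in low rank\<close>

lemma poly_eq_0_of_many_zeros:
  fixes f :: "int poly"
  assumes "degree f \<le> d" "\<And>s. s \<in> {0..int d} \<Longrightarrow> poly f s = 0"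
  shows "f = 0"
proof (rule ccontr)
  assume "f \<noteq> 0"
  then have "card {s. poly f s = 0} \<le> d" using card_poly_roots_bound[of f] assms(1) by simp
  moreover have "card {0..int d} \<le> card {s. poly f s = 0}"
    using assms(2) poly_roots_finite[OF \<open>f \<noteq> 0\<close>] by (intro card_mono) auto
  ultimately show False by simp
qed

text \<open>One variable at a time: along each line the form is a polynomial of degree at most
  \<open>d\<close> with \<open>d + 1\<close> zeros.\<close>

lemma hform_zero_of_grid:
  fixes f :: "int ^ 'n::finite \<Rightarrow> int"
  assumes f: "hform d H f" and W: "finite W"
    and "\<And>t. (\<And>w. w \<in> W \<Longrightarrow> t w \<in> {0..int d}) \<Longrightarrow> f (x + (\<Sum>w\<in>W. t w *s w)) = 0"
  shows "f (x + (\<Sum>w\<in>W. c w *s w)) = 0"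
  using W assms(3)
proof (induction W arbitrary: x rule: finite_induct)
  case (insert w0 W)
  obtain Q where Q: "form_expansion d H f w0 Q" using hform_expand[OF f] by blast
  note Q1 = Q[unfolded form_expansion_def, THEN conjunct1, rule_format]
  note Q2 = Q[unfolded form_expansion_def, THEN conjunct2, THEN conjunct1, rule_format]
  define z where "z = x + (\<Sum>w\<in>W. c w *s w)"
  have "poly (Q z) s = 0" if s: "s \<in> {0..int d}" for s
  proof -
    have "f ((x + s *s w0) + (\<Sum>w\<in>W. c w *s w)) = 0"
    proof (rule insert.IH)
      fix t assume t: "\<And>w. w \<in> W \<Longrightarrow> t w \<in> {0..int d}"
      have "(\<Sum>w\<in>W. (t(w0 := s)) w *s w) = (\<Sum>w\<in>W. t w *s w)"
        using insert.hyps by (intro sum.cong refl) auto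
      moreover have "f (x + (\<Sum>w\<in>insert w0 W. (t(w0 := s)) w *s w)) = 0"
        by (rule insert.prems) (use t s in auto)
      ultimately show "f ((x + s *s w0) + (\<Sum>w\<in>W. t w *s w)) = 0"
        using insert.hyps by (simp add: add.assoc)
    qed
    moreover have "(x + s *s w0) + (\<Sum>w\<in>W. c w *s w) = z + s *s w0" by (simp add: z_def)
    ultimately show ?thesis by (simp add: Q1)
  qed
  then have "Q z = 0" using Q2 by (intro poly_eq_0_of_many_zeros)
  then have "f (z + c w0 *s w0) = 0" using Q1[of z "c w0"] by simp
  moreover have "z + c w0 *s w0 = x + (\<Sum>w\<in>insert w0 W. c w *s w)" using insert.hyps by (simp add: z_def)
  ultimately show ?case by simp
qed simp

text \<open>An integral relation is extracted from a real one by the box principle: the integral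
  vectors \<open>z j\<close> stay bounded, so two of them agree, and subtracting gives integer
  coefficients.\<close>

lemma integer_multiple_in_span:
  fixes W :: "(int ^ 'n::finite) set"
  assumes W: "finite W" and y: "rv y \<in> span (rv ` W)"
  shows "\<exists>c>0. \<exists>k. c *s y = (\<Sum>w\<in>W. k w *s w)"
proof -
  have "rv y \<in> range (\<lambda>u. \<Sum>v\<in>rv ` W. u v *\<^sub>R v)" using y W by (simp add: span_finite)
  then obtain u where u: "rv y = (\<Sum>v\<in>rv ` W. u v *\<^sub>R v)" by blast
  define a where "a w = u (rv w)" for w
  have a: "rv y = (\<Sum>w\<in>W. a w *\<^sub>R rv w)"
    unfolding u a_def by (subst sum.reindex[OF inj_of_int_vec]) simp
  define z where "z j = int j *s y - (\<Sum>w\<in>W. \<lfloor>real j * a w\<rfloor> *s w)" for j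
  define C where "C = (\<Sum>w\<in>W. norm (rv w))"
  have "\<bar>z j $ i\<bar> \<le> \<lfloor>C\<rfloor>" for j i
  proof -
    have "rv (z j) = (\<Sum>w\<in>W. frac (real j * a w) *\<^sub>R rv w)"
      by (simp add: z_def of_int_vec_diff of_int_vec_sum of_int_vec_scaleR a scaleR_sum_right
          sum_subtractf[symmetric] scaleR_left_diff_distrib[symmetric] frac_def)
    also have "norm \<dots> \<le> C"
      unfolding C_def
    proof (rule sum_norm_le)
      fix w assume "w \<in> W"
      have "\<bar>frac (real j * a w)\<bar> * norm (rv w) \<le> 1 * norm (rv w)"
        using frac_ge_0[of "real j * a w"] frac_lt_1[of "real j * a w"] by (intro mult_right_mono) auto
      then show "norm (frac (real j * a w) *\<^sub>R rv w) \<le> norm (rv w)" by simp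
    qed
    finally have "norm (rv (z j)) \<le> C" .
    then have "of_int \<bar>z j $ i\<bar> \<le> C" using component_le_euclidean_length[of "z j" i]
      by (simp add: euclidean_length_def)
    then show ?thesis by (simp add: le_floor_iff)
  qed
  then have "range z \<subseteq> {x. \<forall>i. \<bar>x $ i\<bar> \<le> \<lfloor>C\<rfloor>}" by auto
  then have "finite (range z)" using finite_bounded_vectors by (rule finite_subset)
  then have "\<not> inj z" using finite_imageD[of z UNIV] by auto
  then obtain j i where "z i = z j" "i < j" unfolding inj_def by (metis linorder_neqE_nat)
  then have "int j *s y - int i *s y = (\<Sum>w\<in>W. \<lfloor>real j * a w\<rfloor> *s w) - (\<Sum>w\<in>W. \<lfloor>real i * a w\<rfloor> *s w)"
    unfolding z_def by (simp add: algebra_simps)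
  then have "(int j - int i) *s y = (\<Sum>w\<in>W. (\<lfloor>real j * a w\<rfloor> - \<lfloor>real i * a w\<rfloor>) *s w)"
    unfolding sum_subtractf[symmetric] by (simp add: vec_eq_iff algebra_simps)
  moreover have "int j - int i > 0" using \<open>i < j\<close> by simp
  ultimately show ?thesis by (intro exI[of _ "int j - int i"] conjI exI)
qed

text \<open>Short vectors span \<open>M\<close> over the reals only, so \<open>y0\<close> is
  replaced by a multiple that is an integral combination of them; by homogeneity \<open>f\<close>
  stays nonzero there. Then coefficients in \<open>{0..d}\<close> already detect \<open>f\<close>.
  The bound reflects at most \<open>n\<close> vectors, coefficients at most \<open>d\<close> and
  coordinates at most \<open>T\<close>.\<close>

lemma short_nonzero_exists:
  fixes M :: "(int ^ 'n::finite) set" and f :: "int ^ 'n \<Rightarrow> int"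
  assumes M: "integer_lattice M" and sp: "short_spanned M T" and T: "T \<ge> 0" and f: "hform d H f"
    and y0: "y0 \<in> M" "f y0 \<noteq> 0"
  shows "\<exists>y\<in>M. f y \<noteq> 0 \<and> (\<forall>i. \<bar>y $ i\<bar> \<le> \<lfloor>real CARD('n) * real d * T\<rfloor>)"
proof -
  have Ms: "int_submodule M" using M by (rule lattice_submodule)
  define V where "V = {x \<in> M. euclidean_length x \<le> T}"
  obtain B where B: "B \<subseteq> rv ` V" "independent B" "rv ` V \<subseteq> span B"
    using maximal_independent_subset[of "rv ` V"] by blast
  define W where "W = {x \<in> V. rv x \<in> B}"
  have WB: "rv ` W = B" using B(1) by (auto simp: W_def)
  have finB: "finite B" and "card B \<le> CARD('n)" using independent_bound[OF B(2)] by auto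
  have "inj_on rv W" by (rule inj_of_int_vec)
  then have W: "finite W" "card W \<le> CARD('n)"
    using finB \<open>card B \<le> CARD('n)\<close> WB finite_image_iff[of rv W] card_image[of rv W] by auto
  have "span (rv ` V) \<subseteq> span B" using B(3) by (intro span_minimal) auto
  then have "rv y0 \<in> span (rv ` W)" using sp y0(1) unfolding short_spanned_def WB V_def by blast
  then obtain c k where c: "c > 0" "c *s y0 = (\<Sum>w\<in>W. k w *s w)" using integer_multiple_in_span[OF W(1)] by blast
  have "\<exists>t. (\<forall>w\<in>W. t w \<in> {0..int d}) \<and> f (\<Sum>w\<in>W. t w *s w) \<noteq> 0"
  proof (rule ccontr)
    assume neg: "\<not> ?thesis"
    have "f (0 + (\<Sum>w\<in>W. k w *s w)) = 0"
      by (rule hform_zero_of_grid[OF f W(1)]) (use neg in \<open>simp; blast\<close>)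
    then have "c ^ d * f y0 = 0" using hform_homogeneous[OF f, of c y0] c(2) by simp
    then show False using c(1) y0(2) by simp
  qed
  then obtain t where t: "\<And>w. w \<in> W \<Longrightarrow> t w \<in> {0..int d}" "f (\<Sum>w\<in>W. t w *s w) \<noteq> 0" by blast
  define y where "y = (\<Sum>w\<in>W. t w *s w)"
  have "y \<in> M" unfolding y_def by (intro int_submodule_sum[OF Ms] int_submodule_scale[OF Ms]) (auto simp: W_def V_def)
  moreover have "\<bar>y $ i\<bar> \<le> \<lfloor>real CARD('n) * real d * T\<rfloor>" for i
  proof -
    have "real_of_int \<bar>y $ i\<bar> \<le> (\<Sum>w\<in>W. real_of_int \<bar>t w * w $ i\<bar>)"
      unfolding of_int_sum[symmetric] of_int_le_iff by (simp add: y_def sum_abs)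
    also have "\<dots> \<le> (\<Sum>w\<in>W. real d * T)"
    proof (rule sum_mono)
      fix w assume w: "w \<in> W"
      have "\<bar>real_of_int (w $ i)\<bar> \<le> T" using component_le_euclidean_length[of w i] w by (simp add: W_def V_def)
      moreover have "\<bar>real_of_int (t w)\<bar> \<le> real d" using t(1)[OF w] by auto
      ultimately show "real_of_int \<bar>t w * w $ i\<bar> \<le> real d * T"
        by (simp add: abs_mult mult_mono)
    qed
    also have "\<dots> \<le> real CARD('n) * (real d * T)"
      using W(2) T by (simp add: mult_right_mono)
    finally show ?thesis by (simp add: le_floor_iff mult.assoc)
  qed
  ultimately show ?thesis using t(2) y_def by blast
qed

lemma primitive_proportional:
  fixes x y :: "int ^ 'n::finite"
  assumes eq: "a *s x = c *s y" and a: "a \<noteq> 0" and x: "(GCD i. x $ i) = 1" and y: "(GCD i. y $ i) = 1"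
  shows "x = y \<or> x = - y"
proof -
  have g: "(GCD i. (e *s z) $ i) = \<bar>e\<bar> * (GCD i. z $ i)" for e and z :: "int ^ 'n"
  proof -
    have "range (\<lambda>i. (e *s z) $ i) = (*) e ` range (\<lambda>i. z $ i)" by auto
    then show ?thesis by (simp add: Gcd_mult abs_mult)
  qed
  have "\<bar>a\<bar> = \<bar>c\<bar>" using g[of a x] g[of c y] eq x y by simp
  then consider "c = a" | "c = - a" by linarith
  then show ?thesis
  proof cases
    case 1
    then have "x = y" using eq a by (simp add: vec_eq_iff)
    then show ?thesis ..
  next
    case 2
    have "x $ i = - y $ i" for i
    proof -
      have "(a *s x) $ i = (c *s y) $ i" using eq by simp
      then have "a * x $ i = a * (- y $ i)" using 2 by simp
      then show ?thesis by (rule mult_left_cancel[OF a, THEN iffD1])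
    qed
    then show ?thesis by (simp add: vec_eq_iff)
  qed
qed

text \<open>Lattices of rank one in the descent are thereby determined by a single point, and can be
  counted by points.\<close>

lemma rank_1_lattice_primitive:
  fixes N :: "(int ^ 'n::finite) set"
  assumes N: "integer_lattice N" "lattice_rank N = 1" and x: "x \<in> N" "(GCD i. x $ i) = 1"
  shows "N = range (\<lambda>c. c *s x)"
proof -
  obtain b where b: "lattice_basis b N" using N by (auto simp: integer_lattice_def)
  have "card b = 1" using lattice_rank_eq_card[OF b] N(2) by simp
  then obtain u where "b = {u}" by (rule card_1_singletonE)
  then have Nu: "N = range (\<lambda>c :: int ^ 'n \<Rightarrow> int. c u *s u)" using b by (simp add: lattice_basis_def)
  then obtain c where c: "x = c *s u" using x(1) by blast
  then have "c dvd (GCD i. x $ i)" by (intro Gcd_greatest) auto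
  then have "c dvd 1" using x(2) by simp
  then have "c * c = 1" by (auto simp: zdvd1_eq abs_if split: if_splits)
  then have cu: "c *s x = u" using c by (simp add: vector_smult_assoc)
  show ?thesis
  proof
    show "N \<subseteq> range (\<lambda>c. c *s x)"
    proof
      fix y assume "y \<in> N"
      then obtain e where "y = e *s u" using Nu by blast
      then have "y = (e * c) *s x" using cu by (simp add: vector_smult_assoc[symmetric])
      then show "y \<in> range (\<lambda>c. c *s x)" by blast
    qed
    show "range (\<lambda>c. c *s x) \<subseteq> N"
      using int_submodule_scale[OF lattice_submodule[OF N(1)] x(1)] by blast
  qed
qed

lemma determinant_zero_swap:
  fixes a b c d x y :: int
  assumes "a * d = b * c"
  shows "a * (c * x + d * y) = c * (a * x + b * y)" "b * (c * x + d * y) = d * (a * x + b * y)"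
proof -
  have "a * (c * x + d * y) = c * (a * x) + (a * d) * y" by (simp add: algebra_simps)
  then show "a * (c * x + d * y) = c * (a * x + b * y)" unfolding assms by (simp add: algebra_simps)
  have "b * (c * x + d * y) = (b * c) * x + d * (b * y)" by (simp add: algebra_simps)
  then show "b * (c * x + d * y) = d * (a * x + b * y)" unfolding assms[symmetric] by (simp add: algebra_simps)
qed

text \<open>The classical count for a binary form. For a fixed zero \<open>x0\<close>, Cramer's rule
  puts a multiple of every other, non-proportional zero on the line
  \<open>\<gamma> *s y + s *s x0\<close>, on which \<open>f\<close> is a nonzero polynomial in
  \<open>s\<close>. Each root comes from at most two primitive vectors, and
  \<plusminus>\<open>x0\<close> account for the final summand \<open>2\<close>.\<close>

lemma card_zeros_rank_2:
  fixes M :: "(int ^ 'n::finite) set" and f :: "int ^ 'n \<Rightarrow> int"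
  assumes M: "integer_lattice M" "lattice_rank M = 2" and f: "hform d H f" and y: "y \<in> M" "f y \<noteq> 0"
    and S: "finite S" "\<And>x. x \<in> S \<Longrightarrow> x \<in> M \<and> f x = 0 \<and> (GCD i. x $ i) = 1"
  shows "card S \<le> 2 * d + 2"
proof (cases "S = {}")
  case False
  then obtain x0 where x0: "x0 \<in> S" by blast
  have Ms: "int_submodule M" using M(1) by (rule lattice_submodule)
  obtain b where b: "lattice_basis b M" using M by (auto simp: integer_lattice_def)
  obtain co where co: "coordinates b M co" using lattice_coordinates[OF b] by blast
  have "card b = 2" using lattice_rank_eq_card[OF b] M(2) by simp
  then obtain u v where uv: "b = {u, v}" "u \<noteq> v" by (auto simp: card_2_iff)
  have rep: "co x u *s u + co x v *s v = x" if "x \<in> M" for x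
    using coordinatesD(1)[OF co that] uv by simp
  define \<Delta> where "\<Delta> x z = co x u * co z v - co x v * co z u" for x z
  have cramer: "\<Delta> x z *s w = \<Delta> w z *s x + \<Delta> x w *s z" if "x \<in> M" "z \<in> M" "w \<in> M" for x z w
  proof -
    have "(\<Delta> x z *s (co w u *s u + co w v *s v)) $ i =
        (\<Delta> w z *s (co x u *s u + co x v *s v) + \<Delta> x w *s (co z u *s u + co z v *s v)) $ i" for i
      by (simp add: \<Delta>_def algebra_simps)
    then show ?thesis using that by (simp add: vec_eq_iff rep)
  qed
  have collinear: "co a w *s c = co c w *s a" if ac: "a \<in> M" "c \<in> M" "\<Delta> a c = 0" and w: "w \<in> b" for a c w
  proof -
    have h: "co a u * co c v = co a v * co c u" using ac(3) by (simp add: \<Delta>_def)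
    have "co a w * (co c u * u $ i + co c v * v $ i) = co c w * (co a u * u $ i + co a v * v $ i)" for i
    proof -
      consider "w = u" | "w = v" using w uv by blast
      then show ?thesis
      proof cases
        case 1
        show ?thesis unfolding 1 by (rule determinant_zero_swap(1)[OF h])
      next
        case 2
        show ?thesis unfolding 2 by (rule determinant_zero_swap(2)[OF h])
      qed
    qed
    then have "co a w *s (co c u *s u + co c v *s v) = co c w *s (co a u *s u + co a v *s v)"
      unfolding vec_eq_iff vector_add_component vector_smult_component by blast
    then show ?thesis using ac by (simp add: rep)
  qed
  have x0_prop: "x = x0 \<or> x = - x0" if x: "x \<in> S" "\<Delta> x0 x = 0" for x
  proof -
    have xM: "x \<in> M" "x0 \<in> M" using S(2) x x0 by auto
    have x_ne: "x \<noteq> 0"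
    proof
      assume "x = 0"
      then have "(GCD i. x $ i) = 0" by simp
      then show False using S(2)[OF x(1)] by simp
    qed
    have e: "co x w *s x0 = co x0 w *s x" if "w \<in> b" for w
      by (rule collinear[OF xM(2,1) x(2) that, symmetric])
    have "\<exists>w\<in>b. co x w \<noteq> 0"
    proof (rule ccontr)
      assume "\<not> ?thesis"
      then have "x = 0" using rep[OF xM(1)] uv by simp
      then show False using x_ne by simp
    qed
    then obtain w where "w \<in> b" "co x w \<noteq> 0" by blast
    then have "x0 = x \<or> x0 = - x" using e S(2) x(1) x0 by (intro primitive_proportional) auto
    then show ?thesis by auto
  qed
  define W where "W = {x \<in> S. \<Delta> x0 x \<noteq> 0}"
  have finW: "finite W" using S by (simp add: W_def)
  \<comment> \<open>A common multiple of the determinants, so that the parameters of all zeros on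
    the line are integers.\<close>
  define \<gamma> where "\<gamma> = (\<Prod>x\<in>W. \<Delta> x0 x)"
  have \<gamma>0: "\<gamma> \<noteq> 0" using finW by (simp add: \<gamma>_def W_def)
  have dv: "\<Delta> x0 x dvd \<gamma>" if "x \<in> W" for x using finW that unfolding \<gamma>_def by (rule dvd_prodI)
  have x0M: "x0 \<in> M" "f x0 = 0" using S(2) x0 by auto
  obtain Q where Q: "form_expansion d H f x0 Q" using hform_expand[OF f] by blast
  note Q1 = Q[unfolded form_expansion_def, THEN conjunct1, rule_format]
  note Q2 = Q[unfolded form_expansion_def, THEN conjunct2, THEN conjunct1, rule_format]
  define g where "g = Q (\<gamma> *s y)"
  have "poly g 0 = \<gamma> ^ d * f y" by (simp add: g_def Q1 hform_homogeneous[OF f])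
  then have g0: "g \<noteq> 0" using \<gamma>0 y(2) by auto
  define s where "s x = \<Delta> x y * (\<gamma> div \<Delta> x0 x)" for x
  have sx: "\<gamma> *s y + s x *s x0 = (\<Delta> x0 y * (\<gamma> div \<Delta> x0 x)) *s x" if x: "x \<in> W" for x
  proof -
    have xM: "x \<in> M" using x S(2) by (auto simp: W_def)
    have "(\<Delta> x0 y * (\<gamma> div \<Delta> x0 x)) *s x = (\<gamma> div \<Delta> x0 x) *s (\<Delta> x0 y *s x)"
      by (simp add: vector_smult_assoc mult.commute)
    also have "\<dots> = (\<gamma> div \<Delta> x0 x) *s (\<Delta> x y *s x0 + \<Delta> x0 x *s y)" using cramer[OF x0M(1) y(1) xM] by simp
    also have "\<dots> = ((\<gamma> div \<Delta> x0 x) * \<Delta> x0 x) *s y + s x *s x0"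
      by (simp add: vector_add_ldistrib vector_smult_assoc s_def mult.commute add.commute)
    also have "(\<gamma> div \<Delta> x0 x) * \<Delta> x0 x = \<gamma>" using dv[OF x] by simp
    finally show ?thesis by simp
  qed
  have roots: "s ` W \<subseteq> {t. poly g t = 0}"
  proof
    fix t assume "t \<in> s ` W"
    then obtain x where x: "x \<in> W" "t = s x" by blast
    have "poly g t = f ((\<Delta> x0 y * (\<gamma> div \<Delta> x0 x)) *s x)" using sx[OF x(1)] x(2) by (simp add: g_def Q1)
    also have "\<dots> = 0" using S(2)[of x] x(1) by (simp add: hform_homogeneous[OF f] W_def)
    finally show "t \<in> {t. poly g t = 0}" by simp
  qed
  have yx0: "\<Delta> x0 y \<noteq> 0"
  proof
    assume "\<Delta> x0 y = 0"
    have x0_ne: "x0 \<noteq> 0"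
    proof
      assume "x0 = 0"
      then have "(GCD i. x0 $ i) = 0" by simp
      then show False using S(2)[OF x0] by simp
    qed
    have e: "co x0 w *s y = co y w *s x0" if "w \<in> b" for w
      by (rule collinear[OF x0M(1) y(1) \<open>\<Delta> x0 y = 0\<close> that])
    have "\<exists>w\<in>b. co x0 w \<noteq> 0"
    proof (rule ccontr)
      assume "\<not> ?thesis"
      then have "x0 = 0" using rep[OF x0M(1)] uv by simp
      then show False using x0_ne by simp
    qed
    then obtain w where w: "w \<in> b" "co x0 w \<noteq> 0" by blast
    have "co x0 w ^ d * f y = co y w ^ d * f x0" using e[OF w(1)] by (simp add: hform_homogeneous[OF f, symmetric])
    then show False using w(2) y(2) x0M(2) by (cases d) auto
  qed
  have fibre: "card {x \<in> W. s x = t} \<le> 2" for t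
  proof (cases "{x \<in> W. s x = t} = {}")
    case False
    then obtain x1 where x1: "x1 \<in> W" "s x1 = t" by blast
    have "{x \<in> W. s x = t} \<subseteq> {x1, - x1}"
    proof
      fix x assume x: "x \<in> {x \<in> W. s x = t}"
      have "(\<Delta> x0 y * (\<gamma> div \<Delta> x0 x)) *s x = (\<Delta> x0 y * (\<gamma> div \<Delta> x0 x1)) *s x1"
        using sx[of x] sx[OF x1(1)] x x1(2) by simp
      moreover have "\<gamma> div \<Delta> x0 x \<noteq> 0" using dv[of x] x \<gamma>0 by auto
      then have "\<Delta> x0 y * (\<gamma> div \<Delta> x0 x) \<noteq> 0" using yx0 by simp
      ultimately have "x = x1 \<or> x = - x1" using x x1 S(2) by (intro primitive_proportional) (auto simp: W_def)
      then show "x \<in> {x1, - x1}" by simp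
    qed
    then have "card {x \<in> W. s x = t} \<le> card {x1, - x1}" by (intro card_mono) auto
    also have "\<dots> \<le> 2" by (simp add: card_insert_if)
    finally show ?thesis .
  next
    case True
    show ?thesis unfolding True by simp
  qed
  have "W \<subseteq> (\<Union>t\<in>s ` W. {x \<in> W. s x = t})" by auto
  then have "card W \<le> card (\<Union>t\<in>s ` W. {x \<in> W. s x = t})" using finW by (intro card_mono) auto
  also have "\<dots> \<le> (\<Sum>t\<in>s ` W. card {x \<in> W. s x = t})" using finW by (intro card_UN_le) auto
  also have "\<dots> \<le> (\<Sum>t\<in>s ` W. 2)" by (intro sum_mono fibre)
  also have "\<dots> \<le> 2 * card {t. poly g t = 0}" using card_mono[OF poly_roots_finite[OF g0] roots] by simp
  also have "\<dots> \<le> 2 * d" using card_poly_roots_bound[OF g0] Q2[of "\<gamma> *s y"] by (simp add: g_def)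
  finally have cW: "card W \<le> 2 * d" .
  have "S \<subseteq> W \<union> {x0, - x0}" using x0_prop by (auto simp: W_def)
  then have "card S \<le> card (W \<union> {x0, - x0})" using finW by (intro card_mono) auto
  also have "\<dots> \<le> card W + card {x0, - x0}" by (rule card_Un_le)
  also have "card {x0, - x0} \<le> 2" by (simp add: card_insert_if)
  finally show ?thesis using cW by simp
qed simp

section \<open>From integral zeros to complex linear spaces\<close>

lemma eval_poly_of_int_vec: "eval_poly F (of_int_vec x :: complex ^ 'n::finite) = of_int (eval_poly F x)"
  by (simp add: eval_poly_def of_int_vec_def)

lemma eval_poly_line:
  fixes F :: "('n::finite) int_mpoly" and x y :: "complex ^ 'n"
  shows "\<exists>g. \<forall>s. eval_poly F (x + s *s y) = poly g s"
proof -
  define g where "g = (\<Sum>\<alpha>\<in>Poly_Mapping.keys F. [:of_int (Poly_Mapping.lookup F \<alpha>):] *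
        (\<Prod>i\<in>UNIV. [:x $ i, y $ i:] ^ Poly_Mapping.lookup \<alpha> i))"
  have "eval_poly F (x + s *s y) = poly g s" for s
    by (simp add: eval_poly_def g_def poly_sum poly_prod mult.commute)
  then show ?thesis by blast
qed

lemma poly_zero_of_int_zeros:
  fixes g :: "complex poly"
  assumes "\<And>k :: int. poly g (of_int k) = 0"
  shows "g = 0"
proof (rule ccontr)
  assume "g \<noteq> 0"
  then have "finite {s. poly g s = 0}" by (rule poly_roots_finite)
  then have "finite (range (of_int :: int \<Rightarrow> complex))" by (rule finite_subset[rotated]) (use assms in auto)
  then have "finite (UNIV :: int set)" by (rule finite_imageD) (simp add: inj_on_def)
  then show False by simp
qed

text \<open>Integral coefficients are replaced by complex ones one at a time: along each line
  involved, \<open>F\<close> is a complex polynomial in one variable that vanishes at all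
  integers.\<close>

lemma spans_linear_space_in_if_zero:
  fixes M :: "(int ^ 'n::finite) set"
  assumes M: "int_submodule M" and F: "\<And>x. x \<in> M \<Longrightarrow> eval_poly F x = 0"
  shows "spans_linear_space_in M F"
  unfolding spans_linear_space_in_def
proof
  fix v :: "complex ^ 'n" assume "v \<in> vec.span (of_int_vec ` M)"
  then obtain A u where A: "finite A" "A \<subseteq> of_int_vec ` M" "v = (\<Sum>a\<in>A. u a *s a)"
    unfolding vec.span_explicit by blast
  have "eval_poly F (of_int_vec x + (\<Sum>a\<in>A'. u a *s a)) = 0" if "A' \<subseteq> of_int_vec ` M" "finite A'" "x \<in> M" for A' x
    using that(2,1,3)
  proof (induction A' arbitrary: x rule: finite_induct)
    case empty
    then show ?case using F by (simp add: eval_poly_of_int_vec)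
  next
    case (insert a A')
    then obtain w where w: "w \<in> M" "a = of_int_vec w" by auto
    obtain g where g: "\<And>s. eval_poly F ((of_int_vec x + (\<Sum>a\<in>A'. u a *s a)) + s *s a) = poly g s"
      using eval_poly_line[of F "of_int_vec x + (\<Sum>a\<in>A'. u a *s a)" a] by blast
    have "poly g (of_int k) = 0" for k
    proof -
      have "x + k *s w \<in> M" using insert.prems w(1) M by (intro int_submoduleD(4)[OF M] int_submodule_scale[OF M]) auto
      then have "eval_poly F (of_int_vec (x + k *s w) + (\<Sum>a\<in>A'. u a *s a)) = 0"
        using insert.prems by (intro insert.IH) auto
      moreover have "of_int_vec (x + k *s w) + (\<Sum>a\<in>A'. u a *s a) = (of_int_vec x + (\<Sum>a\<in>A'. u a *s a)) + of_int k *s a"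
        by (simp add: w(2) vec_eq_iff of_int_vec_def)
      ultimately show ?thesis by (simp add: g)
    qed
    then have "g = 0" by (rule poly_zero_of_int_zeros)
    then show ?case using g[of "u a"] insert.hyps by (simp add: ac_simps)
  qed
  moreover have "0 \<in> M" using M by (rule int_submoduleD)
  ultimately have "eval_poly F (of_int_vec 0 + v) = 0" using A by blast
  then show "v \<in> {v. eval_poly F v = 0}" by (simp add: of_int_vec_def zero_vec_def[symmetric])
qed

section \<open>One step of the descent\<close>

lemma primitive_not_dvd:
  fixes x :: "int ^ 'n::finite"
  assumes "(GCD i. x $ i) = 1" "prime p"
  shows "\<exists>i. \<not> p dvd x $ i"
proof (rule ccontr)
  assume "\<not> ?thesis"
  then have "p dvd (GCD i. x $ i)" by (intro Gcd_greatest) auto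
  then show False using assms by (simp add: not_prime_unit)
qed

lemma primitive_not_multiple:
  fixes x :: "int ^ 'n::finite"
  assumes "(GCD i. x $ i) = 1" "prime p"
  shows "x \<noteq> p *s t"
proof
  assume "x = p *s t"
  then have "p dvd x $ i" for i by simp
  then show False using primitive_not_dvd[OF assms] by blast
qed

lemma tangent_lattice_antimono:
  assumes "int_submodule M"
  shows "tangent_lattice M D x (p * q) \<subseteq> tangent_lattice M D x q"
proof
  fix y assume "y \<in> tangent_lattice M D x (p * q)"
  then obtain \<rho> t where y: "y \<in> M" "t \<in> M" "y = \<rho> *s x + (p * q) *s t" "(p * q) ^ 2 dvd D x y"
    by (auto simp: tangent_lattice_def)
  have "y = \<rho> *s x + q *s (p *s t)" using y(3) by (simp add: vector_smult_assoc mult.commute)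
  moreover have "p *s t \<in> M" using assms y(2) by (rule int_submodule_scale)
  moreover have "q ^ 2 dvd D x y" using y(4) by (rule dvd_trans[rotated]) (simp add: power_mult_distrib)
  ultimately show "y \<in> tangent_lattice M D x q" using y(1) unfolding tangent_lattice_def by blast
qed

text \<open>If vectors of length at most \<open>R\<close> span the tangent lattice, Hadamard's
  inequality gives \<open>p ^ k \<le> R\<close>; so large exponents fail and there is a least
  failing one. At the exponent before it the minima are at most \<open>T\<close>, by minimality or
  because that lattice is \<open>M\<close>, which yields both the bound for the new minima and the
  one for the modulus.\<close>

lemma first_unspanned_exponent:
  fixes M :: "(int ^ 'n::finite) set"
  assumes M: "integer_lattice M" and r: "lattice_rank M \<ge> 1" and sp: "short_spanned M T" and R: "1 \<le> R" "R \<le> T"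
    and D: "form_gradient E G D" and x: "x \<in> M" "G x = 0" and xp: "\<nexists>t. t \<in> M \<and> x = p *s t"
    and p: "prime p" and z: "z \<in> M" "\<not> p dvd D x z"
  shows "\<exists>k\<ge>1. 2 ^ k \<le> 2 * R \<and> \<not> short_spanned (tangent_lattice M D x (p ^ k)) R \<and>
    short_spanned (tangent_lattice M D x (p ^ k)) (of_int (p ^ 2) * T) \<and>
    of_int (p ^ k) ^ lattice_rank M * lattice_det M \<le> (of_int p * T) ^ lattice_rank M"
proof -
  have Ms: "int_submodule M" using M by (rule lattice_submodule)
  define N where "N k = tangent_lattice M D x (p ^ k)" for k
  define r where "r = lattice_rank M"
  have r1: "r \<ge> 1" using r by (simp add: r_def)
  have N: "integer_lattice (N k)" "lattice_rank (N k) = r" "lattice_det (N k) = of_int (p ^ k) ^ r * lattice_det M" for k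
    unfolding N_def r_def by (rule tangent_lattice_det[OF M D x xp p refl z])+
  have det1: "1 \<le> lattice_det M" using M by (rule lattice_det_ge_1)
  have p2: "p \<ge> 2" using p by (rule prime_ge_2_int)
  have le: "2 ^ k \<le> R" if "short_spanned (N k) R" for k
  proof -
    have "of_int (p ^ k) ^ r * 1 \<le> of_int (p ^ k) ^ r * lattice_det M"
      using det1 p2 by (intro mult_left_mono) auto
    also have "\<dots> \<le> R ^ r" using lattice_det_le_power[OF N(1) that] R N(2,3) by simp
    finally have "of_int (p ^ k) ^ r \<le> R ^ r" by simp
    then have "(of_int (p ^ k) :: real) \<le> R" using R r1 p2 by (subst (asm) power_mono_iff) auto
    moreover have "(2 :: real) ^ k \<le> of_int p ^ k" using p2 by (intro power_mono) auto
    ultimately show ?thesis by simp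
  qed
  \<comment> \<open>Exponent \<open>0\<close> is excluded explicitly. The minima of \<open>M\<close>
    are bounded by \<open>T\<close> only, so \<open>M\<close> may already fail to be spanned by
    vectors of length at most \<open>R\<close>, and a step must have a nontrivial modulus.\<close>
  define Q where "Q k \<longleftrightarrow> k \<ge> 1 \<and> \<not> short_spanned (N k) R" for k
  obtain k0 :: nat where "R < 2 ^ k0" using real_arch_pow[of 2 R] by auto
  moreover have "(2 :: real) ^ k0 \<le> 2 ^ Suc k0" by simp
  ultimately have "R < 2 ^ Suc k0" by linarith
  then have "Q (Suc k0)" using le[of "Suc k0"] by (auto simp: Q_def)
  define k where "k = (LEAST k. Q k)"
  have Qk: "Q k" unfolding k_def using \<open>Q (Suc k0)\<close> by (rule LeastI)
  then obtain k' where k': "k = Suc k'" by (cases k) (auto simp: Q_def)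
  have "\<not> Q k'" using not_less_Least[of k' Q] k' by (simp add: k_def)
  then have c: "k' = 0 \<or> short_spanned (N k') R" by (auto simp: Q_def)
  have "2 ^ k' \<le> R" using c le R by auto
  have N0: "N 0 = M" using Ms by (simp add: N_def tangent_lattice_1)
  have spT: "short_spanned (N k') T" using c sp N0 R(2) short_spanned_mono by auto
  have "short_spanned (N k) (of_int (p ^ 2) * T)"
  proof (rule short_spanned_multiple[OF spT])
    show "N k \<subseteq> N k'" unfolding N_def k' using tangent_lattice_antimono[OF Ms, of D x p "p ^ k'"] by simp
    show "p ^ 2 *s y \<in> N k" if "y \<in> N k'" for y
      using tangent_lattice_descent[OF Ms D, of y x "p ^ k'" p] that by (simp add: N_def k')
    show "p ^ 2 > 0" using p2 by simp
  qed
  moreover have "of_int (p ^ k') ^ r * lattice_det M \<le> T ^ r"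
    using lattice_det_le_power[OF N(1) spT] R N(2,3) by simp
  then have "of_int p ^ r * (of_int (p ^ k') ^ r * lattice_det M) \<le> of_int p ^ r * T ^ r"
    using p2 by (intro mult_left_mono) auto
  then have "of_int (p ^ k) ^ r * lattice_det M \<le> (of_int p * T) ^ r"
    by (simp add: k' power_mult_distrib mult.assoc)
  ultimately show ?thesis using \<open>2 ^ k' \<le> R\<close> Qk k' by (intro exI[of _ k]) (auto simp: Q_def N_def r_def)
qed

text \<open>What later steps retain of a tangent lattice and its sublattice \<open>N\<close>. The
  congruences refer to every point of \<open>S\<close> in \<open>N\<close>, so the base point can be
  forgotten. Of the three numerical clauses the first bounds the determinant of \<open>N\<close>
  from below and feeds the count, the second bounds it from above as the final statement asks, and
  the third bounds the modulus.\<close>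

definition descent_step ::
    "real \<Rightarrow> real \<Rightarrow> (int ^ ('n::finite)) set \<Rightarrow> (int ^ 'n) set \<Rightarrow> nat \<Rightarrow> nat \<Rightarrow> (int ^ 'n) set \<Rightarrow> bool" where
  "descent_step R T M S p k N \<longleftrightarrow> integer_lattice N \<and> N \<subseteq> M \<and> lattice_rank N + 1 = lattice_rank M \<and>
     short_spanned N (real p ^ 2 * T) \<and> S \<inter> N \<noteq> {} \<and>
     (\<forall>x\<in>S \<inter> N. \<forall>y\<in>N. \<exists>\<rho>. \<forall>l. [y $ l = \<rho> * x $ l] (mod int (p ^ k))) \<and>
     real (p ^ k) ^ lattice_rank M * lattice_det M \<le> real p ^ 2 * T * lattice_det N \<and>
     minkowski_const CARD('n) * R * lattice_det N \<le> real (p ^ k) ^ lattice_rank M * lattice_det M \<and>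
     real (p ^ k) ^ lattice_rank M * lattice_det M \<le> (real p * T) ^ lattice_rank M"

lemma descent_stepD:
  fixes M :: "(int ^ 'n::finite) set"
  assumes "descent_step R T M S p k N"
  shows "integer_lattice N" "N \<subseteq> M" "lattice_rank N + 1 = lattice_rank M"
    "short_spanned N (real p ^ 2 * T)" "S \<inter> N \<noteq> {}"
    "x \<in> S \<inter> N \<Longrightarrow> y \<in> N \<Longrightarrow> \<exists>\<rho>. \<forall>l. [y $ l = \<rho> * x $ l] (mod int (p ^ k))"
    "real (p ^ k) ^ lattice_rank M * lattice_det M \<le> real p ^ 2 * T * lattice_det N"
    "minkowski_const CARD('n) * R * lattice_det N \<le> real (p ^ k) ^ lattice_rank M * lattice_det M"
    "real (p ^ k) ^ lattice_rank M * lattice_det M \<le> (real p * T) ^ lattice_rank M"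
  using assms by (simp_all add: descent_step_def)

text \<open>In a primitive vector of the tangent lattice the coefficient of \<open>x0\<close> is
  prime to \<open>p\<close>. It is invertible modulo \<open>q\<close>, so the vector can take over
  the role of \<open>x0\<close>.\<close>

lemma tangent_lattice_proportional:
  fixes M :: "(int ^ 'n::finite) set"
  assumes p: "prime p" "q = p ^ k" "k \<ge> 1" and x: "x \<in> tangent_lattice M D x0 q" "(GCD i. x $ i) = 1"
    and y: "y \<in> tangent_lattice M D x0 q"
  shows "\<exists>\<rho>. \<forall>l. [y $ l = \<rho> * x $ l] (mod q)"
proof -
  obtain a t where xa: "x = a *s x0 + q *s t" using x(1) by (auto simp: tangent_lattice_def)
  obtain c u where yc: "y = c *s x0 + q *s u" using y by (auto simp: tangent_lattice_def)
  have "\<not> p dvd a"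
  proof
    assume "p dvd a"
    then have "p dvd x $ i" for i using p by (simp add: xa)
    then show False using primitive_not_dvd[OF x(2) p(1)] by blast
  qed
  then have "coprime p a" by (rule prime_imp_coprime[OF p(1)])
  then have "coprime a q" unfolding p(2) by (simp add: coprime_commute)
  then obtain a' where a': "[a * a' = 1] (mod q)" using cong_solve_coprime_int by blast
  have "[y $ l = (c * a') * x $ l] (mod q)" for l
  proof -
    have "q dvd 1 - a * a'" using a' by (simp add: cong_iff_dvd_diff dvd_diff_commute)
    then have "q dvd c * x0 $ l * (1 - a * a') + q * (u $ l - c * a' * t $ l)"
      by (rule dvd_add[OF dvd_mult dvd_triv_left])
    moreover have "c * x0 $ l * (1 - a * a') + q * (u $ l - c * a' * t $ l) = y $ l - (c * a') * x $ l"
      by (simp add: xa yc algebra_simps)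
    ultimately show ?thesis by (simp add: cong_iff_dvd_diff)
  qed
  then show ?thesis by blast
qed

lemma descent_step_exists:
  fixes M :: "(int ^ 'n::finite) set"
  assumes M: "integer_lattice M" and sp: "short_spanned M T" and R: "1 \<le> R" "R \<le> T" and r: "lattice_rank M \<ge> 1"
    and D: "form_gradient E G D" and S: "\<And>x. x \<in> S \<Longrightarrow> (GCD i. x $ i) = 1"
    and x: "x \<in> M" "G x = 0" "x \<in> S" "euclidean_length x \<le> R"
    and p: "prime p" and z: "z \<in> M" "\<not> int p dvd D x z"
  shows "\<exists>k\<ge>1. 2 ^ k \<le> 2 * R \<and> (\<exists>N. descent_step R T M S p k N \<and>
    {y \<in> tangent_lattice M D x (int p ^ k). euclidean_length y \<le> R} \<subseteq> N)"
proof -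
  have pi: "prime (int p)" using p by simp
  have xp: "\<nexists>t. t \<in> M \<and> x = int p *s t" using primitive_not_multiple[OF S[OF x(3)] pi] by blast
  obtain k where k: "k \<ge> 1" "2 ^ k \<le> 2 * R" "\<not> short_spanned (tangent_lattice M D x (int p ^ k)) R"
    "short_spanned (tangent_lattice M D x (int p ^ k)) (of_int (int p ^ 2) * T)"
    "of_int (int p ^ k) ^ lattice_rank M * lattice_det M \<le> (of_int (int p) * T) ^ lattice_rank M"
    using first_unspanned_exponent[OF M r sp R D x(1,2) xp pi z] by blast
  define L where "L = tangent_lattice M D x (int p ^ k)"
  have L: "integer_lattice L" "lattice_rank L = lattice_rank M"
    "lattice_det L = of_int (int p ^ k) ^ lattice_rank M * lattice_det M"
    unfolding L_def by (rule tangent_lattice_det[OF M D x(1,2) xp pi refl z])+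
  obtain \<tau> N where N: "R < \<tau>" "\<tau> \<le> of_int (int p ^ 2) * T" "1 \<le> \<tau>" "integer_lattice N" "N \<subseteq> L" "lattice_rank N + 1 = lattice_rank L"
    "short_spanned N \<tau>" "{x \<in> L. euclidean_length x \<le> R} \<subseteq> N"
    "minkowski_const CARD('n) * \<tau> * lattice_det N \<le> lattice_det L" "lattice_det L \<le> \<tau> * lattice_det N"
    by (rule last_minimum_sublattice[OF L(1) k(4)[folded L_def] k(3)[folded L_def]]) (use R in simp)
  have detN: "1 \<le> lattice_det N" using N(4) by (rule lattice_det_ge_1)
  have Ms: "int_submodule M" using M by (rule lattice_submodule)
  have xL: "x \<in> L"
  proof -
    have "x = 1 *s x + (int p ^ k) *s 0" by simp
    moreover have "0 \<in> M" using Ms by (rule int_submoduleD)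
    moreover have "D x x = 0" using D x(2) by (simp add: form_gradient_def)
    ultimately have "\<exists>\<rho>. \<exists>t\<in>M. x = \<rho> *s x + int p ^ k *s t" by (intro exI[of _ 1] bexI[of _ 0]) auto
    then show ?thesis using x(1) \<open>D x x = 0\<close> unfolding L_def tangent_lattice_def by simp
  qed
  have "descent_step R T M S p k N"
    unfolding descent_step_def
  proof (intro conjI ballI)
    show "integer_lattice N" by fact
    show "N \<subseteq> M" using N(5) tangent_lattice_subset[of M D x "int p ^ k"] unfolding L_def by (rule order_trans)
    show "lattice_rank N + 1 = lattice_rank M" using N(6) L(2) by simp
    show "short_spanned N (real p ^ 2 * T)" using N(7) by (rule short_spanned_mono) (use N(2) in simp)
    show "S \<inter> N \<noteq> {}" using xL x(3,4) N(8) by auto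
    show "\<exists>\<rho>. \<forall>l. [y $ l = \<rho> * x' $ l] (mod int (p ^ k))" if "x' \<in> S \<inter> N" "y \<in> N" for x' y
      using that N(5) tangent_lattice_proportional[OF pi refl k(1), of x' M D x y] S[of x'] by (auto simp: L_def)
    have "\<tau> * lattice_det N \<le> real p ^ 2 * T * lattice_det N" using N(2) detN by (intro mult_right_mono) auto
    then show "real (p ^ k) ^ lattice_rank M * lattice_det M \<le> real p ^ 2 * T * lattice_det N"
      using N(10) by (simp add: L(3))
    have "minkowski_const CARD('n) * R * lattice_det N \<le> minkowski_const CARD('n) * \<tau> * lattice_det N"
      using N(1) detN by (intro mult_right_mono mult_left_mono) (auto simp: minkowski_const_def)
    then show "minkowski_const CARD('n) * R * lattice_det N \<le> real (p ^ k) ^ lattice_rank M * lattice_det M"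
      using N(9) by (simp add: L(3))
    show "real (p ^ k) ^ lattice_rank M * lattice_det M \<le> (real p * T) ^ lattice_rank M"
      using k(5) by simp
  qed
  then show ?thesis using k(1,2) N(8) by (auto simp: L_def)
qed

text \<open>Points are grouped by their own exponent. A point and its representative share
  \<open>p\<close> and \<open>k\<close>, so the sublattice chosen for the representative
  \<open>y\<close> contains all short vectors of the tangent lattice at \<open>y\<close>, the given
  point among them. Hence there are at most as many sublattices as representatives.\<close>

lemma descent_step_family:
  fixes M :: "(int ^ 'n::finite) set"
  assumes M: "integer_lattice M" and hG: "hform E H G" and D: "form_gradient E G D" and E: "E \<ge> 1"
    and S: "\<And>x. x \<in> S \<Longrightarrow> x \<in> M \<and> (GCD i. x $ i) = 1 \<and> euclidean_length x \<le> R"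
    and p: "prime p" and k: "k \<ge> 1" and z: "z \<in> M"
  shows "\<exists>\<N>. finite \<N> \<and> card \<N> \<le> lattice_rank M ^ 2 * ((p ^ k) ^ (lattice_rank M - 2) * E) \<and>
    (\<forall>N\<in>\<N>. descent_step R T M S p k N) \<and>
    (\<forall>x\<in>S. G x = 0 \<and> \<not> int p dvd D x z \<and>
      (\<exists>N. descent_step R T M S p k N \<and> {y \<in> tangent_lattice M D x (int p ^ k). euclidean_length y \<le> R} \<subseteq> N) \<longrightarrow>
      x \<in> \<Union>\<N>)"
proof -
  have pi: "prime (int p)" using p by simp
  define W where "W x N \<longleftrightarrow> descent_step R T M S p k N \<and>
    {y \<in> tangent_lattice M D x (int p ^ k). euclidean_length y \<le> R} \<subseteq> N" for x N
  define X where "X = {x \<in> S. G x = 0 \<and> \<not> int p dvd D x z \<and> (\<exists>N. W x N)}"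
  have X: "x \<in> M \<and> G x = 0 \<and> \<not> int p dvd D x z \<and> (\<nexists>t. t \<in> M \<and> x = int p *s t)" if "x \<in> X" for x
    using that S[of x] primitive_not_multiple[OF _ pi, of x] by (auto simp: X_def)
  obtain Y where Y: "Y \<subseteq> X" "finite Y" "card Y \<le> lattice_rank M ^ 2 * (nat (int p ^ k) ^ (lattice_rank M - 2) * E)"
    "\<forall>x\<in>X. \<exists>y\<in>Y. x \<in> tangent_lattice M D y (int p ^ k)"
    using tangent_lattice_cover[OF M hG D E pi refl k z X] by blast
  define g where "g x = (SOME N. W x N)" for x
  have g: "W x (g x)" if "x \<in> X" for x
    unfolding g_def by (rule someI_ex) (use that in \<open>simp add: X_def\<close>)
  have "nat (int p ^ k) = p ^ k" by (simp add: nat_power_eq)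
  then have "card (g ` Y) \<le> lattice_rank M ^ 2 * ((p ^ k) ^ (lattice_rank M - 2) * E)"
    using Y(3) card_image_le[OF Y(2), of g] by simp
  moreover have "\<forall>N\<in>g ` Y. descent_step R T M S p k N" using g Y(1) by (auto simp: W_def)
  moreover have cov: "x \<in> \<Union>(g ` Y)" if x: "x \<in> X" for x
  proof -
    obtain y where y: "y \<in> Y" "x \<in> tangent_lattice M D y (int p ^ k)" using Y(4) x by blast
    have "W y (g y)" using g y(1) Y(1) by blast
    moreover have "euclidean_length x \<le> R" using x S by (auto simp: X_def)
    ultimately have "x \<in> g y" using y(2) unfolding W_def by blast
    then show ?thesis using y(1) by blast
  qed
  moreover have "finite (g ` Y)" using Y(2) by simp
  moreover have "\<forall>x\<in>S. G x = 0 \<and> \<not> int p dvd D x z \<and> (\<exists>N. W x N) \<longrightarrow> x \<in> \<Union>(g ` Y)"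
    using cov unfolding X_def by simp
  ultimately show ?thesis unfolding W_def by (intro exI[of _ "g ` Y"] conjI)
qed

text \<open>Each point selects an order of vanishing, then a prime, then an exponent. One factor
  \<open>d\<close> counts the orders, the other bounds the degrees of the forms; the sums over
  primes and exponents are left to the final count.\<close>

lemma descent_families:
  fixes M :: "(int ^ 'n::finite) set" and f :: "int ^ 'n \<Rightarrow> int"
  assumes f: "hform d H f" and M: "integer_lattice M" and r: "lattice_rank M \<ge> 1"
    and sp: "short_spanned M T" and R: "1 \<le> R" "R \<le> T" and y: "y \<in> M" "f y \<noteq> 0" "\<forall>i. \<bar>y $ i\<bar> \<le> Y"
    and S: "\<And>x. x \<in> S \<Longrightarrow> x \<in> M \<and> f x = 0 \<and> (GCD i. x $ i) = 1 \<and> euclidean_length x \<le> R \<and> (\<forall>i. \<bar>x $ i\<bar> \<le> X)"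
    and P: "\<And>p. p \<in> P \<Longrightarrow> prime p"
      "\<And>a. a \<noteq> 0 \<Longrightarrow> \<bar>a\<bar> \<le> int d * (H * (X + Y) ^ d) \<Longrightarrow> \<exists>p\<in>P. \<not> int p dvd a"
  shows "\<exists>\<N>. (\<forall>p\<in>P. \<forall>k\<in>{k. k \<ge> 1 \<and> 2 ^ k \<le> 2 * R}. finite (\<N> p k) \<and>
      card (\<N> p k) \<le> d * (lattice_rank M ^ 2 * ((p ^ k) ^ (lattice_rank M - 2) * d)) \<and>
      (\<forall>N\<in>\<N> p k. descent_step R T M S p k N)) \<and>
    S \<subseteq> (\<Union>p\<in>P. \<Union>k\<in>{k. k \<ge> 1 \<and> 2 ^ k \<le> 2 * R}. \<Union>(\<N> p k))"
proof -
  obtain G D where GD: "\<And>e. e \<in> {1..d} \<Longrightarrow> \<exists>K. hform (d - (e - 1)) K (G e)"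
    "\<And>e. e \<in> {1..d} \<Longrightarrow> form_gradient (d - (e - 1)) (G e) (D e)"
    "\<And>x X Y. f x = 0 \<Longrightarrow> \<forall>i. \<bar>x $ i\<bar> \<le> X \<Longrightarrow> \<forall>i. \<bar>y $ i\<bar> \<le> Y \<Longrightarrow>
      \<exists>e\<in>{1..d}. G e x = 0 \<and> D e x y \<noteq> 0 \<and> \<bar>D e x y\<bar> \<le> int d * (H * (X + Y) ^ d)"
    by (rule directional_coefficient_forms[OF f y(2)]) (rule that, (assumption | blast)+)
  have S': "x \<in> M \<and> (GCD i. x $ i) = 1 \<and> euclidean_length x \<le> R" if "x \<in> S" for x using S[OF that] by simp
  have S'': "(GCD i. x $ i) = 1" if "x \<in> S" for x using S[OF that] by simp
  define r where "r = lattice_rank M"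
  define K where "K = {k :: nat. k \<ge> 1 \<and> 2 ^ k \<le> 2 * R}"
  define W where "W e x p k \<longleftrightarrow> G e x = 0 \<and> \<not> int p dvd D e x y \<and> (\<exists>N. descent_step R T M S p k N \<and>
      {z \<in> tangent_lattice M (D e) x (int p ^ k). euclidean_length z \<le> R} \<subseteq> N)" for e x p k
  define Fam where "Fam p k \<N> \<longleftrightarrow> finite \<N> \<and> card \<N> \<le> d * (r ^ 2 * ((p ^ k) ^ (r - 2) * d)) \<and>
    (\<forall>N\<in>\<N>. descent_step R T M S p k N) \<and> (\<forall>x\<in>S. \<forall>e\<in>{1..d}. W e x p k \<longrightarrow> x \<in> \<Union>\<N>)" for p k \<N>
  have ex: "\<exists>\<N>. Fam p k \<N>" if pk: "p \<in> P" "k \<in> K" for p k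
  proof -
    have p: "prime p" and k: "k \<ge> 1" using pk P(1) by (auto simp: K_def)
    define Fe where "Fe e \<N> \<longleftrightarrow> finite \<N> \<and> card \<N> \<le> r ^ 2 * ((p ^ k) ^ (r - 2) * d) \<and>
      (\<forall>N\<in>\<N>. descent_step R T M S p k N) \<and> (\<forall>x\<in>S. W e x p k \<longrightarrow> x \<in> \<Union>\<N>)" for e \<N>
    have "\<exists>\<N>. Fe e \<N>" if e: "e \<in> {1..d}" for e
    proof -
      obtain H' where H': "hform (d - (e - 1)) H' (G e)" using GD(1)[OF e] by blast
      have E1: "d - (e - 1) \<ge> 1" using e by auto
      have "\<exists>\<N>. finite \<N> \<and> card \<N> \<le> r ^ 2 * ((p ^ k) ^ (r - 2) * (d - (e - 1))) \<and>
        (\<forall>N\<in>\<N>. descent_step R T M S p k N) \<and> (\<forall>x\<in>S. W e x p k \<longrightarrow> x \<in> \<Union>\<N>)"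
        unfolding W_def r_def by (rule descent_step_family[OF M H' GD(2)[OF e] E1 S' p k y(1)])
      then obtain \<N> where \<N>: "finite \<N>" "card \<N> \<le> r ^ 2 * ((p ^ k) ^ (r - 2) * (d - (e - 1)))"
        "\<forall>N\<in>\<N>. descent_step R T M S p k N" "\<forall>x\<in>S. W e x p k \<longrightarrow> x \<in> \<Union>\<N>"
        by (elim exE conjE) (rule that)
      have "r ^ 2 * ((p ^ k) ^ (r - 2) * (d - (e - 1))) \<le> r ^ 2 * ((p ^ k) ^ (r - 2) * d)" by simp
      then have "card \<N> \<le> r ^ 2 * ((p ^ k) ^ (r - 2) * d)" using \<N>(2) by (rule order_trans[rotated])
      then show ?thesis using \<N>(1,3,4) unfolding Fe_def by (intro exI[of _ \<N>] conjI)
    qed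
    then obtain \<F> where \<F>: "\<forall>e\<in>{1..d}. Fe e (\<F> e)" using bchoice[of "{1..d}" Fe] by blast
    have "card (\<Union>e\<in>{1..d}. \<F> e) \<le> (\<Sum>e\<in>{1..d}. card (\<F> e))" by (intro card_UN_le) auto
    also have "\<dots> \<le> (\<Sum>e\<in>{1..d}. r ^ 2 * ((p ^ k) ^ (r - 2) * d))"
      using \<F> by (intro sum_mono) (simp add: Fe_def)
    finally have "card (\<Union>e\<in>{1..d}. \<F> e) \<le> d * (r ^ 2 * ((p ^ k) ^ (r - 2) * d))" by simp
    moreover have "finite (\<Union>e\<in>{1..d}. \<F> e)" using \<F> by (simp add: Fe_def)
    moreover have "\<forall>N\<in>(\<Union>e\<in>{1..d}. \<F> e). descent_step R T M S p k N"
      using \<F> unfolding Fe_def by (intro ballI) (elim UN_E, simp)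
    moreover have "x \<in> \<Union>(\<Union>e\<in>{1..d}. \<F> e)" if "x \<in> S" "e \<in> {1..d}" "W e x p k" for x e
    proof -
      have "x \<in> \<Union>(\<F> e)" using \<F> that unfolding Fe_def by simp
      then show ?thesis using that(2) by blast
    qed
    ultimately have "Fam p k (\<Union>e\<in>{1..d}. \<F> e)" unfolding Fam_def by simp
    then show ?thesis by blast
  qed
  define \<N> where "\<N> p k = (SOME \<N>. Fam p k \<N>)" for p k
  have \<N>: "Fam p k (\<N> p k)" if "p \<in> P" "k \<in> K" for p k
    unfolding \<N>_def by (rule someI_ex[OF ex[OF that]])
  have "\<exists>p\<in>P. \<exists>k\<in>K. x \<in> \<Union>(\<N> p k)" if xS: "x \<in> S" for x
  proof -
    note x = S[OF xS]
    obtain e where e: "e \<in> {1..d}" "G e x = 0" "D e x y \<noteq> 0" "\<bar>D e x y\<bar> \<le> int d * (H * (X + Y) ^ d)"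
    proof -
      have "f x = 0" "\<forall>i. \<bar>x $ i\<bar> \<le> X" using x by auto
      from GD(3)[OF this y(3)] show thesis using that by blast
    qed
    obtain p where p: "p \<in> P" "\<not> int p dvd D e x y" using P(2)[OF e(3,4)] by blast
    have "\<exists>k\<ge>1. 2 ^ k \<le> 2 * R \<and> (\<exists>N. descent_step R T M S p k N \<and>
        {z \<in> tangent_lattice M (D e) x (int p ^ k). euclidean_length z \<le> R} \<subseteq> N)"
    proof (rule descent_step_exists[OF M sp R r GD(2)[OF e(1)] S'' _ e(2) xS _ P(1)[OF p(1)] y(1) p(2)])
      show "x \<in> M" "euclidean_length x \<le> R" using x by auto
    qed
    then obtain k where "k \<in> K" "W e x p k" using e(2) p(2) unfolding K_def W_def by blast
    moreover from this have "\<forall>x\<in>S. \<forall>e\<in>{1..d}. W e x p k \<longrightarrow> x \<in> \<Union>(\<N> p k)"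
      using \<N>[OF p(1)] unfolding Fam_def by simp
    ultimately show ?thesis using p(1) e(1) xS by blast
  qed
  then have "S \<subseteq> (\<Union>p\<in>P. \<Union>k\<in>K. \<Union>(\<N> p k))" by blast
  moreover have "\<forall>p\<in>P. \<forall>k\<in>K. finite (\<N> p k) \<and> card (\<N> p k) \<le> d * (r ^ 2 * ((p ^ k) ^ (r - 2) * d)) \<and>
      (\<forall>N\<in>\<N> p k. descent_step R T M S p k N)" using \<N> unfolding Fam_def by simp
  ultimately show ?thesis unfolding K_def r_def by (intro exI[of _ \<N>] conjI)
qed

section \<open>The descent\<close>

lemma euclidean_length_le_of_bounded:
  fixes x :: "int ^ 'n::finite"
  assumes "\<And>i. of_int \<bar>x $ i\<bar> \<le> B"
  shows "euclidean_length x \<le> sqrt (real CARD('n)) * B"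
proof -
  have B: "B \<ge> 0" using assms[of undefined] by (smt (verit) of_int_0_le_iff abs_ge_zero)
  have "(\<Sum>i\<in>UNIV. (norm (rv x $ i))\<^sup>2) \<le> (\<Sum>i\<in>(UNIV :: 'n set). B\<^sup>2)"
    using assms by (intro sum_mono power_mono) (auto simp: of_int_vec_def)
  then have "sqrt (\<Sum>i\<in>UNIV. (norm (rv x $ i))\<^sup>2) \<le> sqrt (real CARD('n) * B\<^sup>2)" by simp
  also have "\<dots> = sqrt (real CARD('n)) * B" using B by (simp add: real_sqrt_mult)
  finally show ?thesis by (simp add: euclidean_length_def norm_vec_def L2_set_def)
qed

text \<open>A weighted geometric mean: the power \<open>r - 1\<close> of the claim is the power
  \<open>r - 3\<close> of the first inequality times the square of the second.\<close>

lemma descent_inequality: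
  fixes \<xi> \<zeta> q Z :: real
  assumes r: "r \<ge> 3" and pos: "\<xi> > 0" "\<zeta> \<ge> 0" "q > 0" "Z > 0"
    and 1: "\<zeta> ^ (r - 1) * q ^ r \<le> Z * \<xi> ^ r" and 2: "q \<le> Z * \<xi>"
  shows "q ^ (r - 2) * \<zeta> ^ (r - 3) \<le> Z * \<xi> ^ (r - 2)"
proof -
  obtain s where s: "r = s + 3" using r le_Suc_ex by (metis add.commute)
  have e1: "(a ^ (s + 1) * b ^ s) ^ (s + 2) = (b ^ (s + 2) * a ^ (s + 3)) ^ s * a\<^sup>2" for a b :: real
  proof -
    have "(a ^ (s + 1) * b ^ s) ^ (s + 2) = a ^ ((s + 1) * (s + 2)) * b ^ (s * (s + 2))"
      by (simp only: power_mult_distrib power_mult)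
    moreover have "(b ^ (s + 2) * a ^ (s + 3)) ^ s * a\<^sup>2 = b ^ ((s + 2) * s) * a ^ ((s + 3) * s + 2)"
      by (simp only: power_mult_distrib power_mult power_add mult.assoc)
    moreover have "(s + 1) * (s + 2) = (s + 3) * s + 2" by (simp add: algebra_simps)
    ultimately show ?thesis by (simp only: mult.commute)
  qed
  have "(q ^ (s + 1) * \<zeta> ^ s) ^ (s + 2) = (\<zeta> ^ (s + 2) * q ^ (s + 3)) ^ s * q\<^sup>2" by (rule e1)
  also have "\<dots> \<le> (Z * \<xi> ^ (s + 3)) ^ s * (Z * \<xi>)\<^sup>2"
    using 1 2 pos by (intro mult_mono[OF power_mono power_mono]) (auto simp: s)
  also have "\<dots> = Z ^ (s + 2) * ((1 :: real) ^ (s + 2) * \<xi> ^ (s + 3)) ^ s * \<xi>\<^sup>2"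
    by (simp add: power_mult_distrib power_add power2_eq_square)
  also have "\<dots> = Z ^ (s + 2) * (\<xi> ^ (s + 1) * 1 ^ s) ^ (s + 2)" by (simp only: e1 mult.assoc)
  also have "\<dots> = (Z * \<xi> ^ (s + 1)) ^ (s + 2)" by (simp only: power_mult_distrib power_one mult_1_right)
  finally have "(q ^ (s + 1) * \<zeta> ^ s) ^ Suc (s + 1) \<le> (Z * \<xi> ^ (s + 1)) ^ Suc (s + 1)" by simp
  then have "q ^ (s + 1) * \<zeta> ^ s \<le> Z * \<xi> ^ (s + 1)"
    by (rule power_le_imp_le_base) (use pos in auto)
  then show ?thesis by (simp add: s)
qed

text \<open>\<open>P\<close> is the common scale for everything of logarithmic size: it bounds the
  primes, hence their number, and the number of exponents. In the last assumption \<open>a\<close>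
  stands for a derivative; the power \<open>P ^ (2 * CARD('n))\<close> leaves room for the growth of
  the minima over all steps.\<close>

locale descent =
  fixes \<Lambda> :: "(int ^ 'n::finite) set" and m d p0 :: nat and f :: "int ^ 'n \<Rightarrow> int" and H :: int and B P :: real
  assumes lattice: "integer_lattice \<Lambda>" and rank: "lattice_rank \<Lambda> = m" and form: "hform d H f"
    and B: "1 \<le> B" and P: "1 \<le> P" and p0: "CARD('n) < p0"
    and exponents: "\<And>k. 2 ^ k \<le> 2 * (sqrt (real CARD('n)) * B) \<Longrightarrow> real k \<le> P"
    and primes: "\<And>r a. 2 \<le> r \<Longrightarrow> r \<le> m \<Longrightarrow> a \<noteq> 0 \<Longrightarrow>
      \<bar>a\<bar> \<le> int d * (H * (\<lfloor>B\<rfloor> + \<lfloor>real CARD('n) * real d * (sqrt (real CARD('n)) * B * P ^ (2 * CARD('n)))\<rfloor>) ^ d) \<Longrightarrow>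
      \<exists>p. prime p \<and> real p \<le> P \<and> [p = r] (mod p0) \<and> \<not> int p dvd a"
begin

definition R :: real where "R = sqrt (real CARD('n)) * B"

definition S :: "(int ^ 'n) set" where
  "S = {x \<in> \<Lambda>. (GCD i. x $ i) = 1 \<and> f x = 0 \<and> (\<forall>i. of_int \<bar>x $ i\<bar> \<le> B)}"

text \<open>The congruence is asked for with respect to every point of \<open>S\<close> in
  \<open>M\<close>. A single fixed vector could be lost in a later sublattice, and then the moduli
  of different steps would not refer to a common vector.\<close>

definition local_conditions :: "(int ^ 'n) set \<Rightarrow> nat \<Rightarrow> (nat \<Rightarrow> nat) \<Rightarrow> bool" where
  "local_conditions M h q \<longleftrightarrow>
     (\<forall>i\<in>{1..h}. q i > 0 \<and> (\<exists>p k. prime p \<and> k \<ge> 1 \<and> q i = p ^ k \<and> [p = m + 1 - i] (mod p0))) \<and>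
     (\<forall>x\<in>S \<inter> M. \<forall>y\<in>M. \<exists>\<rho>. \<forall>l. [y $ l = \<rho> * x $ l] (mod int (\<Prod>i=1..h. q i))) \<and>
     lattice_det M \<le> (1 / minkowski_const CARD('n)) ^ h * (lattice_det \<Lambda> * (\<Prod>i=1..h. real (q i) ^ (m - (i - 1)) / B))"

text \<open>The rank records how many steps have been made; each costs a factor \<open>P ^ 2\<close>
  in the minima. The point of \<open>S\<close> in \<open>M\<close> becomes the vector
  \<open>w\<close> of the final statement.\<close>

definition admissible :: "(int ^ 'n) set \<Rightarrow> bool" where
  "admissible M \<longleftrightarrow> integer_lattice M \<and> M \<subseteq> \<Lambda> \<and> 1 \<le> lattice_rank M \<and> lattice_rank M \<le> m \<and>
     short_spanned M (R * P ^ (2 * (m - lattice_rank M))) \<and> S \<inter> M \<noteq> {} \<and>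
     (\<exists>q. local_conditions M (m - lattice_rank M) q)"

lemma admissibleD:
  assumes "admissible M"
  shows "integer_lattice M" "M \<subseteq> \<Lambda>" "1 \<le> lattice_rank M" "lattice_rank M \<le> m"
    "short_spanned M (R * P ^ (2 * (m - lattice_rank M)))" "S \<inter> M \<noteq> {}"
    "\<exists>q. local_conditions M (m - lattice_rank M) q"
  using assms by (simp_all add: admissible_def)

lemma R_ge: "B \<le> R" "1 \<le> R"
proof -
  have "1 * B \<le> sqrt (real CARD('n)) * B" using B by (intro mult_right_mono) auto
  then show "B \<le> R" by (simp add: R_def)
  then show "1 \<le> R" using B by simp
qed

lemma rank_le: "m \<le> CARD('n)"
  using dim_subset_UNIV[of "rv ` \<Lambda>"] rank by (simp add: lattice_rank_def)

lemma short_S: "x \<in> S \<Longrightarrow> euclidean_length x \<le> R"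
  unfolding R_def S_def by (intro euclidean_length_le_of_bounded) auto

text \<open>The multipliers for the old moduli and for the new one are merged by the Chinese
  remainder theorem, which works because both congruences refer to the same point. In the
  determinant, \<open>B \<le> R\<close> turns the length \<open>R\<close> of the step into the
  \<open>B\<close> of the statement.\<close>

lemma local_conditions_step:
  assumes q: "local_conditions M h q" and h: "h + 1 < m" "lattice_rank M = m - h"
    and p: "prime p" "[p = m - h] (mod p0)" and k: "k \<ge> 1" and N: "descent_step R T M (S \<inter> M) p k N"
  shows "local_conditions N (h + 1) (q(h + 1 := p ^ k))"
proof -
  define q' where "q' = q(h + 1 := p ^ k)"
  note N = descent_stepD[OF N]
  have "(\<Prod>i=1..h. g (q' i) i) = (\<Prod>i=1..h. g (q i) i)" for g :: "nat \<Rightarrow> nat \<Rightarrow> 'z::comm_monoid_mult"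
    by (intro prod.cong) (auto simp: q'_def)
  then have prod': "(\<Prod>i=1..h + 1. g (q' i) i) = (\<Prod>i=1..h. g (q i) i) * g (p ^ k) (h + 1)"
    for g :: "nat \<Rightarrow> nat \<Rightarrow> 'z::comm_monoid_mult"
    by (simp add: q'_def)
  have q1: "\<And>i. i \<in> {1..h} \<Longrightarrow> q i > 0 \<and> (\<exists>p k. prime p \<and> k \<ge> 1 \<and> q i = p ^ k \<and> [p = m + 1 - i] (mod p0))"
    and q2: "\<And>x y. x \<in> S \<inter> M \<Longrightarrow> y \<in> M \<Longrightarrow> \<exists>\<rho>. \<forall>l. [y $ l = \<rho> * x $ l] (mod int (\<Prod>i=1..h. q i))"
    and q3: "lattice_det M \<le> (1 / minkowski_const CARD('n)) ^ h * (lattice_det \<Lambda> * (\<Prod>i=1..h. real (q i) ^ (m - (i - 1)) / B))"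
    using q by (simp_all add: local_conditions_def)
  have 1: "q' i > 0 \<and> (\<exists>p k. prime p \<and> k \<ge> 1 \<and> q' i = p ^ k \<and> [p = m + 1 - i] (mod p0))" if "i \<in> {1..h + 1}" for i
  proof (cases "i = h + 1")
    case True
    then show ?thesis using p k prime_gt_0_nat[OF p(1)] by (auto simp: q'_def)
  next
    case False
    then show ?thesis using that q1[of i] by (simp add: q'_def)
  qed
  have copr: "coprime (p ^ k) (q i)" if i: "i \<in> {1..h}" for i
  proof -
    obtain p' k' where p': "prime p'" "q i = p' ^ k'" "[p' = m + 1 - i] (mod p0)" using q1[OF i] by blast
    have "p \<noteq> p'"
    proof
      assume "p = p'"
      then have "[m - h = m + 1 - i] (mod p0)" using p(2) p'(3) by (metis cong_trans cong_sym)
      \<comment> \<open>Here \<open>p0\<close> has to exceed the dimension: different ranks are then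
        different residues.\<close>
      moreover have "m - h < p0" "m + 1 - i < p0" using rank_le p0 i h by auto
      ultimately have "m - h = m + 1 - i" by (simp add: cong_def)
      then show False using i h by auto
    qed
    then show ?thesis using primes_coprime[OF p(1) p'(1)] p'(2) by simp
  qed
  have copQ: "coprime (int (\<Prod>i=1..h. q i)) (int (p ^ k))"
    unfolding coprime_int_iff using copr by (intro prod_coprime_left) (simp add: coprime_commute)
  have 2: "\<exists>\<rho>. \<forall>l. [y $ l = \<rho> * x $ l] (mod int (\<Prod>i=1..h + 1. q' i))" if x: "x \<in> S \<inter> N" and y: "y \<in> N" for x y
  proof -
    have xM: "x \<in> S \<inter> M" "y \<in> M" "x \<in> S \<inter> M \<inter> N" using x y N(2) by auto
    obtain \<rho>1 where \<rho>1: "\<And>l. [y $ l = \<rho>1 * x $ l] (mod int (\<Prod>i=1..h. q i))" using q2[OF xM(1,2)] by blast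
    obtain \<rho>2 where \<rho>2: "\<And>l. [y $ l = \<rho>2 * x $ l] (mod int (p ^ k))" using N(6)[OF xM(3) y] by blast
    obtain \<rho> where \<rho>: "[\<rho> = \<rho>1] (mod int (\<Prod>i=1..h. q i))" "[\<rho> = \<rho>2] (mod int (p ^ k))"
      using binary_chinese_remainder_int[OF copQ, of \<rho>1 \<rho>2] by blast
    have "[y $ l = \<rho> * x $ l] (mod int (\<Prod>i=1..h. q i) * int (p ^ k))" for l
    proof (rule coprime_cong_mult[OF _ _ copQ])
      show "[y $ l = \<rho> * x $ l] (mod int (\<Prod>i=1..h. q i))"
        using \<rho>1[of l] cong_scalar_right[OF cong_sym[OF \<rho>(1)], of "x $ l"] by (rule cong_trans)
      show "[y $ l = \<rho> * x $ l] (mod int (p ^ k))"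
        using \<rho>2[of l] cong_scalar_right[OF cong_sym[OF \<rho>(2)], of "x $ l"] by (rule cong_trans)
    qed
    moreover have "int (\<Prod>i=1..h + 1. q' i) = int (\<Prod>i=1..h. q i) * int (p ^ k)"
      using prod'[of "\<lambda>a i. a"] by simp
    ultimately show ?thesis by (intro exI[of _ \<rho>] allI) (simp only:)
  qed
  have mk: "minkowski_const CARD('n) > 0" by (rule minkowski_const_pos) simp
  have "minkowski_const CARD('n) * B * lattice_det N \<le> minkowski_const CARD('n) * R * lattice_det N"
    using mk R_ge lattice_det_ge_1[OF N(1)] by (intro mult_right_mono mult_left_mono) auto
  also have "\<dots> \<le> real (p ^ k) ^ (m - h) * lattice_det M" using N(8) h(2) by simp
  also have "\<dots> \<le> real (p ^ k) ^ (m - h) * ((1 / minkowski_const CARD('n)) ^ h *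
      (lattice_det \<Lambda> * (\<Prod>i=1..h. real (q i) ^ (m - (i - 1)) / B)))"
    using q3 by (intro mult_left_mono) auto
  finally have "lattice_det N \<le> (1 / minkowski_const CARD('n)) ^ (h + 1) *
      (lattice_det \<Lambda> * ((\<Prod>i=1..h. real (q i) ^ (m - (i - 1)) / B) * (real (p ^ k) ^ (m - h) / B)))"
    using mk B by (simp add: field_simps)
  also have "(\<Prod>i=1..h. real (q i) ^ (m - (i - 1)) / B) * (real (p ^ k) ^ (m - h) / B) =
      (\<Prod>i=1..h + 1. real (q' i) ^ (m - (i - 1)) / B)"
    using prod'[of "\<lambda>a i. real a ^ (m - (i - 1)) / B", symmetric] by simp
  finally have 3: "lattice_det N \<le> (1 / minkowski_const CARD('n)) ^ (h + 1) *
      (lattice_det \<Lambda> * (\<Prod>i=1..h + 1. real (q' i) ^ (m - (i - 1)) / B))" .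
  show ?thesis unfolding local_conditions_def q'_def[symmetric] using 1 2 3 by blast
qed

lemma admissible_step:
  assumes M: "admissible M" and r: "lattice_rank M \<ge> 2"
    and p: "prime p" "real p \<le> P" "[p = lattice_rank M] (mod p0)" and k: "k \<ge> 1"
    and N: "descent_step R (R * P ^ (2 * (m - lattice_rank M))) M (S \<inter> M) p k N"
  shows "admissible N"
proof -
  define h where "h = m - lattice_rank M"
  have h: "h + 1 < m" "lattice_rank M = m - h" using r admissibleD(4)[OF M] by (auto simp: h_def)
  obtain q where q: "local_conditions M h q" using admissibleD(7)[OF M] by (auto simp: h_def)
  note N' = descent_stepD[OF N]
  have hN: "m - lattice_rank N = h + 1" using N'(3) h by simp
  have "real p ^ 2 * (R * P ^ (2 * h)) \<le> P ^ 2 * (R * P ^ (2 * h))"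
    using p(2) R_ge(2) P by (intro mult_right_mono power_mono) auto
  also have "\<dots> = R * P ^ (2 * (h + 1))" by (simp add: power2_eq_square)
  finally have "short_spanned N (R * P ^ (2 * (h + 1)))"
    using short_spanned_mono[OF N'(4)] by (simp add: h_def)
  moreover have "local_conditions N (h + 1) (q(h + 1 := p ^ k))"
    using local_conditions_step[OF q h p(1) _ k N] p(3) h(2) by simp
  moreover have "S \<inter> N \<noteq> {}" using N'(5) by auto
  moreover have "N \<subseteq> \<Lambda>" using N'(2) admissibleD(2)[OF M] by auto
  moreover have "1 \<le> lattice_rank N" "lattice_rank N \<le> m" using N'(3) h by auto
  ultimately show ?thesis using N'(1) unfolding admissible_def hN by blast
qed

section \<open>Counting the final lattices\<close>

text \<open>The \<open>r\<close>-th root of \<open>B ^ r / lattice_det M\<close> for a lattice of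
  rank \<open>r\<close>. In these terms the main factor of the count is the power
  \<open>r - 2\<close>, and the induction on the rank closes.\<close>

definition size_ratio :: "(int ^ 'n) set \<Rightarrow> real" where
  "size_ratio M = B / root (lattice_rank M) (lattice_det M)"

text \<open>The bound for the minima after \<open>h\<close> steps, divided by
  \<open>B\<close>.\<close>

definition step_factor :: "nat \<Rightarrow> real" where
  "step_factor h = sqrt (real CARD('n)) * P ^ (2 * h)"

text \<open>One summand for each use: powers of \<open>sqrt n\<close> in the lower bound for the
  count, the constants of one descent step, and the number of zeros in rank two.\<close>

definition leaf_const :: real where
  "leaf_const = real CARD('n) ^ CARD('n) + real d ^ 2 * real CARD('n) ^ 3 + 2 * real d + 2"

text \<open>At rank \<open>s\<close> the choice of prime and exponent costs \<open>P ^ 2\<close>,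
  and the comparison of determinants costs \<open>P ^ (2 * (m - s + 1))\<close>. The additional
  factor \<open>s - 2\<close> ensures that a lattice on which \<open>f\<close> vanishes meets the
  bound by itself; the total still fits into the exponent of the statement.\<close>

definition leaf_exponent :: "nat \<Rightarrow> nat" where
  "leaf_exponent r = (\<Sum>s=3..r. 2 + 2 * (m - s + 1) * (s - 2))"

definition leaf_bound :: "nat \<Rightarrow> real" where
  "leaf_bound r = leaf_const ^ r * P ^ leaf_exponent r"

lemma leaf_const_ge: "1 \<le> leaf_const" "real CARD('n) ^ CARD('n) \<le> leaf_const"
    "real d ^ 2 * real CARD('n) ^ 3 \<le> leaf_const" "2 * real d + 2 \<le> leaf_const"
  by (auto simp: leaf_const_def intro!: add_increasing add_increasing2)

lemma size_ratio:
  assumes "integer_lattice M" "lattice_rank M \<ge> 1"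
  shows "size_ratio M > 0" "size_ratio M ^ lattice_rank M * lattice_det M = B ^ lattice_rank M"
proof -
  have det: "lattice_det M > 0" using lattice_det_ge_1[OF assms(1)] by simp
  then have "root (lattice_rank M) (lattice_det M) > 0" using assms(2) by (simp add: real_root_gt_zero)
  then show "size_ratio M > 0" using B by (simp add: size_ratio_def)
  show "size_ratio M ^ lattice_rank M * lattice_det M = B ^ lattice_rank M"
    using det assms(2) by (simp add: size_ratio_def power_divide real_root_pow_pos)
qed

text \<open>Hadamard's inequality with minima at most \<open>B * step_factor h\<close>: the main
  factor of the count is never smaller than a constant times a negative power of
  \<open>P\<close>.\<close>

lemma size_ratio_lower:
  assumes M: "admissible M"
  shows "1 \<le> step_factor (m - lattice_rank M) * size_ratio M"
proof -
  define r where "r = lattice_rank M"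
  define T where "T = R * P ^ (2 * (m - r))"
  note M' = admissibleD[OF M]
  have T: "T \<ge> 0" using R_ge P by (simp add: T_def)
  have "lattice_det M \<le> T ^ r"
    using lattice_det_le_power[OF M'(1,5)] T by (simp add: r_def T_def)
  then have "size_ratio M ^ r * lattice_det M \<le> size_ratio M ^ r * T ^ r"
    using size_ratio[OF M'(1,3)] by (intro mult_left_mono) auto
  then have "B ^ r \<le> (size_ratio M * T) ^ r"
    using size_ratio(2)[OF M'(1,3)] by (simp add: r_def power_mult_distrib)
  then have "B \<le> size_ratio M * T"
    using M'(3) B size_ratio(1)[OF M'(1,3)] T by (subst (asm) power_mono_iff) (auto simp: r_def)
  also have "\<dots> = B * (step_factor (m - r) * size_ratio M)"
    by (simp add: T_def R_def step_factor_def)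
  finally show ?thesis using B by (simp add: r_def)
qed

lemma sqrt_power_le: "k \<le> CARD('n) \<Longrightarrow> sqrt (real CARD('n)) ^ k \<le> leaf_const"
proof -
  assume k: "k \<le> CARD('n)"
  have "sqrt (real CARD('n)) * 1 \<le> sqrt (real CARD('n)) * sqrt (real CARD('n))"
    by (intro mult_left_mono) auto
  then have "sqrt (real CARD('n)) ^ k \<le> real CARD('n) ^ k" by (intro power_mono) auto
  also have "\<dots> \<le> real CARD('n) ^ CARD('n)" using k by (intro power_increasing) auto
  finally show ?thesis using leaf_const_ge(2) by simp
qed

lemma leaf_exponent_Suc: "r \<ge> 3 \<Longrightarrow> leaf_exponent r = leaf_exponent (r - 1) + (2 + 2 * (m - r + 1) * (r - 2))"
proof -
  assume r: "r \<ge> 3"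
  then obtain r' where "r = Suc r'" by (cases r) auto
  then show ?thesis using r by (simp add: leaf_exponent_def)
qed

text \<open>A lattice on which \<open>f\<close> vanishes is a family of one member, so the bound has
  to be at least \<open>1\<close> even if \<open>B ^ r / lattice_det M\<close> is small.\<close>

lemma leaf_bound_ge_1:
  assumes M: "admissible M" and r: "lattice_rank M \<ge> 2"
  shows "1 \<le> leaf_bound (lattice_rank M) * size_ratio M ^ (lattice_rank M - 2)"
proof -
  define r where "r = lattice_rank M"
  define h where "h = m - r"
  note M' = admissibleD[OF M]
  have rn: "r \<le> CARD('n)" using rank_le M'(4) by (simp add: r_def)
  have A: "leaf_const ^ r \<ge> leaf_const ^ 1" using leaf_const_ge(1) r by (intro power_increasing) (auto simp: r_def)
  have e: "2 * h * (r - 2) \<le> leaf_exponent r"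
  proof (cases "r \<ge> 3")
    case True
    have "2 * h * (r - 2) \<le> 2 * (m - r + 1) * (r - 2)" unfolding h_def by (intro mult_right_mono mult_left_mono) auto
    then show ?thesis using leaf_exponent_Suc[OF True] by linarith
  next
    case False
    then show ?thesis using r by (simp add: r_def)
  qed
  have "1 \<le> (step_factor h * size_ratio M) ^ (r - 2)"
    using size_ratio_lower[OF M] by (intro one_le_power) (simp add: h_def r_def)
  also have "\<dots> = sqrt (real CARD('n)) ^ (r - 2) * P ^ (2 * h * (r - 2)) * size_ratio M ^ (r - 2)"
    by (simp only: step_factor_def power_mult_distrib power_mult)
  also have "\<dots> \<le> leaf_const ^ r * P ^ leaf_exponent r * size_ratio M ^ (r - 2)"
  proof (intro mult_right_mono mult_mono power_increasing)
    have "sqrt (real CARD('n)) ^ (r - 2) \<le> leaf_const ^ 1" using sqrt_power_le[of "r - 2"] rn by simp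
    then show "sqrt (real CARD('n)) ^ (r - 2) \<le> leaf_const ^ r" using A by (rule order_trans)
  qed (use e P leaf_const_ge(1) size_ratio(1)[OF M'(1,3)] in auto)
  finally show ?thesis by (simp add: leaf_bound_def r_def)
qed

text \<open>The cancellation on which the count rests: the number of sublattices for one modulus
  \<open>q\<close> is of order \<open>q ^ (r - 2)\<close>, and the bound for each of them is smaller
  than that for \<open>M\<close> by the same power. The inputs are the lower bound for the
  determinant of \<open>N\<close> and the upper bound for the modulus.\<close>

lemma size_ratio_step:
  assumes M: "admissible M" and r: "lattice_rank M = r" "r \<ge> 3" and p: "prime p" "real p \<le> P"
    and N: "descent_step R (R * P ^ (2 * (m - r))) M S' p k N"
  shows "real (p ^ k) ^ (r - 2) * size_ratio N ^ (r - 3) \<le> step_factor (m - r + 1) * size_ratio M ^ (r - 2)"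
proof -
  define h where "h = m - r"
  define q where "q = real (p ^ k)"
  define T where "T = R * P ^ (2 * h)"
  note M' = admissibleD[OF M] and N' = descent_stepD[OF N]
  have rN: "lattice_rank N = r - 1" "lattice_rank N \<ge> 1" using N'(3) r by auto
  note sM = size_ratio[OF M'(1,3)] and sN = size_ratio[OF N'(1) rN(2)]
  have q0: "q > 0" using p by (simp add: q_def prime_gt_0_nat)
  have T0: "T > 0" using R_ge(2) P by (simp add: T_def)
  have TB: "T = B * step_factor h" by (simp add: T_def R_def step_factor_def)
  have Z: "step_factor (h + 1) = P ^ 2 * step_factor h" by (simp add: step_factor_def power2_eq_square)
  have sf0: "step_factor h > 0" and sf1: "step_factor (h + 1) > 0" using P by (simp_all add: step_factor_def)
  have detM: "lattice_det M > 0" and detN: "lattice_det N > 0"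
    using lattice_det_ge_1[OF M'(1)] lattice_det_ge_1[OF N'(1)] by auto
  show ?thesis
    unfolding q_def[symmetric] h_def[symmetric]
  proof (rule descent_inequality[OF r(2) sM(1) _ q0])
    show "size_ratio N \<ge> 0" using sN(1) by simp
    show "step_factor (h + 1) > 0" by (rule sf1)
    have "(q * size_ratio M) ^ r * lattice_det M = size_ratio M ^ r * (q ^ r * lattice_det M)"
      by (simp add: power_mult_distrib)
    have "real p ^ 2 * T \<le> P ^ 2 * T" using p T0 by (intro mult_right_mono power_mono) auto
    then have pT: "real p ^ 2 * T * lattice_det N \<le> P ^ 2 * T * lattice_det N"
      by (rule mult_right_mono) (use detN in simp)
    have "q ^ r * lattice_det M \<le> P ^ 2 * T * lattice_det N"
      using N'(7) pT r(1) by (simp add: q_def T_def h_def)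
    then have "size_ratio N ^ (r - 1) * (q ^ r * lattice_det M) \<le> size_ratio N ^ (r - 1) * (P ^ 2 * T * lattice_det N)"
      using sN(1) by (intro mult_left_mono) auto
    also have "\<dots> = P ^ 2 * T * (size_ratio N ^ (r - 1) * lattice_det N)" by simp
    also have "\<dots> = P ^ 2 * T * B ^ (r - 1)" using sN(2) rN(1) by simp
    also have "\<dots> = step_factor (h + 1) * (B * B ^ (r - 1))" unfolding TB Z by simp
    also have "B * B ^ (r - 1) = B ^ r" using r(2) by (simp add: power_eq_if)
    also have "B ^ r = size_ratio M ^ r * lattice_det M" using sM(2) r(1) by simp
    finally have "(size_ratio N ^ (r - 1) * q ^ r) * lattice_det M \<le> (step_factor (h + 1) * size_ratio M ^ r) * lattice_det M"
      by (simp add: mult.assoc)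
    then show "size_ratio N ^ (r - 1) * q ^ r \<le> step_factor (h + 1) * size_ratio M ^ r" using detM by simp
    have "q ^ r * lattice_det M \<le> (real p * T) ^ r" using N'(9) r(1) by (simp add: q_def T_def h_def)
    also have "\<dots> \<le> (P ^ 2 * T) ^ r"
    proof (intro power_mono mult_right_mono)
      have "P * 1 \<le> P * P" using P by (intro mult_left_mono) auto
      then show "real p \<le> P ^ 2" using p(2) by (simp add: power2_eq_square)
    qed (use T0 in auto)
    finally have "size_ratio M ^ r * (q ^ r * lattice_det M) \<le> size_ratio M ^ r * (P ^ 2 * T) ^ r"
      using sM(1) by (intro mult_left_mono) auto
    moreover have "size_ratio M ^ r * (P ^ 2 * T) ^ r = (step_factor (h + 1) * size_ratio M) ^ r * B ^ r"
      unfolding TB Z by (simp only: power_mult_distrib[symmetric] ac_simps)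
    ultimately have "q ^ r * (size_ratio M ^ r * lattice_det M) \<le> (step_factor (h + 1) * size_ratio M) ^ r * B ^ r"
      by (simp only: mult.left_commute)
    then have "q ^ r * B ^ r \<le> (step_factor (h + 1) * size_ratio M) ^ r * B ^ r" using sM(2) r(1) by simp
    then have "q ^ r \<le> (step_factor (h + 1) * size_ratio M) ^ r" using B by simp
    then show "q \<le> step_factor (h + 1) * size_ratio M"
      using r(2) q0 sM(1) sf1 by (subst (asm) power_mono_iff) auto
  qed
qed

definition leaf_family :: "(int ^ 'n) set \<Rightarrow> (int ^ 'n) set set \<Rightarrow> bool" where
  "leaf_family M \<F> \<longleftrightarrow> finite \<F> \<and> (\<forall>N\<in>\<F>. admissible N \<and> (\<forall>y\<in>N. f y = 0)) \<and> S \<inter> M \<subseteq> \<Union>\<F> \<and>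
     real (card \<F>) \<le> leaf_bound (lattice_rank M) * size_ratio M ^ (lattice_rank M - 2)"

lemma leaf_family_singleton:
  assumes "admissible M" "lattice_rank M \<ge> 2" "\<forall>y\<in>M. f y = 0"
  shows "leaf_family M {M}"
  unfolding leaf_family_def using assms(1,3) leaf_bound_ge_1[OF assms(1,2)]
  by (intro conjI ballI) auto

definition class_primes :: "nat \<Rightarrow> nat set" where
  "class_primes r = {p. prime p \<and> real p \<le> P \<and> [p = r] (mod p0)}"

definition step_exponents :: "nat set" where
  "step_exponents = {k. k \<ge> 1 \<and> 2 ^ k \<le> 2 * R}"

lemma card_class_primes: "finite (class_primes r)" "real (card (class_primes r)) \<le> P"
proof -
  have sub: "class_primes r \<subseteq> {1..nat \<lfloor>P\<rfloor>}"
    using prime_ge_1_nat by (auto simp: class_primes_def le_nat_floor)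
  then show "finite (class_primes r)" by (rule finite_subset) simp
  have "card (class_primes r) \<le> nat \<lfloor>P\<rfloor>" using card_mono[OF _ sub] by simp
  also have "real (nat \<lfloor>P\<rfloor>) \<le> P" using P by simp
  finally show "real (card (class_primes r)) \<le> P" by simp
qed

lemma card_step_exponents: "finite step_exponents" "real (card step_exponents) \<le> P"
proof -
  have sub: "step_exponents \<subseteq> {1..nat \<lfloor>P\<rfloor>}"
    using exponents by (auto simp: step_exponents_def R_def le_nat_floor)
  then show "finite step_exponents" by (rule finite_subset) simp
  have "card step_exponents \<le> nat \<lfloor>P\<rfloor>" using card_mono[OF _ sub] by simp
  also have "real (nat \<lfloor>P\<rfloor>) \<le> P" using P by simp
  finally show "real (card step_exponents) \<le> P" by simp
qed

lemma descendants:
  assumes M: "admissible M" and r: "lattice_rank M = r" "r \<ge> 2" and y0: "y0 \<in> M" "f y0 \<noteq> 0"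
  shows "\<exists>\<N>. (\<forall>p\<in>class_primes r. \<forall>k\<in>step_exponents. finite (\<N> p k) \<and>
      card (\<N> p k) \<le> d * (r ^ 2 * ((p ^ k) ^ (r - 2) * d)) \<and>
      (\<forall>N\<in>\<N> p k. admissible N \<and> descent_step R (R * P ^ (2 * (m - r))) M (S \<inter> M) p k N)) \<and>
    S \<inter> M \<subseteq> (\<Union>p\<in>class_primes r. \<Union>k\<in>step_exponents. \<Union>(\<N> p k))"
proof -
  define T where "T = R * P ^ (2 * (m - r))"
  note M' = admissibleD[OF M]
  have "R * 1 \<le> R * P ^ (2 * (m - r))" using R_ge P by (intro mult_left_mono) auto
  then have RT: "R \<le> T" by (simp add: T_def)
  have T0: "T \<ge> 0" using R_ge RT by simp
  have sp: "short_spanned M T" using M'(5) r by (simp add: T_def)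
  obtain y where y: "y \<in> M" "f y \<noteq> 0" "\<forall>i. \<bar>y $ i\<bar> \<le> \<lfloor>real CARD('n) * real d * T\<rfloor>"
    using short_nonzero_exists[of M T d H f y0, OF M'(1) sp T0 form y0] by blast
  have X: "x \<in> M \<and> f x = 0 \<and> (GCD i. x $ i) = 1 \<and> euclidean_length x \<le> R \<and> (\<forall>i. \<bar>x $ i\<bar> \<le> \<lfloor>B\<rfloor>)"
    if "x \<in> S \<inter> M" for x
    using that short_S[of x] by (auto simp: S_def le_floor_iff)
  have Ps: "\<exists>p\<in>class_primes r. \<not> int p dvd a"
    if a: "a \<noteq> 0" "\<bar>a\<bar> \<le> int d * (H * (\<lfloor>B\<rfloor> + \<lfloor>real CARD('n) * real d * T\<rfloor>) ^ d)" for a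
  proof -
    \<comment> \<open>The bound for the minima at the present rank is replaced by the uniform one in
      which the assumption on primes is phrased.\<close>
    have "P ^ (2 * (m - r)) \<le> P ^ (2 * CARD('n))" using P rank_le by (intro power_increasing) auto
    then have "T \<le> sqrt (real CARD('n)) * B * P ^ (2 * CARD('n))"
      unfolding T_def R_def using B by (intro mult_left_mono) auto
    then have "real CARD('n) * real d * T \<le> real CARD('n) * real d * (sqrt (real CARD('n)) * B * P ^ (2 * CARD('n)))"
      by (intro mult_left_mono) auto
    then have "\<lfloor>real CARD('n) * real d * T\<rfloor> \<le> \<lfloor>real CARD('n) * real d * (sqrt (real CARD('n)) * B * P ^ (2 * CARD('n)))\<rfloor>"
      by (rule floor_mono)
    moreover have "0 \<le> \<lfloor>B\<rfloor> + \<lfloor>real CARD('n) * real d * T\<rfloor>" using B T0 by simp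
    ultimately have "int d * (H * (\<lfloor>B\<rfloor> + \<lfloor>real CARD('n) * real d * T\<rfloor>) ^ d) \<le>
        int d * (H * (\<lfloor>B\<rfloor> + \<lfloor>real CARD('n) * real d * (sqrt (real CARD('n)) * B * P ^ (2 * CARD('n)))\<rfloor>) ^ d)"
      using hform_nonneg[OF form] by (intro mult_left_mono power_mono) auto
    then have "\<exists>p. prime p \<and> real p \<le> P \<and> [p = r] (mod p0) \<and> \<not> int p dvd a"
      using a r M'(4) by (intro primes) auto
    then show ?thesis by (auto simp: class_primes_def)
  qed
  have rM: "lattice_rank M \<ge> 1" using r by simp
  have pr: "\<And>p. p \<in> class_primes r \<Longrightarrow> prime p" by (simp add: class_primes_def)
  have "\<exists>\<N>. (\<forall>p\<in>class_primes r. \<forall>k\<in>step_exponents. finite (\<N> p k) \<and>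
      card (\<N> p k) \<le> d * (r ^ 2 * ((p ^ k) ^ (r - 2) * d)) \<and> (\<forall>N\<in>\<N> p k. descent_step R T M (S \<inter> M) p k N)) \<and>
    S \<inter> M \<subseteq> (\<Union>p\<in>class_primes r. \<Union>k\<in>step_exponents. \<Union>(\<N> p k))"
    unfolding step_exponents_def r(1)[symmetric]
    by (rule descent_families[where P = "class_primes (lattice_rank M)", OF form M'(1) rM sp R_ge(2) RT y X pr[folded r(1)] Ps[folded r(1)]])
  then obtain \<N> where \<N>: "\<forall>p\<in>class_primes r. \<forall>k\<in>step_exponents. finite (\<N> p k) \<and>
      card (\<N> p k) \<le> d * (r ^ 2 * ((p ^ k) ^ (r - 2) * d)) \<and> (\<forall>N\<in>\<N> p k. descent_step R T M (S \<inter> M) p k N)"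
    "S \<inter> M \<subseteq> (\<Union>p\<in>class_primes r. \<Union>k\<in>step_exponents. \<Union>(\<N> p k))"
    by (elim exE conjE) (rule that)
  have "admissible N" if pk: "p \<in> class_primes r" "k \<in> step_exponents" "N \<in> \<N> p k" for p k N
  proof (rule admissible_step[OF M])
    show "lattice_rank M \<ge> 2" "prime p" "real p \<le> P" "[p = lattice_rank M] (mod p0)" "k \<ge> 1"
      using r pk by (auto simp: class_primes_def step_exponents_def)
    show "descent_step R (R * P ^ (2 * (m - lattice_rank M))) M (S \<inter> M) p k N"
      using \<N>(1) pk r(1) by (simp add: T_def)
  qed
  then show ?thesis using \<N> unfolding T_def by (intro exI[of _ \<N>] conjI ballI) simp_all
qed

lemma finite_S: "finite S"
proof (rule finite_subset[OF _ finite_bounded_vectors[of "\<lfloor>B\<rfloor>"]])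
  show "S \<subseteq> {x. \<forall>i. \<bar>x $ i\<bar> \<le> \<lfloor>B\<rfloor>}" by (auto simp: S_def le_floor_iff)
qed

text \<open>Counting as in higher rank would cost a factor \<open>P ^ 2\<close> for primes and
  exponents, while \<open>leaf_exponent 2 = 0\<close>. Instead, the sublattices have rank one and
  are determined by the zeros they contain, of which a binary form has few.\<close>

lemma leaf_family_rank_2:
  assumes M: "admissible M" and r: "lattice_rank M = 2" and y0: "y0 \<in> M" "f y0 \<noteq> 0"
  shows "\<exists>\<F>. leaf_family M \<F>"
proof -
  obtain \<N> where \<N>: "\<And>p k N. p \<in> class_primes 2 \<Longrightarrow> k \<in> step_exponents \<Longrightarrow> N \<in> \<N> p k \<Longrightarrow>
      admissible N \<and> descent_step R (R * P ^ (2 * (m - 2))) M (S \<inter> M) p k N"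
    "S \<inter> M \<subseteq> (\<Union>p\<in>class_primes 2. \<Union>k\<in>step_exponents. \<Union>(\<N> p k))"
    using descendants[OF M r order_refl y0] by blast
  define \<F> where "\<F> = (\<Union>p\<in>class_primes 2. \<Union>k\<in>step_exponents. \<N> p k)"
  have leaf: "admissible N \<and> (\<forall>y\<in>N. f y = 0) \<and> N \<in> (\<lambda>x. range (\<lambda>c. c *s x)) ` (S \<inter> M)" if N: "N \<in> \<F>" for N
  proof -
    obtain p k where pk: "p \<in> class_primes 2" "k \<in> step_exponents" "N \<in> \<N> p k" using N by (auto simp: \<F>_def)
    have adm: "admissible N" and st: "descent_step R (R * P ^ (2 * (m - 2))) M (S \<inter> M) p k N" using \<N>(1)[OF pk] by auto
    note N' = descent_stepD[OF st]
    obtain x where x: "x \<in> S \<inter> M" "x \<in> N" using N'(5) by blast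
    have "lattice_rank N = 1" using N'(3) r by simp
    then have Nx: "N = range (\<lambda>c. c *s x)" using x by (intro rank_1_lattice_primitive N'(1)) (auto simp: S_def)
    have "f y = 0" if "y \<in> N" for y
      using that x hform_homogeneous[OF form] by (auto simp: Nx S_def)
    then show ?thesis using adm Nx x(1) by blast
  qed
  have fin: "finite (S \<inter> M)" using finite_S by simp
  have "\<F> \<subseteq> (\<lambda>x. range (\<lambda>c. c *s x)) ` (S \<inter> M)" using leaf by blast
  then have fF: "finite \<F>" and "card \<F> \<le> card (S \<inter> M)"
    using finite_surj[OF fin] surj_card_le[OF fin] by auto
  note this(2)
  also have "card (S \<inter> M) \<le> 2 * d + 2"
    using fin by (intro card_zeros_rank_2[OF admissibleD(1)[OF M] r form y0]) (auto simp: S_def)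
  finally have "real (card \<F>) \<le> real (2 * d + 2)" by (simp only: of_nat_le_iff)
  also have "\<dots> \<le> leaf_const ^ 1" using leaf_const_ge(4) by simp
  also have "\<dots> \<le> leaf_const ^ 2" using leaf_const_ge(1) by (intro power_increasing) auto
  also have "\<dots> = leaf_bound 2" by (simp add: leaf_bound_def leaf_exponent_def)
  finally have "real (card \<F>) \<le> leaf_bound (lattice_rank M) * size_ratio M ^ (lattice_rank M - 2)" by (simp add: r)
  moreover have "S \<inter> M \<subseteq> \<Union>\<F>" using \<N>(2) unfolding \<F>_def by blast
  moreover have "\<forall>N\<in>\<F>. admissible N \<and> (\<forall>y\<in>N. f y = 0)" using leaf by simp
  ultimately show ?thesis using fF unfolding leaf_family_def by (intro exI[of _ \<F>] conjI)
qed

lemma leaf_family_exists: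
  assumes "admissible M" "lattice_rank M = r" "r \<ge> 2"
  shows "\<exists>\<F>. leaf_family M \<F>"
  using assms
proof (induction r arbitrary: M rule: less_induct)
  case (less r)
  note M = less.prems(1) and r = less.prems(2,3)
  show ?case
  proof (cases "\<forall>y\<in>M. f y = 0")
    case True
    then show ?thesis using leaf_family_singleton[OF M] r by blast
  next
    case False
    then obtain y0 where y0: "y0 \<in> M" "f y0 \<noteq> 0" by blast
    show ?thesis
    proof (cases "r = 2")
      case True
      then show ?thesis using leaf_family_rank_2[OF M _ y0] r by simp
    next
      case False
      then have r3: "r \<ge> 3" using r by simp
      obtain \<N> where \<N>: "\<And>p k. p \<in> class_primes r \<Longrightarrow> k \<in> step_exponents \<Longrightarrow> finite (\<N> p k) \<and>
          card (\<N> p k) \<le> d * (r ^ 2 * ((p ^ k) ^ (r - 2) * d))"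
        "\<And>p k N. p \<in> class_primes r \<Longrightarrow> k \<in> step_exponents \<Longrightarrow> N \<in> \<N> p k \<Longrightarrow>
          admissible N \<and> descent_step R (R * P ^ (2 * (m - r))) M (S \<inter> M) p k N"
        "S \<inter> M \<subseteq> (\<Union>p\<in>class_primes r. \<Union>k\<in>step_exponents. \<Union>(\<N> p k))"
        using descendants[OF M r y0] by blast
      define I where "I = class_primes r \<times> step_exponents"
      define \<D> where "\<D> a = \<N> (fst a) (snd a)" for a
      define Z where "Z = step_factor (m - r + 1)"
      have finI: "finite I" using card_class_primes(1) card_step_exponents(1) by (simp add: I_def)
      have cI: "real (card I) \<le> P * P"
        unfolding I_def card_cartesian_product of_nat_mult
        using card_class_primes(2) card_step_exponents(2) P by (intro mult_mono) auto
      have fin\<D>: "finite (\<D> a)" if "a \<in> I" for a using \<N>(1) that by (auto simp: I_def \<D>_def)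
      define \<G> where "\<G> N = (SOME \<F>. leaf_family N \<F>)" for N
      have \<G>: "leaf_family N (\<G> N) \<and> lattice_rank N = r - 1" if "a \<in> I" "N \<in> \<D> a" for a N
      proof -
        have "admissible N" and st: "descent_step R (R * P ^ (2 * (m - r))) M (S \<inter> M) (fst a) (snd a) N"
          using \<N>(2) that by (auto simp: I_def \<D>_def)
        moreover have rN: "lattice_rank N = r - 1" using descent_stepD(3)[OF st] r by simp
        ultimately have "\<exists>\<F>. leaf_family N \<F>" using r3 by (intro less.IH[of "r - 1"]) auto
        then show ?thesis using rN unfolding \<G>_def by (auto intro: someI_ex)
      qed
      define \<F> where "\<F> = (\<Union>a\<in>I. \<Union>N\<in>\<D> a. \<G> N)"
      have fF: "finite \<F>" unfolding \<F>_def using finI fin\<D> \<G> by (auto simp: leaf_family_def)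
      have leaf: "admissible N \<and> (\<forall>y\<in>N. f y = 0)" if "N \<in> \<F>" for N
      proof -
        obtain a N' where "a \<in> I" "N' \<in> \<D> a" "N \<in> \<G> N'" using \<open>N \<in> \<F>\<close> by (auto simp: \<F>_def)
        then show ?thesis using \<G>[of a N'] by (simp add: leaf_family_def)
      qed
      have cov: "S \<inter> M \<subseteq> \<Union>\<F>"
      proof
        fix x assume x: "x \<in> S \<inter> M"
        then obtain p k N where pk: "p \<in> class_primes r" "k \<in> step_exponents" "N \<in> \<N> p k" "x \<in> N"
          using \<N>(3) by blast
        then have aN: "(p, k) \<in> I" "N \<in> \<D> (p, k)" by (auto simp: I_def \<D>_def)
        have "S \<inter> N \<subseteq> \<Union>(\<G> N)" using \<G>[OF aN] by (simp add: leaf_family_def)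
        then have "x \<in> \<Union>(\<G> N)" using x pk(4) by blast
        then show "x \<in> \<Union>\<F>" using aN by (auto simp: \<F>_def)
      qed
      have lb0: "leaf_bound (r - 1) \<ge> 0" using leaf_const_ge(1) P by (simp add: leaf_bound_def)
      have sM0: "size_ratio M > 0" using size_ratio(1)[OF admissibleD(1,3)[OF M]] .
      have Z0: "Z \<ge> 0" using P by (simp add: Z_def step_factor_def)
      \<comment> \<open>The bound for one pair of prime and exponent. It is free of the modulus:
        \<open>q ^ (r - 2)\<close> stands in the denominator of \<open>W\<close> and in the bound
        for the number of sublattices.\<close>
      define V where "V = real d ^ 2 * real r ^ 2 * (leaf_bound (r - 1) * (Z * size_ratio M ^ (r - 2)))"
      have V0: "V \<ge> 0" using lb0 Z0 sM0 by (simp add: V_def)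
      have pk_bound: "(\<Sum>N\<in>\<D> a. real (card (\<G> N))) \<le> V" if a: "a \<in> I" for a
      proof -
        define q where "q = real (fst a ^ snd a)"
        have p: "prime (fst a)" "real (fst a) \<le> P" using a by (auto simp: I_def class_primes_def)
        have q0: "q > 0" using p by (simp add: q_def prime_gt_0_nat)
        define W where "W = leaf_bound (r - 1) * (Z * size_ratio M ^ (r - 2) / q ^ (r - 2))"
        have W0: "W \<ge> 0" using lb0 Z0 sM0 q0 by (simp add: W_def)
        have "real (card (\<G> N)) \<le> W" if N: "N \<in> \<D> a" for N
        proof -
          have st: "descent_step R (R * P ^ (2 * (m - r))) M (S \<inter> M) (fst a) (snd a) N"
            using \<N>(2) a N by (auto simp: I_def \<D>_def)
          have "q ^ (r - 2) * size_ratio N ^ (r - 3) \<le> Z * size_ratio M ^ (r - 2)"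
            using size_ratio_step[OF M r(1) r3 p st] by (simp add: q_def Z_def)
          then have "size_ratio N ^ (r - 3) \<le> Z * size_ratio M ^ (r - 2) / q ^ (r - 2)"
            using q0 by (simp add: pos_le_divide_eq mult.commute)
          then have "leaf_bound (r - 1) * size_ratio N ^ (r - 3) \<le> W"
            unfolding W_def using lb0 by (intro mult_left_mono)
          moreover have "r - 1 - 2 = r - 3" by simp
          ultimately show ?thesis using \<G>[OF a N] unfolding leaf_family_def by (metis order_trans)
        qed
        then have "(\<Sum>N\<in>\<D> a. real (card (\<G> N))) \<le> (\<Sum>N\<in>\<D> a. W)" by (rule sum_mono)
        also have "\<dots> = real (card (\<D> a)) * W" by simp
        also have "\<dots> \<le> real (d * (r ^ 2 * ((fst a ^ snd a) ^ (r - 2) * d))) * W"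
          using \<N>(1) a W0 by (intro mult_right_mono) (auto simp: I_def \<D>_def simp del: of_nat_mult)
        also have "\<dots> = real d ^ 2 * real r ^ 2 * (q ^ (r - 2) * W)"
          by (simp add: q_def power2_eq_square)
        also have "q ^ (r - 2) * W = leaf_bound (r - 1) * (Z * size_ratio M ^ (r - 2))" using q0 by (simp add: W_def)
        finally show ?thesis by (simp add: V_def)
      qed
      have "card \<F> \<le> (\<Sum>a\<in>I. card (\<Union>N\<in>\<D> a. \<G> N))" unfolding \<F>_def by (rule card_UN_le[OF finI])
      also have "\<dots> \<le> (\<Sum>a\<in>I. \<Sum>N\<in>\<D> a. card (\<G> N))" using fin\<D> by (intro sum_mono card_UN_le)
      finally have "real (card \<F>) \<le> (\<Sum>a\<in>I. \<Sum>N\<in>\<D> a. real (card (\<G> N)))"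
        by (simp only: of_nat_le_iff of_nat_sum[symmetric])
      also have "\<dots> \<le> (\<Sum>a\<in>I. V)" by (intro sum_mono pk_bound)
      also have "\<dots> = real (card I) * V" by simp
      also have "\<dots> \<le> P * P * V" using cI V0 by (rule mult_right_mono)
      also have "\<dots> = (real d ^ 2 * real r ^ 2 * sqrt (real CARD('n))) * leaf_const ^ (r - 1) *
          (P ^ leaf_exponent (r - 1) * P ^ (2 + 2 * (m - r + 1))) * size_ratio M ^ (r - 2)"
        by (simp add: V_def Z_def step_factor_def leaf_bound_def power_add power2_eq_square)
      also have "\<dots> \<le> leaf_const * leaf_const ^ (r - 1) * P ^ leaf_exponent r * size_ratio M ^ (r - 2)"
      proof (intro mult_right_mono mult_mono)
        have "r \<le> CARD('n)" using rank_le admissibleD(4)[OF M] r by simp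
        then have "real r ^ 2 * sqrt (real CARD('n)) \<le> real CARD('n) ^ 2 * real CARD('n)"
          by (intro mult_mono power_mono) (auto intro!: real_le_lsqrt simp: power2_eq_square)
        then have "real d ^ 2 * (real r ^ 2 * sqrt (real CARD('n))) \<le> real d ^ 2 * (real CARD('n) ^ 2 * real CARD('n))"
          by (intro mult_left_mono) auto
        then show "real d ^ 2 * real r ^ 2 * sqrt (real CARD('n)) \<le> leaf_const"
          using leaf_const_ge(3) by (simp add: power2_eq_square power3_eq_cube mult.assoc)
        have "2 * (m - r + 1) * 1 \<le> 2 * (m - r + 1) * (r - 2)" using r3 by (intro mult_left_mono) auto
        then have "leaf_exponent (r - 1) + (2 + 2 * (m - r + 1)) \<le> leaf_exponent r"
          unfolding leaf_exponent_Suc[OF r3] by linarith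
        then show "P ^ leaf_exponent (r - 1) * P ^ (2 + 2 * (m - r + 1)) \<le> P ^ leaf_exponent r"
          unfolding power_add[symmetric] using P by (rule power_increasing)
      qed (use leaf_const_ge(1) P sM0 in auto)
      also have "leaf_const * leaf_const ^ (r - 1) = leaf_const ^ r" using r by (simp add: power_eq_if)
      finally have "real (card \<F>) \<le> leaf_bound (lattice_rank M) * size_ratio M ^ (lattice_rank M - 2)"
        by (simp add: leaf_bound_def r(1))
      moreover have "\<forall>N\<in>\<F>. admissible N \<and> (\<forall>y\<in>N. f y = 0)" using leaf by simp
      ultimately show ?thesis using fF cov unfolding leaf_family_def by (intro exI[of _ \<F>] conjI)
    qed
  qed
qed

end

section \<open>Primes in arithmetic progressions\<close>

lemma sum_divisors_swap:
  fixes g :: "nat \<Rightarrow> nat \<Rightarrow> 'a::comm_monoid_add"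
  shows "(\<Sum>n=1..N. \<Sum>d | d dvd n. g d (n div d)) = (\<Sum>d=1..N. \<Sum>e=1..N div d. g d e)"
proof -
  have "(\<Sum>n=1..N. \<Sum>d | d dvd n. g d (n div d)) = (\<Sum>(n, d)\<in>(SIGMA n:{1..N}. {d. d dvd n}). g d (n div d))"
    by (rule sum.Sigma) auto
  also have "\<dots> = (\<Sum>(d, e)\<in>(SIGMA d:{1..N}. {1..N div d}). g d e)"
    by (rule sum.reindex_bij_witness[of _ "\<lambda>(d, e). (d * e, d)" "\<lambda>(n, d). (d, n div d)"],
      auto simp: div_le_mono Suc_le_eq div_greater_zero_iff dvd_imp_le less_eq_div_iff_mult_less_eq mult.commute
        intro: Nat.gr0I elim!: dvdE, metis dvd_imp_le dvd_triv_left le_trans mult_pos_pos)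
  also have "\<dots> = (\<Sum>d=1..N. \<Sum>e=1..N div d. g d e)"
    by (rule sum.Sigma[symmetric]) auto
  finally show ?thesis .
qed

section \<open>Chebyshev's upper bound and Mertens' theorem\<close>

definition chebyshev_psi :: "nat \<Rightarrow> real" where
  "chebyshev_psi N = (\<Sum>d=1..N. mangoldt d)"

lemma ln_fact_mangoldt: "ln (fact N :: real) = (\<Sum>d=1..N. mangoldt d * real (N div d))"
proof -
  have "ln (fact N :: real) = (\<Sum>n=1..N. ln (real n))"
    by (induction N) (auto simp: ln_mult)
  also have "\<dots> = (\<Sum>n=1..N. \<Sum>d | d dvd n. mangoldt d)"
    by (intro sum.cong refl, subst mangoldt_sum) auto
  also have "\<dots> = (\<Sum>d=1..N. \<Sum>e=1..N div d. mangoldt d)"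
    by (rule sum_divisors_swap)
  finally show ?thesis by (simp add: mult.commute)
qed

text \<open>Chebyshev's argument: the logarithm of the central binomial coefficient is the sum of
  \<open>mangoldt d\<close> weighted by \<open>2 * n div d - 2 * (n div d)\<close>, which is
  nonnegative and equals \<open>1\<close> for \<open>d\<close> in \<open>{n<..2*n}\<close>.\<close>

lemma chebyshev_psi_double: "chebyshev_psi (2 * n) - chebyshev_psi n \<le> 2 * real n * ln 2"
proof -
  have ext: "ln (fact n :: real) = (\<Sum>d=1..2*n. mangoldt d * real (n div d))"
    unfolding ln_fact_mangoldt by (rule sum.mono_neutral_left) auto
  have "chebyshev_psi (2 * n) - chebyshev_psi n = (\<Sum>d\<in>{n<..2*n}. mangoldt d)"
  proof -
    have "{1..2*n} = {1..n} \<union> {n<..2*n}" by auto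
    then have "sum (mangoldt :: nat \<Rightarrow> real) {1..2*n} = sum mangoldt {1..n} + sum mangoldt {n<..2*n}"
      by (simp only:) (rule sum.union_disjoint, auto)
    then show ?thesis unfolding chebyshev_psi_def by simp
  qed
  also have "\<dots> \<le> (\<Sum>d\<in>{n<..2*n}. mangoldt d * (real (2 * n div d) - 2 * real (n div d)))"
  proof (intro sum_mono)
    fix d assume d: "d \<in> {n<..2*n}"
    then have "n div d = 0" "2 * n div d \<ge> 1" by (auto simp: Suc_le_eq div_greater_zero_iff)
    then have "real (2 * n div d) - 2 * real (n div d) \<ge> 1" by simp
    then show "mangoldt d \<le> mangoldt d * (real (2 * n div d) - 2 * real (n div d))"
      using mangoldt_nonneg[of d] by (simp add: mult_le_cancel_left1)
  qed
  also have "\<dots> \<le> (\<Sum>d=1..2*n. mangoldt d * (real (2 * n div d) - 2 * real (n div d)))"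
  proof (intro sum_mono2)
    fix d assume "d \<in> {1..2*n} - {n<..2*n}"
    then have "d > 0" by auto
    then have "2 * (n div d) \<le> 2 * n div d"
      by (simp add: less_eq_div_iff_mult_less_eq mult.assoc)
    then have "2 * real (n div d) \<le> real (2 * n div d)" by linarith
    then show "0 \<le> mangoldt d * (real (2 * n div d) - 2 * real (n div d))"
      using mangoldt_nonneg[of d] by (intro mult_nonneg_nonneg) simp_all
  qed auto
  also have "\<dots> = ln (fact (2 * n)) - 2 * ln (fact n)"
    unfolding ext ln_fact_mangoldt[of "2 * n"]
    by (simp add: sum_subtractf sum_distrib_left right_diff_distrib mult.left_commute)
  also have "\<dots> = ln (real (2 * n choose n))"
  proof -
    have "fact n * fact (2 * n - n) * (2 * n choose n) = fact (2 * n)"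
      by (rule binomial_fact_lemma) simp
    then have "real (fact n * fact (2 * n - n) * (2 * n choose n)) = real (fact (2 * n))" by simp
    then have "(fact (2 * n) :: real) = fact n * fact n * real (2 * n choose n)"
      by (simp add: mult_2)
    then show ?thesis by (simp add: ln_mult)
  qed
  also have "\<dots> \<le> ln (2 ^ (2 * n))"
  proof -
    have "(2 * n choose n) \<le> (\<Sum>k\<le>2*n. 2 * n choose k)"
      by (rule member_le_sum) auto
    then have "(2 * n choose n) \<le> 2 ^ (2 * n)" by (simp add: choose_row_sum)
    then have "real (2 * n choose n) \<le> real (2 ^ (2 * n))" by (simp only: of_nat_le_iff)
    then have "real (2 * n choose n) \<le> 2 ^ (2 * n)" by simp
    then show ?thesis by (intro ln_mono) (auto simp: zero_less_binomial_iff)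
  qed
  also have "\<dots> = 2 * real n * ln 2" by (simp add: ln_realpow)
  finally show ?thesis .
qed

lemma chebyshev_psi_le: "chebyshev_psi N \<le> 4 * real N"
proof (induction N rule: less_induct)
  case (less N)
  show ?case
  proof (cases "N = 0")
    case True
    then show ?thesis by (simp add: chebyshev_psi_def)
  next
    case False
    define n where "n = N div 2"
    have IH: "chebyshev_psi n \<le> 4 * real n" using False by (intro less) (simp add: n_def)
    have ln2: "ln (2::real) \<le> 1" using ln_le_minus_one[of 2] by simp
    have le: "chebyshev_psi (2 * n) \<le> 4 * real n + 2 * real n"
    proof -
      have "2 * real n * ln 2 \<le> 2 * real n * 1" using ln2 by (intro mult_left_mono) auto
      then show ?thesis using IH chebyshev_psi_double[of n] by simp
    qed
    show ?thesis
    proof (cases "even N")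
      case True
      then have "N = 2 * n" by (simp add: n_def)
      then show ?thesis using le by simp
    next
      case odd: False
      then have N: "N = Suc (2 * n)" by (simp add: n_def)
      have "chebyshev_psi N = chebyshev_psi (2 * n) + mangoldt N"
        unfolding chebyshev_psi_def N by simp
      also have "mangoldt N \<le> ln (real N)" by (rule mangoldt_le) (use False in auto)
      also have "ln (real N) \<le> 2 * real n" using ln_le_minus_one[of "real N"] N by simp
      finally show ?thesis using le N by simp
    qed
  qed
qed

lemma ln_fact_ge: "real N * ln (real N) - real N \<le> ln (fact N :: real)"
proof (induction N)
  case (Suc N)
  show ?case
  proof (cases "N = 0")
    case False
    have "real (Suc N) = real N * (1 + 1 / real N)" using False by (simp add: field_simps)
    then have "ln (real (Suc N)) - ln (real N) = ln (1 + 1 / real N)"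
      using False ln_mult_pos[of "real N" "1 + 1 / real N"] by (simp add: add_pos_nonneg)
    also have "\<dots> \<le> 1 / real N" by (rule ln_add_one_self_le_self) auto
    finally have "real N * (ln (real (Suc N)) - ln (real N)) \<le> real N * (1 / real N)"
      by (intro mult_left_mono) auto
    then have "real N * (ln (real (Suc N)) - ln (real N)) \<le> 1" using False by simp
    moreover have "ln (fact (Suc N) :: real) = ln (real (Suc N)) + ln (fact N)"
      by (simp add: ln_mult del: of_nat_Suc)
    ultimately show ?thesis using Suc by (simp add: algebra_simps)
  qed simp
qed simp

lemma ln_fact_le: "ln (fact N :: real) \<le> real N * ln (real N)"
proof (cases "N = 0")
  case False
  have "(fact N :: real) \<le> real N ^ N"
    by (metis fact_le_power of_nat_fact of_nat_power order_refl)
  then have "ln (fact N :: real) \<le> ln (real N ^ N)" by (intro ln_mono) auto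
  then show ?thesis using False by (simp add: ln_realpow)
qed simp

text \<open>\<open>ln (fact N)\<close> is the sum of \<open>mangoldt d * (N div d)\<close>.
  Replacing the integer part by \<open>N / d\<close> costs at most \<open>chebyshev_psi N\<close>,
  and Stirling's estimate evaluates the factorial.\<close>

lemma mertens_bound:
  assumes "N \<ge> 1"
  shows "\<bar>(\<Sum>d=1..N. mangoldt d / real d) - ln (real N)\<bar> \<le> 4"
proof -
  define S where "S = (\<Sum>d=1..N. mangoldt d / real d)"
  have NS: "real N * S = (\<Sum>d=1..N. mangoldt d * (real N / real d))"
    by (simp add: S_def sum_distrib_left mult_ac)
  have "ln (fact N) \<le> real N * S"
    unfolding NS ln_fact_mangoldt
    by (intro sum_mono mult_left_mono mangoldt_nonneg) (rule of_nat_div_le_of_nat)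
  then have "real N * (ln (real N) - 1) \<le> real N * S" using ln_fact_ge[of N] by (simp add: algebra_simps)
  then have 1: "ln (real N) - 1 \<le> S" using assms by simp
  have "real N * S \<le> (\<Sum>d=1..N. mangoldt d * (real (N div d) + 1))"
    unfolding NS
  proof (intro sum_mono mult_left_mono mangoldt_nonneg)
    fix d assume "d \<in> {1..N}"
    then have "N < d * (N div d) + d" by (metis atLeastAtMost_iff dividend_less_div_times mult.commute One_nat_def Suc_le_eq add.commute)
    then have "real N < real d * (real (N div d) + 1)"
      by (metis of_nat_1 of_nat_add of_nat_less_iff of_nat_mult distrib_left mult.right_neutral)
    then show "real N / real d \<le> real (N div d) + 1"
      using \<open>d \<in> {1..N}\<close> by (simp add: field_simps)
  qed
  also have "\<dots> = ln (fact N) + chebyshev_psi N"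
    unfolding ln_fact_mangoldt chebyshev_psi_def by (simp add: distrib_left sum.distrib)
  also have "\<dots> \<le> real N * ln (real N) + 4 * real N"
    using ln_fact_le chebyshev_psi_le by (intro add_mono) auto
  finally have "real N * S \<le> real N * (ln (real N) + 4)" by (simp add: algebra_simps)
  then have "S \<le> ln (real N) + 4" using assms by simp
  with 1 show ?thesis unfolding S_def by (simp add: abs_if)
qed

section \<open>The Moebius function and Shapiro's identity\<close>

definition moebius :: "nat \<Rightarrow> real" where
  "moebius n = (if squarefree n then (-1) ^ card (prime_factors n) else 0)"

lemma abs_moebius_le: "\<bar>moebius n\<bar> \<le> 1"
  by (simp add: moebius_def power_abs)

lemma moebius_mult_prime:
  assumes "prime p" "\<not> p dvd d" "d > 0"
  shows "moebius (p * d) = - moebius d"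
proof -
  have co: "coprime p d" using assms prime_imp_coprime by blast
  have "squarefree (p * d) \<longleftrightarrow> squarefree d"
    using assms(1) co squarefree_mult_coprime squarefree_multD(2) squarefree_prime by blast
  moreover have "prime_factors (p * d) = insert p (prime_factors d)"
    using assms by (auto simp: prime_factors_product prime_prime_factors)
  moreover have "p \<notin> prime_factors d" using assms by auto
  ultimately show ?thesis by (simp add: moebius_def)
qed

lemma sum_moebius_divisors:
  assumes "n > 0"
  shows "(\<Sum>d | d dvd n. moebius d) = (if n = 1 then 1 else 0)"
proof (cases "n = 1")
  case True
  then show ?thesis by (simp add: moebius_def)
next
  case False
  then obtain p where p: "prime p" "p dvd n" using prime_factor_nat by blast
  define A where "A = {d. d dvd n \<and> squarefree d \<and> \<not> p dvd d}"
  define B where "B = {d. d dvd n \<and> squarefree d \<and> p dvd d}"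
  have fin: "finite {d. d dvd n}" using assms by simp
  have finA: "finite A" "finite B" unfolding A_def B_def by (rule finite_subset[OF _ fin], blast)+
  have "(\<Sum>d | d dvd n. moebius d) = (\<Sum>d\<in>A \<union> B. moebius d)"
    using fin by (intro sum.mono_neutral_right) (auto simp: A_def B_def moebius_def)
  also have "\<dots> = (\<Sum>d\<in>A. moebius d) + (\<Sum>d\<in>B. moebius d)"
    by (intro sum.union_disjoint finA) (auto simp: A_def B_def)
  also have "(\<Sum>d\<in>B. moebius d) = (\<Sum>d\<in>A. moebius (p * d))"
  proof (rule sum.reindex_bij_witness[of _ "\<lambda>d. p * d" "\<lambda>d. d div p"])
    fix d assume d: "d \<in> B"
    then obtain e where e: "d = p * e" by (auto simp: B_def)
    have "\<not> p dvd e"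
    proof
      assume "p dvd e"
      then have "p ^ 2 dvd d" by (simp add: e power2_eq_square)
      then have "p dvd 1" using d squarefreeD unfolding B_def by blast
      then show False using p(1) by simp
    qed
    moreover have "squarefree e" using d unfolding B_def e by (auto dest: squarefree_multD(2))
    ultimately show "d div p \<in> A" using d p(1) by (auto simp: A_def B_def e prime_gt_0_nat dest: dvd_mult_right)
    show "p * (d div p) = d" using e p by (simp add: prime_gt_0_nat)
  next
    fix d assume d: "d \<in> A"
    then have co: "coprime p d" using p prime_imp_coprime by (auto simp: A_def)
    then have "p * d dvd n" using d p divides_mult by (auto simp: A_def)
    then show "p * d \<in> B" using d p co by (simp add: A_def B_def squarefree_mult_coprime squarefree_prime)
    show "p * d div p = d" using p by (simp add: prime_gt_0_nat)
  next
    fix d assume "d \<in> B"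
    then show "moebius (p * (d div p)) = moebius d" by (auto simp: B_def)
  qed
  also have "\<dots> = (\<Sum>d\<in>A. - moebius d)"
  proof (intro sum.cong refl moebius_mult_prime p(1))
    fix d assume "d \<in> A"
    then show "\<not> p dvd d" "d > 0" using assms by (auto simp: A_def intro: Nat.gr0I)
  qed
  finally show ?thesis using False by (simp add: sum_negf)
qed

lemma sum_divisors_nested:
  fixes g :: "nat \<Rightarrow> nat \<Rightarrow> 'a::comm_monoid_add"
  assumes "n > 0"
  shows "(\<Sum>d | d dvd n. \<Sum>e | e dvd n div d. g d e) = (\<Sum>e | e dvd n. \<Sum>d | d dvd n div e. g d e)"
proof -
  have fin: "finite {d. d dvd n}" "\<And>d. d dvd n \<Longrightarrow> finite {e. e dvd n div d}" using assms by (auto elim!: dvdE)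
  have "(\<Sum>d | d dvd n. \<Sum>e | e dvd n div d. g d e) = (\<Sum>(d, e)\<in>(SIGMA d:{d. d dvd n}. {e. e dvd n div d}). g d e)"
    using fin by (intro sum.Sigma) auto
  also have "\<dots> = (\<Sum>(e, d)\<in>(SIGMA e:{e. e dvd n}. {d. d dvd n div e}). g d e)"
  proof (rule sum.reindex_bij_witness[of _ "\<lambda>(d, e). (e, d)" "\<lambda>(d, e). (e, d)"])
    have *: "e dvd n \<and> d dvd n div e" if "d dvd n" "e dvd n div d" for d e
      using that assms by (auto elim!: dvdE simp: mult_ac)
    fix a assume "a \<in> (SIGMA d:{d. d dvd n}. {e. e dvd n div d})"
    then show "(case a of (d, e) \<Rightarrow> (e, d)) \<in> (SIGMA e:{e. e dvd n}. {d. d dvd n div e})"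
      using * by (auto split: prod.splits)
  next
    have *: "e dvd n \<and> d dvd n div e" if "d dvd n" "e dvd n div d" for d e
      using that assms by (auto elim!: dvdE simp: mult_ac)
    fix a assume "a \<in> (SIGMA d:{d. d dvd n}. {e. e dvd n div d})"
    then show "(case a of (d, e) \<Rightarrow> (e, d)) \<in> (SIGMA e:{e. e dvd n}. {d. d dvd n div e})"
      using * by (auto split: prod.splits)
  qed auto
  also have "\<dots> = (\<Sum>e | e dvd n. \<Sum>d | d dvd n div e. g d e)"
    using fin by (intro sum.Sigma[symmetric]) auto
  finally show ?thesis .
qed

text \<open>Moebius inversion of the logarithm produces \<open>mangoldt n\<close>, and the constant
  \<open>ln x\<close> is seen at \<open>n = 1\<close> only. With \<open>x = N\<close> this extra
  term detects a vanishing L-value.\<close>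

lemma sum_moebius_ln:
  assumes "n > 0" "x > 0"
  shows "(\<Sum>d | d dvd n. moebius d * ln (x / real d)) = (if n = 1 then ln x else 0) + mangoldt n"
proof -
  have ln_split: "ln (x / real d) = ln (x / real n) + (\<Sum>e | e dvd n div d. mangoldt e)" if "d dvd n" for d
  proof -
    obtain e where e: "n = d * e" using \<open>d dvd n\<close> by blast
    then have pos: "d > 0" "e > 0" using assms by auto
    have "ln (x / real d) = ln (x / real n) + ln (real e)"
      using e pos assms by (simp add: ln_div ln_mult)
    moreover have "(\<Sum>a | a dvd e. mangoldt a) = ln (real e)"
      using mangoldt_sum[of e, where ?'a = real] pos by simp
    ultimately show ?thesis using e pos by simp
  qed
  have "(\<Sum>d | d dvd n. moebius d * ln (x / real d))
    = (\<Sum>d | d dvd n. moebius d * ln (x / real n)) + (\<Sum>d | d dvd n. \<Sum>e | e dvd n div d. moebius d * mangoldt e)"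
  proof -
    have "moebius d * ln (x / real d)
      = moebius d * ln (x / real n) + (\<Sum>e | e dvd n div d. moebius d * mangoldt e)" if "d \<in> {d. d dvd n}" for d
    proof -
      have dn: "d dvd n" using that by simp
      show ?thesis
        by (simp only: ln_split[OF dn] distrib_left sum_distrib_left)
    qed
    then have "(\<Sum>d | d dvd n. moebius d * ln (x / real d))
      = (\<Sum>d | d dvd n. moebius d * ln (x / real n) + (\<Sum>e | e dvd n div d. moebius d * mangoldt e))"
      by (intro sum.cong refl)
    then show ?thesis by (simp only: sum.distrib)
  qed
  also have "(\<Sum>d | d dvd n. \<Sum>e | e dvd n div d. moebius d * mangoldt e)
    = (\<Sum>e | e dvd n. \<Sum>d | d dvd n div e. moebius d * mangoldt e)"
    using assms by (intro sum_divisors_nested)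
  also have "\<dots> = (\<Sum>e | e dvd n. if e = n then mangoldt e else 0)"
  proof (intro sum.cong refl)
    fix e assume "e \<in> {e. e dvd n}"
    then obtain k where k: "n = e * k" by auto
    then have pos: "e > 0" "k > 0" using assms by auto
    have "(\<Sum>d | d dvd n div e. moebius d * mangoldt e) = mangoldt e * (\<Sum>d | d dvd k. moebius d)"
      using k pos by (simp add: sum_distrib_left mult.commute)
    also have "\<dots> = (if e = n then mangoldt e else 0)"
      using sum_moebius_divisors[OF pos(2)] k pos by auto
    finally show "(\<Sum>d | d dvd n div e. moebius d * mangoldt e) = (if e = n then mangoldt e else 0)" .
  qed
  also have "\<dots> = mangoldt n" using assms by simp
  also have "(\<Sum>d | d dvd n. moebius d * ln (x / real n)) = (if n = 1 then ln x else 0)"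
    using sum_moebius_divisors[OF assms(1)] by (simp add: sum_distrib_right[symmetric])
  finally show ?thesis .
qed

section \<open>L-series at \<open>1\<close> of nonprincipal characters\<close>

text \<open>Summation by parts. Sums starting at \<open>a\<close> are differences of two sums
  starting at \<open>1\<close>, hence the factor \<open>2\<close>. The general type serves complex
  characters and real sequences alike.\<close>

lemma abel_bound:
  fixes \<xi> :: "nat \<Rightarrow> 'a::real_normed_algebra_1" and f :: "nat \<Rightarrow> real"
  assumes P: "\<And>N. norm (\<Sum>n=1..N. \<xi> n) \<le> M" and a: "a \<ge> 1"
    and dec: "\<And>n. n \<ge> a \<Longrightarrow> f (Suc n) \<le> f n" and nonneg: "\<And>n. n \<ge> a \<Longrightarrow> 0 \<le> f n"
  shows "norm (\<Sum>n=a..b. \<xi> n * of_real (f n)) \<le> 2 * M * f a"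
proof -
  have M0: "0 \<le> M" using P[of 0] by simp
  show ?thesis
proof (cases "a \<le> b")
  case False
  then show ?thesis using M0 nonneg[of a] by simp
next
  case True
  define X where "X n = (\<Sum>i=a..n. \<xi> i)" for n
  have X: "norm (X n) \<le> 2 * M" if "n \<ge> a" for n
  proof -
    have "{1..n} = {1..a-1} \<union> {a..n}" using that a by auto
    then have "(\<Sum>i=1..n. \<xi> i) = (\<Sum>i=1..a-1. \<xi> i) + X n"
      unfolding X_def using a by (subst sum.union_disjoint[symmetric]) auto
    then have "X n = (\<Sum>i=1..n. \<xi> i) - (\<Sum>i=1..a-1. \<xi> i)" by simp
    then show ?thesis using norm_triangle_ineq4 P[of n] P[of "a - 1"] by (smt (verit))
  qed
  have "norm ((\<Sum>n=a..b. \<xi> n * of_real (f n)) - X b * of_real (f b)) \<le> 2 * M * (f a - f b)"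
    using True
  proof (induction b rule: dec_induct)
    case base
    then show ?case by (simp add: X_def)
  next
    case (step b)
    have "(\<Sum>n=a..Suc b. \<xi> n * of_real (f n)) - X (Suc b) * of_real (f (Suc b))
      = ((\<Sum>n=a..b. \<xi> n * of_real (f n)) - X b * of_real (f b)) + X b * of_real (f b - f (Suc b))"
      using step by (simp add: X_def algebra_simps)
    also have "norm \<dots> \<le> 2 * M * (f a - f b) + 2 * M * (f b - f (Suc b))"
    proof (intro norm_triangle_mono step.IH)
      have "norm (X b * of_real (f b - f (Suc b))) \<le> norm (X b) * norm (of_real (f b - f (Suc b)) :: 'a)"
        by (rule norm_mult_ineq)
      also have "\<dots> \<le> 2 * M * (f b - f (Suc b))"
        using X[of b] dec[of b] step M0 by (simp only: norm_of_real) (intro mult_mono, auto)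
      finally show "norm (X b * of_real (f b - f (Suc b))) \<le> 2 * M * (f b - f (Suc b))" .
    qed
    finally show ?case by (simp add: algebra_simps)
  qed
  moreover have "norm (X b * of_real (f b)) \<le> 2 * M * f b"
  proof -
    have "norm (X b * of_real (f b)) \<le> norm (X b) * norm (of_real (f b) :: 'a)"
      by (rule norm_mult_ineq)
    also have "\<dots> \<le> 2 * M * f b"
      using X[of b] nonneg[of b] True M0 by (simp only: norm_of_real) (intro mult_mono, auto)
    finally show ?thesis .
  qed
  ultimately have "norm (((\<Sum>n=a..b. \<xi> n * of_real (f n)) - X b * of_real (f b)) + X b * of_real (f b))
     \<le> 2 * M * (f a - f b) + 2 * M * f b"
    by (rule norm_triangle_mono)
  then show ?thesis by (simp add: algebra_simps)
qed
qed

text \<open>Of a character, complete multiplicativity, the bound \<open>1\<close> and bounded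
  partial sums are retained; the last property is what sets it apart from the principal one.\<close>

locale nonprincipal_char =
  fixes \<xi> :: "nat \<Rightarrow> complex" and M :: real
  assumes mult: "\<xi> (a * b) = \<xi> a * \<xi> b" and one: "\<xi> 1 = 1" and norm_le: "norm (\<xi> n) \<le> 1"
    and partial: "norm (\<Sum>n=1..N. \<xi> n) \<le> M"
begin

definition L_one :: complex where
  "L_one = lim (\<lambda>N. \<Sum>n=1..N. \<xi> n * of_real (1 / real n))"

lemma M_nonneg: "0 \<le> M" using partial[of 0] by simp

lemma L_partial_diff:
  assumes "N \<le> K"
  shows "norm ((\<Sum>n=1..K. \<xi> n * of_real (1 / real n)) - (\<Sum>n=1..N. \<xi> n * of_real (1 / real n)))
    \<le> 2 * M / (real N + 1)"
proof -
  have "{1..K} = {1..N} \<union> {Suc N..K}" using assms by auto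
  then have "(\<Sum>n=1..K. \<xi> n * of_real (1 / real n))
    = (\<Sum>n=1..N. \<xi> n * of_real (1 / real n)) + (\<Sum>n=Suc N..K. \<xi> n * of_real (1 / real n))"
    by (simp only:) (rule sum.union_disjoint, auto)
  moreover have "norm (\<Sum>n=Suc N..K. \<xi> n * of_real (1 / real n)) \<le> 2 * M * (1 / real (Suc N))"
    by (rule abel_bound[OF partial]) (auto simp: field_simps)
  ultimately show ?thesis by (simp add: add.commute)
qed

lemma L_convergent: "(\<lambda>N. \<Sum>n=1..N. \<xi> n * of_real (1 / real n)) \<longlonglongrightarrow> L_one"
proof -
  define P where "P N = (\<Sum>n=1..N. \<xi> n * of_real (1 / real n))" for N
  have PP: "norm (P K - P N) \<le> 2 * M / (real N + 1)" if "N \<le> K" for N K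
    using L_partial_diff[OF that] by (simp add: P_def)
  have "Cauchy P"
  proof (rule CauchyI)
    fix e :: real assume e: "e > 0"
    obtain k :: nat where k: "2 * M / e < real k" using reals_Archimedean2 by blast
    have k': "2 * M / (real k + 1) < e" using k e M_nonneg by (simp add: field_simps)
    have *: "norm (P a - P b) < e" if "k \<le> b" "b \<le> a" for a b
    proof -
      have "norm (P a - P b) \<le> 2 * M / (real b + 1)" by (rule PP) fact
      also have "\<dots> \<le> 2 * M / (real k + 1)" using that M_nonneg by (intro divide_left_mono) auto
      finally show ?thesis using k' by simp
    qed
    show "\<exists>k. \<forall>a\<ge>k. \<forall>b\<ge>k. norm (P a - P b) < e"
    proof (intro exI[of _ k] allI impI)
      fix a b assume "k \<le> a" "k \<le> b"
      then show "norm (P a - P b) < e" using *[of a b] *[of b a] by (cases "a \<le> b") (auto simp: norm_minus_commute)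
    qed
  qed
  then have "convergent P" by (simp add: Cauchy_convergent_iff)
  then show ?thesis unfolding L_one_def P_def[abs_def] by (simp add: convergent_LIMSEQ_iff)
qed

lemma L_approx: "norm ((\<Sum>n=1..N. \<xi> n * of_real (1 / real n)) - L_one) \<le> 2 * M / (real N + 1)"
proof (rule LIMSEQ_le_const2)
  show "(\<lambda>K. norm ((\<Sum>n=1..N. \<xi> n * of_real (1 / real n)) - (\<Sum>n=1..K. \<xi> n * of_real (1 / real n))))
     \<longlonglongrightarrow> norm ((\<Sum>n=1..N. \<xi> n * of_real (1 / real n)) - L_one)"
    by (intro tendsto_intros L_convergent)
  show "\<exists>k. \<forall>K\<ge>k. norm ((\<Sum>n=1..N. \<xi> n * of_real (1 / real n)) - (\<Sum>n=1..K. \<xi> n * of_real (1 / real n)))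
     \<le> 2 * M / (real N + 1)"
    using L_partial_diff by (intro exI[of _ N] allI impI) (subst norm_minus_commute, blast)
qed

lemma L_approx_quot:
  assumes "d \<ge> 1" "N \<ge> 1"
  shows "norm ((\<Sum>e=1..N div d. \<xi> e * of_real (1 / real e)) - L_one) \<le> 2 * M * real d / real N"
proof -
  have "N < d * (N div d) + d" using assms by (metis dividend_less_div_times mult.commute Suc_le_eq One_nat_def add.commute)
  then have "real N < real d * (real (N div d) + 1)"
    by (metis of_nat_1 of_nat_add of_nat_less_iff of_nat_mult distrib_left mult.right_neutral)
  then have "2 * M * real N \<le> 2 * M * (real d * (real (N div d) + 1))"
    using M_nonneg by (intro mult_left_mono) auto
  then have "2 * M / (real (N div d) + 1) \<le> 2 * M * real d / real N"
    using assms by (simp add: field_simps)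
  then show ?thesis using L_approx[of "N div d"] by linarith
qed

definition S :: "nat \<Rightarrow> complex" where
  "S N = (\<Sum>n=1..N. \<xi> n * of_real (mangoldt n / real n))"

lemma ln_over_antimono:
  assumes "n \<ge> 3"
  shows "ln (real (Suc n)) / real (Suc n) \<le> ln (real n) / real n"
proof -
  have "real (Suc n) = real n * (1 + 1 / real n)" using assms by (simp add: field_simps)
  then have "ln (real (Suc n)) = ln (real n) + ln (1 + 1 / real n)"
    using assms ln_mult_pos[of "real n" "1 + 1 / real n"] by (simp add: add_pos_nonneg)
  moreover have "ln (1 + 1 / real n) \<le> 1 / real n" by (rule ln_add_one_self_le_self) auto
  ultimately have "real n * ln (real (Suc n)) \<le> real n * (ln (real n) + 1 / real n)"
    by (intro mult_left_mono) auto
  also have "\<dots> = real n * ln (real n) + 1" using assms by (simp add: field_simps)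
  also have "1 \<le> ln (real n)"
  proof -
    have "exp 1 \<le> (3::real)" by (rule exp_le)
    also have "3 \<le> real n" using assms by simp
    finally show ?thesis using assms by (subst ln_ge_iff) auto
  qed
  finally show ?thesis using assms by (simp add: field_simps)
qed

text \<open>The sum of \<open>\<xi> n * ln n / n\<close> is bounded by summation by parts. Writing
  \<open>ln\<close> as a divisor sum of \<open>mangoldt\<close> turns it into
  \<open>S N * L_one\<close>, up to an error that Chebyshev's bound controls; then one divides by
  \<open>L_one\<close>.\<close>

lemma S_bounded:
  assumes "L_one \<noteq> 0"
  shows "\<exists>C. \<forall>N\<ge>1. norm (S N) \<le> C"
proof (intro exI allI impI)
  fix N :: nat assume N: "N \<ge> 1"
  define T where "T = (\<Sum>n=1..N. \<xi> n * of_real (ln (real n) / real n))"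
  have T: "norm T \<le> 2 + 2 * M * (ln 3 / 3)"
  proof -
    \<comment> \<open>\<open>ln n / n\<close> decreases only from \<open>3\<close> on, so the first
      two terms are treated separately.\<close>
    have part: "norm (\<Sum>n=3..N. \<xi> n * of_real (ln (real n) / real n)) \<le> 2 * M * (ln (real 3) / real 3)"
      by (rule abel_bound[OF partial]) (use ln_over_antimono in auto)
    have trm: "norm (\<xi> 2 * of_real (ln (real 2) / real 2)) \<le> 1"
    proof -
      have "norm (\<xi> 2) * \<bar>ln (2::real) / 2\<bar> \<le> 1 * 1"
        using norm_le[of 2] ln_le_minus_one[of "2::real"] by (intro mult_mono) auto
      then show ?thesis by (simp add: norm_mult)
    qed
    show ?thesis
    proof (cases "N \<ge> 2")
      case True
      then have "{1..N} = insert 1 (insert 2 {3..N})" by auto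
      then have "T = \<xi> 2 * of_real (ln (real 2) / real 2) + (\<Sum>n=3..N. \<xi> n * of_real (ln (real n) / real n))"
        unfolding T_def by simp
      then have "norm T \<le> 1 + 2 * M * (ln (real 3) / real 3)"
        using norm_triangle_mono[OF trm part] by simp
      then show ?thesis by simp
    next
      case False
      then have "N = 1" using N by simp
      then show ?thesis using M_nonneg by (simp add: T_def add_nonneg_nonneg)
    qed
  qed
  have "T = (\<Sum>n=1..N. \<Sum>d | d dvd n. \<xi> d * \<xi> (n div d) * of_real (mangoldt d / (real d * real (n div d))))"
    unfolding T_def
  proof (intro sum.cong refl)
    fix n assume n: "n \<in> {1..N}"
    have "\<xi> n * of_real (ln (real n) / real n) = \<xi> n * of_real ((\<Sum>d | d dvd n. mangoldt d) / real n)"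
      using n by (subst mangoldt_sum) auto
    also have "\<dots> = (\<Sum>d | d dvd n. \<xi> n * of_real (mangoldt d / real n))"
      by (simp add: sum_divide_distrib sum_distrib_left)
    also have "\<dots> = (\<Sum>d | d dvd n. \<xi> d * \<xi> (n div d) * of_real (mangoldt d / (real d * real (n div d))))"
    proof (intro sum.cong refl)
      fix d assume "d \<in> {d. d dvd n}"
      then obtain k where k: "n = d * k" by auto
      then have "d > 0" using n by (auto intro: Nat.gr0I)
      then show "\<xi> n * of_real (mangoldt d / real n)
        = \<xi> d * \<xi> (n div d) * of_real (mangoldt d / (real d * real (n div d)))"
        using k by (simp add: mult)
    qed
    finally show "\<xi> n * of_real (ln (real n) / real n)
      = (\<Sum>d | d dvd n. \<xi> d * \<xi> (n div d) * of_real (mangoldt d / (real d * real (n div d))))" .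
  qed
  also have "\<dots> = (\<Sum>d=1..N. \<Sum>e=1..N div d. \<xi> d * \<xi> e * of_real (mangoldt d / (real d * real e)))"
    by (rule sum_divisors_swap)
  also have "\<dots> = (\<Sum>d=1..N. \<xi> d * of_real (mangoldt d / real d) * (\<Sum>e=1..N div d. \<xi> e * of_real (1 / real e)))"
    by (simp add: sum_distrib_left mult_ac)
  finally have T_eq: "T = (\<Sum>d=1..N. \<xi> d * of_real (mangoldt d / real d) * (\<Sum>e=1..N div d. \<xi> e * of_real (1 / real e)))" .
  have "norm (T - S N * L_one) \<le> 8 * M"
  proof -
    have "T - S N * L_one = (\<Sum>d=1..N. \<xi> d * of_real (mangoldt d / real d) * ((\<Sum>e=1..N div d. \<xi> e * of_real (1 / real e)) - L_one))"
      unfolding T_eq S_def by (simp only: sum_distrib_right right_diff_distrib sum_subtractf)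
    also have "norm \<dots> \<le> (\<Sum>d=1..N. mangoldt d * (2 * M / real N))"
    proof (intro sum_norm_le)
      fix d assume d: "d \<in> {1..N}"
      have "norm (\<xi> d * of_real (mangoldt d / real d) * ((\<Sum>e=1..N div d. \<xi> e * of_real (1 / real e)) - L_one))
        = norm (\<xi> d) * (mangoldt d / real d) * norm ((\<Sum>e=1..N div d. \<xi> e * of_real (1 / real e)) - L_one)"
        unfolding norm_mult norm_of_real using mangoldt_nonneg[of d] by simp
      also have "\<dots> \<le> 1 * (mangoldt d / real d) * (2 * M * real d / real N)"
        using d N L_approx_quot[of d N] norm_le[of d] mangoldt_nonneg[of d] by (intro mult_mono) auto
      also have "\<dots> = mangoldt d * (2 * M / real N)" using d by simp
      finally show "norm (\<xi> d * of_real (mangoldt d / real d) * ((\<Sum>e=1..N div d. \<xi> e * of_real (1 / real e)) - L_one))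
        \<le> mangoldt d * (2 * M / real N)" .
    qed
    also have "\<dots> = chebyshev_psi N * (2 * M / real N)" by (simp only: chebyshev_psi_def sum_distrib_right)
    also have "\<dots> \<le> (4 * real N) * (2 * M / real N)"
      using chebyshev_psi_le[of N] M_nonneg by (intro mult_right_mono) auto
    also have "\<dots> = 8 * M" using N by simp
    finally show ?thesis .
  qed
  then have "norm (S N * L_one) \<le> 8 * M + (2 + 2 * M * (ln 3 / 3))"
    using T norm_triangle_sub[of "S N * L_one" T] by (simp add: norm_minus_commute)
  then show "norm (S N) \<le> (8 * M + (2 + 2 * M * (ln 3 / 3))) / norm L_one"
    using assms by (simp add: norm_mult field_simps)
qed

text \<open>The same double sum with \<open>moebius d * ln (N / d)\<close> in the place of
  \<open>mangoldt d\<close>. As \<open>L_one = 0\<close>, the inner sums are themselves error terms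
  of order \<open>d / N\<close>, and the sum of \<open>ln (N / d)\<close> is of order
  \<open>N\<close> by Stirling's estimate.\<close>

lemma S_log:
  assumes "L_one = 0"
  shows "\<exists>C. \<forall>N\<ge>1. norm (of_real (ln (real N)) + S N) \<le> C"
proof (intro exI allI impI)
  fix N :: nat assume N: "N \<ge> 1"
  have "of_real (ln (real N)) + S N
    = (\<Sum>n=1..N. \<xi> n * of_real (((if n = 1 then ln (real N) else 0) + mangoldt n) / real n))"
  proof -
    have "(\<Sum>n=1..N. \<xi> n * of_real (((if n = 1 then ln (real N) else 0) + mangoldt n) / real n))
      = (\<Sum>n=1..N. (if n = 1 then of_real (ln (real N)) else 0) + \<xi> n * of_real (mangoldt n / real n))"
      using one by (intro sum.cong) (auto simp: algebra_simps)
    then show ?thesis using N by (simp add: sum.distrib S_def)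
  qed
  also have "\<dots> = (\<Sum>n=1..N. \<Sum>d | d dvd n. \<xi> d * \<xi> (n div d) * of_real (moebius d * ln (real N / real d) / (real d * real (n div d))))"
  proof (intro sum.cong refl)
    fix n assume n: "n \<in> {1..N}"
    then have "(if n = 1 then ln (real N) else 0) + mangoldt n = (\<Sum>d | d dvd n. moebius d * ln (real N / real d))"
      using sum_moebius_ln[of n "real N"] N by simp
    then have "\<xi> n * of_real (((if n = 1 then ln (real N) else 0) + mangoldt n) / real n)
      = (\<Sum>d | d dvd n. \<xi> n * of_real (moebius d * ln (real N / real d) / real n))"
      by (simp add: sum_divide_distrib sum_distrib_left)
    also have "\<dots> = (\<Sum>d | d dvd n. \<xi> d * \<xi> (n div d) * of_real (moebius d * ln (real N / real d) / (real d * real (n div d))))"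
    proof (intro sum.cong refl)
      fix d assume "d \<in> {d. d dvd n}"
      then obtain k where k: "n = d * k" by auto
      then have "d > 0" using n by (auto intro: Nat.gr0I)
      then show "\<xi> n * of_real (moebius d * ln (real N / real d) / real n)
        = \<xi> d * \<xi> (n div d) * of_real (moebius d * ln (real N / real d) / (real d * real (n div d)))"
        using k by (simp add: mult)
    qed
    finally show "\<xi> n * of_real (((if n = 1 then ln (real N) else 0) + mangoldt n) / real n)
      = (\<Sum>d | d dvd n. \<xi> d * \<xi> (n div d) * of_real (moebius d * ln (real N / real d) / (real d * real (n div d))))" .
  qed
  also have "\<dots> = (\<Sum>d=1..N. \<Sum>e=1..N div d. \<xi> d * \<xi> e * of_real (moebius d * ln (real N / real d) / (real d * real e)))"
    by (rule sum_divisors_swap)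
  also have "\<dots> = (\<Sum>d=1..N. \<xi> d * of_real (moebius d * ln (real N / real d) / real d) * ((\<Sum>e=1..N div d. \<xi> e * of_real (1 / real e)) - L_one))"
    unfolding assms diff_zero sum_distrib_left by (intro sum.cong refl) simp
  also have "norm \<dots> \<le> (\<Sum>d=1..N. ln (real N / real d) * (2 * M / real N))"
  proof (intro sum_norm_le)
    fix d assume d: "d \<in> {1..N}"
    have lnn: "0 \<le> ln (real N / real d)" using d by (intro ln_ge_zero) (auto simp: field_simps)
    have "norm (\<xi> d * of_real (moebius d * ln (real N / real d) / real d) * ((\<Sum>e=1..N div d. \<xi> e * of_real (1 / real e)) - L_one))
      = norm (\<xi> d) * (\<bar>moebius d\<bar> * (ln (real N / real d) / real d)) * norm ((\<Sum>e=1..N div d. \<xi> e * of_real (1 / real e)) - L_one)"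
      unfolding norm_mult norm_of_real using lnn by (simp add: abs_mult)
    also have "\<dots> \<le> 1 * (1 * (ln (real N / real d) / real d)) * (2 * M * real d / real N)"
      using d N L_approx_quot[of d N] norm_le[of d] abs_moebius_le[of d] lnn by (intro mult_mono) auto
    also have "\<dots> = ln (real N / real d) * (2 * M / real N)" using d by simp
    finally show "norm (\<xi> d * of_real (moebius d * ln (real N / real d) / real d) * ((\<Sum>e=1..N div d. \<xi> e * of_real (1 / real e)) - L_one))
        \<le> ln (real N / real d) * (2 * M / real N)" .
  qed
  also have "\<dots> = (real N * ln (real N) - ln (fact N)) * (2 * M / real N)"
  proof -
    have lnf: "ln (fact N :: real) = (\<Sum>n=1..N. ln (real n))"
      by (induction N) (auto simp: ln_mult)
    have "(\<Sum>d=1..N. ln (real N / real d)) = (\<Sum>d=1..N. ln (real N) - ln (real d))"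
      using N by (intro sum.cong refl) (simp add: ln_div)
    then have "(\<Sum>d=1..N. ln (real N / real d)) = real N * ln (real N) - ln (fact N)"
      by (simp add: sum_subtractf lnf)
    then show ?thesis by (simp only: sum_distrib_right[symmetric])
  qed
  also have "\<dots> \<le> real N * (2 * M / real N)"
    using ln_fact_ge[of N] M_nonneg by (intro mult_right_mono) auto
  also have "\<dots> = 2 * M" using N by simp
  finally show "norm (of_real (ln (real N)) + S N) \<le> 2 * M" .
qed

end

section \<open>Nonvanishing for real characters\<close>

lemma sum_power_nonneg:
  fixes x :: real
  assumes "\<bar>x\<bar> \<le> 1"
  shows "0 \<le> (\<Sum>i\<le>k. x ^ i)"
proof (cases "x \<ge> 0")
  case True
  then show ?thesis by (intro sum_nonneg) auto
next
  case False
  have "(1 - x) * (\<Sum>i\<le>k. x ^ i) = 1 - x ^ Suc k" by (rule sum_gp_basic)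
  moreover have "x ^ Suc k \<le> 1" using assms
    by (metis abs_le_D1 power_abs power_le_one abs_ge_zero)
  ultimately have "0 \<le> (1 - x) * (\<Sum>i\<le>k. x ^ i)" by simp
  then show ?thesis using False by (simp add: zero_le_mult_iff)
qed

lemma sum_divisors_prime_power_mult:
  fixes r :: "nat \<Rightarrow> real"
  assumes mult: "\<And>a b. r (a * b) = r a * r b" and one: "r 1 = 1" and p: "prime p" "\<not> p dvd u" "u > 0"
  shows "(\<Sum>d | d dvd p ^ k * u. r d) = (\<Sum>i\<le>k. r p ^ i) * (\<Sum>d | d dvd u. r d)"
proof -
  have pow: "r (p ^ i) = r p ^ i" for i by (induction i) (auto simp: mult one[unfolded One_nat_def])
  have "(\<Sum>i\<le>k. r p ^ i) * (\<Sum>d | d dvd u. r d) = (\<Sum>(i, d)\<in>{..k} \<times> {d. d dvd u}. r (p ^ i * d))"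
    by (simp add: sum_product sum.cartesian_product mult pow)
  also have "\<dots> = (\<Sum>x\<in>(\<lambda>(i, d). p ^ i * d) ` ({..k} \<times> {d. d dvd u}). r x)"
  proof (subst sum.reindex)
    show "inj_on (\<lambda>(i, d). p ^ i * d) ({..k} \<times> {d. d dvd u})"
    proof (rule inj_onI, clarify)
      fix i d j e assume de: "d dvd u" "e dvd u" and eq: "p ^ i * d = p ^ j * e"
      have nd: "\<not> p dvd d" "\<not> p dvd e" "d > 0" "e > 0"
        using de p by (auto dest: dvd_trans intro: Nat.gr0I)
      have "multiplicity p (p ^ i * d) = i" "multiplicity p (p ^ j * e) = j"
        using nd p(1) by (auto simp: prime_elem_multiplicity_mult_distrib not_dvd_imp_multiplicity_0)
      then have "i = j" using eq by simp
      then show "i = j \<and> d = e" using eq p(1) by (simp add: prime_gt_0_nat)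
    qed
  qed (auto simp: case_prod_unfold)
  also have "(\<lambda>(i, d). p ^ i * d) ` ({..k} \<times> {d. d dvd u}) = {d. d dvd p ^ k * u}"
  proof (intro equalityI subsetI)
    fix x assume "x \<in> {d. d dvd p ^ k * u}"
    then obtain b c where "x = b * c" "b dvd p ^ k" "c dvd u" using division_decomp by blast
    then show "x \<in> (\<lambda>(i, d). p ^ i * d) ` ({..k} \<times> {d. d dvd u})"
      using p(1) by (auto simp: divides_primepow_nat)
  qed (auto intro: mult_dvd_mono le_imp_power_dvd)
  finally show ?thesis by simp
qed

text \<open>The divisor sum is multiplicative: prime powers split off one at a time, each
  contributing a finite geometric sum with ratio in \<open>[-1, 1]\<close>.\<close>

lemma sum_divisors_nonneg:
  fixes r :: "nat \<Rightarrow> real"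
  assumes mult: "\<And>a b. r (a * b) = r a * r b" and one: "r 1 = 1" and le: "\<And>n. \<bar>r n\<bar> \<le> 1" and "n > 0"
  shows "0 \<le> (\<Sum>d | d dvd n. r d)"
  using \<open>n > 0\<close>
proof (induction n rule: less_induct)
  case (less n)
  show ?case
  proof (cases "n = 1")
    case True
    then show ?thesis using one by simp
  next
    case False
    then obtain p where p: "prime p" "p dvd n" using prime_factor_nat by blast
    obtain u where u: "n = p ^ multiplicity p n * u" "\<not> p dvd u"
      by (metis less.prems mult.commute multiplicity_decompose' not_gr_zero not_prime_unit p(1))
    have pos: "u > 0" using u(2) by (auto intro: Nat.gr0I)
    have "multiplicity p n \<noteq> 0" using p less.prems by (simp add: prime_multiplicity_gt_zero_iff[THEN iffD2])
    then have "p ^ multiplicity p n > 1" using p(1) by (metis neq0_conv one_less_power prime_gt_1_nat)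
    then have "u < n" using pos u(1) by (metis mult_less_cancel2 nat_mult_1)
    then have "0 \<le> (\<Sum>d | d dvd u. r d)" using less.IH pos by blast
    then show ?thesis
      by (subst u(1), subst sum_divisors_prime_power_mult[OF mult one p(1) u(2) pos])
        (intro mult_nonneg_nonneg sum_power_nonneg le)
  qed
qed

text \<open>Arithmetic and geometric mean of the terms with indices \<open>i\<close> and
  \<open>n - 1 - i\<close>; ratio \<open>s ^ 2\<close> makes every geometric mean equal to
  \<open>s ^ (n - 1)\<close>.\<close>

lemma geometric_ge:
  fixes s :: real
  assumes "0 < s"
  shows "real n * s ^ (n - 1) \<le> (\<Sum>i<n. (s ^ 2) ^ i)"
proof -
  have "2 * (\<Sum>i<n. (s ^ 2) ^ i) = (\<Sum>i<n. (s ^ 2) ^ i) + (\<Sum>i<n. (s ^ 2) ^ (n - Suc i))"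
    by (simp add: sum.nat_diff_reindex)
  also have "\<dots> = (\<Sum>i<n. (s ^ i) ^ 2 + (s ^ (n - Suc i)) ^ 2)"
    by (simp add: sum.distrib power_mult[symmetric] mult.commute)
  also have "\<dots> \<ge> (\<Sum>i<n. 2 * s ^ (n - 1))"
  proof (intro sum_mono)
    fix i assume "i \<in> {..<n}"
    then have "s ^ (n - 1) = s ^ i * s ^ (n - Suc i)" by (simp add: power_add[symmetric])
    then show "2 * s ^ (n - 1) \<le> (s ^ i) ^ 2 + (s ^ (n - Suc i)) ^ 2"
      using sum_squares_bound[of "s ^ i" "s ^ (n - Suc i)"] by (simp add: mult.assoc)
  qed
  finally show ?thesis by simp
qed

text \<open>The weight of the Lambert series is compared with its behaviour as \<open>t\<close>
  tends to \<open>1\<close>. Monotonicity comes down to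
  \<open>n * (n + 1) * t ^ n \<le> G n * G (n + 1)\<close> for the geometric sums \<open>G\<close>,
  and this follows from \<open>geometric_ge\<close> for the square root of \<open>t\<close>.\<close>

lemma lambert_weight_antimono:
  fixes t :: real
  assumes t: "0 < t" "t < 1" and n: "n \<ge> 1"
  defines "B \<equiv> (\<lambda>n::nat. 1 / (real n * (1 - t)) - t ^ n / (1 - t ^ n))"
  shows "B (Suc n) \<le> B n" "0 \<le> B n"
proof -
  define G where "G n = (\<Sum>i<n. t ^ i)" for n :: nat
  have G: "1 - t ^ n = (1 - t) * G n" for n
    unfolding G_def using t by (simp add: sum_gp_strict)
  have Gpos: "G n > 0" if "n \<ge> 1" for n
    unfolding G_def by (rule sum_pos2[of _ 0]) (use that t in auto)
  define s where "s = sqrt t"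
  have s: "0 < s" "s < 1" "s ^ 2 = t" using t by (auto simp: s_def)
  have Gge: "real k * s ^ (k - 1) \<le> G k" for k
    using geometric_ge[OF s(1), of k] s by (simp add: G_def)
  have "real n * real (Suc n) * t ^ n \<le> (real n * s ^ (n - 1)) * (real (Suc n) * s ^ n)"
  proof -
    have "t ^ n = (s ^ 2) ^ n" using s(3) by simp
    also have "\<dots> = s ^ (n + n)" by (simp add: power_mult[symmetric] mult_2)
    also have "\<dots> \<le> s ^ (n - 1 + n)" using s by (intro power_decreasing) auto
    finally have "t ^ n \<le> s ^ (n - 1) * s ^ n" by (simp add: power_add)
    then have "(real n * real (Suc n)) * t ^ n \<le> (real n * real (Suc n)) * (s ^ (n - 1) * s ^ n)"
      by (intro mult_left_mono) auto
    then show ?thesis by (simp add: mult_ac)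
  qed
  also have "\<dots> \<le> G n * G (Suc n)"
    using Gge[of n] Gge[of "Suc n"] s Gpos[OF n] by (intro mult_mono) auto
  finally have key: "real n * real (Suc n) * t ^ n \<le> G n * G (Suc n)" .
  have Gp: "G n > 0" "G (Suc n) > 0" using Gpos n by auto
  have "B n - B (Suc n) = (1 / (1 - t)) * (1 / (real n * real (Suc n)) - t ^ n / (G n * G (Suc n)))"
  proof -
    have Gs: "G (Suc n) = G n + t ^ n" by (simp add: G_def)
    have Gn: "t ^ n = 1 - (1 - t) * G n" using G[of n] by linarith
    have a: "1 / (real n * (1 - t)) - 1 / (real (Suc n) * (1 - t)) = (1 / (1 - t)) * (1 / (real n * real (Suc n)))"
    proof -
      have "1 / (x * u) - 1 / ((x + 1) * u) = (1 / u) * (1 / (x * (x + 1)))" if "x > 0" "u > 0" for x u :: real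
        using that by (simp add: divide_simps)
      from this[of "real n" "1 - t"] show ?thesis using t n by (simp add: add.commute)
    qed
    have "t ^ n / ((1 - t) * G n) - t ^ Suc n / ((1 - t) * G (Suc n))
       = (1 / (1 - t)) * ((t ^ n * G (Suc n) - t ^ Suc n * G n) / (G n * G (Suc n)))"
    proof -
      have "a / (u * x) - b / (u * y) = (1 / u) * ((a * y - b * x) / (x * y))"
        if "x > 0" "y > 0" "u > 0" for a b x y u :: real
        using that by (simp add: divide_simps; simp add: algebra_simps)
      from this[OF Gp] show ?thesis using t by simp
    qed
    also have "t ^ n * G (Suc n) - t ^ Suc n * G n = t ^ n * ((1 - t) * G n + t ^ n)"
      unfolding Gs by (simp add: algebra_simps)
    also have "(1 - t) * G n + t ^ n = 1" using Gn by simp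
    finally have "t ^ n / ((1 - t) * G n) - t ^ Suc n / ((1 - t) * G (Suc n)) = (1 / (1 - t)) * (t ^ n / (G n * G (Suc n)))" by simp
    then show ?thesis using a unfolding B_def G by (simp add: right_diff_distrib)
  qed
  moreover have "t ^ n / (G n * G (Suc n)) \<le> 1 / (real n * real (Suc n))"
  proof -
    have "a / x \<le> 1 / y" if "x > 0" "y > 0" "y * a \<le> x" for a x y :: real
      using that by (simp add: divide_simps mult.commute)
    from this[OF _ _ key] show ?thesis using Gp n by simp
  qed
  ultimately have "B n - B (Suc n) \<ge> 0" using t by (simp add: zero_le_mult_iff)
  then show "B (Suc n) \<le> B n" by simp
  have "real n * t ^ n \<le> G n"
  proof -
    have "real n * t ^ n = (\<Sum>i<n. t ^ n)" by simp
    also have "\<dots> \<le> G n" unfolding G_def using t by (intro sum_mono power_decreasing) auto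
    finally show ?thesis .
  qed
  then have "t ^ n / G n \<le> 1 / real n"
    using Gp n by (simp add: divide_simps mult.commute)
  then have "(1 / (1 - t)) * (t ^ n / G n) \<le> (1 / (1 - t)) * (1 / real n)"
    using t by (intro mult_left_mono) auto
  then have "t ^ n / ((1 - t) * G n) \<le> 1 / (real n * (1 - t))"
    by (simp add: mult.commute)
  then show "0 \<le> B n" by (simp add: B_def G)
qed

text \<open>Monsky's argument: the power series coefficients of the Lambert series
  \<open>\<Sum>n. \<xi> n * t ^ n / (1 - t ^ n)\<close> are nonnegative, and equal to \<open>1\<close> at the powers of \<open>q\<close>, so that it is
  unbounded as \<open>t\<close> tends to \<open>1\<close>, whereas \<open>L_one = 0\<close> would keep it bounded.\<close>

lemma (in nonprincipal_char) real_L_one_nonzero: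
  assumes real: "\<And>n. \<xi> n \<in> \<real>" and q: "prime q" "\<xi> q = 0"
  shows "L_one \<noteq> 0"
proof
  assume L0: "L_one = 0"
  define r where "r n = Re (\<xi> n)" for n
  have \<xi>: "\<xi> n = of_real (r n)" for n using real[of n] by (simp add: r_def of_real_Re)
  have rmult: "r (a * b) = r a * r b" for a b
    using mult[of a b] by (simp add: \<xi> flip: of_real_mult)
  have rone: "r 1 = 1" using one by (simp add: r_def)
  have rle: "\<bar>r n\<bar> \<le> 1" for n using norm_le[of n] by (simp add: \<xi>)
  have rpart: "norm (\<Sum>n=1..N. r n) \<le> M" for N
    using partial[of N] by (simp add: \<xi> flip: of_real_sum)
  have rL: "\<bar>\<Sum>n=1..N. r n / real n\<bar> \<le> 2 * M / (real N + 1)" for N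
  proof -
    have "(\<Sum>n=1..N. \<xi> n * of_real (1 / real n)) = of_real (\<Sum>n=1..N. r n / real n)"
      by (simp add: \<xi>)
    then show ?thesis using L_approx[of N] L0 by (simp only: diff_zero norm_of_real)
  qed
  define A where "A n = (\<Sum>d | d dvd n. r d)" for n
  have A0: "0 \<le> A n" if "n > 0" for n
    unfolding A_def by (rule sum_divisors_nonneg[OF rmult rone rle that])
  have Aq: "A (q ^ k) = 1" for k
  proof -
    have rq: "r q = 0" using q by (simp add: r_def)
    have "A (q ^ k) = (\<Sum>i\<le>k. r q ^ i) * (\<Sum>d | d dvd 1. r d)"
      unfolding A_def using sum_divisors_prime_power_mult[OF rmult rone q(1), of 1 k] q(1)
      by (simp add: prime_nat_iff)
    also have "(\<Sum>i\<le>k. r q ^ i) = 1"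
      unfolding rq by (simp add: power_0_left)
    finally show ?thesis using rone by simp
  qed
  \<comment> \<open>A finite form of the Lambert series with three contributions: the truncated
    L-series, small because \<open>L_one = 0\<close>; the weights \<open>B\<close>, handled by
    summation by parts; and the truncation error, which disappears as \<open>N\<close> grows with
    \<open>t\<close> fixed.\<close>
  have bound: "(\<Sum>n=1..N. A n * t ^ n) \<le> 2 * M / ((real N + 1) * (1 - t)) + 2 * M + real N * t ^ N / (1 - t)"
    if t: "0 < t" "t < 1" and N: "N \<ge> 1" for N :: nat and t :: real
  proof -
    define B where "B n = 1 / (real n * (1 - t)) - t ^ n / (1 - t ^ n)" for n :: nat
    have td: "t ^ d < 1" if "d \<ge> 1" for d using t that by (simp add: power_less_one_iff)
    have "(\<Sum>n=1..N. A n * t ^ n) = (\<Sum>n=1..N. \<Sum>d | d dvd n. r d * (t ^ d) ^ (n div d))"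
      unfolding A_def sum_distrib_right
      by (intro sum.cong refl) (auto simp: power_mult[symmetric])
    also have "\<dots> = (\<Sum>d=1..N. \<Sum>e=1..N div d. r d * (t ^ d) ^ e)"
      by (rule sum_divisors_swap)
    also have "\<dots> = (\<Sum>d=1..N. r d / real d * (1 / (1 - t)) - r d * B d - r d * ((t ^ d) ^ Suc (N div d) / (1 - t ^ d)))"
    proof (intro sum.cong refl)
      fix d assume d: "d \<in> {1..N}"
      have ne: "1 - t ^ d \<noteq> 0" using td[of d] d by simp
      have "(1 - t ^ d) * (\<Sum>e=1..N div d. (t ^ d) ^ e) = (t ^ d) ^ 1 - (t ^ d) ^ Suc (N div d)"
      proof (cases "N div d = 0")
        case False
        then show ?thesis by (intro sum_gp_multiplied) simp
      qed simp
      then have "(\<Sum>e=1..N div d. (t ^ d) ^ e) = (t ^ d - (t ^ d) ^ Suc (N div d)) / (1 - t ^ d)"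
        using ne by (simp add: field_simps)
      then have "(\<Sum>e=1..N div d. (t ^ d) ^ e) = 1 / (real d * (1 - t)) - B d - (t ^ d) ^ Suc (N div d) / (1 - t ^ d)"
        by (simp add: B_def diff_divide_distrib)
      then have "r d * (\<Sum>e=1..N div d. (t ^ d) ^ e)
        = r d * (1 / (real d * (1 - t)) - B d - (t ^ d) ^ Suc (N div d) / (1 - t ^ d))" by simp
      then show "(\<Sum>e=1..N div d. r d * (t ^ d) ^ e)
        = r d / real d * (1 / (1 - t)) - r d * B d - r d * ((t ^ d) ^ Suc (N div d) / (1 - t ^ d))"
        by (simp add: sum_distrib_left right_diff_distrib)
    qed
    also have "\<dots> = (\<Sum>d=1..N. r d / real d) * (1 / (1 - t)) - (\<Sum>d=1..N. r d * B d)
       - (\<Sum>d=1..N. r d * ((t ^ d) ^ Suc (N div d) / (1 - t ^ d)))"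
      by (simp only: sum_subtractf sum_distrib_right)
    also have "\<dots> \<le> 2 * M / (real N + 1) * (1 / (1 - t)) + 2 * M + real N * t ^ N / (1 - t)"
    proof -
      have 1: "(\<Sum>d=1..N. r d / real d) * (1 / (1 - t)) \<le> 2 * M / (real N + 1) * (1 / (1 - t))"
        using rL[of N] t by (intro mult_right_mono) auto
      have "norm (\<Sum>n=1..N. r n * of_real (B n)) \<le> 2 * M * B 1"
        by (rule abel_bound[OF rpart]) (use lambert_weight_antimono[OF t] in \<open>auto simp: B_def\<close>)
      moreover have "B 1 = 1" using t by (simp add: B_def field_simps)
      ultimately have 2: "- (\<Sum>d=1..N. r d * B d) \<le> 2 * M" by (simp add: abs_le_iff)
      have "\<bar>\<Sum>d=1..N. r d * ((t ^ d) ^ Suc (N div d) / (1 - t ^ d))\<bar> \<le> (\<Sum>d=1..N. t ^ N / (1 - t))"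
      proof (rule order_trans[OF sum_abs], intro sum_mono)
        fix d assume d: "d \<in> {1..N}"
        have "N < d * (N div d) + d"
          using d by (metis atLeastAtMost_iff dividend_less_div_times mult.commute Suc_le_eq One_nat_def add.commute)
        then have "N \<le> d * Suc (N div d)" by simp
        then have "t ^ (d * Suc (N div d)) \<le> t ^ N" using t by (intro power_decreasing) auto
        then have a: "(t ^ d) ^ Suc (N div d) \<le> t ^ N" by (simp only: power_mult)
        have "t ^ d \<le> t ^ 1" using d t by (intro power_decreasing) auto
        then have b: "1 - t \<le> 1 - t ^ d" by simp
        have "\<bar>r d * ((t ^ d) ^ Suc (N div d) / (1 - t ^ d))\<bar> = \<bar>r d\<bar> * ((t ^ d) ^ Suc (N div d) / (1 - t ^ d))"
          using t b by (simp add: abs_mult)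
        also have "\<dots> \<le> 1 * (t ^ N / (1 - t))"
          using rle[of d] t a b by (intro mult_mono frac_le) auto
        finally show "\<bar>r d * ((t ^ d) ^ Suc (N div d) / (1 - t ^ d))\<bar> \<le> t ^ N / (1 - t)" by simp
      qed
      then have 3: "- (\<Sum>d=1..N. r d * ((t ^ d) ^ Suc (N div d) / (1 - t ^ d))) \<le> real N * t ^ N / (1 - t)"
        by (simp add: abs_le_iff)
      show ?thesis using 1 2 3 by linarith
    qed
    finally show ?thesis by simp
  qed
  \<comment> \<open>\<open>t\<close> is chosen such that the powers of \<open>q\<close> up to
    \<open>q ^ K\<close> contribute at least \<open>1 / 2\<close> each. Only afterwards is
    \<open>N\<close> taken so large that the upper bound falls below
    \<open>2 * M + 1\<close>.\<close>
  obtain K :: nat where K: "real K > 2 * (2 * M + 1)" using reals_Archimedean2 by blast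
  have q2: "q > 1" by (rule prime_gt_1_nat[OF q(1)])
  define t where "t = root (q ^ K) (1 / 2 :: real)"
  have qK: "q ^ K > 0" using q2 by simp
  have t: "0 < t" "t < 1" "t ^ (q ^ K) = 1 / 2"
    using qK by (auto simp: t_def real_root_lt_1_iff)
  have "(\<lambda>N. 2 * M / (1 - t) * inverse (real (Suc N)) + (2 * M + (real N * t ^ N) / (1 - t))) \<longlonglongrightarrow> 2 * M / (1 - t) * 0 + (2 * M + 0 / (1 - t))"
    using t powser_times_n_limit_0[of t] by (intro tendsto_intros LIMSEQ_inverse_real_of_nat) auto
  then have "\<forall>\<^sub>F N in sequentially. 2 * M / (1 - t) * inverse (real (Suc N)) + (2 * M + (real N * t ^ N) / (1 - t)) < 2 * M + 1"
    by (rule order_tendstoD) simp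
  then obtain N0 where N0: "\<And>N. N \<ge> N0 \<Longrightarrow> 2 * M / (1 - t) * inverse (real (Suc N)) + (2 * M + (real N * t ^ N) / (1 - t)) < 2 * M + 1"
    unfolding eventually_sequentially by blast
  define N where "N = max N0 (q ^ K)"
  have N: "N \<ge> 1" "N \<ge> q ^ K" "N \<ge> N0" using qK by (auto simp: N_def le_max_iff_disj Suc_le_eq)
  have "real K * (1 / 2) = (\<Sum>k=1..K. 1 / 2)" by simp
  also have "\<dots> \<le> (\<Sum>k=1..K. A (q ^ k) * t ^ (q ^ k))"
  proof (intro sum_mono)
    fix k assume "k \<in> {1..K}"
    then have "q ^ k \<le> q ^ K" using q2 by (intro power_increasing) auto
    then have "t ^ (q ^ K) \<le> t ^ (q ^ k)" by (rule power_decreasing) (use t in auto)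
    then show "1 / 2 \<le> A (q ^ k) * t ^ (q ^ k)" using t Aq by simp
  qed
  also have "\<dots> = (\<Sum>n\<in>(\<lambda>k. q ^ k) ` {1..K}. A n * t ^ n)"
    using q2 by (subst sum.reindex) (auto simp: inj_on_def)
  also have "\<dots> \<le> (\<Sum>n=1..N. A n * t ^ n)"
  proof (intro sum_mono2)
    show "(\<lambda>k. q ^ k) ` {1..K} \<subseteq> {1..N}"
    proof
      fix x assume "x \<in> (\<lambda>k. q ^ k) ` {1..K}"
      then obtain k where k: "k \<le> K" "x = q ^ k" by auto
      then have "q ^ k \<le> q ^ K" using q2 by (intro power_increasing) auto
      then have "q ^ k \<le> N" using N(2) by (rule order_trans)
      then show "x \<in> {1..N}" using k q2 by (auto simp: Suc_le_eq)
    qed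
    show "0 \<le> A b * t ^ b" if "b \<in> {1..N} - (\<lambda>k. q ^ k) ` {1..K}" for b
      using that A0[of b] t by auto
  qed auto
  also have "\<dots> \<le> 2 * M / ((real N + 1) * (1 - t)) + 2 * M + real N * t ^ N / (1 - t)"
    by (rule bound) (use t N in auto)
  also have "\<dots> = 2 * M / (1 - t) * inverse (real (Suc N)) + (2 * M + (real N * t ^ N) / (1 - t))"
    by (simp add: divide_inverse mult_ac)
  also have "\<dots> < 2 * M + 1" by (rule N0) (use N in simp)
  finally show False using K by simp
qed

section \<open>Characters modulo a prime\<close>

text \<open>The nonzero residues form a cyclic group generated by \<open>g\<close>. The discrete
  logarithm \<open>ind\<close> therefore gives all characters as \<open>dchar j\<close> with
  \<open>j < m - 1\<close>, and \<open>dchar 0\<close> is the principal one.\<close>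

locale prime_modulus =
  fixes m g :: nat
  assumes m: "prime m" and g: "residue_primroot m g"
begin

definition ind :: "nat \<Rightarrow> nat" where
  "ind n = inv_into {..<m - 1} (\<lambda>i. g ^ i mod m) (n mod m)"

definition \<zeta> :: complex where "\<zeta> = exp (2 * of_real pi * \<i> / of_nat (m - 1))"

definition dchar :: "nat \<Rightarrow> nat \<Rightarrow> complex" where
  "dchar j n = (if m dvd n then 0 else \<zeta> ^ (j * ind n))"

lemma modulus_gt_1: "m > 1" "m - 1 \<ge> 1" using prime_gt_1_nat[OF m] by auto

lemma bij: "bij_betw (\<lambda>i. g ^ i mod m) {..<m - 1} (totatives m)"
  using residue_primroot_is_generator[OF modulus_gt_1(1) g] by (simp add: totient_prime m)

lemma ind:
  assumes "\<not> m dvd n"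
  shows "ind n < m - 1" "[g ^ ind n = n] (mod m)"
proof -
  have "coprime m n" using prime_imp_coprime[OF m assms] .
  then have "coprime (n mod m) m" using modulus_gt_1 by (simp add: coprime_commute)
  moreover have "n mod m > 0" using assms by (simp add: dvd_eq_mod_eq_0)
  moreover have "n mod m \<le> m" using modulus_gt_1 by (simp add: less_imp_le)
  ultimately have "n mod m \<in> totatives m" by (simp add: totatives_def)
  then have *: "n mod m \<in> (\<lambda>i. g ^ i mod m) ` {..<m - 1}"
    using bij by (simp add: bij_betw_def)
  show "ind n < m - 1" using inv_into_into[OF *] by (simp add: ind_def)
  show "[g ^ ind n = n] (mod m)" using f_inv_into_f[OF *] by (simp add: ind_def cong_def)
qed

lemma coprime_g: "coprime m g" using g by (simp add: residue_primroot_def)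

lemma cong_pow_iff: "[g ^ a = g ^ b] (mod m) \<longleftrightarrow> [a = b] (mod (m - 1))"
  using order_divides_expdiff[OF coprime_g, of a b] g by (simp add: residue_primroot_def totient_prime m)

lemma \<zeta>_pow: "\<zeta> ^ k = exp (2 * of_real pi * \<i> * of_nat k / of_nat (m - 1))"
  unfolding \<zeta>_def by (simp add: exp_of_nat_mult[symmetric] mult_ac)

lemma \<zeta>_eq_iff: "\<zeta> ^ a = \<zeta> ^ b \<longleftrightarrow> [a = b] (mod (m - 1))"
  unfolding \<zeta>_pow cong_def by (rule complex_root_unity_eq[OF modulus_gt_1(2)])

lemma \<zeta>_norm: "norm (\<zeta> ^ k) = 1"
  by (simp add: \<zeta>_def norm_power norm_exp_eq_Re)

lemma ind_mult:
  assumes "\<not> m dvd a" "\<not> m dvd b"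
  shows "[ind (a * b) = ind a + ind b] (mod (m - 1))"
proof -
  have "\<not> m dvd a * b" using assms m by (simp add: prime_dvd_mult_iff)
  then have "[g ^ ind (a * b) = a * b] (mod m)" by (rule ind)
  moreover have "[g ^ ind a * g ^ ind b = a * b] (mod m)" using assms by (intro cong_mult ind)
  ultimately have "[g ^ ind (a * b) = g ^ (ind a + ind b)] (mod m)"
    by (simp add: power_add) (metis cong_sym cong_trans)
  then show ?thesis by (simp only: cong_pow_iff)
qed

lemma dchar_mult: "dchar j (a * b) = dchar j a * dchar j b"
proof (cases "m dvd a \<or> m dvd b")
  case True
  then show ?thesis by (auto simp: dchar_def)
next
  case False
  then have nd: "\<not> m dvd a * b" using m by (simp add: prime_dvd_mult_iff)
  have "[j * ind (a * b) = j * (ind a + ind b)] (mod (m - 1))"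
    using False by (intro cong_mult ind_mult) auto
  then have "\<zeta> ^ (j * ind (a * b)) = \<zeta> ^ (j * (ind a + ind b))" by (simp only: \<zeta>_eq_iff)
  then show ?thesis using False nd by (simp add: dchar_def distrib_left power_add)
qed

lemma ind_1: "ind 1 = 0"
proof -
  have nd: "\<not> m dvd 1" using modulus_gt_1 by simp
  have "[g ^ ind 1 = g ^ 0] (mod m)" using ind(2)[OF nd] by simp
  then have "[ind 1 = 0] (mod (m - 1))" by (simp only: cong_pow_iff)
  then show ?thesis using ind(1)[OF nd] by (simp add: cong_def)
qed

lemma dchar_1: "dchar j 1 = 1"
  using modulus_gt_1 ind_1 by (simp add: dchar_def)

lemma dchar_norm_le: "norm (dchar j n) \<le> 1"
  using \<zeta>_norm by (auto simp: dchar_def)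

lemma dchar_add_period: "dchar j (n + m) = dchar j n"
  by (simp add: dchar_def ind_def dvd_add_left_iff)

lemma sum_roots:
  assumes "\<not> (m - 1) dvd j"
  shows "(\<Sum>i<m - 1. \<zeta> ^ (j * i)) = 0"
proof -
  have ne: "\<zeta> ^ j \<noteq> 1"
    using \<zeta>_eq_iff[of j 0] assms by (simp add: cong_0_iff)
  have "(\<Sum>i<m - 1. (\<zeta> ^ j) ^ i) = (1 - (\<zeta> ^ j) ^ (m - 1)) / (1 - \<zeta> ^ j)"
    using ne by (simp add: sum_gp_strict)
  also have "(\<zeta> ^ j) ^ (m - 1) = \<zeta> ^ (j * (m - 1))" by (simp add: power_mult)
  also have "\<dots> = 1" using \<zeta>_eq_iff[of "j * (m - 1)" 0] by (simp add: cong_0_iff)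
  finally show ?thesis by (simp add: power_mult)
qed

lemma ind_pow:
  assumes "i < m - 1"
  shows "ind (g ^ i mod m) = i"
  using assms bij inv_into_f_f[of "\<lambda>i. g ^ i mod m" "{..<m - 1}" i] by (simp add: ind_def bij_betw_def)

lemma sum_dchar_period:
  assumes "0 < j" "j < m - 1"
  shows "(\<Sum>n<m. dchar j n) = 0"
proof -
  have "(\<Sum>n<m. dchar j n) = (\<Sum>n\<in>totatives m. dchar j n)"
  proof (rule sum.mono_neutral_right)
    show "totatives m \<subseteq> {..<m}" using modulus_gt_1 totatives_less by auto
    show "\<forall>i\<in>{..<m} - totatives m. dchar j i = 0"
    proof
      fix i assume i: "i \<in> {..<m} - totatives m"
      then have "m dvd i"
        using m prime_imp_coprime[OF m, of i] by (auto simp: totatives_def coprime_commute)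
      then show "dchar j i = 0" by (simp add: dchar_def)
    qed
  qed auto
  also have "\<dots> = (\<Sum>i<m - 1. dchar j (g ^ i mod m))"
    by (rule sum.reindex_bij_betw[OF bij, symmetric])
  also have "\<dots> = (\<Sum>i<m - 1. \<zeta> ^ (j * i))"
  proof (intro sum.cong refl)
    fix i assume i: "i \<in> {..<m - 1}"
    have "\<not> m dvd g ^ i mod m"
    proof
      assume "m dvd g ^ i mod m"
      then have "m dvd g ^ i" by (simp add: dvd_mod_iff)
      then have "m dvd g" using m prime_dvd_power by blast
      then have "m dvd 1" using coprime_common_divisor[OF coprime_g, of m] by simp
      then show False using modulus_gt_1 by simp
    qed
    then show "dchar j (g ^ i mod m) = \<zeta> ^ (j * i)" using ind_pow i by (simp add: dchar_def)
  qed
  also have "\<dots> = 0" using assms by (intro sum_roots) (auto dest: nat_dvd_not_less)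
  finally show ?thesis .
qed

text \<open>Sums over full periods vanish, so a partial sum reduces to fewer than \<open>m\<close>
  terms.\<close>

lemma nonprincipal_dchar:
  assumes "0 < j" "j < m - 1"
  shows "nonprincipal_char (dchar j) (real m)"
proof
  fix N
  have period: "dchar j (n + k * m) = dchar j n" for n k
  proof (induction k)
    case (Suc k)
    then show ?case using dchar_add_period[of j "n + k * m"] by (simp add: ac_simps)
  qed simp
  have zero: "(\<Sum>n<k * m. dchar j n) = 0" for k
  proof -
    have "(\<Sum>n<k * m. dchar j n) = (\<Sum>i<k. sum (dchar j) {i * m..<i * m + m})"
      by (rule sum.nat_group[symmetric])
    also have "\<dots> = (\<Sum>i<k. 0)"
    proof (intro sum.cong refl)
      fix i
      have "sum (dchar j) {i * m..<i * m + m} = (\<Sum>n\<in>{0..<m}. dchar j (n + i * m))"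
        using sum.shift_bounds_nat_ivl[of "dchar j" 0 "i * m" m] by (simp add: add.commute)
      also have "\<dots> = 0" using sum_dchar_period[OF assms] by (simp only: period lessThan_atLeast0)
      finally show "sum (dchar j) {i * m..<i * m + m} = 0" .
    qed
    finally show ?thesis by simp
  qed
  define K where "K = Suc N div m"
  have "(\<Sum>n=1..N. dchar j n) = (\<Sum>n<Suc N. dchar j n)"
  proof -
    have "{..<Suc N} = insert 0 {1..N}" by auto
    then show ?thesis by (simp add: dchar_def)
  qed
  also have "\<dots> = (\<Sum>n<K * m. dchar j n) + (\<Sum>n\<in>{K * m..<Suc N}. dchar j n)"
    using sum.atLeastLessThan_concat[of 0 "K * m" "Suc N" "dchar j"]
    by (simp add: K_def lessThan_atLeast0 div_times_less_eq_dividend)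
  also have "\<dots> = (\<Sum>n\<in>{K * m..<Suc N}. dchar j n)" by (simp add: zero)
  also have "norm \<dots> \<le> (\<Sum>n\<in>{K * m..<Suc N}. 1)"
    by (intro sum_norm_le dchar_norm_le)
  also have "\<dots> = real (Suc N - K * m)" by simp
  also have "\<dots> \<le> real m"
  proof -
    have "Suc N - K * m = Suc N mod m" by (simp add: K_def minus_div_mult_eq_mod)
    also have "\<dots> \<le> m" using modulus_gt_1 by (simp add: less_imp_le)
    finally show ?thesis by simp
  qed
  finally show "norm (\<Sum>n=1..N. dchar j n) \<le> real m" .
qed (auto simp: dchar_mult dchar_1[unfolded One_nat_def] dchar_norm_le)

lemma dchar_orthogonal:
  assumes "\<not> m dvd a"
  shows "(\<Sum>j<m - 1. cnj (dchar j a) * dchar j n) = (if [n = a] (mod m) then of_nat (m - 1) else 0)"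
proof (cases "m dvd n")
  case True
  then have "\<not> [n = a] (mod m)" using assms cong_dvd_iff by blast
  then show ?thesis using True by (simp add: dchar_def)
next
  case False
  define k where "k = ind n + (m - 1 - ind a)"
  have ia: "ind a < m - 1" using ind assms by auto
  have unit: "cnj (\<zeta> ^ b) * \<zeta> ^ b = 1" for b
    using \<zeta>_norm[of b] by (metis complex_norm_square mult.commute of_real_1 power_one)
  have "cnj (dchar j a) * dchar j n = \<zeta> ^ (k * j)" for j
  proof -
    have "\<zeta> ^ (j * ind a + j * k) = \<zeta> ^ (j * ind n)"
    proof -
      have "j * ind a + j * k = j * ind n + j * (m - 1)"
        using ia by (simp add: k_def distrib_left[symmetric])
      then have "[j * ind a + j * k = j * ind n] (mod (m - 1))" by (simp add: cong_def)
      then show ?thesis by (simp only: \<zeta>_eq_iff)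
    qed
    then have "dchar j n = \<zeta> ^ (j * ind a) * \<zeta> ^ (j * k)" using False by (simp add: dchar_def power_add)
    then have "cnj (dchar j a) * dchar j n = (cnj (\<zeta> ^ (j * ind a)) * \<zeta> ^ (j * ind a)) * \<zeta> ^ (j * k)"
      using assms by (simp add: dchar_def)
    then show ?thesis unfolding unit by (simp add: mult.commute)
  qed
  then have eq: "(\<Sum>j<m - 1. cnj (dchar j a) * dchar j n) = (\<Sum>j<m - 1. \<zeta> ^ (k * j))" by simp
  have iff: "[n = a] (mod m) \<longleftrightarrow> (m - 1) dvd k"
  proof -
    have "[n = a] (mod m) \<longleftrightarrow> [g ^ ind n = g ^ ind a] (mod m)"
      using ind(2)[OF assms] ind(2)[OF False] by (metis cong_sym cong_trans)
    also have "\<dots> \<longleftrightarrow> [ind n = ind a] (mod (m - 1))" by (rule cong_pow_iff)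
    also have "\<dots> \<longleftrightarrow> [ind n + (m - 1 - ind a) = ind a + (m - 1 - ind a)] (mod (m - 1))"
      by (simp only: cong_add_rcancel_nat)
    also have "\<dots> \<longleftrightarrow> (m - 1) dvd k" using ia by (simp add: k_def cong_def dvd_eq_mod_eq_0)
    finally show ?thesis .
  qed
  show ?thesis
  proof (cases "(m - 1) dvd k")
    case True
    have "\<zeta> ^ (k * j) = 1" for j
      using True \<zeta>_eq_iff[of "k * j" 0] by (simp add: cong_0_iff)
    then show ?thesis using eq iff True by simp
  next
    case False
    then show ?thesis using eq iff sum_roots by simp
  qed
qed

end

section \<open>Mertens' theorem in a residue class\<close>

context prime_modulus
begin

definition char_mangoldt_sum :: "nat \<Rightarrow> nat \<Rightarrow> complex" where
  "char_mangoldt_sum j N = (\<Sum>n=1..N. dchar j n * of_real (mangoldt n / real n))"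

text \<open>Only powers of \<open>m\<close> contribute, and they are dominated by a geometric
  series. This is the difference between the principal character and the constant
  \<open>1\<close>.\<close>

lemma mangoldt_multiples_le: "(\<Sum>n=1..N. if m dvd n then mangoldt n / real n else 0) \<le> ln (real m)"
proof -
  have "(\<Sum>n=1..N. if m dvd n then mangoldt n / real n else 0)
    \<le> (\<Sum>n\<in>(\<lambda>k. m ^ k) ` {1..N}. mangoldt n / real n)"
  proof -
    have "(\<Sum>n=1..N. if m dvd n then mangoldt n / real n else 0)
      = (\<Sum>n\<in>{1..N} \<inter> (\<lambda>k. m ^ k) ` {1..N}. if m dvd n then mangoldt n / real n else 0)"
    proof (rule sum.mono_neutral_right)
      show "\<forall>n\<in>{1..N} - {1..N} \<inter> (\<lambda>k. m ^ k) ` {1..N}. (if m dvd n then mangoldt n / real n else 0) = 0"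
      proof (rule ballI, rule ccontr)
        fix n assume n: "n \<in> {1..N} - {1..N} \<inter> (\<lambda>k. m ^ k) ` {1..N}"
          and ne: "(if m dvd n then mangoldt n / real n else 0) \<noteq> 0"
        then have md: "m dvd n" "primepow n" by (auto simp: mangoldt_def split: if_splits)
        then obtain p k where pk: "prime p" "k > 0" "n = p ^ k" by (auto simp: primepow_def)
        then have "m dvd p" using md m prime_dvd_power by blast
        then have "m = p" using m pk by (simp add: primes_dvd_imp_eq)
        moreover have "k \<le> N"
        proof -
          have "k < p ^ k" using prime_gt_1_nat[OF pk(1)] by (simp add: power_gt_expt)
          then show ?thesis using n pk by auto
        qed
        ultimately show False using n pk by auto
      qed
    qed auto
    also have "\<dots> \<le> (\<Sum>n\<in>{1..N} \<inter> (\<lambda>k. m ^ k) ` {1..N}. mangoldt n / real n)"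
      using mangoldt_nonneg by (intro sum_mono) auto
    also have "\<dots> \<le> (\<Sum>n\<in>(\<lambda>k. m ^ k) ` {1..N}. mangoldt n / real n)"
      using mangoldt_nonneg by (intro sum_mono2) auto
    finally show ?thesis .
  qed
  also have "\<dots> = (\<Sum>k=1..N. mangoldt (m ^ k) / real (m ^ k))"
    using modulus_gt_1 by (subst sum.reindex) (auto simp: inj_on_def)
  also have "\<dots> \<le> (\<Sum>k=1..N. ln (real m) * (1 / 2) ^ k)"
  proof (intro sum_mono)
    fix k assume k: "k \<in> {1..N}"
    have "2 ^ k \<le> real m ^ k" using modulus_gt_1 by (intro power_mono) auto
    then have "inverse (real m ^ k) \<le> inverse (2 ^ k)" by (intro le_imp_inverse_le) auto
    then have "ln (real m) * inverse (real m ^ k) \<le> ln (real m) * inverse (2 ^ k)"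
      using modulus_gt_1 by (intro mult_left_mono) auto
    then show "mangoldt (m ^ k) / real (m ^ k) \<le> ln (real m) * (1 / 2) ^ k"
      using k m by (simp add: field_simps)
  qed
  also have "\<dots> = ln (real m) * (\<Sum>k=1..N. (1 / 2) ^ k)" by (simp only: sum_distrib_left)
  also have "(\<Sum>k=1..N. (1 / 2) ^ k) = 1 - (1 / 2 :: real) ^ N"
    by (induction N) auto
  also have "ln (real m) * (1 - (1 / 2 :: real) ^ N) \<le> ln (real m) * 1"
    using modulus_gt_1 by (intro mult_left_mono) auto
  finally show ?thesis by simp
qed

lemma char_mangoldt_sum_principal:
  assumes "N \<ge> 1"
  shows "norm (char_mangoldt_sum 0 N - of_real (ln (real N))) \<le> 4 + ln (real m)"
proof -
  define E where "E = (\<Sum>n=1..N. if m dvd n then mangoldt n / real n else 0)"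
  define S where "S = (\<Sum>n=1..N. mangoldt n / real n)"
  have "char_mangoldt_sum 0 N = of_real (S - E)"
    unfolding char_mangoldt_sum_def S_def E_def sum_subtractf[symmetric] of_real_sum
    by (intro sum.cong refl) (simp add: dchar_def)
  then have "norm (char_mangoldt_sum 0 N - of_real (ln (real N))) = \<bar>(S - ln (real N)) - E\<bar>"
    by (simp only: of_real_diff[symmetric] norm_of_real diff_right_commute)
  also have "\<dots> \<le> 4 + ln (real m)"
  proof -
    have "0 \<le> E" unfolding E_def using mangoldt_nonneg by (intro sum_nonneg) auto
    then show ?thesis using mertens_bound[OF assms] mangoldt_multiples_le[of N] unfolding S_def E_def by linarith
  qed
  finally show ?thesis .
qed

definition progression_mangoldt_sum :: "nat \<Rightarrow> nat \<Rightarrow> real" where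
  "progression_mangoldt_sum a N = (\<Sum>n=1..N. if [n = a] (mod m) then mangoldt n / real n else 0)"

lemma progression_mangoldt_sum_eq:
  assumes "\<not> m dvd a"
  shows "of_real (real (m - 1) * progression_mangoldt_sum a N) = (\<Sum>j<m - 1. cnj (dchar j a) * char_mangoldt_sum j N)"
proof -
  have "(\<Sum>j<m - 1. cnj (dchar j a) * char_mangoldt_sum j N)
    = (\<Sum>j<m - 1. \<Sum>n=1..N. cnj (dchar j a) * dchar j n * of_real (mangoldt n / real n))"
    by (simp add: char_mangoldt_sum_def sum_distrib_left mult.assoc)
  also have "\<dots> = (\<Sum>n=1..N. \<Sum>j<m - 1. cnj (dchar j a) * dchar j n * of_real (mangoldt n / real n))"
    by (rule sum.swap)
  also have "\<dots> = (\<Sum>n=1..N. (if [n = a] (mod m) then of_nat (m - 1) else 0) * of_real (mangoldt n / real n))"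
    unfolding sum_distrib_right[symmetric] dchar_orthogonal[OF assms] ..
  also have "\<dots> = of_real (real (m - 1) * progression_mangoldt_sum a N)"
    unfolding progression_mangoldt_sum_def sum_distrib_left of_real_sum by (intro sum.cong refl) simp
  finally show ?thesis by simp
qed

lemma dchar_reflect:
  assumes "j < m - 1"
  shows "dchar (m - 1 - j) n = cnj (dchar j n)"
proof (cases "m dvd n")
  case False
  have unit: "cnj (\<zeta> ^ b) * \<zeta> ^ b = 1" for b
    using \<zeta>_norm[of b] by (metis complex_norm_square mult.commute of_real_1 power_one)
  have "(m - 1 - j) * ind n + j * ind n = (m - 1) * ind n"
    using assms by (simp add: distrib_right[symmetric])
  then have "\<zeta> ^ ((m - 1 - j) * ind n) * \<zeta> ^ (j * ind n) = \<zeta> ^ ((m - 1) * ind n)"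
    by (simp only: power_add[symmetric])
  also have "\<dots> = 1" using \<zeta>_eq_iff[of "(m - 1) * ind n" 0] by (simp add: cong_0_iff)
  finally have "\<zeta> ^ ((m - 1 - j) * ind n) * \<zeta> ^ (j * ind n) = cnj (\<zeta> ^ (j * ind n)) * \<zeta> ^ (j * ind n)"
    using unit by simp
  then have "\<zeta> ^ ((m - 1 - j) * ind n) = cnj (\<zeta> ^ (j * ind n))"
    using \<zeta>_norm[of "j * ind n"] by (metis mult_right_cancel norm_zero zero_neq_one)
  then show ?thesis using False by (simp add: dchar_def)
qed (simp add: dchar_def)

text \<open>The sum over the class of \<open>1\<close> is nonnegative, and each vanishing L-value
  lowers its main term by \<open>ln N\<close>, so at most one value can vanish. Conjugate characters
  vanish together; hence an exceptional character is real, and \<open>real_L_one_nonzero\<close>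
  excludes it.\<close>

lemma L_one_nonzero:
  assumes "0 < j" "j < m - 1"
  shows "nonprincipal_char.L_one (dchar j) \<noteq> 0"
proof
  assume L0: "nonprincipal_char.L_one (dchar j) = 0"
  define L where "L j = nonprincipal_char.L_one (dchar j)" for j
  define Z where "Z = {j. 0 < j \<and> j < m - 1 \<and> L j = 0}"
  have finZ: "finite Z" by (rule finite_subset[of _ "{..<m}"]) (auto simp: Z_def)
  define j' where "j' = m - 1 - j"
  have j': "0 < j'" "j' < m - 1" using assms by (auto simp: j'_def)
  have refl: "dchar j' n = cnj (dchar j n)" for n
    unfolding j'_def using assms by (intro dchar_reflect)
  have "L j' = cnj (L j)"
  proof -
    have "(\<lambda>N. \<Sum>n=1..N. dchar j n * of_real (1 / real n)) \<longlonglongrightarrow> L j"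
      unfolding L_def by (rule nonprincipal_char.L_convergent[OF nonprincipal_dchar[OF assms]])
    then have "(\<lambda>N. cnj (\<Sum>n=1..N. dchar j n * of_real (1 / real n))) \<longlonglongrightarrow> cnj (L j)"
      by (rule tendsto_cnj)
    then have "(\<lambda>N. \<Sum>n=1..N. dchar j' n * of_real (1 / real n)) \<longlonglongrightarrow> cnj (L j)"
      by (simp add: refl)
    moreover have "(\<lambda>N. \<Sum>n=1..N. dchar j' n * of_real (1 / real n)) \<longlonglongrightarrow> L j'"
      unfolding L_def by (rule nonprincipal_char.L_convergent[OF nonprincipal_dchar[OF j']])
    ultimately show ?thesis using LIMSEQ_unique by blast
  qed
  then have Z2: "j \<in> Z" "j' \<in> Z" using L0 assms j' by (auto simp: Z_def L_def)
  have "card Z \<le> 1"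
  proof (rule ccontr)
    assume "\<not> card Z \<le> 1"
    then have cZ: "real (card Z) \<ge> 2" by simp
    have "\<forall>j\<in>{1..<m - 1}. \<exists>C. \<forall>N\<ge>1. norm ((if L j = 0 then of_real (ln (real N)) else 0) + char_mangoldt_sum j N) \<le> C"
    proof
      fix j assume "j \<in> {1..<m - 1}"
      then have np: "nonprincipal_char (dchar j) (real m)" by (intro nonprincipal_dchar) auto
      have eq: "nonprincipal_char.S (dchar j) N = char_mangoldt_sum j N" for N
        by (simp add: nonprincipal_char.S_def[OF np] char_mangoldt_sum_def)
      show "\<exists>C. \<forall>N\<ge>1. norm ((if L j = 0 then of_real (ln (real N)) else 0) + char_mangoldt_sum j N) \<le> C"
        using nonprincipal_char.S_log[OF np] nonprincipal_char.S_bounded[OF np] unfolding eq L_def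
        by (cases "nonprincipal_char.L_one (dchar j) = 0") auto
    qed
    then obtain C where C: "\<And>j N. j \<in> {1..<m - 1} \<Longrightarrow> N \<ge> 1 \<Longrightarrow>
        norm ((if L j = 0 then of_real (ln (real N)) else 0) + char_mangoldt_sum j N) \<le> C j"
      by metis
    have ub: "ln (real N) \<le> 4 + ln (real m) + (\<Sum>j\<in>{1..<m - 1}. C j)" if N: "N \<ge> 1" for N
    proof -
      have "\<not> m dvd 1" using modulus_gt_1 by simp
      from progression_mangoldt_sum_eq[OF this, of N] have "of_real (real (m - 1) * progression_mangoldt_sum 1 N) = (\<Sum>j<m - 1. char_mangoldt_sum j N)"
        by (simp add: dchar_1[unfolded One_nat_def])
      then have "real (m - 1) * progression_mangoldt_sum 1 N = Re (\<Sum>j<m - 1. char_mangoldt_sum j N)" by (metis Re_complex_of_real)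
      moreover have "progression_mangoldt_sum 1 N \<ge> 0" unfolding progression_mangoldt_sum_def using mangoldt_nonneg by (intro sum_nonneg) auto
      ultimately have "0 \<le> Re (\<Sum>j<m - 1. char_mangoldt_sum j N)" by (metis mult_nonneg_nonneg of_nat_0_le_iff)
      also have "\<dots> = Re (char_mangoldt_sum 0 N) + (\<Sum>j\<in>{1..<m - 1}. Re (char_mangoldt_sum j N))"
      proof -
        have "{..<m - 1} = insert 0 {1..<m - 1}" using modulus_gt_1 by auto
        then show ?thesis by simp
      qed
      also have "Re (char_mangoldt_sum 0 N) \<le> ln (real N) + (4 + ln (real m))"
        using char_mangoldt_sum_principal[OF N] abs_Re_le_cmod[of "char_mangoldt_sum 0 N - of_real (ln (real N))"] by simp
      also have "(\<Sum>j\<in>{1..<m - 1}. Re (char_mangoldt_sum j N)) \<le> (\<Sum>j\<in>{1..<m - 1}. C j - (if j \<in> Z then ln (real N) else 0))"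
      proof (intro sum_mono)
        fix j assume j: "j \<in> {1..<m - 1}"
        then have "L j = 0 \<longleftrightarrow> j \<in> Z" by (auto simp: Z_def)
        then show "Re (char_mangoldt_sum j N) \<le> C j - (if j \<in> Z then ln (real N) else 0)"
          using C[OF j N] abs_Re_le_cmod[of "(if L j = 0 then of_real (ln (real N)) else 0) + char_mangoldt_sum j N"]
          by (auto split: if_splits)
      qed
      also have "\<dots> = (\<Sum>j\<in>{1..<m - 1}. C j) - real (card Z) * ln (real N)"
      proof -
        have "(\<Sum>j\<in>{1..<m - 1}. if j \<in> Z then ln (real N) else 0) = (\<Sum>j\<in>{1..<m - 1} \<inter> Z. ln (real N))"
          by (rule sum.inter_restrict[symmetric]) simp
        also have "{1..<m - 1} \<inter> Z = Z" by (auto simp: Z_def)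
        finally show ?thesis by (simp add: sum_subtractf)
      qed
      finally have "(real (card Z) - 1) * ln (real N) \<le> 4 + ln (real m) + (\<Sum>j\<in>{1..<m - 1}. C j)"
        by (simp add: algebra_simps)
      moreover have "1 * ln (real N) \<le> (real (card Z) - 1) * ln (real N)"
        using cZ N by (intro mult_right_mono) auto
      ultimately show ?thesis by linarith
    qed
    define D where "D = 4 + ln (real m) + (\<Sum>j\<in>{1..<m - 1}. C j)"
    obtain N :: nat where N: "real N > exp D" using reals_Archimedean2 by blast
    then have "N \<ge> 1" using exp_gt_zero[of D] by (intro Suc_leI[of 0, folded One_nat_def]) (metis of_nat_0_less_iff order_less_trans)
    then have "ln (real N) \<le> D" using ub by (simp add: D_def)
    then have "real N \<le> exp D" using N \<open>N \<ge> 1\<close> by (metis exp_le_cancel_iff exp_ln of_nat_0_less_iff less_le_trans zero_less_one)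
    then show False using N by simp
  qed
  then have "j = j'" using Z2 finZ by (metis card_le_Suc0_iff_eq One_nat_def)
  then have "dchar j n \<in> \<real>" for n using refl by (metis Reals_cnj_iff)
  \<comment> \<open>The prime at which the real character vanishes is the modulus itself.\<close>
  moreover have "dchar j m = 0" by (simp add: dchar_def)
  ultimately show False
    using nonprincipal_char.real_L_one_nonzero[OF nonprincipal_dchar[OF assms] _ m] L0 by blast
qed

lemma progression_mangoldt_sum_asymp:
  assumes "\<not> m dvd a"
  shows "\<exists>C. \<forall>N\<ge>1. \<bar>real (m - 1) * progression_mangoldt_sum a N - ln (real N)\<bar> \<le> C"
proof -
  have "\<forall>j\<in>{1..<m - 1}. \<exists>C. \<forall>N\<ge>1. norm (char_mangoldt_sum j N) \<le> C"
  proof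
    fix j assume j: "j \<in> {1..<m - 1}"
    then have np: "nonprincipal_char (dchar j) (real m)" by (intro nonprincipal_dchar) auto
    have eq: "nonprincipal_char.S (dchar j) N = char_mangoldt_sum j N" for N
      by (simp add: nonprincipal_char.S_def[OF np] char_mangoldt_sum_def)
    show "\<exists>C. \<forall>N\<ge>1. norm (char_mangoldt_sum j N) \<le> C"
      using nonprincipal_char.S_bounded[OF np] L_one_nonzero[of j] j unfolding eq by auto
  qed
  then obtain C where C: "\<And>j N. j \<in> {1..<m - 1} \<Longrightarrow> N \<ge> 1 \<Longrightarrow> norm (char_mangoldt_sum j N) \<le> C j"
    by metis
  have "\<bar>real (m - 1) * progression_mangoldt_sum a N - ln (real N)\<bar> \<le> 4 + ln (real m) + (\<Sum>j\<in>{1..<m - 1}. C j)" if N: "N \<ge> 1" for N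
  proof -
    have "{..<m - 1} = insert 0 {1..<m - 1}" using modulus_gt_1 by auto
    moreover have "dchar 0 a = 1" using assms by (simp add: dchar_def)
    ultimately have "of_real (real (m - 1) * progression_mangoldt_sum a N) = char_mangoldt_sum 0 N + (\<Sum>j\<in>{1..<m - 1}. cnj (dchar j a) * char_mangoldt_sum j N)"
      using progression_mangoldt_sum_eq[OF assms, of N] by simp
    then have "of_real (real (m - 1) * progression_mangoldt_sum a N - ln (real N))
      = (char_mangoldt_sum 0 N - of_real (ln (real N))) + (\<Sum>j\<in>{1..<m - 1}. cnj (dchar j a) * char_mangoldt_sum j N)"
      by simp
    moreover have "norm (\<Sum>j\<in>{1..<m - 1}. cnj (dchar j a) * char_mangoldt_sum j N) \<le> (\<Sum>j\<in>{1..<m - 1}. C j)"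
    proof (intro sum_norm_le)
      fix j assume j: "j \<in> {1..<m - 1}"
      have "norm (cnj (dchar j a)) * norm (char_mangoldt_sum j N) \<le> 1 * C j"
        using C[OF j N] dchar_norm_le[of j a] by (intro mult_mono) auto
      then show "norm (cnj (dchar j a) * char_mangoldt_sum j N) \<le> C j" by (simp add: norm_mult)
    qed
    ultimately have "norm (of_real (real (m - 1) * progression_mangoldt_sum a N - ln (real N)) :: complex)
      \<le> (4 + ln (real m)) + (\<Sum>j\<in>{1..<m - 1}. C j)"
      using norm_triangle_mono[OF char_mangoldt_sum_principal[OF N]] by metis
    then show ?thesis by (simp only: norm_of_real)
  qed
  then show ?thesis by blast
qed

end

section \<open>A lower bound of Chebyshev type in a residue class\<close>

lemma mangoldt_nonprime_le:
  assumes "N \<ge> 1"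
  shows "(\<Sum>n | n \<in> {1..N} \<and> \<not> prime n. mangoldt n) \<le> sqrt (real N) * (log 2 (real N) + 1) * ln (real N)"
proof -
  define A where "A = {1..nat \<lfloor>sqrt (real N)\<rfloor>}"
  define K where "K = {0..nat \<lfloor>log 2 (real N)\<rfloor>}"
  define I where "I = {1..N} \<inter> (\<lambda>(p, k). p ^ k) ` (A \<times> K)"
  have fin: "finite A" "finite K" "finite I" by (auto simp: A_def K_def I_def)
  have "(\<Sum>n | n \<in> {1..N} \<and> \<not> prime n. mangoldt n)
     = (\<Sum>n\<in>{n \<in> {1..N}. \<not> prime n} \<inter> I. mangoldt n :: real)"
  proof (rule sum.mono_neutral_right)
    show "\<forall>n\<in>{n. n \<in> {1..N} \<and> \<not> prime n} - {n \<in> {1..N}. \<not> prime n} \<inter> I. mangoldt n = (0::real)"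
    proof (rule ballI, rule ccontr)
      fix n assume n: "n \<in> {n. n \<in> {1..N} \<and> \<not> prime n} - {n \<in> {1..N}. \<not> prime n} \<inter> I" and ne: "mangoldt n \<noteq> (0::real)"
      then have "primepow n" by (auto simp: mangoldt_def split: if_splits)
      then obtain p k where pk: "prime p" "k > 0" "n = p ^ k" by (auto simp: primepow_def)
      then have "k \<noteq> 1" using n by auto
      then have k2: "k \<ge> 2" using pk by simp
      have p2: "p \<ge> 2" using pk(1) by (rule prime_ge_2_nat)
      have nN: "p ^ k \<le> N" using n pk by auto
      have "p ^ 2 \<le> p ^ k" using k2 p2 by (intro power_increasing) auto
      then have "p ^ 2 \<le> N" using nN by simp
      then have "real p ^ 2 \<le> real N" by (metis of_nat_le_iff of_nat_power)
      then have "real p \<le> sqrt (real N)" by (rule real_le_rsqrt)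
      then have "p \<in> A" using p2 by (simp add: A_def le_nat_floor)
      moreover have "2 ^ k \<le> p ^ k" using p2 by (intro power_mono) auto
      then have "2 ^ k \<le> N" using nN by simp
      then have "2 ^ k \<le> real N" by (metis of_nat_le_iff of_nat_numeral of_nat_power)
      then have "real k \<le> log 2 (real N)" by (simp add: le_log_of_power)
      then have "k \<in> K" by (simp add: K_def le_nat_floor)
      ultimately have "n \<in> I" using n pk by (auto simp: I_def)
      then show False using n by auto
    qed
  qed auto
  also have "\<dots> \<le> (\<Sum>n\<in>I. mangoldt n)"
    using fin mangoldt_nonneg by (intro sum_mono2) auto
  also have "\<dots> \<le> (\<Sum>n\<in>I. ln (real N))"
  proof (intro sum_mono)
    fix n assume "n \<in> I"
    then have n: "n \<ge> 1" "n \<le> N" by (auto simp: I_def)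
    have "mangoldt n \<le> ln (real n)" by (rule mangoldt_le) (use n in auto)
    also have "\<dots> \<le> ln (real N)" using n by (intro ln_mono) auto
    finally show "mangoldt n \<le> ln (real N)" .
  qed
  also have "\<dots> = real (card I) * ln (real N)" by simp
  also have "\<dots> \<le> (sqrt (real N) * (log 2 (real N) + 1)) * ln (real N)"
  proof (intro mult_right_mono)
    have "card I \<le> card ((\<lambda>(p, k). p ^ k) ` (A \<times> K))" unfolding I_def using fin by (intro card_mono) auto
    also have "\<dots> \<le> card (A \<times> K)" using fin by (intro card_image_le) auto
    also have "\<dots> = card A * card K" by (simp add: card_cartesian_product)
    finally have "real (card I) \<le> real (card A) * real (card K)" by (metis of_nat_le_iff of_nat_mult)
    also have "\<dots> \<le> sqrt (real N) * (log 2 (real N) + 1)"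
    proof (intro mult_mono)
      show "real (card A) \<le> sqrt (real N)" by (simp add: A_def)
      show "real (card K) \<le> log 2 (real N) + 1" using assms by (simp add: K_def)
    qed auto
    finally show "real (card I) \<le> sqrt (real N) * (log 2 (real N) + 1)" .
    show "0 \<le> ln (real N)" using assms by simp
  qed
  finally show ?thesis .
qed

text \<open>Between \<open>N\<close> and \<open>K * N\<close> the Mertens sum of the class grows by
  at least \<open>1\<close>. Its terms there are at most \<open>mangoldt n / N\<close>, so
  \<open>mangoldt\<close> itself accumulates at least \<open>N\<close>; proper prime powers are
  negligible.\<close>

theorem chebyshev_progression:
  fixes m a :: nat
  assumes "prime m" "\<not> m dvd a"
  shows "\<exists>c>0. \<exists>X0. \<forall>X\<ge>X0. c * X \<le> (\<Sum>p | prime p \<and> real p \<le> X \<and> [p = a] (mod m). ln (real p))"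
proof -
  obtain g where "g \<in> totatives m" "ord m g = m - 1" using residue_prime_has_primroot[OF assms(1)] by blast
  then have "residue_primroot m g"
    using assms(1) by (simp add: residue_primroot_def totatives_def totient_prime prime_gt_0_nat coprime_commute)
  then interpret prime_modulus m g using assms(1) by unfold_locales
  obtain C where C: "\<And>N. N \<ge> 1 \<Longrightarrow> \<bar>real (m - 1) * progression_mangoldt_sum a N - ln (real N)\<bar> \<le> C"
    using progression_mangoldt_sum_asymp[OF assms(2)] by blast
  \<comment> \<open>\<open>ln K\<close> is to outweigh the two error terms \<open>C\<close> and to
    leave \<open>m - 1\<close>, the factor in front of the sum over the class.\<close>
  define K where "K = nat \<lceil>exp (2 * C + real (m - 1))\<rceil>"
  have Kexp: "exp (2 * C + real (m - 1)) \<le> real K" unfolding K_def by linarith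
  then have Kpos: "real K > 0" using exp_gt_zero less_le_trans by blast
  have lnK: "2 * C + real (m - 1) \<le> ln (real K)"
    using Kexp Kpos by (simp add: ln_ge_iff)
  have psi: "real N \<le> (\<Sum>n | n \<in> {1..K * N} \<and> [n = a] (mod m). mangoldt n)" if N: "N \<ge> 1" for N
  proof -
    have KN: "K * N \<ge> 1" "N \<le> K * N" using N Kpos by (auto simp: Suc_le_eq)
    have "real (m - 1) * (progression_mangoldt_sum a (K * N) - progression_mangoldt_sum a N) \<ge> ln (real (K * N)) - ln (real N) - 2 * C"
      using C[OF N] C[OF KN(1)] by (simp add: right_diff_distrib)
    also have "ln (real (K * N)) - ln (real N) = ln (real K)" using N Kpos by (simp add: ln_mult_pos)
    finally have "real (m - 1) * 1 \<le> real (m - 1) * (progression_mangoldt_sum a (K * N) - progression_mangoldt_sum a N)" using lnK by linarith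
    then have "1 \<le> progression_mangoldt_sum a (K * N) - progression_mangoldt_sum a N" using modulus_gt_1 by (simp only: mult_le_cancel_left_pos of_nat_0_less_iff)
    also have "\<dots> = (\<Sum>n\<in>{N<..K * N}. if [n = a] (mod m) then mangoldt n / real n else 0)"
    proof -
      have "{1..Q} = {1..N} \<union> {N<..Q}" if "N \<le> Q" for Q using that by auto
      from this[OF KN(2)] have "{1..K * N} = {1..N} \<union> {N<..K * N}" .
      then have "progression_mangoldt_sum a (K * N) = progression_mangoldt_sum a N + (\<Sum>n\<in>{N<..K * N}. if [n = a] (mod m) then mangoldt n / real n else 0)"
        unfolding progression_mangoldt_sum_def by (simp only:) (rule sum.union_disjoint, auto)
      then show ?thesis by simp
    qed
    also have "\<dots> \<le> (\<Sum>n\<in>{N<..K * N}. if [n = a] (mod m) then mangoldt n / real N else 0)"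
      using N mangoldt_nonneg by (intro sum_mono) (auto intro!: divide_left_mono)
    also have "\<dots> \<le> (\<Sum>n\<in>{1..K * N}. if [n = a] (mod m) then mangoldt n / real N else 0)"
      using N mangoldt_nonneg by (intro sum_mono2) auto
    also have "\<dots> = (\<Sum>n | n \<in> {1..K * N} \<and> [n = a] (mod m). mangoldt n / real N)"
      by (rule sum.inter_filter[symmetric]) simp
    also have "\<dots> = (\<Sum>n | n \<in> {1..K * N} \<and> [n = a] (mod m). mangoldt n) / real N"
      by (simp add: sum_divide_distrib)
    finally show ?thesis using N by (simp add: field_simps)
  qed
  \<comment> \<open>The loss from rounding \<open>X / K\<close> down and from the proper prime
    powers. It is of smaller order than \<open>X\<close>, so half of \<open>X / K\<close>
    remains.\<close>
  define h where "h X = 1 + sqrt X * (log 2 X + 1) * ln X" for X :: real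
  have "((\<lambda>X. h X / X) \<longlongrightarrow> 0) at_top" unfolding h_def by real_asymp
  then have "\<forall>\<^sub>F X in at_top. h X / X < 1 / (2 * real K)"
    by (rule order_tendstoD) (use Kpos in simp)
  then obtain X1 where X1: "\<And>X. X \<ge> X1 \<Longrightarrow> h X / X < 1 / (2 * real K)"
    unfolding eventually_at_top_linorder by blast
  have "1 / (2 * real K) * X \<le> (\<Sum>p | prime p \<and> real p \<le> X \<and> [p = a] (mod m). ln (real p))"
    if X: "X \<ge> max X1 (real K)" for X
  proof -
    define N where "N = nat \<lfloor>X / real K\<rfloor>"
    have Xp: "X > 0" "X \<ge> real K" using X Kpos by auto
    have N1: "N \<ge> 1" using Xp Kpos by (simp add: N_def le_nat_iff le_floor_iff field_simps)
    have Nle: "real N \<le> X / real K" using Xp Kpos by (simp add: N_def)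
    have Nge: "X / real K - 1 \<le> real N" using Xp Kpos unfolding N_def by linarith
    have KN: "real (K * N) \<le> X" using Nle Kpos by (simp add: field_simps)
    have KN1: "K * N \<ge> 1" using N1 Kpos by (simp add: Suc_le_eq)
    have finp: "finite {p. prime p \<and> real p \<le> X \<and> [p = a] (mod m)}"
      by (rule finite_subset[of _ "{..nat \<lfloor>X\<rfloor>}"]) (auto simp: le_nat_floor)
    have "real N \<le> (\<Sum>n | n \<in> {1..K * N} \<and> [n = a] (mod m). mangoldt n)" using psi[OF N1] .
    also have "\<dots> \<le> (\<Sum>n\<in>{p. prime p \<and> real p \<le> X \<and> [p = a] (mod m)} \<union> {n. n \<in> {1..K * N} \<and> \<not> prime n}. mangoldt n)"
    proof (intro sum_mono2)
      show "{n. n \<in> {1..K * N} \<and> [n = a] (mod m)} \<subseteq> {p. prime p \<and> real p \<le> X \<and> [p = a] (mod m)} \<union> {n. n \<in> {1..K * N} \<and> \<not> prime n}"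
      proof
        fix n assume n: "n \<in> {n. n \<in> {1..K * N} \<and> [n = a] (mod m)}"
        then have "real n \<le> real (K * N)" by (simp del: of_nat_mult)
        then have "real n \<le> X" using KN by simp
        then show "n \<in> {p. prime p \<and> real p \<le> X \<and> [p = a] (mod m)} \<union> {n. n \<in> {1..K * N} \<and> \<not> prime n}"
          using n by auto
      qed
    qed (use finp mangoldt_nonneg in auto)
    also have "\<dots> = (\<Sum>n\<in>{p. prime p \<and> real p \<le> X \<and> [p = a] (mod m)}. mangoldt n) + (\<Sum>n | n \<in> {1..K * N} \<and> \<not> prime n. mangoldt n)"
      using finp by (intro sum.union_disjoint) auto
    also have "(\<Sum>n\<in>{p. prime p \<and> real p \<le> X \<and> [p = a] (mod m)}. mangoldt n) = (\<Sum>p | prime p \<and> real p \<le> X \<and> [p = a] (mod m). ln (real p))"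
      by (intro sum.cong refl) auto
    also have "(\<Sum>n | n \<in> {1..K * N} \<and> \<not> prime n. mangoldt n) \<le> sqrt (real (K * N)) * (log 2 (real (K * N)) + 1) * ln (real (K * N))"
      by (rule mangoldt_nonprime_le[OF KN1])
    also have "\<dots> \<le> sqrt X * (log 2 X + 1) * ln X"
    proof -
      have "1 \<le> real (K * N)" using KN1 by (metis of_nat_1 of_nat_le_iff)
      then show ?thesis using KN by (intro mult_mono add_mono real_sqrt_le_mono log_mono ln_mono) auto
    qed
    finally have "X / real K \<le> (\<Sum>p | prime p \<and> real p \<le> X \<and> [p = a] (mod m). ln (real p)) + h X"
      using Nge by (simp add: h_def)
    moreover have "h X \<le> 1 / (2 * real K) * X" using X1[of X] X Xp by (simp add: field_simps)
    moreover have "X / real K = 1 / (2 * real K) * X + 1 / (2 * real K) * X" by simp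
    ultimately show ?thesis by linarith
  qed
  then show ?thesis using Kpos by (intro exI[of _ "1 / (2 * real K)"] conjI exI[of _ "max X1 (real K)"]) auto
qed

section \<open>The choice of the primes\<close>

text \<open>Distinct primes dividing \<open>a\<close> have a product dividing \<open>a\<close>. If
  all primes of a class up to \<open>P\<close> divided \<open>a\<close>, the Chebyshev bound would
  force \<open>c * P \<le> ln |a|\<close>.\<close>

lemma sum_ln_primes_le:
  fixes a :: int
  assumes A: "finite A" "\<And>p. p \<in> A \<Longrightarrow> prime p \<and> int p dvd a" and a: "a \<noteq> 0"
  shows "(\<Sum>p\<in>A. ln (real p)) \<le> ln (real_of_int \<bar>a\<bar>)"
proof -
  have "int (\<Prod>p\<in>A. p) dvd a"
    using A
  proof (induction A rule: finite_induct)
    case (insert p A)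
    have "coprime p (\<Prod>p\<in>A. p)"
      using insert by (intro prod_coprime_right) (auto intro!: primes_coprime)
    then have "coprime (int p) (int (\<Prod>p\<in>A. p))" by (simp only: coprime_int_iff)
    then have "int p * int (\<Prod>p\<in>A. p) dvd a" using insert by (intro divides_mult) auto
    then show ?case using insert.hyps by simp
  qed simp
  then have le: "int (\<Prod>p\<in>A. p) \<le> \<bar>a\<bar>" by (rule order_trans[OF abs_ge_self dvd_imp_le_int[OF a]])
  have pos: "real p > 0" if "p \<in> A" for p using A(2)[OF that] by (simp add: prime_gt_0_nat)
  have "(\<Sum>p\<in>A. ln (real p)) = ln (\<Prod>p\<in>A. real p)" using A(1) pos by (simp add: ln_prod)
  also have "\<dots> \<le> ln (real_of_int \<bar>a\<bar>)"
  proof (subst ln_le_cancel_iff)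
    show "0 < (\<Prod>p\<in>A. real p)" using pos by (rule prod_pos)
    have "real_of_int (int (\<Prod>p\<in>A. p)) \<le> real_of_int \<bar>a\<bar>" using le by (simp only: of_int_le_iff)
    then show "(\<Prod>p\<in>A. real p) \<le> real_of_int \<bar>a\<bar>" by simp
  qed (use a in simp)
  finally show ?thesis .
qed

lemma chebyshev_progressions:
  assumes "finite A" "prime m" "\<And>a. a \<in> A \<Longrightarrow> \<not> m dvd a"
  shows "\<exists>c>0. \<exists>X0\<ge>0. \<forall>a\<in>A. \<forall>X\<ge>X0. c * X \<le> (\<Sum>p | prime p \<and> real p \<le> X \<and> [p = a] (mod m). ln (real p))"
  using assms(1,3)
proof (induction A rule: finite_induct)
  case empty
  then show ?case by (auto intro: exI[of _ 1])
next
  case (insert a A)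
  define \<theta> where "\<theta> a X = (\<Sum>p | prime p \<and> real p \<le> X \<and> [p = a] (mod m). ln (real p))" for a X
  obtain c X0 where c: "c > 0" "X0 \<ge> 0" "\<And>a X. a \<in> A \<Longrightarrow> X \<ge> X0 \<Longrightarrow> c * X \<le> \<theta> a X"
    using insert unfolding \<theta>_def by blast
  obtain c' X0' where c': "c' > 0" "\<And>X. X \<ge> X0' \<Longrightarrow> c' * X \<le> \<theta> a X"
    using chebyshev_progression[OF assms(2), of a] insert.prems unfolding \<theta>_def by blast
  have "min c c' * X \<le> \<theta> b X" if b: "b \<in> insert a A" and X: "X \<ge> max X0 X0'" for b X
  proof (cases "b = a")
    case True
    have "min c c' * X \<le> c' * X" using X c(2) by (intro mult_right_mono) auto
    then show ?thesis using c'(2)[of X] X True by simp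
  next
    case False
    have "min c c' * X \<le> c * X" using X c(2) by (intro mult_right_mono) auto
    then show ?thesis using c(3)[of b X] X b False by simp
  qed
  moreover have "min c c' > 0" "max X0 X0' \<ge> 0" using c c' by auto
  ultimately show ?case unfolding \<theta>_def by blast
qed

lemma sum_abs_coeffs_le:
  fixes F :: "('n::finite) int_mpoly"
  assumes "is_form F d"
  shows "(\<Sum>\<alpha>\<in>Poly_Mapping.keys F. \<bar>Poly_Mapping.lookup F \<alpha>\<bar>) \<le> int ((d + 1) ^ CARD('n)) * poly_height F"
    and "\<bar>Poly_Mapping.lookup F \<alpha>\<bar> \<le> poly_height F"
proof -
  have "range (\<lambda>\<alpha>. \<bar>Poly_Mapping.lookup F \<alpha>\<bar>) \<subseteq> insert 0 ((\<lambda>\<alpha>. \<bar>Poly_Mapping.lookup F \<alpha>\<bar>) ` Poly_Mapping.keys F)"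
    by (auto simp: in_keys_iff)
  then have "finite (range (\<lambda>\<alpha>. \<bar>Poly_Mapping.lookup F \<alpha>\<bar>))" by (rule finite_subset) simp
  then have le: "\<bar>Poly_Mapping.lookup F \<alpha>\<bar> \<le> poly_height F" for \<alpha>
    unfolding poly_height_def by (intro Max_ge) auto
  then show "\<bar>Poly_Mapping.lookup F \<alpha>\<bar> \<le> poly_height F" .
  have h0: "0 \<le> poly_height F" using le[of 0] by simp
  have "card (Poly_Mapping.keys F) \<le> card (PiE (UNIV :: 'n set) (\<lambda>_. {..d}))"
  proof (rule card_inj_on_le)
    show "inj_on Poly_Mapping.lookup (Poly_Mapping.keys F)" by (simp add: inj_on_def)
    show "Poly_Mapping.lookup ` Poly_Mapping.keys F \<subseteq> PiE UNIV (\<lambda>_. {..d})"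
    proof
      fix g assume "g \<in> Poly_Mapping.lookup ` Poly_Mapping.keys F"
      then obtain \<alpha> where \<alpha>: "\<alpha> \<in> Poly_Mapping.keys F" "g = Poly_Mapping.lookup \<alpha>" by blast
      have "g i \<le> (\<Sum>i\<in>UNIV. g i)" for i by (rule member_le_sum) auto
      moreover have "(\<Sum>i\<in>UNIV. g i) = d" using assms \<alpha> by (simp add: is_form_def)
      ultimately show "g \<in> PiE UNIV (\<lambda>_. {..d})" by (auto simp: PiE_def Pi_def)
    qed
  qed (auto intro: finite_PiE)
  also have "\<dots> = (d + 1) ^ CARD('n)" by (simp add: card_PiE)
  finally have c: "card (Poly_Mapping.keys F) \<le> (d + 1) ^ CARD('n)" .
  have "(\<Sum>\<alpha>\<in>Poly_Mapping.keys F. \<bar>Poly_Mapping.lookup F \<alpha>\<bar>) \<le> (\<Sum>\<alpha>\<in>Poly_Mapping.keys F. poly_height F)"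
    by (intro sum_mono le)
  also have "\<dots> = int (card (Poly_Mapping.keys F)) * poly_height F" by simp
  also have "\<dots> \<le> int ((d + 1) ^ CARD('n)) * poly_height F"
    using c h0 by (intro mult_right_mono) (simp_all only: of_nat_le_iff)
  finally show "(\<Sum>\<alpha>\<in>Poly_Mapping.keys F. \<bar>Poly_Mapping.lookup F \<alpha>\<bar>) \<le> int ((d + 1) ^ CARD('n)) * poly_height F" .
qed

lemma linear_dominates_log:
  fixes a b c :: real
  assumes "c > 0"
  shows "eventually (\<lambda>K. a + b * ln K < c * K) at_top"
  using assms by real_asymp

text \<open>\<open>P\<close> enters only through its logarithm, with a coefficient depending on
  \<open>n\<close> and \<open>d\<close>. This makes it possible to choose \<open>P\<close> although
  the integer to be avoided is bounded in terms of \<open>P\<close>.\<close>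

lemma ln_bound_aux:
  fixes n d :: nat and H :: int and h B P :: real
  assumes n: "n \<ge> 1" and h: "1 \<le> h" and B: "1 \<le> B" and P: "1 \<le> P"
    and H: "0 \<le> H" "real_of_int H \<le> real ((d + 1) ^ n) * h"
    and a: "a \<noteq> 0" "\<bar>a\<bar> \<le> int d * (H * (\<lfloor>B\<rfloor> + \<lfloor>real n * real d * (sqrt (real n) * B * P ^ (2 * n))\<rfloor>) ^ d)"
  shows "ln (real_of_int \<bar>a\<bar>) \<le> ln (real ((d + 1) ^ (n + 1))) + real d * ln (1 + real n ^ 2 * real d) +
    (ln h + real d * ln B) + real (2 * n * d) * ln P"
proof -
  define X where "X = real n * real d * (sqrt (real n) * B * P ^ (2 * n))"
  define D where "D = 1 + real n ^ 2 * real d"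
  have D: "D \<ge> 1" by (simp add: D_def)
  have X0: "X \<ge> 0" using B P by (simp add: X_def)
  have P1: "1 \<le> P ^ (2 * n)" using P by (rule one_le_power)
  have "sqrt (real n) * 1 \<le> sqrt (real n) * sqrt (real n)" using n by (intro mult_left_mono) auto
  then have sn: "sqrt (real n) \<le> real n" by simp
  have "X = (real n * sqrt (real n)) * real d * (B * P ^ (2 * n))" by (simp add: X_def)
  also have "\<dots> \<le> (real n * real n) * real d * (B * P ^ (2 * n))"
    using sn B P by (intro mult_right_mono mult_left_mono) auto
  finally have X1: "X \<le> (real n ^ 2 * real d) * (B * P ^ (2 * n))" by (simp add: power2_eq_square)
  have "B * 1 \<le> B * P ^ (2 * n)" using P1 B by (intro mult_left_mono) auto
  then have BX: "B + X \<le> D * (B * P ^ (2 * n))" using X1 by (simp add: D_def algebra_simps)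
  define E where "E = int d * (H * (\<lfloor>B\<rfloor> + \<lfloor>X\<rfloor>) ^ d)"
  have "real_of_int \<bar>a\<bar> \<le> real_of_int E" using a(2) by (simp only: of_int_le_iff E_def X_def)
  also have "real_of_int E = real d * (real_of_int H * (real_of_int \<lfloor>B\<rfloor> + real_of_int \<lfloor>X\<rfloor>) ^ d)"
    by (simp add: E_def)
  also have "\<dots> \<le> real (d + 1) * ((real ((d + 1) ^ n) * h) * (D * (B * P ^ (2 * n))) ^ d)"
  proof (intro mult_mono power_mono)
    have "real_of_int \<lfloor>B\<rfloor> + real_of_int \<lfloor>X\<rfloor> \<le> B + X" by (intro add_mono) simp_all
    then show "real_of_int \<lfloor>B\<rfloor> + real_of_int \<lfloor>X\<rfloor> \<le> D * (B * P ^ (2 * n))" using BX by linarith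
    show "0 \<le> real_of_int \<lfloor>B\<rfloor> + real_of_int \<lfloor>X\<rfloor>" using B X0 by simp
    then show "0 \<le> (real_of_int \<lfloor>B\<rfloor> + real_of_int \<lfloor>X\<rfloor>) ^ d" by (rule zero_le_power)
    then show "0 \<le> real_of_int H * (real_of_int \<lfloor>B\<rfloor> + real_of_int \<lfloor>X\<rfloor>) ^ d" using H(1) by simp
  qed (use H h in auto)
  also have "\<dots> = real ((d + 1) ^ (n + 1)) * (h * (D * (B * P ^ (2 * n))) ^ d)"
    by (simp only: power_add power_one_right of_nat_mult ac_simps)
  finally have "real_of_int \<bar>a\<bar> \<le> real ((d + 1) ^ (n + 1)) * (h * (D * (B * P ^ (2 * n))) ^ d)" .
  then have "ln (real_of_int \<bar>a\<bar>) \<le> ln (real ((d + 1) ^ (n + 1)) * (h * (D * (B * P ^ (2 * n))) ^ d))"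
    using a(1) by (intro ln_mono) auto
  also have "\<dots> = ln (real ((d + 1) ^ (n + 1))) + (ln h + real d * (ln D + (ln B + real (2 * n) * ln P)))"
  proof -
    have "(d + 1) ^ (n + 1) > 0" by (rule zero_less_power) simp
    then have pos: "real ((d + 1) ^ (n + 1)) > 0" "D > 0" "B > 0" "h > 0" "P ^ (2 * n) > 0"
      using D B h P by (simp_all only: of_nat_0_less_iff) auto
    then have "ln (D * (B * P ^ (2 * n))) = ln D + (ln B + ln (P ^ (2 * n)))"
      by (simp only: ln_mult_pos mult_pos_pos)
    moreover have "ln (P ^ (2 * n)) = real (2 * n) * ln P" using P by (subst ln_realpow) auto
    ultimately have "ln ((D * (B * P ^ (2 * n))) ^ d) = real d * (ln D + (ln B + real (2 * n) * ln P))"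
      using pos by (subst ln_realpow) auto
    moreover have "ln (real ((d + 1) ^ (n + 1)) * (h * (D * (B * P ^ (2 * n))) ^ d)) =
        ln (real ((d + 1) ^ (n + 1))) + (ln h + ln ((D * (B * P ^ (2 * n))) ^ d))"
      using pos by (simp only: ln_mult_pos mult_pos_pos zero_less_power)
    ultimately show ?thesis by simp
  qed
  finally show ?thesis by (simp add: D_def algebra_simps)
qed

text \<open>With \<open>P = K * L\<close>, where \<open>L\<close> is the logarithm of the height,
  the requirement is \<open>ln |a| < c * P\<close>. Since \<open>ln P \<le> ln K + L\<close>,
  division by \<open>L\<close> reduces it to a comparison of \<open>ln K\<close> with
  \<open>K\<close>, so \<open>K\<close> depends only on \<open>n\<close>, \<open>d\<close> and
  \<open>p0\<close>.\<close>

lemma descent_scale_exists: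
  fixes n d p0 :: nat
  assumes n: "n \<ge> 1" and p0: "prime p0" "n < p0"
  shows "\<exists>K\<ge>1. \<forall>(H :: int) h B. 1 \<le> h \<longrightarrow> 1 \<le> B \<longrightarrow> 0 \<le> H \<longrightarrow> real_of_int H \<le> real ((d + 1) ^ n) * h \<longrightarrow>
    1 \<le> K * ln (max 2 (h * B)) \<and>
    (\<forall>k. 2 ^ k \<le> 2 * (sqrt (real n) * B) \<longrightarrow> real k \<le> K * ln (max 2 (h * B))) \<and>
    (\<forall>r a. 2 \<le> r \<longrightarrow> r \<le> n \<longrightarrow> a \<noteq> 0 \<longrightarrow>
      \<bar>a\<bar> \<le> int d * (H * (\<lfloor>B\<rfloor> + \<lfloor>real n * real d * (sqrt (real n) * B * (K * ln (max 2 (h * B))) ^ (2 * n))\<rfloor>) ^ d) \<longrightarrow>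
      (\<exists>p. prime p \<and> real p \<le> K * ln (max 2 (h * B)) \<and> [p = r] (mod p0) \<and> \<not> int p dvd a))"
proof -
  have "\<exists>c>0. \<exists>X0\<ge>0. \<forall>a\<in>{2..n}. \<forall>X\<ge>X0. c * X \<le> (\<Sum>p | prime p \<and> real p \<le> X \<and> [p = a] (mod p0). ln (real p))"
    using p0 by (intro chebyshev_progressions) (auto dest!: dvd_imp_le)
  then obtain c X0 where c: "c > 0" "X0 \<ge> 0"
    "\<And>r X. 2 \<le> r \<Longrightarrow> r \<le> n \<Longrightarrow> X \<ge> X0 \<Longrightarrow> c * X \<le> (\<Sum>p | prime p \<and> real p \<le> X \<and> [p = r] (mod p0). ln (real p))"
    by auto
  have ln2: "ln (2 :: real) > 0" by simp
  define c0 where "c0 = ln (real ((d + 1) ^ (n + 1))) + real d * ln (1 + real n ^ 2 * real d)"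
  have "1 \<le> (d + 1) ^ (n + 1)" by (rule one_le_power) simp
  then have "1 \<le> real ((d + 1) ^ (n + 1))" by (simp only: real_of_nat_ge_one_iff)
  then have "ln (real ((d + 1) ^ (n + 1))) \<ge> 0" by (rule ln_ge_zero)
  moreover have "ln (1 + real n ^ 2 * real d) \<ge> 0" by (rule ln_ge_zero) simp
  then have "real d * ln (1 + real n ^ 2 * real d) \<ge> 0" by (intro mult_nonneg_nonneg) auto
  ultimately have c0: "c0 \<ge> 0" unfolding c0_def by (rule add_nonneg_nonneg)
  define b where "b = real (2 * n * d)"
  \<comment> \<open>From \<open>2 ^ k \<le> 2 * (sqrt n * B)\<close>: the constant part of the bound
    for \<open>k * ln 2\<close> is converted into a multiple of \<open>L\<close> by means of
    \<open>ln 2 \<le> L\<close>.\<close>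
  define K1 where "K1 = ((ln 2 + ln (real n)) / ln 2 + 1) / ln 2"
  have "eventually (\<lambda>K. (c0 / ln 2 + (1 + real d + b)) + (b / ln 2) * ln K < c * K) at_top"
    using c(1) by (rule linear_dominates_log)
  \<comment> \<open>These bounds give \<open>K \<ge> 1\<close>, then \<open>P \<ge> 1\<close>, then
    that \<open>P\<close> lies in the range of the Chebyshev bound, and finally the bound for the
    exponents. The divisor \<open>ln 2\<close> is the least possible value of the logarithm of the
    height.\<close>
  moreover have "eventually (\<lambda>K. K \<ge> max (max 1 (1 / ln 2)) (max (X0 / ln 2) K1)) at_top"
    by (rule eventually_ge_at_top)
  ultimately have "eventually (\<lambda>K. (c0 / ln 2 + (1 + real d + b)) + (b / ln 2) * ln K < c * K \<and>
      K \<ge> max (max 1 (1 / ln 2)) (max (X0 / ln 2) K1)) at_top"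
    by (rule eventually_conj)
  then have "\<exists>K. (c0 / ln 2 + (1 + real d + b)) + (b / ln 2) * ln K < c * K \<and>
      K \<ge> max (max 1 (1 / ln 2)) (max (X0 / ln 2) K1)"
    unfolding eventually_at_top_linorder by blast
  then obtain K where K: "(c0 / ln 2 + (1 + real d + b)) + (b / ln 2) * ln K < c * K"
    "K \<ge> 1" "K \<ge> 1 / ln 2" "K \<ge> X0 / ln 2" "K \<ge> K1" by auto
  have lnK: "ln K \<ge> 0" using K(2) by simp
  have "1 \<le> K * ln (max 2 (h * B)) \<and>
    (\<forall>k. 2 ^ k \<le> 2 * (sqrt (real n) * B) \<longrightarrow> real k \<le> K * ln (max 2 (h * B))) \<and>
    (\<forall>r a. 2 \<le> r \<longrightarrow> r \<le> n \<longrightarrow> a \<noteq> 0 \<longrightarrow>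
      \<bar>a\<bar> \<le> int d * (H * (\<lfloor>B\<rfloor> + \<lfloor>real n * real d * (sqrt (real n) * B * (K * ln (max 2 (h * B))) ^ (2 * n))\<rfloor>) ^ d) \<longrightarrow>
      (\<exists>p. prime p \<and> real p \<le> K * ln (max 2 (h * B)) \<and> [p = r] (mod p0) \<and> \<not> int p dvd a))"
    if hB: "1 \<le> h" "1 \<le> B" and H: "0 \<le> H" "real_of_int H \<le> real ((d + 1) ^ n) * h" for H :: int and h B
  proof -
    define L where "L = ln (max 2 (h * B))"
    define P where "P = K * L"
    have L2: "ln 2 \<le> L" unfolding L_def by (intro ln_mono) auto
    have L0: "L > 0" using L2 ln2 by linarith
    have hBL: "ln h + ln B \<le> L"
    proof -
      have "ln h + ln B = ln (h * B)" using hB by (simp add: ln_mult)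
      also have "\<dots> \<le> L" unfolding L_def using hB by (intro ln_mono) auto
      finally show ?thesis .
    qed
    have lnB: "0 \<le> ln B" "0 \<le> ln h" using hB by auto
    have KP: "x / ln 2 \<le> K \<Longrightarrow> x \<ge> 0 \<Longrightarrow> x \<le> P" for x
    proof -
      assume x: "x / ln 2 \<le> K" "x \<ge> 0"
      have "x = x / ln 2 * ln 2" using ln2 by simp
      also have "\<dots> \<le> K * L" using x L2 ln2 K(2) by (intro mult_mono) auto
      finally show "x \<le> P" by (simp add: P_def)
    qed
    have P1: "1 \<le> P" using KP[of 1] K(3) by simp
    have PX: "X0 \<le> P" using KP[of X0] K(4) c(2) by simp
    have 1: "real k \<le> P" if k: "2 ^ k \<le> 2 * (sqrt (real n) * B)" for k
    proof -
      have "sqrt (real n) \<le> real n" using n by (intro real_le_lsqrt) (auto simp: power2_eq_square)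
      then have "2 * (sqrt (real n) * B) \<le> 2 * (real n * B)" using hB by (intro mult_left_mono mult_right_mono) auto
      then have "ln ((2 :: real) ^ k) \<le> ln (2 * (real n * B))" using k by (intro ln_mono) auto
      then have "real k * ln 2 \<le> ln 2 + (ln (real n) + ln B)" using n hB by (simp add: ln_realpow ln_mult)
      also have "\<dots> \<le> (ln 2 + ln (real n)) / ln 2 * ln 2 + L" using hBL lnB ln2 by simp
      also have "\<dots> \<le> (ln 2 + ln (real n)) / ln 2 * L + L"
        using L2 ln2 n by (intro add_right_mono mult_left_mono) auto
      also have "\<dots> = K1 * L * ln 2" using ln2 by (simp add: K1_def field_simps)
      finally have "real k \<le> K1 * L" using ln2 by simp
      also have "\<dots> \<le> P" unfolding P_def using K(5) L0 by (intro mult_right_mono) auto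
      finally show ?thesis .
    qed
    have 2: "\<exists>p. prime p \<and> real p \<le> P \<and> [p = r] (mod p0) \<and> \<not> int p dvd a"
      if r: "2 \<le> r" "r \<le> n" and a: "a \<noteq> 0"
        "\<bar>a\<bar> \<le> int d * (H * (\<lfloor>B\<rfloor> + \<lfloor>real n * real d * (sqrt (real n) * B * P ^ (2 * n))\<rfloor>) ^ d)" for r a
    proof (rule ccontr)
      assume neg: "\<not> ?thesis"
      define A where "A = {p. prime p \<and> real p \<le> P \<and> [p = r] (mod p0)}"
      have "A \<subseteq> {..nat \<lfloor>P\<rfloor>}" by (auto simp: A_def le_nat_floor)
      then have finA: "finite A" by (rule finite_subset) simp
      have "ln P = ln K + ln L" unfolding P_def using K(2) L0 by (simp add: ln_mult)
      also have "ln L \<le> L" using ln_le_minus_one[OF L0] by linarith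
      finally have lnP: "ln P \<le> ln K + L" by simp
      have "c * P \<le> (\<Sum>p\<in>A. ln (real p))" unfolding A_def using c(3) r PX by simp
      also have "\<dots> \<le> ln (real_of_int \<bar>a\<bar>)" using finA a(1) neg by (intro sum_ln_primes_le) (auto simp: A_def)
      also have "\<dots> \<le> c0 + (ln h + real d * ln B) + b * ln P"
        using ln_bound_aux[OF n hB P1 H a] by (simp add: c0_def b_def)
      also have "\<dots> \<le> c0 + (L + real d * L) + b * (ln K + L)"
      proof -
        have "real d * ln B \<le> real d * L" using hBL lnB by (intro mult_left_mono) auto
        moreover have "b * ln P \<le> b * (ln K + L)" using lnP by (intro mult_left_mono) (auto simp: b_def)
        ultimately show ?thesis using hBL lnB by linarith
      qed
      also have "\<dots> = (c0 + b * ln K) / ln 2 * ln 2 + (1 + real d + b) * L"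
      proof -
        have "(c0 + b * ln K) / ln 2 * ln 2 = c0 + b * ln K" using ln2 by (intro nonzero_eq_divide_eq[THEN iffD1]) auto
        then show ?thesis by (simp only: algebra_simps)
      qed
      also have "\<dots> \<le> (c0 + b * ln K) / ln 2 * L + (1 + real d + b) * L"
        using L2 c0 lnK ln2 by (intro add_right_mono mult_left_mono) (auto simp: b_def)
      also have "\<dots> = ((c0 / ln 2 + (1 + real d + b)) + (b / ln 2) * ln K) * L"
        by (simp add: algebra_simps add_divide_distrib)
      also have "\<dots> < c * K * L" using K(1) L0 by (rule mult_strict_right_mono)
      finally show False by (simp add: P_def)
    qed
    show ?thesis unfolding L_def[symmetric] P_def[symmetric] using P1 1 2 by blast
  qed
  then show ?thesis using K(2) by blast
qed

section \<open>Comparison with the exponents and constants of the statement\<close>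

lemma poly_height_ge_1:
  fixes F :: "('n::finite) int_mpoly"
  assumes "is_form F d" "eval_poly F (x :: int ^ 'n) \<noteq> 0"
  shows "1 \<le> poly_height F"
proof -
  have "Poly_Mapping.keys F \<noteq> {}" using assms(2) by (auto simp: eval_poly_def)
  then obtain \<alpha> where "\<alpha> \<in> Poly_Mapping.keys F" by blast
  then have "Poly_Mapping.lookup F \<alpha> \<noteq> 0" by (simp add: in_keys_iff)
  then have "1 \<le> \<bar>Poly_Mapping.lookup F \<alpha>\<bar>" by simp
  also have "\<dots> \<le> poly_height F" using assms(1) by (rule sum_abs_coeffs_le)
  finally show ?thesis .
qed

lemma leaf_exponent_sum:
  assumes "k + 2 \<le> m"
  shows "real (\<Sum>s=3..k + 2. 2 + 2 * (m - s + 1) * (s - 2)) =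
    2 * real k + (real m - 1) * real k * (real k + 1) - real k * (real k + 1) * (2 * real k + 1) / 3"
  using assms
proof (induction k)
  case (Suc k)
  define u where "u = m - (k + 3)"
  have u: "real u = real m - real k - 3" using Suc.prems by (simp add: u_def of_nat_diff)
  have "(\<Sum>s=3..Suc k + 2. 2 + 2 * (m - s + 1) * (s - 2)) =
      (\<Sum>s=3..k + 2. 2 + 2 * (m - s + 1) * (s - 2)) + (2 + 2 * (u + 1) * (k + 1))"
    by (simp add: numeral_3_eq_3 u_def)
  then have "real (\<Sum>s=3..Suc k + 2. 2 + 2 * (m - s + 1) * (s - 2)) =
      real (\<Sum>s=3..k + 2. 2 + 2 * (m - s + 1) * (s - 2)) + real (2 + 2 * (u + 1) * (k + 1))"
    by (simp only: of_nat_add)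
  also have "real (2 + 2 * (u + 1) * (k + 1)) = 2 + 2 * (real m - real k - 2) * (real k + 1)"
    by (simp add: u algebra_simps)
  also have "real (\<Sum>s=3..k + 2. 2 + 2 * (m - s + 1) * (s - 2)) =
      2 * real k + (real m - 1) * real k * (real k + 1) - real k * (real k + 1) * (2 * real k + 1) / 3"
    using Suc by simp
  finally show ?case by (simp add: field_simps)
qed simp

context descent
begin

text \<open>With \<open>k = m - 2\<close>, the exponent of the statement exceeds
  \<open>leaf_exponent m\<close> by at least \<open>k * (k + 1) * (k + 5) / 3\<close>.\<close>

lemma leaf_exponent_le:
  assumes "m \<ge> 2"
  shows "real (leaf_exponent m) \<le> (real m - 2) * (2 * real m ^ 2 + real m + 3) / 3"
proof -
  obtain k where k: "m = k + 2" using assms le_Suc_ex[of 2 m] by (metis add.commute)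
  have "real (leaf_exponent m) = 2 * real k + (real m - 1) * real k * (real k + 1) - real k * (real k + 1) * (2 * real k + 1) / 3"
    unfolding leaf_exponent_def using leaf_exponent_sum[of k m] k by simp
  also have "\<dots> \<le> (real m - 2) * (2 * real m ^ 2 + real m + 3) / 3"
  proof -
    have "(real m - 2) * (2 * real m ^ 2 + real m + 3) / 3 -
      (2 * real k + (real m - 1) * real k * (real k + 1) - real k * (real k + 1) * (2 * real k + 1) / 3) =
      real k * (real k ^ 2 + 6 * real k + 5) / 3"
      by (simp add: k field_simps power2_eq_square)
    moreover have "real k * (real k ^ 2 + 6 * real k + 5) / 3 \<ge> 0" by simp
    ultimately show ?thesis by linarith
  qed
  finally show ?thesis .
qed

lemma admissible_whole:
  assumes "m \<ge> 2" "S \<noteq> {}" "B \<ge> successive_minimum \<Lambda> m"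
  shows "admissible \<Lambda>"
proof -
  have "short_spanned \<Lambda> (successive_minimum \<Lambda> m)"
    using short_spanned_successive_minimum[OF lattice rank] assms(1) by simp
  then have "short_spanned \<Lambda> R" by (rule short_spanned_mono) (use assms(3) R_ge in linarith)
  moreover have "local_conditions \<Lambda> 0 q" for q by (simp add: local_conditions_def)
  then have "\<exists>q. local_conditions \<Lambda> 0 q" by (intro exI)
  moreover have "S \<inter> \<Lambda> \<noteq> {}" using assms(2) by (auto simp: S_def)
  ultimately show ?thesis using lattice rank assms(1) unfolding admissible_def by simp
qed

lemma size_ratio_powr:
  assumes "m \<ge> 2"
  shows "size_ratio \<Lambda> ^ (m - 2) = (B ^ m / lattice_det \<Lambda>) powr ((real m - 2) / real m)"
proof -
  have det: "lattice_det \<Lambda> > 0" using lattice_det_ge_1[OF lattice] by simp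
  have s: "size_ratio \<Lambda> > 0" "size_ratio \<Lambda> ^ m * lattice_det \<Lambda> = B ^ m"
    using size_ratio[OF lattice] rank assms by auto
  then have "B ^ m / lattice_det \<Lambda> = size_ratio \<Lambda> ^ m" using det by (simp add: field_simps)
  also have "\<dots> = size_ratio \<Lambda> powr real m" using s(1) by (simp add: powr_realpow)
  finally have "(B ^ m / lattice_det \<Lambda>) powr ((real m - 2) / real m) = size_ratio \<Lambda> powr (real m - 2)"
    using assms by (simp add: powr_powr)
  also have "\<dots> = size_ratio \<Lambda> powr real (m - 2)" using assms by (simp add: of_nat_diff)
  also have "\<dots> = size_ratio \<Lambda> ^ (m - 2)" using s(1) by (simp add: powr_realpow)
  finally show ?thesis by simp
qed

end

theorem theorem4:
  fixes d :: nat
  assumes "CARD('n::finite) \<ge> 2"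
  shows "\<exists>C>0. \<forall>(\<Lambda> :: (int ^ 'n) set) (m :: nat) (F :: 'n int_mpoly) (B :: real) (p0 :: nat).
    integer_lattice \<Lambda> \<longrightarrow> lattice_rank \<Lambda> = m \<longrightarrow> m \<ge> 2 \<longrightarrow>
    is_form F d \<longrightarrow> (\<exists>x\<in>\<Lambda>. eval_poly F x \<noteq> 0) \<longrightarrow>
    p0 = (LEAST p. prime p \<and> p > CARD('n)) \<longrightarrow>
    B \<ge> successive_minimum \<Lambda> m \<longrightarrow>
    (\<exists>(J :: nat) (M :: nat \<Rightarrow> (int ^ 'n) set).
      (\<forall>j\<in>{1..J}. integer_lattice (M j) \<and> M j \<subseteq> \<Lambda> \<and> spans_linear_space_in (M j) F) \<and>
      real J \<le> C * ((B ^ m / lattice_det \<Lambda>) powr ((real m - 2) / real m) *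
        log_height F B powr ((real m - 2) * (2 * real m ^ 2 + real m + 3) / 3)) \<and>
      (\<forall>j\<in>{1..J}. \<forall>i\<in>{1..lattice_rank (M j)}.
        successive_minimum (M j) i \<le> C * (B * log_height F B ^ (m * (m + 1)))) \<and>
      primitive_zeros F B \<Lambda> \<subseteq> (\<Union>j\<in>{1..J}. M j) \<and>
      (\<forall>j\<in>{1..J}. M j \<subset> \<Lambda> \<longrightarrow>
        (\<exists>(h :: nat) (q :: nat \<Rightarrow> nat) (w :: int ^ 'n).
          lattice_rank (M j) + h = m \<and>
          (\<forall>i\<in>{1..h}. q i > 0 \<and>
            (\<exists>p k. prime p \<and> k \<ge> 1 \<and> q i = p ^ k \<and> [p = m + 1 - i] (mod p0))) \<and>
          M j \<subseteq> {x \<in> \<Lambda>. \<exists>\<rho> :: int. \<forall>l. [x $ l = \<rho> * w $ l] (mod int (\<Prod>i=1..h. q i))} \<and>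
          lattice_det (M j) \<le>
            C * (lattice_det \<Lambda> * (\<Prod>i=1..h. real (q i) ^ (m - (i - 1)) / B)))))"
proof -
  define n where "n = CARD('n)"
  define p1 where "p1 = (LEAST p. prime p \<and> p > n)"
  have n1: "n \<ge> 1" using assms by (simp add: n_def)
  have p1: "prime p1 \<and> p1 > n"
    unfolding p1_def by (rule LeastI_ex) (use bigger_prime in blast)
  obtain K where K: "K \<ge> 1" "\<forall>(H :: int) h B. 1 \<le> h \<longrightarrow> 1 \<le> B \<longrightarrow> 0 \<le> H \<longrightarrow> real_of_int H \<le> real ((d + 1) ^ n) * h \<longrightarrow>
    1 \<le> K * ln (max 2 (h * B)) \<and>
    (\<forall>k. 2 ^ k \<le> 2 * (sqrt (real n) * B) \<longrightarrow> real k \<le> K * ln (max 2 (h * B))) \<and>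
    (\<forall>r a. 2 \<le> r \<longrightarrow> r \<le> n \<longrightarrow> a \<noteq> 0 \<longrightarrow>
      \<bar>a\<bar> \<le> int d * (H * (\<lfloor>B\<rfloor> + \<lfloor>real n * real d * (sqrt (real n) * B * (K * ln (max 2 (h * B))) ^ (2 * n))\<rfloor>) ^ d) \<longrightarrow>
      (\<exists>p. prime p \<and> real p \<le> K * ln (max 2 (h * B)) \<and> [p = r] (mod p1) \<and> \<not> int p dvd a))"
    using descent_scale_exists[OF n1 p1[THEN conjunct1] p1[THEN conjunct2], of d] by (elim exE conjE) (rule that)
  define A where "A = real n ^ n + real d ^ 2 * real n ^ 3 + 2 * real d + 2"
  define E where "E m = (real m - 2) * (2 * real m ^ 2 + real m + 3) / 3" for m
  define c where "c = minkowski_const n"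
  \<comment> \<open>\<open>C1\<close>, \<open>C2\<close> and \<open>C3\<close> serve the number of
    lattices, the minima and the determinants. Each is taken at the largest possible rank
    \<open>n\<close>, and so depends on \<open>n\<close> and \<open>d\<close> alone.\<close>
  define C1 where "C1 = A ^ n * K powr E n"
  define C2 where "C2 = sqrt (real n) * K ^ (n * (n + 1))"
  define C3 where "C3 = (1 / c) ^ n"
  define C where "C = C1 + C2 + C3"
  have A1: "A \<ge> 1" by (simp add: A_def)
  have c: "0 < c" "c \<le> 1"
  proof -
    show "0 < c" unfolding c_def using n1 by (rule minkowski_const_pos)
    have "1 \<le> real ((2 * n) ^ n)" using n1 by (simp only: real_of_nat_ge_one_iff) (intro one_le_power, simp)
    then show "c \<le> 1" by (simp add: c_def minkowski_const_def)
  qed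
  have C123: "C1 > 0" "C2 > 0" "C3 > 0" using A1 K(1) c n1 by (auto simp: C1_def C2_def C3_def)
  have C0: "C > 0" using C123 by (simp add: C_def)
  have main: "\<exists>(J :: nat) (M :: nat \<Rightarrow> (int ^ 'n) set).
      (\<forall>j\<in>{1..J}. integer_lattice (M j) \<and> M j \<subseteq> \<Lambda> \<and> spans_linear_space_in (M j) F) \<and>
      real J \<le> C * ((B ^ m / lattice_det \<Lambda>) powr ((real m - 2) / real m) *
        log_height F B powr ((real m - 2) * (2 * real m ^ 2 + real m + 3) / 3)) \<and>
      (\<forall>j\<in>{1..J}. \<forall>i\<in>{1..lattice_rank (M j)}.
        successive_minimum (M j) i \<le> C * (B * log_height F B ^ (m * (m + 1)))) \<and>
      primitive_zeros F B \<Lambda> \<subseteq> (\<Union>j\<in>{1..J}. M j) \<and>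
      (\<forall>j\<in>{1..J}. M j \<subset> \<Lambda> \<longrightarrow>
        (\<exists>(h :: nat) (q :: nat \<Rightarrow> nat) (w :: int ^ 'n).
          lattice_rank (M j) + h = m \<and>
          (\<forall>i\<in>{1..h}. q i > 0 \<and>
            (\<exists>p k. prime p \<and> k \<ge> 1 \<and> q i = p ^ k \<and> [p = m + 1 - i] (mod p0))) \<and>
          M j \<subseteq> {x \<in> \<Lambda>. \<exists>\<rho> :: int. \<forall>l. [x $ l = \<rho> * w $ l] (mod int (\<Prod>i=1..h. q i))} \<and>
          lattice_det (M j) \<le>
            C * (lattice_det \<Lambda> * (\<Prod>i=1..h. real (q i) ^ (m - (i - 1)) / B))))"
    if \<Lambda>: "integer_lattice \<Lambda>" "lattice_rank \<Lambda> = m" and m: "m \<ge> 2" and F: "is_form F d"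
      and x0: "\<exists>x\<in>\<Lambda>. eval_poly F x \<noteq> 0" and p0: "p0 = (LEAST p. prime p \<and> p > CARD('n))"
      and sm: "B \<ge> successive_minimum \<Lambda> m"
    for \<Lambda> :: "(int ^ 'n) set" and m :: nat and F :: "'n int_mpoly" and B :: real and p0 :: nat
  proof -
    define L where "L = log_height F B"
    define P where "P = K * L"
    define H where "H = (\<Sum>\<alpha>\<in>Poly_Mapping.keys F. \<bar>Poly_Mapping.lookup F \<alpha>\<bar>)"
    define f where "f = (eval_poly F :: int ^ 'n \<Rightarrow> int)"
    have p0: "p0 = p1" using p0 by (simp add: p1_def n_def)
    have B1: "1 \<le> B" using short_spanned_successive_minimum(2)[OF \<Lambda>] m sm by simp
    have h1: "1 \<le> real_of_int (poly_height F)" using poly_height_ge_1[OF F] x0 by auto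
    have H0: "0 \<le> H" by (simp add: H_def sum_nonneg)
    have "real_of_int H \<le> real_of_int (int ((d + 1) ^ n) * poly_height F)"
      using sum_abs_coeffs_le(1)[OF F] unfolding H_def n_def of_int_le_iff .
    then have H1: "real_of_int H \<le> real ((d + 1) ^ n) * real_of_int (poly_height F)" by simp
    note KP = K(2)[THEN spec[of _ H], THEN spec[of _ "real_of_int (poly_height F)"], THEN spec[of _ B],
        THEN mp[OF _ h1], THEN mp[OF _ B1], THEN mp[OF _ H0], THEN mp[OF _ H1], folded log_height_def L_def P_def]
    have P1: "1 \<le> P" using KP by (rule conjunct1)
    have L0: "L > 0"
    proof -
      have "0 < ln (2 :: real)" by simp
      also have "\<dots> \<le> L" unfolding L_def log_height_def by (intro ln_mono) auto
      finally show ?thesis .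
    qed
    have form: "hform d H f" unfolding f_def H_def using F by (rule hform_eval_poly)
    have mn: "m \<le> n" using dim_subset_UNIV[of "rv ` \<Lambda>"] \<Lambda>(2) by (simp add: lattice_rank_def n_def)
    interpret descent \<Lambda> m d p0 f H B P
    proof
      show "integer_lattice \<Lambda>" "lattice_rank \<Lambda> = m" "hform d H f" "1 \<le> B" "1 \<le> P" by fact+
      show "CARD('n) < p0" using p1 by (simp add: p0 n_def)
      show "real k \<le> P" if "2 ^ k \<le> 2 * (sqrt (real CARD('n)) * B)" for k
        by (rule KP[THEN conjunct2, THEN conjunct1, rule_format]) (use that in \<open>simp only: n_def\<close>)
      show "\<exists>p. prime p \<and> real p \<le> P \<and> [p = r] (mod p0) \<and> \<not> int p dvd a"
        if "2 \<le> r" "r \<le> m" "a \<noteq> 0"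
          "\<bar>a\<bar> \<le> int d * (H * (\<lfloor>B\<rfloor> + \<lfloor>real CARD('n) * real d * (sqrt (real CARD('n)) * B * P ^ (2 * CARD('n)))\<rfloor>) ^ d)"
        for r a
        unfolding p0
      proof (rule KP[THEN conjunct2, THEN conjunct2, rule_format])
        show "2 \<le> r" "r \<le> n" "a \<noteq> 0" using that mn by auto
        show "\<bar>a\<bar> \<le> int d * (H * (\<lfloor>B\<rfloor> + \<lfloor>real n * real d * (sqrt (real n) * B * P ^ (2 * n))\<rfloor>) ^ d)"
          unfolding n_def by (rule that)
      qed
    qed
    have S_eq: "primitive_zeros F B \<Lambda> = S" unfolding primitive_zeros_def S_def by (simp only: f_def)
    have J0: "0 \<le> (B ^ m / lattice_det \<Lambda>) powr ((real m - 2) / real m) * L powr E m" by simp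
    show ?thesis
    proof (cases "S = {}")
      case True
      \<comment> \<open>Without points there is no candidate for \<open>w\<close> and the descent
        does not start; the empty family covers everything.\<close>
      show ?thesis
        by (rule exI[of _ 0]) (use True J0 C123 in \<open>simp add: S_eq C_def E_def L_def\<close>)
    next
      case False
      have "\<exists>\<F>. leaf_family \<Lambda> \<F>"
        using admissible_whole[OF m False sm] \<Lambda>(2) m by (intro leaf_family_exists) auto
      then obtain \<F> where \<F>: "finite \<F>" "\<And>N. N \<in> \<F> \<Longrightarrow> admissible N" "\<And>N y. N \<in> \<F> \<Longrightarrow> y \<in> N \<Longrightarrow> f y = 0"
        "S \<inter> \<Lambda> \<subseteq> \<Union>\<F>" "real (card \<F>) \<le> leaf_bound m * size_ratio \<Lambda> ^ (m - 2)"
      proof -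
        assume *: "\<And>\<F>. finite \<F> \<Longrightarrow> (\<And>N. N \<in> \<F> \<Longrightarrow> admissible N) \<Longrightarrow>
          (\<And>N y. N \<in> \<F> \<Longrightarrow> y \<in> N \<Longrightarrow> f y = 0) \<Longrightarrow> S \<inter> \<Lambda> \<subseteq> \<Union>\<F> \<Longrightarrow>
          real (card \<F>) \<le> leaf_bound m * size_ratio \<Lambda> ^ (m - 2) \<Longrightarrow> thesis"
        from \<open>\<exists>\<F>. leaf_family \<Lambda> \<F>\<close> obtain \<F> where "leaf_family \<Lambda> \<F>" ..
        then show thesis unfolding leaf_family_def \<Lambda>(2) by (intro *[of \<F>]) simp_all
      qed
      obtain M where M: "bij_betw M {1..card \<F>} \<F>" using ex_bij_betw_nat_finite_1[OF \<F>(1)] by blast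
      then have MF: "M j \<in> \<F>" if "j \<in> {1..card \<F>}" for j using that by (auto simp: bij_betw_def)
      have UM: "(\<Union>j\<in>{1..card \<F>}. M j) = \<Union>\<F>" using M by (auto simp: bij_betw_def)
      have 1: "integer_lattice N \<and> N \<subseteq> \<Lambda> \<and> spans_linear_space_in N F" if "N \<in> \<F>" for N
        using admissibleD(1,2)[OF \<F>(2)[OF that]] \<F>(3)[OF that] lattice_submodule
        by (auto intro!: spans_linear_space_in_if_zero simp: f_def)
      have 2: "real (card \<F>) \<le> C * ((B ^ m / lattice_det \<Lambda>) powr ((real m - 2) / real m) * L powr E m)"
      proof -
        have "leaf_bound m = A ^ m * P powr real (leaf_exponent m)"
          using P1 by (simp add: leaf_bound_def leaf_const_def A_def n_def powr_realpow)
        also have "\<dots> \<le> A ^ n * P powr E m"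
          using A1 P1 mn leaf_exponent_le[OF m] by (intro mult_mono power_increasing powr_mono) (auto simp: E_def)
        also have "P powr E m = K powr E m * L powr E m" using K(1) L0 by (simp add: P_def powr_mult)
        also have "K powr E m \<le> K powr E n"
        proof (intro powr_mono K(1))
          show "E m \<le> E n" unfolding E_def using mn m
            by (intro divide_right_mono mult_mono add_mono power_mono) auto
        qed
        finally have "leaf_bound m \<le> C1 * L powr E m"
          using A1 by (simp add: C1_def mult.assoc mult_left_mono mult_right_mono)
        also have "\<dots> \<le> C * L powr E m" using C123 by (intro mult_right_mono) (auto simp: C_def)
        finally have "leaf_bound m * size_ratio \<Lambda> ^ (m - 2) \<le> C * L powr E m * size_ratio \<Lambda> ^ (m - 2)"
          using size_ratio(1)[OF \<Lambda>(1)] \<Lambda>(2) m by (intro mult_right_mono) auto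
        then show ?thesis using \<F>(5) unfolding size_ratio_powr[OF m] by (simp add: ac_simps)
      qed
      have 3: "successive_minimum N i \<le> C * (B * L ^ (m * (m + 1)))"
        if N: "N \<in> \<F>" and i: "i \<in> {1..lattice_rank N}" for N i
      proof -
        note N' = admissibleD[OF \<F>(2)[OF N]]
        have "m * (m + 1) \<le> n * (n + 1)" using mn by (intro mult_mono) auto
        have "2 * (m - lattice_rank N) \<le> (m + 1) * m" using m by (intro mult_mono) auto
        then have e: "2 * (m - lattice_rank N) \<le> m * (m + 1)" by (simp only: mult.commute)
        have "successive_minimum N i \<le> R * P ^ (2 * (m - lattice_rank N))"
          using N'(1,5) i by (rule successive_minimum_le)
        also have "\<dots> \<le> R * P ^ (m * (m + 1))"
          using e P1 R_ge by (intro mult_left_mono power_increasing) auto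
        also have "\<dots> = (sqrt (real n) * K ^ (m * (m + 1))) * (B * L ^ (m * (m + 1)))"
          by (simp add: R_def P_def n_def power_mult_distrib)
        also have "\<dots> \<le> C * (B * L ^ (m * (m + 1)))"
        proof (rule mult_right_mono)
          have "sqrt (real n) * K ^ (m * (m + 1)) \<le> C2"
            unfolding C2_def using K(1) \<open>m * (m + 1) \<le> n * (n + 1)\<close> by (intro mult_left_mono power_increasing) auto
          then show "sqrt (real n) * K ^ (m * (m + 1)) \<le> C" using C123 by (simp add: C_def)
        qed (use B1 L0 in auto)
        finally show ?thesis .
      qed
      have 4: "\<exists>(h :: nat) (q :: nat \<Rightarrow> nat) (w :: int ^ 'n). lattice_rank N + h = m \<and>
          (\<forall>i\<in>{1..h}. q i > 0 \<and> (\<exists>p k. prime p \<and> k \<ge> 1 \<and> q i = p ^ k \<and> [p = m + 1 - i] (mod p0))) \<and>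
          N \<subseteq> {x \<in> \<Lambda>. \<exists>\<rho> :: int. \<forall>l. [x $ l = \<rho> * w $ l] (mod int (\<Prod>i=1..h. q i))} \<and>
          lattice_det N \<le> C * (lattice_det \<Lambda> * (\<Prod>i=1..h. real (q i) ^ (m - (i - 1)) / B))"
        if N: "N \<in> \<F>" for N
      proof -
        note N' = admissibleD[OF \<F>(2)[OF N]]
        define h where "h = m - lattice_rank N"
        obtain q where q: "local_conditions N h q" using N'(7) by (auto simp: h_def)
        \<comment> \<open>Any point of \<open>S\<close> in \<open>N\<close> will do, since the
          congruences were carried along for all of them.\<close>
        obtain w where w: "w \<in> S \<inter> N" using N'(6) by blast
        have q1: "\<forall>i\<in>{1..h}. q i > 0 \<and> (\<exists>p k. prime p \<and> k \<ge> 1 \<and> q i = p ^ k \<and> [p = m + 1 - i] (mod p0))"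
          and q2: "\<forall>y\<in>N. \<exists>\<rho>. \<forall>l. [y $ l = \<rho> * w $ l] (mod int (\<Prod>i=1..h. q i))"
          and q3: "lattice_det N \<le> (1 / c) ^ h * (lattice_det \<Lambda> * (\<Prod>i=1..h. real (q i) ^ (m - (i - 1)) / B))"
          using q w unfolding local_conditions_def c_def n_def by simp_all
        have "(1 / c) ^ h \<le> C3" unfolding C3_def h_def using c mn by (intro power_increasing) auto
        then have "(1 / c) ^ h \<le> C" using C123 by (simp add: C_def)
        moreover have "0 \<le> lattice_det \<Lambda> * (\<Prod>i=1..h. real (q i) ^ (m - (i - 1)) / B)"
          using lattice_det_ge_1[OF \<Lambda>(1)] B1 by (intro mult_nonneg_nonneg prod_nonneg) auto
        ultimately have "lattice_det N \<le> C * (lattice_det \<Lambda> * (\<Prod>i=1..h. real (q i) ^ (m - (i - 1)) / B))"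
          by (intro order_trans[OF q3 mult_right_mono])
        moreover have "N \<subseteq> {x \<in> \<Lambda>. \<exists>\<rho> :: int. \<forall>l. [x $ l = \<rho> * w $ l] (mod int (\<Prod>i=1..h. q i))}"
          using N'(2) q2 by blast
        moreover have "lattice_rank N + h = m" using N'(4) by (simp add: h_def)
        ultimately show ?thesis using q1 by (intro exI[of _ h] exI[of _ q] exI[of _ w] conjI)
      qed
      show ?thesis
      proof (intro exI[of _ "card \<F>"] exI[of _ M] conjI)
        show "\<forall>j\<in>{1..card \<F>}. integer_lattice (M j) \<and> M j \<subseteq> \<Lambda> \<and> spans_linear_space_in (M j) F"
          using 1 MF by blast
        show "real (card \<F>) \<le> C * ((B ^ m / lattice_det \<Lambda>) powr ((real m - 2) / real m) *
            log_height F B powr ((real m - 2) * (2 * real m ^ 2 + real m + 3) / 3))"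
          using 2 unfolding E_def L_def .
        show "\<forall>j\<in>{1..card \<F>}. \<forall>i\<in>{1..lattice_rank (M j)}.
            successive_minimum (M j) i \<le> C * (B * log_height F B ^ (m * (m + 1)))"
          using 3 MF unfolding L_def by blast
        show "primitive_zeros F B \<Lambda> \<subseteq> (\<Union>j\<in>{1..card \<F>}. M j)"
          unfolding S_eq UM using \<F>(4) by (auto simp: S_def)
      qed (intro ballI impI 4 MF)
    qed
  qed
  show ?thesis by (intro exI[of _ C] conjI C0 allI impI) (rule main; assumption)
qed

end
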